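(* Let $V$ be a finite nonempty set, $r=(r(i,j))_{i,j\in V}$ an irreducible family of transition rates with $r(i,i)=0$ for all $i$, and let $g:\mathbb{N}_0\to[0,\infty)$ satisfy $g(0)=0$, $\lim_{n\to\infty}g(n)=1$ and $g(n)\ge 1$ for all $n\ge 1$. For $u\in\Sigma_N$ let $\mathbb{P}^N_u$ be the law of the rescaled zero-range process $\zeta^N_t=\eta_{tN}/N$, $t\ge 0$, started at $u$, and for $u\in\Sigma$ let $\zeta^u\in C([0,\infty),\Sigma)$ be the piecewise linear path defined in the context. If $u_N\in\Sigma_N$, $N\ge1$, is a sequence converging to some $u\in\Sigma$, then $\mathbb{P}^N_{u_N}$ converges weakly, as $N\to\infty$, to the Dirac measure $\delta_{\zeta^u}$.
   Context: Notation: $\mathbb{N}_0=\{0,1,2,\dots\}$; $\Sigma=\{u\in[0,1]^V:\sum_{i\in V}u(i)=1\}$; $\Sigma_N=\{u\in\Sigma: Nu\in\mathbb{N}_0^V\}$. $D([0,\infty),\Sigma)$ is the space of right-continuous $\Sigma$-valued paths with left limits, with the Skorokhod topology and its Borel $\sigma$-field; $C([0,\infty),\Sigma)$ is the set of continuous paths. Weak convergence is on $D([0,\infty),\Sigma)$. Zero-range process: the Markov process $(\eta_s)_{s\ge0}$ on $\mathbb{N}_0^V$ with generator $Lf(\eta)=\sum_{i,j\in V}g(\eta(i))\,r(i,j)\,[f(\eta^{i,j})-f(\eta)]$, where $\eta^{i,j}$ is obtained from $\eta$ by moving one particle from $i$ to $j$. The number of particles is conserved. For $u\in\Sigma_N$,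 $\mathbb{P}^N_u$ is the law on $D([0,\infty),\Sigma)$ of $\zeta^N_t=\eta_{tN}/N$ when $\eta_0=Nu$. Trace rates: for $k\in V$ and nonempty $B\subseteq V$, let $T^k_B$ be the hitting time of $B$ by the continuous-time random walk on $V$ with jump rates $r$ started at $k$, and $T^k_j=T^k_{\{j\}}$. For nonempty $A\subseteq V$ and $i\ne j$ in $A$ put $r^A(i,j)=r(i,j)+\sum_{k\notin A}r(i,k)P(T^k_A=T^k_j)$, and $r^A(i,i)=0$. Put $\lambda^A(i)=\sum_{j\in A}[r^A(j,i)-r^A(i,j)]$ for $i\in A$. A set $A\subseteq V$ is $r$-absorbing if $A=V$ or $\lambda^{A\cup\{j\}}(j)\le0$ for all $j\in V\setminus A$. For $S\subseteq V$, $\mathcal{A}(S)$ is the intersection of all $r$-absorbing subsets of $V$ containing $S$. The path $\zeta^u$: for $v\in\Sigma$ let $\mathcal{S}(v)=\{i\in V:v(i)>0\}$, $\mathcal{A}(v)=\mathcal{A}(\mathcal{S}(v))$, and let $\lambda^v\in\mathbb{R}^V$ be given by $\lambda^v(i)=\lambda^{\mathcal{A}(v)}(i)$ for $i\in\mathcal{A}(v)$ and $\lambda^v(i)=0$ otherwise. Let $\mathcal{S}_\downarrow(v)=\{i\in\mathcal{S}(v):\lambda^v(i)<0\}$; this set is nonempty whenever $\lambda^v\neq 0$. Given $u\in\Sigma$, set $(T_0,v_0)=(0,u)$. Given $(T_k,v_k)$: if $\lambda^{v_k}=0$, stop and set $f=k$; otherwise put $T^{v_k}=\min\{-v_k(i)/\lambda^{v_k}(i):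 i\in\mathcal{S}_\downarrow(v_k)\}\in(0,\infty)$, $v_{k+1}=v_k+T^{v_k}\lambda^{v_k}$, $T_{k+1}=T_k+T^{v_k}$. The procedure stops after finitely many steps. Then $\zeta^u_t=v_k+(t-T_k)\lambda^{v_k}$ for $T_k\le t<T_{k+1}$, $k<f$, and $\zeta^u_t=v_f$ for $t\ge T_f$. *)

theory Defs
  imports "HOL-Probability.Probability"
begin

section \<open>Path space, Skorokhod topology, weak convergence\<close>

definition cadlag :: "(real \<Rightarrow> 'a::topological_space) \<Rightarrow> bool" where
  "cadlag x \<longleftrightarrow> (\<forall>t\<ge>0. (x \<longlongrightarrow> x t) (at_right t)) \<and> (\<forall>t>0. \<exists>l. (x \<longlongrightarrow> l) (at_left t))"

text \<open>A path on $[0,\infty)$ is a function that is \<^const>\<open>undefined\<close> at negative times,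
  so that paths are equal iff they agree on $[0,\infty)$. Left limits automatically lie in \<open>S\<close>
  when \<open>S\<close> is closed, as it is in the application to the simplex.\<close>

definition cadlag_paths :: "'a::metric_space set \<Rightarrow> (real \<Rightarrow> 'a) set" where
  "cadlag_paths S = {x \<in> {0..} \<rightarrow>\<^sub>E S. cadlag x}"

definition time_changes :: "(real \<Rightarrow> real) set" where
  "time_changes = {\<tau>. bij_betw \<tau> {0..} {0..} \<and> strict_mono_on {0..} \<tau>}"

definition skorokhod_converges :: "(nat \<Rightarrow> real \<Rightarrow> 'a::metric_space) \<Rightarrow> (real \<Rightarrow> 'a) \<Rightarrow> bool" where
  "skorokhod_converges y x \<longleftrightarrow>
    (\<exists>\<tau>. (\<forall>n. \<tau> n \<in> time_changes) \<and>
         uniform_limit {0..} \<tau> (\<lambda>t. t) sequentially \<and>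
         (\<forall>T. uniform_limit {0..T} (\<lambda>n t. y n (\<tau> n t)) x sequentially))"

text \<open>The Skorokhod (J1) topology is the metrizable topology whose convergent sequences are those
  above (Jacod--Shiryaev, Theorem VI.1.14). Being metrizable it is sequential,
  i.e. its open sets are the sequentially open ones.\<close>

definition skorokhod_open :: "'a::metric_space set \<Rightarrow> (real \<Rightarrow> 'a) set \<Rightarrow> bool" where
  "skorokhod_open S U \<longleftrightarrow> U \<subseteq> cadlag_paths S \<and>
    (\<forall>x\<in>U. \<forall>y. (\<forall>n. y n \<in> cadlag_paths S) \<and> skorokhod_converges y x
        \<longrightarrow> (\<forall>\<^sub>F n in sequentially. y n \<in> U))"

definition skorokhod_topology :: "'a::metric_space set \<Rightarrow> (real \<Rightarrow> 'a) topology" where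
  "skorokhod_topology S = topology (skorokhod_open S)"

lemma istopology_skorokhod: "istopology (skorokhod_open S)"
  unfolding istopology_def
proof (intro conjI allI impI)
  fix U U' assume "skorokhod_open S U" "skorokhod_open S U'"
  then show "skorokhod_open S (U \<inter> U')"
    unfolding skorokhod_open_def by (auto intro: eventually_conj)
next
  fix \<U> assume U: "\<forall>U\<in>\<U>. skorokhod_open S U"
  show "skorokhod_open S (\<Union>\<U>)"
    unfolding skorokhod_open_def
  proof (intro conjI ballI allI impI)
    show "\<Union>\<U> \<subseteq> cadlag_paths S"
      using U unfolding skorokhod_open_def by blast
  next
    fix x y
    assume "x \<in> \<Union>\<U>" and y: "(\<forall>n. y n \<in> cadlag_paths S) \<and> skorokhod_converges y x"
    then obtain V where V: "V \<in> \<U>" "x \<in> V" by blast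
    then have "\<forall>\<^sub>F n in sequentially. y n \<in> V"
      using U y unfolding skorokhod_open_def by blast
    then show "\<forall>\<^sub>F n in sequentially. y n \<in> \<Union>\<U>"
      by eventually_elim (use V in blast)
  qed
qed

lemma openin_skorokhod [simp]: "openin (skorokhod_topology S) = skorokhod_open S"
  unfolding skorokhod_topology_def by (rule topology_inverse'[OF istopology_skorokhod])

lemma topspace_skorokhod [simp]: "topspace (skorokhod_topology S) = cadlag_paths S"
proof -
  have "skorokhod_open S (cadlag_paths S)"
    by (auto simp: skorokhod_open_def)
  then show ?thesis
    unfolding topspace_def openin_skorokhod
    by (intro subset_antisym Union_upper) (auto simp: skorokhod_open_def)
qed

definition skorokhod_borel :: "'a::metric_space set \<Rightarrow> (real \<Rightarrow> 'a) measure" where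
  "skorokhod_borel S = sigma (cadlag_paths S) {U. openin (skorokhod_topology S) U}"

definition converges_weakly :: "'a topology \<Rightarrow> (nat \<Rightarrow> 'a measure) \<Rightarrow> 'a measure \<Rightarrow> bool" where
  "converges_weakly T P Q \<longleftrightarrow>
    (\<forall>F :: 'a \<Rightarrow> real. continuous_map T euclidean F \<and> bounded (F ` topspace T)
        \<longrightarrow> (\<lambda>n. \<integral>x. F x \<partial>P n) \<longlonglongrightarrow> (\<integral>x. F x \<partial>Q))"


section \<open>Markov processes on a countable state space\<close>

definition markov_semigroup :: "(real \<Rightarrow> 's \<Rightarrow> 's pmf) \<Rightarrow> bool" where
  "markov_semigroup P \<longleftrightarrow> P 0 = return_pmf \<and>
    (\<forall>s\<ge>0. \<forall>t\<ge>0. \<forall>x. P (s + t) x = bind_pmf (P s x) (P t))"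

text \<open>The generator is taken on the Banach space of bounded functions with the supremum norm.
  All bounded functions are required to be in its domain; this is appropriate for chains
  with bounded jump rates.\<close>

definition has_generator :: "(real \<Rightarrow> 's \<Rightarrow> 's pmf) \<Rightarrow> (('s \<Rightarrow> real) \<Rightarrow> 's \<Rightarrow> real) \<Rightarrow> bool" where
  "has_generator P L \<longleftrightarrow>
    (\<forall>f. bounded (range f) \<longrightarrow>
      uniform_limit UNIV (\<lambda>t x. (measure_pmf.expectation (P t x) f - f x) / t) (L f) (at_right 0))"

definition natural_filtration :: "'w measure \<Rightarrow> (real \<Rightarrow> 'w \<Rightarrow> 's) \<Rightarrow> real \<Rightarrow> 'w measure" where
  "natural_filtration M X s = sigma (space M) {X t -` B \<inter> space M |t B. 0 \<le> t \<and> t \<le> s}"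

definition markov_process ::
    "(('s::{countable,topological_space} \<Rightarrow> real) \<Rightarrow> 's \<Rightarrow> real) \<Rightarrow> 'w measure \<Rightarrow> (real \<Rightarrow> 'w \<Rightarrow> 's) \<Rightarrow> bool" where
  "markov_process L M X \<longleftrightarrow>
    prob_space M \<and>
    (\<forall>t\<ge>0. X t \<in> M \<rightarrow>\<^sub>M count_space UNIV) \<and>
    (\<forall>\<omega>\<in>space M. cadlag (\<lambda>t. X t \<omega>)) \<and>
    (\<exists>P. markov_semigroup P \<and> has_generator P L \<and>
      (\<forall>s\<ge>0. \<forall>t\<ge>0. \<forall>f :: 's \<Rightarrow> real. bounded (range f) \<longrightarrow>
        (AE \<omega> in M. real_cond_exp M (natural_filtration M X s) (\<lambda>\<omega>. f (X (s + t) \<omega>)) \<omega>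
                  = measure_pmf.expectation (P t (X s \<omega>)) f)))"


section \<open>The zero-range process and its rescaling\<close>

definition prob_simplex :: "(real ^ 'v::finite) set" where
  "prob_simplex = {u. (\<forall>i. u $ i \<in> {0..1}) \<and> (\<Sum>i\<in>UNIV. u $ i) = 1}"

definition lattice_simplex :: "nat \<Rightarrow> (real ^ 'v::finite) set" where
  "lattice_simplex N = {u \<in> prob_simplex. \<forall>i. real N * u $ i \<in> \<nat>}"

definition irreducible_rates :: "('v \<Rightarrow> 'v \<Rightarrow> real) \<Rightarrow> bool" where
  "irreducible_rates r \<longleftrightarrow> (\<forall>i j. (i, j) \<in> {(a, b). 0 < r a b}\<^sup>*)"

text \<open>Only used with weight \<open>g (\<eta> i)\<close>, which vanishes when there is no particle to move.\<close>

definition move_particle :: "'v \<Rightarrow> 'v \<Rightarrow> ('v \<Rightarrow> nat) \<Rightarrow> ('v \<Rightarrow> nat)" where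
  "move_particle i j \<eta> = (let \<eta>' = \<eta>(i := \<eta> i - 1) in \<eta>'(j := \<eta>' j + 1))"

definition zrp_generator ::
    "('v::finite \<Rightarrow> 'v \<Rightarrow> real) \<Rightarrow> (nat \<Rightarrow> real) \<Rightarrow> (('v \<Rightarrow> nat) \<Rightarrow> real) \<Rightarrow> ('v \<Rightarrow> nat) \<Rightarrow> real" where
  "zrp_generator r g f \<eta> =
    (\<Sum>i\<in>UNIV. \<Sum>j\<in>UNIV. g (\<eta> i) * r i j * (f (move_particle i j \<eta>) - f \<eta>))"

text \<open>Since \<open>'v\<close> is finite, the product topology on \<open>'v \<Rightarrow> nat\<close> used by \<^const>\<open>cadlag\<close>
  is the discrete one.\<close>

definition zero_range_process ::
    "('v::finite \<Rightarrow> 'v \<Rightarrow> real) \<Rightarrow> (nat \<Rightarrow> real) \<Rightarrow> 'w measure \<Rightarrow> (real \<Rightarrow> 'w \<Rightarrow> 'v \<Rightarrow> nat) \<Rightarrow> bool" where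
  "zero_range_process r g M \<eta> \<longleftrightarrow> markov_process (zrp_generator r g) M \<eta>"

definition rescaled_path :: "nat \<Rightarrow> (real \<Rightarrow> 'w \<Rightarrow> 'v::finite \<Rightarrow> nat) \<Rightarrow> 'w \<Rightarrow> real \<Rightarrow> real ^ 'v" where
  "rescaled_path N \<eta> \<omega> = (\<lambda>t\<in>{0..}. \<chi> i. real (\<eta> (t * real N) \<omega> i) / real N)"

definition rescaled_law ::
    "nat \<Rightarrow> 'w measure \<Rightarrow> (real \<Rightarrow> 'w \<Rightarrow> 'v::finite \<Rightarrow> nat) \<Rightarrow> (real \<Rightarrow> real ^ 'v) measure" where
  "rescaled_law N M \<eta> = distr M (skorokhod_borel prob_simplex) (rescaled_path N \<eta>)"


section \<open>The random walk with rates r and its hitting times\<close>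

text \<open>The walk is built from independent Exp(1) variables \<open>e (n, j)\<close>: after its \<open>n\<close>-th jump, at
  position \<open>x\<close>, it waits for the first of the independent clocks \<open>e (n, j) / r x j\<close>, of law
  Exp(\<open>r x j\<close>), and then jumps to the corresponding \<open>j\<close>. Clocks with rate 0 never ring.\<close>

definition clocks :: "(nat \<times> 'v \<Rightarrow> real) measure" where
  "clocks = (\<Pi>\<^sub>M p\<in>UNIV. density lborel (exponential_density 1))"

definition ring_time :: "('v \<Rightarrow> 'v \<Rightarrow> real) \<Rightarrow> (nat \<times> 'v \<Rightarrow> real) \<Rightarrow> nat \<Rightarrow> 'v \<Rightarrow> 'v \<Rightarrow> ereal" where
  "ring_time r e n x j = (if r x j > 0 then ereal (e (n, j) / r x j) else \<infinity>)"

primrec jump_chain :: "('v::finite \<Rightarrow> 'v \<Rightarrow> real) \<Rightarrow> 'v \<Rightarrow> (nat \<times> 'v \<Rightarrow> real) \<Rightarrow> nat \<Rightarrow> 'v" where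
  "jump_chain r k e 0 = k"
| "jump_chain r k e (Suc n) = arg_min (ring_time r e n (jump_chain r k e n)) (\<lambda>_. True)"

definition jump_time :: "('v::finite \<Rightarrow> 'v \<Rightarrow> real) \<Rightarrow> 'v \<Rightarrow> (nat \<times> 'v \<Rightarrow> real) \<Rightarrow> nat \<Rightarrow> ereal" where
  "jump_time r k e n = (\<Sum>m<n. Min (range (ring_time r e m (jump_chain r k e m))))"

definition random_walk :: "('v::finite \<Rightarrow> 'v \<Rightarrow> real) \<Rightarrow> 'v \<Rightarrow> real \<Rightarrow> (nat \<times> 'v \<Rightarrow> real) \<Rightarrow> 'v" where
  "random_walk r k t e = jump_chain r k e (LEAST n. ereal t < jump_time r k e (Suc n))"

definition hitting_time ::
    "('v::finite \<Rightarrow> 'v \<Rightarrow> real) \<Rightarrow> 'v \<Rightarrow> 'v set \<Rightarrow> (nat \<times> 'v \<Rightarrow> real) \<Rightarrow> ereal" where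
  "hitting_time r k B e = Inf {ereal t |t. 0 \<le> t \<and> random_walk r k t e \<in> B}"


section \<open>Trace rates, absorbing sets and the limit path\<close>

definition trace_rate :: "('v::finite \<Rightarrow> 'v \<Rightarrow> real) \<Rightarrow> 'v set \<Rightarrow> 'v \<Rightarrow> 'v \<Rightarrow> real" where
  "trace_rate r A i j = (if i = j then 0 else
     r i j + (\<Sum>k\<in>-A. r i k *
       measure clocks {e \<in> space clocks. hitting_time r k A e = hitting_time r k {j} e}))"

definition drift :: "('v::finite \<Rightarrow> 'v \<Rightarrow> real) \<Rightarrow> 'v set \<Rightarrow> 'v \<Rightarrow> real" where
  "drift r A i = (\<Sum>j\<in>A. trace_rate r A j i - trace_rate r A i j)"

definition absorbing :: "('v::finite \<Rightarrow> 'v \<Rightarrow> real) \<Rightarrow> 'v set \<Rightarrow> bool" where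
  "absorbing r A \<longleftrightarrow> A = UNIV \<or> (\<forall>j\<in>-A. drift r (A \<union> {j}) j \<le> 0)"

definition absorbing_hull :: "('v::finite \<Rightarrow> 'v \<Rightarrow> real) \<Rightarrow> 'v set \<Rightarrow> 'v set" where
  "absorbing_hull r S = \<Inter>{A. absorbing r A \<and> S \<subseteq> A}"

definition support :: "real ^ 'v::finite \<Rightarrow> 'v set" where
  "support v = {i. v $ i > 0}"

definition velocity :: "('v::finite \<Rightarrow> 'v \<Rightarrow> real) \<Rightarrow> real ^ 'v \<Rightarrow> real ^ 'v" where
  "velocity r v = (\<chi> i. if i \<in> absorbing_hull r (support v)
     then drift r (absorbing_hull r (support v)) i else 0)"

definition decreasing_sites :: "('v::finite \<Rightarrow> 'v \<Rightarrow> real) \<Rightarrow> real ^ 'v \<Rightarrow> 'v set" where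
  "decreasing_sites r v = {i \<in> support v. velocity r v $ i < 0}"

definition exit_time :: "('v::finite \<Rightarrow> 'v \<Rightarrow> real) \<Rightarrow> real ^ 'v \<Rightarrow> real" where
  "exit_time r v = Min ((\<lambda>i. - v $ i / velocity r v $ i) ` decreasing_sites r v)"

text \<open>The pairs $(T_k, v_k)$; once the procedure has stopped the sequence stays constant.\<close>

primrec breakpoint :: "('v::finite \<Rightarrow> 'v \<Rightarrow> real) \<Rightarrow> real ^ 'v \<Rightarrow> nat \<Rightarrow> real \<times> (real ^ 'v)" where
  "breakpoint r u 0 = (0, u)"
| "breakpoint r u (Suc k) = (case breakpoint r u k of (T, v) \<Rightarrow>
     if velocity r v = 0 then (T, v)
     else (T + exit_time r v, v + exit_time r v *\<^sub>R velocity r v))"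

definition stop_index :: "('v::finite \<Rightarrow> 'v \<Rightarrow> real) \<Rightarrow> real ^ 'v \<Rightarrow> nat" where
  "stop_index r u = (LEAST k. velocity r (snd (breakpoint r u k)) = 0)"

definition limit_path :: "('v::finite \<Rightarrow> 'v \<Rightarrow> real) \<Rightarrow> real ^ 'v \<Rightarrow> real \<Rightarrow> real ^ 'v" where
  "limit_path r u = (\<lambda>t\<in>{0..}.
     let T = (\<lambda>k. fst (breakpoint r u k)); v = (\<lambda>k. snd (breakpoint r u k)); f = stop_index r u
     in if t \<ge> T f then v f
        else let k = (THE k. k < f \<and> T k \<le> t \<and> t < T (Suc k))
             in v k + (t - T k) *\<^sub>R velocity r (v k))"

end

theory Submission imports Defs begin

text \<open>Write \<open>adj r\<close> for the adjoint of the generator of the walk. The drift of a set \<open>A\<close> is \<open>adj r \<phi>\<close>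
  for the function \<open>\<phi>\<close> that equals 1 on \<open>A\<close> and satisfies \<open>adj r \<phi> = 0\<close> elsewhere, so the limit path solves
  \<open>\<zeta> t = u + adj r (Y t)\<close>, where \<open>Y t i\<close> grows at rate at most 1, and at rate 1 while site \<open>i\<close> is not empty.
  For the process, \<open>Y t i\<close> is the rescaled time integral of \<open>g (\<eta> i)\<close>. An occupied site has speed at least 1,
  and the time means of the expected speeds are asymptotically at most 1: otherwise a cluster point would be an
  invariant mean whose strata, according to the set of sites with infinitely many particles, are
  invariant for open networks, and these have product form with fugacities at most 1. Hence the process on
  blocks of length \<open>\<delta> N\<close> solves the fluid equations approximately, up to martingale noise,
  and approximate solutions stay close to each other.\<close>

section \<open>The walk and its adjoint\<close>

text \<open>\<open>g\<close> need not be monotone, so ordered couplings are not at hand and no rate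
  of relaxation is known; the mean speed is bounded by compactness instead. The number of particles
  tends to infinity, so a limit of time means loses countable additivity: mass escapes to
  configurations with infinitely many particles at the sites of some set. A mean on all bounded
  functions still sees this mass, and such a set becomes a set of reservoirs working at rate 1, the
  limit of \<open>g\<close>. Summability of the mass over the remaining sites is what keeps their
  fugacities at most 1.

  Blocks of length \<delta> N are long on the microscopic scale, so that time means apply, and short
  on the fluid scale. Two approximate solutions are compared relative to a site that is occupied in
  both, with weights that make the excess of one over the other decay.

  Each \<open>N\<close> comes with its own transition semigroup, so the estimates are uniform over
  all semigroups with the given generator. The limit path is continuous, hence locally uniform
  closeness suffices for weak convergence, but the integrals make sense only once the path map is
  known to be measurable for the Skorokhod Borel sets.\<close>

definition gen :: "('v::finite \<Rightarrow> 'v \<Rightarrow> real) \<Rightarrow> ('v \<Rightarrow> real) \<Rightarrow> 'v \<Rightarrow> real" where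
  "gen r f i = (\<Sum>j\<in>UNIV. r i j * (f j - f i))"

definition adj :: "('v::finite \<Rightarrow> 'v \<Rightarrow> real) \<Rightarrow> ('v \<Rightarrow> real) \<Rightarrow> 'v \<Rightarrow> real" where
  "adj r \<phi> i = (\<Sum>j\<in>UNIV. \<phi> j * r j i - \<phi> i * r i j)"

lemma adj_alt: "adj r \<phi> i = (\<Sum>j\<in>UNIV. \<phi> j * r j i) - \<phi> i * sum (r i) UNIV"
  unfolding adj_def by (simp add: sum_subtractf sum_distrib_left)

lemma adj_gen_duality: "(\<Sum>i\<in>UNIV. f i * adj r \<phi> i) = (\<Sum>i\<in>UNIV. \<phi> i * gen r f i)"
proof -
  have "(\<Sum>i\<in>UNIV. f i * adj r \<phi> i) = (\<Sum>i\<in>UNIV. \<Sum>j\<in>UNIV. f i * (\<phi> j * r j i)) - (\<Sum>i\<in>UNIV. \<Sum>j\<in>UNIV. f i * (\<phi> i * r i j))"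
    unfolding adj_def by (simp add: sum_distrib_left algebra_simps sum_subtractf)
  also have "(\<Sum>i\<in>UNIV. \<Sum>j\<in>UNIV. f i * (\<phi> j * r j i)) = (\<Sum>i\<in>UNIV. \<Sum>j\<in>UNIV. f j * (\<phi> i * r i j))"
    by (rule sum.swap)
  also have "\<dots> - (\<Sum>i\<in>UNIV. \<Sum>j\<in>UNIV. f i * (\<phi> i * r i j)) = (\<Sum>i\<in>UNIV. \<phi> i * gen r f i)"
    unfolding gen_def by (simp add: sum_distrib_left algebra_simps sum_subtractf)
  finally show ?thesis .
qed

lemma sum_adj_zero: "(\<Sum>i\<in>UNIV. adj r \<phi> i) = 0"
  using adj_gen_duality[of "\<lambda>_. 1" r \<phi>] by (simp add: gen_def)

lemma adj_add: "adj r (\<lambda>i. \<phi> i + \<psi> i) i = adj r \<phi> i + adj r \<psi> i"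
  by (simp add: adj_def algebra_simps flip: sum.distrib)

lemma adj_diff: "adj r (\<lambda>i. \<phi> i - \<psi> i) i = adj r \<phi> i - adj r \<psi> i"
  by (simp add: adj_def algebra_simps flip: sum_subtractf)

lemma adj_scale: "adj r (\<lambda>i. c * \<phi> i) i = c * adj r \<phi> i"
  by (simp add: adj_def algebra_simps sum_distrib_left)

locale irreducible_walk =
  fixes r :: "'v::finite \<Rightarrow> 'v \<Rightarrow> real"
  assumes r_nonneg: "\<And>i j. 0 \<le> r i j"
    and r_diag: "\<And>i. r i i = 0"
    and r_irred: "irreducible_rates r"
begin

text \<open>Irreducibility in the form that the maximum principles use: a path from \<open>i\<close>
  to \<open>k\<close> has to leave \<open>P\<close> along some edge.\<close>

lemma exit_edge:
  assumes "i \<in> P" "k \<notin> P"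
  obtains a b where "a \<in> P" "b \<notin> P" "r a b > 0"
proof -
  have "(i, k) \<in> {(a, b). 0 < r a b}\<^sup>*" using r_irred unfolding irreducible_rates_def by blast
  then have "k \<notin> P \<longrightarrow> (\<exists>a\<in>P. \<exists>b. b \<notin> P \<and> r a b > 0)"
    by (induction rule: rtrancl_induct) (use assms in auto)
  with assms that show ?thesis by blast
qed

text \<open>Duality with the indicator of \<open>P\<close>: what accumulates in \<open>P\<close> is
  the flux from outside minus the flux to the outside.\<close>

lemma adj_sum_on:
  "(\<Sum>k\<in>P. adj r \<phi> k) = (\<Sum>j\<in>-P. \<phi> j * sum (r j) P) - (\<Sum>j\<in>P. \<phi> j * sum (r j) (-P))"
proof -
  have "(\<Sum>k\<in>P. adj r \<phi> k) = (\<Sum>k\<in>UNIV. indicator P k * adj r \<phi> k)"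
    by (simp add: indicator_def if_distrib sum.If_cases cong: if_cong)
  also have "\<dots> = (\<Sum>k\<in>UNIV. \<phi> k * gen r (indicator P) k)" by (rule adj_gen_duality)
  also have "\<dots> = (\<Sum>k\<in>-P. \<phi> k * gen r (indicator P) k) + (\<Sum>k\<in>P. \<phi> k * gen r (indicator P) k)"
    using sum.union_disjoint[of "-P" P "\<lambda>k. \<phi> k * gen r (indicator P) k"] by (simp add: Compl_partition2)
  also have "(\<Sum>k\<in>-P. \<phi> k * gen r (indicator P) k) = (\<Sum>j\<in>-P. \<phi> j * sum (r j) P)"
    by (rule sum.cong) (auto simp: gen_def indicator_def if_distrib sum.If_cases cong: if_cong)
  also have "(\<Sum>k\<in>P. \<phi> k * gen r (indicator P) k) = (\<Sum>j\<in>P. - (\<phi> j * sum (r j) (-P)))"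
  proof (rule sum.cong)
    fix k assume "k \<in> P"
    have "gen r (indicator P) k = (\<Sum>j\<in>UNIV. if j \<in> P then 0 else - r k j)"
      unfolding gen_def by (rule sum.cong) (use \<open>k\<in>P\<close> in \<open>auto simp: indicator_def\<close>)
    also have "\<dots> = - sum (r k) (-P)" by (simp add: sum.If_cases sum_negf Compl_eq)
    finally show "\<phi> k * gen r (indicator P) k = - (\<phi> k * sum (r k) (-P))" by simp
  qed simp
  finally show ?thesis by (simp add: sum_negf)
qed

text \<open>On the set \<open>P\<close> where \<phi> is positive the net flux is nonnegative, since
  \<open>P\<close> avoids \<open>A\<close>. Yet nothing positive enters \<open>P\<close> from
  outside, while irreducibility provides an edge out of \<open>P\<close> that carries a positive
  flux.\<close>

lemma adj_max_principle:
  assumes "A \<noteq> {}" "\<And>k. k \<notin> A \<Longrightarrow> adj r \<phi> k \<ge> 0" "\<And>k. k \<in> A \<Longrightarrow> \<phi> k \<le> 0"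
  shows "\<phi> k \<le> 0"
proof (rule ccontr)
  assume k: "\<not> \<phi> k \<le> 0"
  define P where "P = {k. \<phi> k > 0}"
  have PA: "P \<inter> A = {}" using assms(3) by (auto simp: P_def not_le[symmetric])
  obtain a0 where "a0 \<in> A" using assms(1) by blast
  then have "a0 \<notin> P" "k \<in> P" using PA k by (auto simp: P_def)
  then obtain a b where ab: "a \<in> P" "b \<notin> P" "r a b > 0" using exit_edge[of k P a0] by blast
  have "0 \<le> (\<Sum>k\<in>P. adj r \<phi> k)" by (rule sum_nonneg) (use PA assms(2) in blast)
  moreover have "(\<Sum>j\<in>-P. \<phi> j * sum (r j) P) \<le> 0"
    by (rule sum_nonpos) (auto simp: P_def mult_nonpos_nonneg sum_nonneg r_nonneg)
  moreover have "(\<Sum>j\<in>P. \<phi> j * sum (r j) (-P)) > 0"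
  proof (rule sum_pos2[OF _ ab(1)])
    have "sum (r a) (-P) > 0" by (rule sum_pos2[of _ b]) (use ab r_nonneg in auto)
    then show "\<phi> a * sum (r a) (-P) > 0" using ab(1) by (simp add: P_def)
    show "\<And>i. i \<in> P \<Longrightarrow> 0 \<le> \<phi> i * sum (r i) (-P)" by (auto simp: P_def intro!: mult_nonneg_nonneg sum_nonneg r_nonneg)
  qed simp
  ultimately show False using adj_sum_on[of \<phi> P] by linarith
qed

text \<open>The linear system is square, one equation per site, so existence follows from
  uniqueness, and uniqueness is the maximum principle for a solution and for its negative.\<close>

lemma adj_solution_exists:
  assumes "A \<noteq> {}"
  obtains \<phi> where "\<And>k. k \<in> A \<Longrightarrow> \<phi> k = a k" "\<And>k. k \<notin> A \<Longrightarrow> adj r \<phi> k = b k"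
proof -
  define T :: "real^'v \<Rightarrow> real^'v" where "T x = (\<chi> k. if k \<in> A then x $ k else adj r (($) x) k)" for x
  have comp: "($) (x + y) = (\<lambda>i. x $ i + y $ i)" "($) (c *\<^sub>R x) = (\<lambda>i. c * x $ i)" for x y :: "real^'v" and c
    by auto
  have lin: "linear T"
    by (rule linearI) (auto simp: T_def vec_eq_iff comp adj_add adj_scale)
  have "inj T" unfolding linear_injective_0[OF lin]
  proof (intro allI impI)
    fix x assume "T x = 0"
    then have h: "\<And>k. k \<in> A \<Longrightarrow> x $ k = 0" "\<And>k. k \<notin> A \<Longrightarrow> adj r (($) x) k = 0"
      by (auto simp: T_def vec_eq_iff split: if_splits)
    have "x $ k \<le> 0" for k by (rule adj_max_principle[OF assms, of "($) x"]) (use h in auto)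
    moreover have "- (x $ k) \<le> 0" for k
      using adj_max_principle[OF assms, of "\<lambda>k. (-1) * x $ k" k] adj_scale[of r "-1" "($) x"] h by auto
    ultimately show "x = 0" by (metis antisym neg_le_0_iff_le vec_eq_iff zero_index)
  qed
  then have "surj T" using lin linear_injective_imp_surjective by blast
  then obtain x where "T x = (\<chi> k. if k \<in> A then a k else b k)" by (metis surjD)
  then have "\<And>k. k \<in> A \<Longrightarrow> x $ k = a k" "\<And>k. k \<notin> A \<Longrightarrow> adj r (($) x) k = b k"
    by (auto simp: T_def vec_eq_iff split: if_splits)
  then show ?thesis using that by blast
qed

text \<open>The maximum principle for the negative gives \<phi> \<ge> 0. A zero at the end of an
  edge that starts at a positive site would receive inflow without outflow.\<close>

lemma adj_solution_pos:
  assumes "A \<noteq> {}" "\<And>k. k \<in> A \<Longrightarrow> \<phi> k > 0" "\<And>k. k \<notin> A \<Longrightarrow> adj r \<phi> k = 0"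
  shows "\<phi> k > 0"
proof -
  have "adj r (\<lambda>k. -1 * \<phi> k) k \<ge> 0" if "k \<notin> A" for k
    using adj_scale[of r "-1" \<phi> k] assms(3)[OF that] by simp
  then have nn: "\<phi> k \<ge> 0" for k
    using adj_max_principle[OF assms(1), of "\<lambda>k. -1 * \<phi> k" k] assms(2) by (simp add: less_imp_le)
  show ?thesis
  proof (rule ccontr)
    assume k: "\<not> \<phi> k > 0"
    obtain a0 where "a0 \<in> A" using assms(1) by blast
    then obtain a b where ab: "\<phi> a > 0" "\<not> \<phi> b > 0" "r a b > 0"
      using exit_edge[of a0 "{k. \<phi> k > 0}" k] k assms(2) by auto
    then have b: "\<phi> b = 0" "b \<notin> A" using nn[of b] assms(2)[of b] by auto
    have "0 < (\<Sum>j\<in>UNIV. \<phi> j * r j b)"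
      by (rule sum_pos2[of _ a]) (use ab nn r_nonneg in auto)
    then show False using assms(3)[OF b(2)] b(1) by (simp add: adj_alt)
  qed
qed

text \<open>The dual principle, for functions instead of densities; it identifies the hitting
  probabilities. The contradiction arises at an edge that leaves the set of maximum points.\<close>

lemma gen_max_principle:
  assumes "A \<noteq> {}" "\<And>k. k \<notin> A \<Longrightarrow> gen r h k \<ge> 0" "\<And>k. k \<in> A \<Longrightarrow> h k \<le> 0"
  shows "h k \<le> 0"
proof (rule ccontr)
  assume k: "\<not> h k \<le> 0"
  define m where "m = Max (range h)"
  have hm: "h j \<le> m" for j unfolding m_def by simp
  have mpos: "m > 0" using k hm[of k] by linarith
  have "m \<in> range h" unfolding m_def by (rule Max_in) auto
  then obtain k0 where k0: "h k0 = m" by auto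
  obtain a0 where "a0 \<in> A" using assms(1) by blast
  then have "h a0 \<noteq> m" using assms(3) mpos by force
  then obtain a b where ab: "h a = m" "h b \<noteq> m" "r a b > 0"
    using exit_edge[of k0 "{k. h k = m}" a0] k0 by auto
  then have "a \<notin> A" using assms(3)[of a] mpos by auto
  have "(\<Sum>j\<in>UNIV. r a j * (h a - h j)) > 0"
  proof (rule sum_pos2[of _ b])
    show "0 < r a b * (h a - h b)" using ab hm[of b] by simp
  qed (use ab hm r_nonneg in auto)
  moreover have "gen r h a = - (\<Sum>j\<in>UNIV. r a j * (h a - h j))"
    unfolding gen_def by (simp add: algebra_simps flip: sum_negf)
  ultimately show False using assms(2)[OF \<open>a \<notin> A\<close>] by linarith
qed

end

section \<open>Trace rates\<close>

definition exp_law :: "real measure" where "exp_law = density lborel (exponential_density 1)"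

lemma sets_exp_law [simp, measurable_cong]: "sets exp_law = sets borel" by (simp add: exp_law_def)
lemma space_exp_law [simp]: "space exp_law = UNIV" by (simp add: exp_law_def)

interpretation exp_law: prob_space exp_law
  unfolding exp_law_def by (rule prob_space_exponential_density) simp

lemma emeasure_exp_law_greater:
  assumes "c \<ge> 0" shows "emeasure exp_law {c<..} = ennreal (exp (- c))"
proof -
  have "distributed exp_law lborel (\<lambda>x. x) (exponential_density 1)"
    unfolding distributed_def
    by (auto simp: exp_law_def borel_measurable_erlang_density distr_id2)
  from exp_law.exponential_distributedD_gt[OF this assms zero_less_one]
  have "measure exp_law {x \<in> UNIV. c < x} = exp (- c)" by simp
  then show ?thesis by (simp add: exp_law.emeasure_eq_measure greaterThan_def)
qed

lemma AE_exp_law_pos: "AE x in exp_law. x > 0"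
proof -
  have "measure exp_law {0<..} = 1"
    using emeasure_exp_law_greater[of 0] by (simp add: exp_law.emeasure_eq_measure)
  then have "AE x in exp_law. x \<in> {0<..}" by (subst exp_law.prob_eq_1[symmetric]) auto
  then show ?thesis by simp
qed

text \<open>The clocks consulted at one jump, that is, one row of \<open>clocks\<close>.\<close>

definition row_law :: "('v::finite \<Rightarrow> real) measure" where "row_law = Pi\<^sub>M UNIV (\<lambda>_. exp_law)"

lemma space_row_law [simp]: "space (row_law :: ('v::finite \<Rightarrow> real) measure) = UNIV"
  by (simp add: row_law_def space_PiM)

lemma sets_row_law [measurable_cong]: "sets row_law = sets (Pi\<^sub>M UNIV (\<lambda>_. borel))"
  unfolding row_law_def by (rule sets_PiM_cong) auto

interpretation row_law: prob_space "row_law :: ('v::finite \<Rightarrow> real) measure"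
  unfolding row_law_def by (rule prob_space_PiM) unfold_locales

lemma clocks_eq: "clocks = Pi\<^sub>M UNIV (\<lambda>_. exp_law)"
  by (simp add: clocks_def exp_law_def)

lemma space_clocks [simp]: "space (clocks :: (nat \<times> 'v \<Rightarrow> real) measure) = UNIV"
  by (simp add: clocks_eq space_PiM)

lemma sets_clocks [measurable_cong]: "sets clocks = sets (Pi\<^sub>M UNIV (\<lambda>_. borel))"
  unfolding clocks_eq by (rule sets_PiM_cong) auto

interpretation clocks: prob_space "clocks :: (nat \<times> 'v \<Rightarrow> real) measure"
  unfolding clocks_eq by (rule prob_space_PiM) unfold_locales

lemma measure_clocks_UNIV [simp]: "measure (clocks :: (nat \<times> 'v \<Rightarrow> real) measure) UNIV = 1"
  using clocks.prob_space by simp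

lemma AE_clocks_pos: "AE e in (clocks :: (nat \<times> 'v::finite \<Rightarrow> real) measure). \<forall>p. e p > 0"
  unfolding AE_all_countable
proof
  fix p :: "nat \<times> 'v"
  show "AE e in clocks. e p > 0"
    unfolding clocks_eq
    by (rule AE_PiM_component[where P="\<lambda>x. x > 0"]) (use AE_exp_law_pos in \<open>auto intro: exp_law.prob_space_axioms\<close>)
qed

definition jump_target :: "('v::finite \<Rightarrow> 'v \<Rightarrow> real) \<Rightarrow> 'v \<Rightarrow> ('v \<Rightarrow> real) \<Rightarrow> 'v" where
  "jump_target r x w = arg_min (\<lambda>j. if r x j > 0 then ereal (w j / r x j) else \<infinity>) (\<lambda>_. True)"

lemma jump_chain_Suc: "jump_chain r k e (Suc n) = jump_target r (jump_chain r k e n) (\<lambda>j. e (n, j))"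
  by (simp add: jump_target_def ring_time_def[abs_def])

text \<open>\<open>arg_min\<close> picks an element of the set \<open>Q\<close> of minimisers, and
  the pick depends on this set alone. As \<open>Q\<close> takes only finitely many values, the
  result is measurable whatever the choice does at ties.\<close>

lemma measurable_arg_min_finite:
  fixes t :: "'v::finite \<Rightarrow> 'a \<Rightarrow> ereal"
  assumes [measurable]: "\<And>j. t j \<in> borel_measurable M"
  shows "(\<lambda>w. arg_min (\<lambda>j. t j w) (\<lambda>_. True)) \<in> M \<rightarrow>\<^sub>M count_space UNIV"
proof -
  define Q where "Q w = {x. \<not> (\<exists>y. t y w < t x w)}" for w
  have "Q \<in> M \<rightarrow>\<^sub>M count_space UNIV"
  proof (rule measurable_count_space_eq_countable[THEN iffD2, rotated])
    show "Q \<in> space M \<rightarrow> UNIV \<and> (\<forall>S\<in>UNIV. Q -` {S} \<inter> space M \<in> sets M)"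
    proof (intro conjI ballI)
      fix S
      have "Q -` {S} \<inter> space M = {w \<in> space M. \<forall>x. x \<in> S \<longleftrightarrow> \<not> (\<exists>y. t y w < t x w)}"
        by (auto simp: Q_def)
      also have "\<dots> \<in> sets M" by measurable
      finally show "Q -` {S} \<inter> space M \<in> sets M" .
    qed simp
  qed (rule countable_finite, simp)
  then have "(\<lambda>w. SOME x. x \<in> Q w) \<in> M \<rightarrow>\<^sub>M count_space UNIV"
    by (rule measurable_compose) simp
  then show ?thesis by (simp add: arg_min_def is_arg_min_def Q_def)
qed

lemma measurable_jump_target [measurable]: "jump_target r x \<in> row_law \<rightarrow>\<^sub>M count_space UNIV"
  unfolding jump_target_def by (rule measurable_arg_min_finite) measurable

context irreducible_walk begin

text \<open>Only the event \<open>S\<close> that the clock of \<open>y\<close> rings strictly first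
  is computed, so ties need no discussion. These lower bounds add up to one, which turns them into
  equalities in \<open>prob_jump_target\<close>.\<close>

lemma prob_jump_target_ge:
  assumes ry: "r x y > 0"
  shows "measure row_law {w. jump_target r x w = y} \<ge> r x y / sum (r x) UNIV"
proof -
  define S where "S = {w :: 'v \<Rightarrow> real. \<forall>j. j \<noteq> y \<longrightarrow> r x j * w y / r x y < w j}"
  have S_meas: "S \<in> sets row_law"
  proof -
    have "{w \<in> space row_law. \<forall>j. j \<noteq> y \<longrightarrow> r x j * w y / r x y < w j} \<in> sets row_law" by measurable
    then show ?thesis by (simp add: S_def)
  qed
  have sub: "S \<subseteq> {w. jump_target r x w = y}"
  proof
    fix w assume w: "w \<in> S"
    let ?t = "\<lambda>j. if r x j > 0 then ereal (w j / r x j) else \<infinity>"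
    have lt: "?t y < ?t j" if "j \<noteq> y" for j
    proof (cases "r x j > 0")
      case True
      have "r x j * w y / r x y < w j" using w that by (simp add: S_def)
      then show ?thesis using True ry by (simp add: field_simps)
    qed (use ry in simp)
    have "?t (jump_target r x w) = ?t y"
      unfolding jump_target_def
    proof (rule arg_min_equality)
      show "?t y \<le> ?t j" for j using lt[of j] by (cases "j = y") auto
    qed simp
    then show "w \<in> {w. jump_target r x w = y}" using lt[of "jump_target r x w"] by force
  qed
  define I where "I = UNIV - {y}"
  \<comment> \<open>Given the value \<open>a\<close> of the clock of \<open>y\<close>, the clock of
    \<open>j\<close> has to exceed \<open>r x j * a / r x y\<close>. The product of these
    probabilities is \<open>exp (- (\<rho> * a))\<close>, and integrating over \<open>a\<close>
    gives \<open>1 / (1 + \<rho>)\<close>.\<close>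
  define \<rho> where "\<rho> = sum (r x) I / r x y"
  have \<rho>: "\<rho> \<ge> 0" unfolding \<rho>_def using ry by (auto intro!: divide_nonneg_nonneg sum_nonneg r_nonneg)
  have \<rho>1: "1 + \<rho> = sum (r x) UNIV / r x y"
    unfolding \<rho>_def I_def using ry by (simp add: sum.remove[of UNIV y] add_divide_distrib)
  interpret P: product_sigma_finite "\<lambda>_::'v. exp_law" by unfold_locales
  interpret PI: prob_space "Pi\<^sub>M I (\<lambda>_. exp_law)" by (rule prob_space_PiM) unfold_locales
  have row: "distr (exp_law \<Otimes>\<^sub>M Pi\<^sub>M I (\<lambda>_. exp_law)) (Pi\<^sub>M (insert y I) (\<lambda>_. exp_law)) (\<lambda>(a, X). X(y := a)) = Pi\<^sub>M (insert y I) (\<lambda>_. exp_law)"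
    by (rule distr_pair_PiM_eq_PiM) (auto intro: exp_law.prob_space_axioms)
  have UN: "insert y I = UNIV" by (auto simp: I_def)
  have meas: "(\<lambda>(a, X). X(y := a)) \<in> exp_law \<Otimes>\<^sub>M Pi\<^sub>M I (\<lambda>_. exp_law) \<rightarrow>\<^sub>M row_law"
    unfolding row_law_def UN[symmetric] by measurable
  have "emeasure row_law S = emeasure (distr (exp_law \<Otimes>\<^sub>M Pi\<^sub>M I (\<lambda>_. exp_law)) row_law (\<lambda>(a, X). X(y := a))) S"
    using row unfolding UN row_law_def by simp
  also have "\<dots> = emeasure (exp_law \<Otimes>\<^sub>M Pi\<^sub>M I (\<lambda>_. exp_law)) ((\<lambda>(a, X). X(y := a)) -` S \<inter> space (exp_law \<Otimes>\<^sub>M Pi\<^sub>M I (\<lambda>_. exp_law)))"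
    by (rule emeasure_distr[OF meas S_meas])
  also have "\<dots> = (\<integral>\<^sup>+a. emeasure (Pi\<^sub>M I (\<lambda>_. exp_law)) (Pair a -` ((\<lambda>(a, X). X(y := a)) -` S \<inter> space (exp_law \<Otimes>\<^sub>M Pi\<^sub>M I (\<lambda>_. exp_law)))) \<partial>exp_law)"
    by (rule PI.emeasure_pair_measure_alt[OF measurable_sets[OF meas S_meas]])
  also have "\<dots> = (\<integral>\<^sup>+a. ennreal (exp (- (\<rho> * a))) \<partial>exp_law)"
  proof (rule nn_integral_cong_AE)
    show "AE a in exp_law. emeasure (Pi\<^sub>M I (\<lambda>_. exp_law)) (Pair a -` ((\<lambda>(a, X). X(y := a)) -` S \<inter> space (exp_law \<Otimes>\<^sub>M Pi\<^sub>M I (\<lambda>_. exp_law)))) = ennreal (exp (- (\<rho> * a)))"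
      using AE_exp_law_pos
    proof eventually_elim
      case (elim a)
      have "Pair a -` ((\<lambda>(a, X). X(y := a)) -` S \<inter> space (exp_law \<Otimes>\<^sub>M Pi\<^sub>M I (\<lambda>_. exp_law))) = Pi\<^sub>E I (\<lambda>j. {r x j * a / r x y<..})"
        by (auto simp: S_def I_def space_pair_measure space_PiM PiE_iff)
      then have "emeasure (Pi\<^sub>M I (\<lambda>_. exp_law)) (Pair a -` ((\<lambda>(a, X). X(y := a)) -` S \<inter> space (exp_law \<Otimes>\<^sub>M Pi\<^sub>M I (\<lambda>_. exp_law)))) = (\<Prod>j\<in>I. emeasure exp_law {r x j * a / r x y<..})"
        by (simp add: P.emeasure_PiM)
      also have "\<dots> = (\<Prod>j\<in>I. ennreal (exp (- (r x j * a / r x y))))"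
        using elim ry r_nonneg by (intro prod.cong refl emeasure_exp_law_greater) simp
      also have "\<dots> = ennreal (\<Prod>j\<in>I. exp (- (r x j * a / r x y)))" by (rule prod_ennreal) simp
      also have "(\<Prod>j\<in>I. exp (- (r x j * a / r x y))) = exp (- (\<rho> * a))"
        by (simp add: \<rho>_def I_def sum_negf sum_divide_distrib sum_distrib_right flip: exp_sum)
      finally show ?case .
    qed
  qed
  also have "\<dots> = (\<integral>\<^sup>+a. ennreal (exponential_density 1 a) * ennreal (exp (- (\<rho> * a))) \<partial>lborel)"
    unfolding exp_law_def by (rule nn_integral_density) (auto simp: borel_measurable_erlang_density)
  also have "\<dots> = (\<integral>\<^sup>+a. ennreal (1 / (1 + \<rho>)) * ennreal (exponential_density (1 + \<rho>) a) \<partial>lborel)"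
  proof (rule nn_integral_cong)
    fix a :: real
    have "exponential_density 1 a * exp (- (\<rho> * a)) = 1 / (1 + \<rho>) * exponential_density (1 + \<rho>) a"
      using \<rho> by (auto simp: exponential_density_def exp_diff exp_minus exp_add distrib_right field_simps)
    then show "ennreal (exponential_density 1 a) * ennreal (exp (- (\<rho> * a))) = ennreal (1 / (1 + \<rho>)) * ennreal (exponential_density (1 + \<rho>) a)"
      using \<rho> by (simp add: exponential_density_nonneg flip: ennreal_mult)
  qed
  also have "\<dots> = ennreal (1 / (1 + \<rho>)) * (\<integral>\<^sup>+a. ennreal (exponential_density (1 + \<rho>) a) \<partial>lborel)"
    by (rule nn_integral_cmult) (simp add: borel_measurable_erlang_density)
  also have "(\<integral>\<^sup>+a. ennreal (exponential_density (1 + \<rho>) a) \<partial>lborel) = 1"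
    using prob_space.emeasure_space_1[OF prob_space_exponential_density[of "1 + \<rho>"]] \<rho>
    by (simp add: emeasure_density borel_measurable_erlang_density)
  finally have "measure row_law S = 1 / (1 + \<rho>)" using \<rho> by (simp add: row_law.emeasure_eq_measure)
  also have "\<dots> = r x y / sum (r x) UNIV" unfolding \<rho>1 by simp
  finally have "measure row_law S = r x y / sum (r x) UNIV" .
  moreover have "measure row_law S \<le> measure row_law {w. jump_target r x w = y}"
  proof (rule row_law.finite_measure_mono[OF sub])
    have "{w \<in> space row_law. jump_target r x w = y} \<in> sets row_law" by measurable
    then show "{w. jump_target r x w = y} \<in> sets row_law" by simp
  qed
  ultimately show ?thesis by simp
qed

lemma prob_jump_target:
  assumes "sum (r x) UNIV > 0"
  shows "measure row_law {w. jump_target r x w = y} = r x y / sum (r x) UNIV"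
proof -
  let ?p = "\<lambda>y. measure row_law {w. jump_target r x w = y}"
  have ev: "{w. jump_target r x w = y} \<in> sets row_law" for y
  proof -
    have "{w \<in> space row_law. jump_target r x w = y} \<in> sets row_law" by measurable
    then show ?thesis by simp
  qed
  have "(\<Sum>y\<in>UNIV. ?p y) = measure row_law (\<Union>y\<in>UNIV. {w. jump_target r x w = y})"
    by (rule row_law.finite_measure_finite_Union[symmetric]) (auto simp: ev disjoint_family_on_def)
  also have "(\<Union>y\<in>UNIV. {w. jump_target r x w = y}) = space row_law" by auto
  finally have sum1: "(\<Sum>y\<in>UNIV. ?p y) = 1" by (simp only: row_law.prob_space)
  have ge: "r x y / sum (r x) UNIV \<le> ?p y" for y
    using prob_jump_target_ge[of x y] r_nonneg[of x y] by (cases "r x y = 0") auto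
  have "(\<Sum>y\<in>UNIV. ?p y - r x y / sum (r x) UNIV) = 0"
    using sum1 assms by (simp add: sum_subtractf flip: sum_divide_distrib)
  then show ?thesis using sum_nonneg_eq_0_iff[of UNIV "\<lambda>y. ?p y - r x y / sum (r x) UNIV"] ge by simp
qed

end

text \<open>The shift behind first-step analysis: a fresh row that decides the first jump, followed
  by the clocks of the remaining walk.\<close>

definition prepend_row :: "('v \<Rightarrow> real) \<times> (nat \<times> 'v \<Rightarrow> real) \<Rightarrow> nat \<times> 'v \<Rightarrow> real" where
  "prepend_row = (\<lambda>(w, e) (n, j). case n of 0 \<Rightarrow> w j | Suc m \<Rightarrow> e (m, j))"

lemma measurable_prepend_row: "prepend_row \<in> row_law \<Otimes>\<^sub>M clocks \<rightarrow>\<^sub>M (clocks :: (nat \<times> 'v::finite \<Rightarrow> real) measure)"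
  unfolding clocks_eq
proof (rule measurable_PiM_single')
  fix p :: "nat \<times> 'v"
  obtain n j where p: "p = (n, j)" by force
  show "(\<lambda>x. prepend_row x p) \<in> row_law \<Otimes>\<^sub>M Pi\<^sub>M UNIV (\<lambda>_. exp_law) \<rightarrow>\<^sub>M exp_law"
    unfolding p prepend_row_def row_law_def by (cases n) (simp_all add: split_beta')
qed auto

text \<open>A cylinder over \<open>J\<close> splits into its part \<open>J0\<close> in row 0 and the
  shifted rest \<open>J1\<close>; by independence the two probabilities multiply to the product over
  \<open>J\<close>.\<close>

lemma distr_prepend_row: "distr (row_law \<Otimes>\<^sub>M clocks) (clocks :: (nat \<times> 'v::finite \<Rightarrow> real) measure) prepend_row = clocks"
proof -
  interpret P: product_prob_space "\<lambda>_ :: nat \<times> 'v. exp_law" UNIV by unfold_locales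
  have "distr (row_law \<Otimes>\<^sub>M clocks) (clocks :: (nat \<times> 'v \<Rightarrow> real) measure) prepend_row = Pi\<^sub>M UNIV (\<lambda>_. exp_law)"
  proof (rule P.PiM_eq)
    fix J :: "(nat \<times> 'v) set" and F :: "nat \<times> 'v \<Rightarrow> real set"
    assume J: "finite J" and F: "\<And>j. j \<in> J \<Longrightarrow> F j \<in> sets exp_law"
    define J0 where "J0 = {j. (0, j) \<in> J}"
    define J1 where "J1 = {p. (Suc (fst p), snd p) \<in> J}"
    define s where "s p = (Suc (fst p), snd p)" for p :: "nat \<times> 'v"
    have fin: "finite J1" unfolding J1_def s_def[symmetric]
      using finite_vimageI[OF J, of s] by (auto simp: s_def inj_def vimage_def)
    let ?X = "prod_emb UNIV (\<lambda>_. exp_law) J (Pi\<^sub>E J F)"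
    let ?E0 = "prod_emb UNIV (\<lambda>_. exp_law) J0 (Pi\<^sub>E J0 (\<lambda>j. F (0, j)))"
    let ?E1 = "prod_emb UNIV (\<lambda>_. exp_law) J1 (Pi\<^sub>E J1 (\<lambda>p. F (s p)))"
    have X: "?X \<in> sets clocks" unfolding clocks_eq by (rule sets_PiM_I) (use F J in auto)
    have E0: "?E0 \<in> sets row_law" unfolding row_law_def by (rule sets_PiM_I) (use F in \<open>auto simp: J0_def\<close>)
    have E1: "?E1 \<in> sets clocks" unfolding clocks_eq by (rule sets_PiM_I) (use F fin in \<open>auto simp: J1_def s_def\<close>)
    have emb: "prod_emb UNIV (\<lambda>_. exp_law) K (Pi\<^sub>E K A) = {f. \<forall>k\<in>K. f k \<in> A k}" for K :: "'k set" and A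
      by (auto simp: prod_emb_def space_PiM PiE_iff)
    have pre: "prepend_row -` ?X \<inter> space (row_law \<Otimes>\<^sub>M clocks) = ?E0 \<times> ?E1"
    proof -
      have "(\<forall>p\<in>J. prepend_row (w, e) p \<in> F p) \<longleftrightarrow> (\<forall>j\<in>J0. w j \<in> F (0, j)) \<and> (\<forall>p\<in>J1. e p \<in> F (s p))" for w e
      proof (intro iffI conjI ballI)
        assume h: "\<forall>p\<in>J. prepend_row (w, e) p \<in> F p"
        show "w j \<in> F (0, j)" if "j \<in> J0" for j using h that by (force simp: J0_def prepend_row_def)
        show "e p \<in> F (s p)" if "p \<in> J1" for p using bspec[OF h, of "s p"] that by (auto simp: J1_def s_def prepend_row_def)
      next
        fix p assume h: "(\<forall>j\<in>J0. w j \<in> F (0, j)) \<and> (\<forall>p\<in>J1. e p \<in> F (s p))" and p: "p \<in> J"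
        obtain n j where nj: "p = (n, j)" by force
        show "prepend_row (w, e) p \<in> F p"
        proof (cases n)
          case 0
          then show ?thesis using h p nj by (auto simp: J0_def prepend_row_def)
        next
          case (Suc m)
          then have "(m, j) \<in> J1" using p nj by (simp add: J1_def)
          then have "e (m, j) \<in> F (s (m, j))" using h by blast
          then show ?thesis using Suc nj by (simp add: s_def prepend_row_def)
        qed
      qed
      then show ?thesis unfolding emb by (simp only: space_pair_measure space_row_law space_clocks UNIV_Times_UNIV Int_UNIV_right vimage_def mem_Collect_eq set_eq_iff mem_Times_iff split_paired_all fst_conv snd_conv simp_thms split_paired_All)
    qed
    have "emeasure (distr (row_law \<Otimes>\<^sub>M clocks) clocks prepend_row) ?X = emeasure (row_law \<Otimes>\<^sub>M clocks) (?E0 \<times> ?E1)"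
      unfolding pre[symmetric] by (rule emeasure_distr[OF measurable_prepend_row X])
    also have "\<dots> = emeasure row_law ?E0 * emeasure clocks ?E1"
      by (rule clocks.emeasure_pair_measure_Times[OF E0 E1])
    also have "emeasure row_law ?E0 = (\<Prod>j\<in>J0. emeasure exp_law (F (0, j)))"
      unfolding row_law_def by (rule emeasure_PiM_emb) (use F in \<open>auto simp: J0_def intro: exp_law.prob_space_axioms\<close>)
    also have "emeasure clocks ?E1 = (\<Prod>p\<in>J1. emeasure exp_law (F (s p)))"
      unfolding clocks_eq by (rule emeasure_PiM_emb) (use F fin in \<open>auto simp: J1_def s_def intro: exp_law.prob_space_axioms\<close>)
    also have "(\<Prod>j\<in>J0. emeasure exp_law (F (0, j))) = (\<Prod>p\<in>Pair 0 ` J0. emeasure exp_law (F p))"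
      by (subst prod.reindex) (auto simp: inj_on_def)
    also have "(\<Prod>p\<in>J1. emeasure exp_law (F (s p))) = (\<Prod>p\<in>s ` J1. emeasure exp_law (F p))"
      by (subst prod.reindex) (auto simp: inj_on_def s_def)
    also have "(\<Prod>p\<in>Pair 0 ` J0. emeasure exp_law (F p)) * (\<Prod>p\<in>s ` J1. emeasure exp_law (F p)) = (\<Prod>p\<in>Pair 0 ` J0 \<union> s ` J1. emeasure exp_law (F p))"
      by (rule prod.union_disjoint[symmetric]) (use fin in \<open>auto simp: s_def\<close>)
    also have "Pair 0 ` J0 \<union> s ` J1 = J"
    proof (rule set_eqI)
      fix p :: "nat \<times> 'v"
      obtain n j where nj: "p = (n, j)" by force
      show "p \<in> Pair 0 ` J0 \<union> s ` J1 \<longleftrightarrow> p \<in> J"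
        unfolding nj by (cases n) (auto simp: J0_def J1_def s_def image_iff)
    qed
    finally show "emeasure (distr (row_law \<Otimes>\<^sub>M clocks) clocks prepend_row) ?X = (\<Prod>j\<in>J. emeasure exp_law (F j))" .
  qed (simp add: clocks_eq)
  then show ?thesis by (simp add: clocks_eq)
qed

lemma jump_chain_prepend_row:
  "jump_chain r k (prepend_row (w, e)) (Suc n) = jump_chain r (jump_target r k w) e n"
proof (induction n)
  case 0
  have "(\<lambda>j. prepend_row (w, e) (0, j)) = w" by (auto simp: prepend_row_def)
  then show ?case unfolding jump_chain_Suc by simp
next
  case (Suc n)
  have "(\<lambda>j. prepend_row (w, e) (Suc n, j)) = (\<lambda>j. e (n, j))" by (auto simp: prepend_row_def)
  then show ?case unfolding jump_chain_Suc[of r k _ "Suc n"] Suc.IH jump_chain_Suc[of r _ e n] by simp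
qed

lemma measurable_jump_chain [measurable]: "(\<lambda>e. jump_chain r k e n) \<in> clocks \<rightarrow>\<^sub>M count_space UNIV"
proof (induction n)
  case (Suc n)
  have "(\<lambda>e. jump_target r x (\<lambda>j. e (n, j))) \<in> clocks \<rightarrow>\<^sub>M count_space UNIV" for x
  proof (rule measurable_compose[OF _ measurable_jump_target])
    show "(\<lambda>e j. e (n, j)) \<in> clocks \<rightarrow>\<^sub>M row_law"
      unfolding row_law_def clocks_eq by (rule measurable_PiM_single') auto
  qed
  then show ?case unfolding jump_chain_Suc
    by (rule measurable_compose_countable[where f="\<lambda>x e. jump_target r x (\<lambda>j. e (n, j))", OF _ Suc])
qed simp

text \<open>\<open>n = 0\<close> is allowed: a walk that starts in \<open>A\<close> hits
  \<open>A\<close> at its starting point.\<close>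

definition first_hits :: "('v::finite \<Rightarrow> 'v \<Rightarrow> real) \<Rightarrow> 'v set \<Rightarrow> 'v \<Rightarrow> 'v \<Rightarrow> (nat \<times> 'v \<Rightarrow> real) set" where
  "first_hits r A j k = {e. \<exists>n. jump_chain r k e n = j \<and> (\<forall>m<n. jump_chain r k e m \<notin> A)}"

lemma first_hits_sets [measurable]: "first_hits r A j k \<in> sets clocks"
proof -
  have [measurable]: "(\<lambda>e. jump_chain r k e n) \<in> clocks \<rightarrow>\<^sub>M count_space UNIV" for n by (rule measurable_jump_chain)
  have "{e \<in> space clocks. \<exists>n. jump_chain r k e n = j \<and> (\<forall>m<n. jump_chain r k e m \<notin> A)} \<in> sets clocks"
    by measurable
  then show ?thesis by (simp add: first_hits_def)
qed

lemma first_hits_prepend_row: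
  assumes "k \<notin> A" "j \<in> A"
  shows "prepend_row (w, e) \<in> first_hits r A j k \<longleftrightarrow> e \<in> first_hits r A j (jump_target r k w)"
proof
  assume "prepend_row (w, e) \<in> first_hits r A j k"
  then obtain n where n: "jump_chain r k (prepend_row (w, e)) n = j"
    "\<And>m. m < n \<Longrightarrow> jump_chain r k (prepend_row (w, e)) m \<notin> A" by (auto simp: first_hits_def)
  then obtain n' where n': "n = Suc n'" using assms by (cases n) auto
  have "jump_chain r (jump_target r k w) e m \<notin> A" if "m < n'" for m
    using n(2)[of "Suc m"] that by (simp only: n' jump_chain_prepend_row) simp
  moreover have "jump_chain r (jump_target r k w) e n' = j"
    using n(1) by (simp only: n' jump_chain_prepend_row)
  ultimately show "e \<in> first_hits r A j (jump_target r k w)" by (auto simp: first_hits_def)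
next
  assume "e \<in> first_hits r A j (jump_target r k w)"
  then obtain n where n: "jump_chain r (jump_target r k w) e n = j"
    "\<And>m. m < n \<Longrightarrow> jump_chain r (jump_target r k w) e m \<notin> A" by (auto simp: first_hits_def)
  have "jump_chain r k (prepend_row (w, e)) m \<notin> A" if "m < Suc n" for m
  proof (cases m)
    case (Suc m')
    then show ?thesis using n(2)[of m'] that by (simp only: jump_chain_prepend_row) simp
  qed (use assms in simp)
  moreover have "jump_chain r k (prepend_row (w, e)) (Suc n) = j"
    using n(1) by (simp only: jump_chain_prepend_row)
  ultimately show "prepend_row (w, e) \<in> first_hits r A j k"
    unfolding first_hits_def by (intro CollectI exI[of _ "Suc n"]) blast
qed

lemma first_hits_start:
  assumes "k \<in> A"
  shows "first_hits r A j k = (if k = j then UNIV else {})"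
proof -
  have "(\<forall>m<n. jump_chain r k e m \<notin> A) \<longleftrightarrow> n = 0" for n e
    using assms by (auto intro: gr0I)
  then show ?thesis unfolding first_hits_def by auto
qed

context irreducible_walk begin

lemma exit_rate_pos:
  fixes A :: "'v set"
  assumes "A \<noteq> {}" "A \<noteq> UNIV"
  shows "sum (r x) UNIV > 0"
proof -
  obtain a b where ab: "a \<in> A" "b \<notin> A" using assms by auto
  then have "a \<noteq> x \<or> b \<noteq> x" by auto
  then obtain y where "y \<noteq> x" by blast
  then obtain b where "r x b > 0" using exit_edge[of x "{x}" y] by auto
  then show ?thesis by (intro sum_pos2[of _ b]) (auto simp: r_nonneg)
qed

text \<open>First-step analysis: by \<open>distr_prepend_row\<close>, what follows the first jump is
  a walk from the target with fresh clocks, so off \<open>A\<close> the hitting probability is the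
  average of its values at the possible targets.\<close>

lemma gen_first_hits:
  assumes A: "k \<notin> A" "j \<in> A"
  shows "gen r (\<lambda>k. measure clocks (first_hits r A j k)) k = 0"
proof -
  let ?h = "\<lambda>k. measure clocks (first_hits r A j k)"
  interpret pair: pair_prob_space row_law "clocks :: (nat \<times> 'v \<Rightarrow> real) measure" by unfold_locales
  have pos: "sum (r k) UNIV > 0" by (rule exit_rate_pos[of A]) (use A in auto)
  have ev: "{w. jump_target r k w = y} \<in> sets row_law" for y
  proof -
    have "{w \<in> space row_law. jump_target r k w = y} \<in> sets row_law" by measurable
    then show ?thesis by simp
  qed
  have "?h k = measure (distr (row_law \<Otimes>\<^sub>M clocks) clocks prepend_row) (first_hits r A j k)"
    by (simp only: distr_prepend_row)
  also have "\<dots> = measure (row_law \<Otimes>\<^sub>M clocks) (prepend_row -` first_hits r A j k \<inter> space (row_law \<Otimes>\<^sub>M clocks))"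
    by (rule measure_distr[OF measurable_prepend_row first_hits_sets])
  also have "prepend_row -` first_hits r A j k \<inter> space (row_law \<Otimes>\<^sub>M clocks)
    = (\<Union>y\<in>UNIV. {w. jump_target r k w = y} \<times> first_hits r A j y)"
  proof (rule set_eqI)
    fix x :: "('v \<Rightarrow> real) \<times> (nat \<times> 'v \<Rightarrow> real)"
    obtain w e where x: "x = (w, e)" by force
    show "x \<in> prepend_row -` first_hits r A j k \<inter> space (row_law \<Otimes>\<^sub>M clocks) \<longleftrightarrow> x \<in> (\<Union>y\<in>UNIV. {w. jump_target r k w = y} \<times> first_hits r A j y)"
      unfolding x using first_hits_prepend_row[OF A, of w e r] by (simp add: space_pair_measure)
  qed
  also have "measure (row_law \<Otimes>\<^sub>M clocks) \<dots> = (\<Sum>y\<in>UNIV. measure (row_law \<Otimes>\<^sub>M clocks) ({w. jump_target r k w = y} \<times> first_hits r A j y))"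
    by (rule pair.finite_measure_finite_Union) (auto simp: disjoint_family_on_def intro!: pair_measureI ev first_hits_sets)
  also have "\<dots> = (\<Sum>y\<in>UNIV. r k y / sum (r k) UNIV * ?h y)"
  proof (rule sum.cong[OF refl])
    fix y
    have "measure (row_law \<Otimes>\<^sub>M clocks) ({w. jump_target r k w = y} \<times> first_hits r A j y)
      = measure row_law {w. jump_target r k w = y} * ?h y"
      by (simp add: measure_def clocks.emeasure_pair_measure_Times[OF ev first_hits_sets] enn2real_mult)
    then show "measure (row_law \<Otimes>\<^sub>M clocks) ({w. jump_target r k w = y} \<times> first_hits r A j y) = r k y / sum (r k) UNIV * ?h y"
      by (simp only: prob_jump_target[OF pos])
  qed
  finally have "sum (r k) UNIV * ?h k = (\<Sum>y\<in>UNIV. r k y * ?h y)"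
    using pos by (simp add: sum_divide_distrib[symmetric])
  then show ?thesis by (simp add: gen_def right_diff_distrib sum_subtractf sum_distrib_right)
qed

text \<open>Recurrence without any limit theorem: the sum is harmonic off \<open>A\<close> and
  equals 1 on \<open>A\<close>, so the maximum principle, applied from both sides, leaves only the
  constant 1.\<close>

lemma sum_first_hits:
  assumes "A \<noteq> {}"
  shows "(\<Sum>j\<in>A. measure clocks (first_hits r A j k)) = 1"
proof -
  define f where "f k = (\<Sum>j\<in>A. measure clocks (first_hits r A j k))" for k
  have f: "gen r f k = 0" if "k \<notin> A" for k
  proof -
    have "gen r f k = (\<Sum>y\<in>UNIV. \<Sum>j\<in>A. r k y * (measure clocks (first_hits r A j y) - measure clocks (first_hits r A j k)))"
      by (simp add: gen_def f_def sum_distrib_left flip: sum_subtractf)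
    also have "\<dots> = (\<Sum>j\<in>A. gen r (\<lambda>k. measure clocks (first_hits r A j k)) k)"
      unfolding gen_def by (rule sum.swap)
    finally show ?thesis using gen_first_hits[OF that] by simp
  qed
  have f1: "f k = 1" if "k \<in> A" for k
  proof -
    have "f k = (\<Sum>j\<in>A. if j = k then 1 else 0)"
      unfolding f_def by (rule sum.cong) (auto simp: first_hits_start[OF that])
    then show ?thesis using that by simp
  qed
  have "f k - 1 \<le> 0"
    by (rule gen_max_principle[OF assms]) (use f f1 in \<open>auto simp: gen_def\<close>)
  moreover have "1 - f k \<le> 0"
  proof (rule gen_max_principle[OF assms])
    fix k assume "k \<notin> A"
    have "gen r (\<lambda>k. 1 - f k) k = - gen r f k" by (simp add: gen_def sum_negf[symmetric] algebra_simps)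
    then show "0 \<le> gen r (\<lambda>k. 1 - f k) k" using f[OF \<open>k \<notin> A\<close>] by simp
  qed (use f1 in auto)
  ultimately show ?thesis by (simp add: f_def)
qed

lemma AE_first_hits:
  assumes "A \<noteq> {}"
  shows "AE e in clocks. \<exists>j\<in>A. e \<in> first_hits r A j k"
proof -
  have disj: "disjoint_family_on (\<lambda>j. first_hits r A j k) A"
  proof (unfold disjoint_family_on_def, intro ballI impI equals0I)
    fix i j e assume h: "i \<in> A" "j \<in> A" "i \<noteq> j" "e \<in> first_hits r A i k \<inter> first_hits r A j k"
    then obtain n m where "jump_chain r k e n = i" "\<forall>l<n. jump_chain r k e l \<notin> A"
      "jump_chain r k e m = j" "\<forall>l<m. jump_chain r k e l \<notin> A"
      by (auto simp: first_hits_def)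
    with h(1-3) show False by (cases n m rule: linorder_cases) auto
  qed
  have "measure clocks (\<Union>j\<in>A. first_hits r A j k) = (\<Sum>j\<in>A. measure clocks (first_hits r A j k))"
    by (rule clocks.finite_measure_finite_Union) (auto simp: disj)
  also have "\<dots> = 1" by (rule sum_first_hits[OF assms])
  finally have "AE e in clocks. e \<in> (\<Union>j\<in>A. first_hits r A j k)"
    by (subst clocks.prob_eq_1[symmetric]) auto
  then show ?thesis by simp
qed

end

lemma measurable_jump_time [measurable]: "(\<lambda>e. jump_time r k e n) \<in> borel_measurable clocks"
proof -
  have "(\<lambda>e. Min (range (ring_time r e m x))) \<in> borel_measurable clocks" for m x
  proof -
    have 1: "Min (range (ring_time r e m x)) = (INF j. ring_time r e m x j)" for e
      by (rule Min_Inf) auto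
    have [measurable]: "(\<lambda>e. e p) \<in> borel_measurable clocks" for p :: "nat \<times> 'a"
      unfolding clocks_eq by measurable
    show ?thesis unfolding 1 ring_time_def by measurable
  qed
  then have "(\<lambda>e. Min (range (ring_time r e m (jump_chain r k e m)))) \<in> borel_measurable clocks" for m
    by (rule measurable_compose_countable[OF _ measurable_jump_chain])
  then show ?thesis unfolding jump_time_def by (rule borel_measurable_ereal_sum)
qed

lemma measurable_random_walk: "random_walk r k t \<in> clocks \<rightarrow>\<^sub>M count_space UNIV"
proof -
  have "(\<lambda>e. LEAST n. ereal t < jump_time r k e (Suc n)) \<in> clocks \<rightarrow>\<^sub>M count_space UNIV"
    by (rule measurable_Least) measurable
  then show ?thesis unfolding random_walk_def[abs_def]
    by (rule measurable_compose_countable[OF measurable_jump_chain])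
qed

text \<open>Nothing is assumed about \<open>e\<close>, so jump times may fail to increase, or may
  accumulate. If none of them exceeds \<open>t\<close>, none exceeds a later time either, and
  \<open>LEAST\<close> keeps returning the same arbitrary number: the path is frozen.\<close>

lemma random_walk_right_constant:
  fixes t :: real
  obtains t' where "t < t'" "\<And>s. t \<le> s \<Longrightarrow> s < t' \<Longrightarrow> random_walk r k s e = random_walk r k t e"
proof (cases "\<exists>n. ereal t < jump_time r k e (Suc n)")
  case True
  define n where "n = (LEAST n. ereal t < jump_time r k e (Suc n))"
  have n: "ereal t < jump_time r k e (Suc n)" unfolding n_def using True by (rule LeastI_ex)
  have le: "jump_time r k e (Suc m) \<le> ereal t" if "m < n" for m
    using not_less_Least[of m "\<lambda>n. ereal t < jump_time r k e (Suc n)"] that by (simp add: n_def)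
  obtain t' where t': "ereal t < ereal t'" "ereal t' < jump_time r k e (Suc n)"
    using ereal_dense2[OF n] by blast
  show ?thesis
  proof (rule that[of t'])
    fix s assume s: "t \<le> s" "s < t'"
    have "(LEAST n. ereal s < jump_time r k e (Suc n)) = n"
    proof (rule Least_equality)
      have "ereal s < ereal t'" using s by simp
      then show "ereal s < jump_time r k e (Suc n)" using t'(2) by (rule less_trans)
    next
      fix m assume m: "ereal s < jump_time r k e (Suc m)"
      show "n \<le> m"
      proof (rule ccontr)
        assume "\<not> n \<le> m"
        then have "jump_time r k e (Suc m) \<le> ereal t" by (intro le) simp
        also have "\<dots> \<le> ereal s" using s by simp
        finally show False using m by simp
      qed
    qed
    then show "random_walk r k s e = random_walk r k t e" by (simp add: random_walk_def n_def)
  qed (use t' in simp)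
next
  case False
  show ?thesis
  proof (rule that[of "t + 1"])
    fix s assume s: "t \<le> s" "s < t + 1"
    have "\<not> ereal s < jump_time r k e (Suc n)" for n
    proof
      have "ereal t \<le> ereal s" using s by simp
      also assume "ereal s < jump_time r k e (Suc n)"
      finally show False using False by blast
    qed
    then show "random_walk r k s e = random_walk r k t e" using False by (simp add: random_walk_def)
  qed simp
qed

text \<open>Right-constancy lets rational times stand in for all times, which makes the hitting time
  a countable infimum of measurable functions. The value \<open>\<infinity>\<close> takes out the
  rational times at which the walk is not in \<open>B\<close>.\<close>

lemma hitting_time_rat:
  "hitting_time r k B e = (INF q\<in>{q::rat. 0 \<le> q}. if random_walk r k (of_rat q) e \<in> B then ereal (of_rat q) else \<infinity>)"
  unfolding hitting_time_def
proof (rule antisym)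
  show "Inf {ereal t |t. 0 \<le> t \<and> random_walk r k t e \<in> B}
    \<le> (INF q\<in>{q::rat. 0 \<le> q}. if random_walk r k (of_rat q) e \<in> B then ereal (of_rat q) else \<infinity>)"
    by (rule INF_greatest) (auto intro!: Inf_lower exI simp: zero_le_of_rat_iff)
  show "(INF q\<in>{q::rat. 0 \<le> q}. if random_walk r k (of_rat q) e \<in> B then ereal (of_rat q) else \<infinity>)
    \<le> Inf {ereal t |t. 0 \<le> t \<and> random_walk r k t e \<in> B}" (is "?I \<le> _")
  proof (rule Inf_greatest)
    fix x assume "x \<in> {ereal t |t. 0 \<le> t \<and> random_walk r k t e \<in> B}"
    then obtain t where t: "x = ereal t" "0 \<le> t" "random_walk r k t e \<in> B" by auto
    obtain t' where t': "t < t'" "\<And>s. t \<le> s \<Longrightarrow> s < t' \<Longrightarrow> random_walk r k s e = random_walk r k t e"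
      using random_walk_right_constant[of t r k e] by blast
    show "?I \<le> x" unfolding t(1)
    proof (rule ereal_le_epsilon2)
      fix d :: real assume d: "0 < d"
      then have "t < min t' (t + d)" using t' by simp
      from of_rat_dense[OF this] obtain q where q: "t < of_rat q" "of_rat q < min t' (t + d)" by blast
      have "0 \<le> (of_rat q :: real)" using q(1) t(2) by linarith
      then have q0: "q \<in> {q. 0 \<le> q}" by (simp add: zero_le_of_rat_iff)
      have "random_walk r k (of_rat q) e \<in> B" using t'(2)[of "of_rat q"] t(3) q by simp
      then have "?I \<le> ereal (of_rat q)" using INF_lower[OF q0, of "\<lambda>q. if random_walk r k (of_rat q) e \<in> B then ereal (of_rat q) else \<infinity>"] by simp
      also have "\<dots> \<le> ereal t + ereal d" using q by simp
      finally show "?I \<le> ereal t + ereal d" .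
    qed
  qed
qed

lemma measurable_hitting_time [measurable]: "hitting_time r k B \<in> borel_measurable clocks"
proof -
  have [measurable]: "random_walk r k t \<in> clocks \<rightarrow>\<^sub>M count_space UNIV" for t by (rule measurable_random_walk)
  show ?thesis unfolding hitting_time_rat[abs_def]
    by (rule borel_measurable_INF) measurable
qed

context irreducible_walk begin

lemma jump_time_strict_mono:
  assumes pos: "\<And>x. sum (r x) UNIV > 0" and e: "\<And>p. e p > 0"
  shows "strict_mono (jump_time r k e)" "jump_time r k e 0 = 0" "\<bar>jump_time r k e n\<bar> \<noteq> \<infinity>"
proof -
  define H where "H m = Min (range (ring_time r e m (jump_chain r k e m)))" for m
  have H: "0 < H m" "H m \<noteq> \<infinity>" for m
  proof -
    let ?x = "jump_chain r k e m"
    have "\<exists>y. r ?x y > 0"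
    proof (rule ccontr)
      assume "\<nexists>y. r ?x y > 0"
      then have "sum (r ?x) UNIV \<le> 0" by (intro sum_nonpos) (simp add: not_less)
      then show False using pos[of ?x] by simp
    qed
    then obtain y where y: "r ?x y > 0" ..
    have "H m \<le> ring_time r e m ?x y" unfolding H_def by (rule Min_le) auto
    then show "H m \<noteq> \<infinity>" using y by (auto simp: ring_time_def)
    have "0 < ring_time r e m ?x j" for j using e by (simp add: ring_time_def)
    then show "0 < H m" unfolding H_def by (subst Min_gr_iff) auto
  qed
  have J: "jump_time r k e (Suc n) = jump_time r k e n + H n" for n by (simp add: jump_time_def H_def add.commute)
  show J0: "jump_time r k e 0 = 0" by (simp add: jump_time_def)
  show fin: "\<bar>jump_time r k e n\<bar> \<noteq> \<infinity>" for n
  proof (induction n)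
    case (Suc n)
    then show ?case using H[of n] unfolding J by (cases "jump_time r k e n"; cases "H n") auto
  qed (simp add: J0)
  show "strict_mono (jump_time r k e)"
    unfolding strict_mono_Suc_iff
  proof
    fix n show "jump_time r k e n < jump_time r k e (Suc n)"
      using H[of n] fin[of n] unfolding J by (cases "jump_time r k e n"; cases "H n") auto
  qed
qed

lemma hitting_time_ge:
  assumes pos: "\<And>x. sum (r x) UNIV > 0" and e: "\<And>p. e p > 0"
    and B: "\<And>m. m < n \<Longrightarrow> jump_chain r k e m \<notin> B"
  shows "hitting_time r k B e \<ge> jump_time r k e n"
  unfolding hitting_time_def
proof (rule Inf_greatest)
  fix x assume "x \<in> {ereal t |t. 0 \<le> t \<and> random_walk r k t e \<in> B}"
  then obtain t where t: "x = ereal t" "0 \<le> t" "random_walk r k t e \<in> B" by auto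
  show "jump_time r k e n \<le> x"
  proof (rule ccontr)
    assume "\<not> jump_time r k e n \<le> x"
    then have lt: "ereal t < jump_time r k e n" by (simp add: t(1))
    obtain m where m: "n = Suc m"
    proof (cases n)
      case 0
      then show ?thesis using lt t(2) jump_time_strict_mono(2)[OF pos, of e k, OF e] by simp
    qed (use that in blast)
    have "(LEAST n. ereal t < jump_time r k e (Suc n)) \<le> m" by (rule Least_le) (use lt m in simp)
    then show False using B t(3) by (simp add: random_walk_def m)
  qed
qed

lemma hitting_time_eq:
  assumes pos: "\<And>x. sum (r x) UNIV > 0" and e: "\<And>p. e p > 0"
    and B: "\<And>m. m < n \<Longrightarrow> jump_chain r k e m \<notin> B" "jump_chain r k e n \<in> B"
  shows "hitting_time r k B e = jump_time r k e n"
proof (rule antisym)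
  note J = jump_time_strict_mono[OF pos, of e k, OF e]
  obtain t where t: "jump_time r k e n = ereal t" using J(3)[of n] by auto
  have "jump_time r k e 0 \<le> jump_time r k e n" using strict_mono_less_eq[OF J(1)] by simp
  then have t0: "0 \<le> t" unfolding J(2) t by simp
  have "(LEAST m. ereal t < jump_time r k e (Suc m)) = n"
  proof (rule Least_equality)
    show "ereal t < jump_time r k e (Suc n)" unfolding t[symmetric] using strict_mono_less[OF J(1)] by simp
    fix m assume "ereal t < jump_time r k e (Suc m)"
    then have "n < Suc m" unfolding t[symmetric] using strict_mono_less[OF J(1)] by blast
    then show "n \<le> m" by simp
  qed
  then have "random_walk r k t e \<in> B" using B(2) by (simp add: random_walk_def)
  then show "hitting_time r k B e \<le> jump_time r k e n"
    unfolding hitting_time_def t using t0 by (intro Inf_lower) blast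
qed (rule hitting_time_ge[OF pos e B(1)])

text \<open>Almost surely some point of \<open>A\<close> is visited after finitely many jumps, so
  the hitting time of \<open>A\<close> is a finite jump time. If the first point of \<open>A\<close>
  is not \<open>j\<close>, then \<open>j\<close> is reached at the next jump time at the earliest,
  which is strictly later.\<close>

lemma measure_hitting_time_eq:
  assumes A: "k \<notin> A" "j \<in> A"
  shows "measure clocks {e \<in> space clocks. hitting_time r k A e = hitting_time r k {j} e} = measure clocks (first_hits r A j k)"
proof (rule measure_eq_AE)
  have pos: "sum (r x) UNIV > 0" for x by (rule exit_rate_pos[of A]) (use A in auto)
  have ne: "A \<noteq> {}" using A by auto
  show "AE e in clocks. e \<in> {e \<in> space clocks. hitting_time r k A e = hitting_time r k {j} e} \<longleftrightarrow> e \<in> first_hits r A j k"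
    using AE_first_hits[OF ne, of k] AE_clocks_pos
  proof eventually_elim
    case (elim e)
    have e: "e p > 0" for p using elim(2) by blast
    note sm = jump_time_strict_mono(1)[OF pos, of e k, OF e]
    obtain i n where i: "i \<in> A" "jump_chain r k e n = i" "\<And>m. m < n \<Longrightarrow> jump_chain r k e m \<notin> A"
      using elim(1) by (auto simp: first_hits_def)
    have TA: "hitting_time r k A e = jump_time r k e n"
      by (rule hitting_time_eq[OF pos e]) (use i in auto)
    show ?case
    proof (cases "i = j")
      case True
      have "hitting_time r k {j} e = jump_time r k e n"
      proof (rule hitting_time_eq[OF pos e])
        show "jump_chain r k e m \<notin> {j}" if "m < n" for m using i(3)[OF that] A by auto
      qed (use i True in simp)
      then show ?thesis using TA i True by (auto simp: first_hits_def)
    next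
      case False
      have "jump_time r k e (Suc n) \<le> hitting_time r k {j} e"
      proof (rule hitting_time_ge[OF pos e])
        fix m assume "m < Suc n"
        then show "jump_chain r k e m \<notin> {j}" using i A False by (cases "m = n") auto
      qed
      then have "hitting_time r k A e \<noteq> hitting_time r k {j} e"
        using TA strict_mono_less[OF sm, of n "Suc n"] by auto
      moreover have "e \<notin> first_hits r A j k"
      proof
        assume "e \<in> first_hits r A j k"
        then obtain m where m: "jump_chain r k e m = j" "\<forall>l<m. jump_chain r k e l \<notin> A" by (auto simp: first_hits_def)
        then show False using i A False by (cases n m rule: linorder_cases) auto
      qed
      ultimately show ?thesis by simp
    qed
  qed
  show "{e \<in> space clocks. hitting_time r k A e = hitting_time r k {j} e} \<in> sets clocks" by measurable
qed measurable

text \<open>With \<open>h j\<close> the probability of entering \<open>A\<close> at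
  \<open>j\<close>, the trace rates are \<open>r\<close> summed against \<open>h j\<close>, and the
  drift becomes the sum of \<open>gen r (h j)\<close> over \<open>A\<close>. As \<open>h j\<close>
  is harmonic off \<open>A\<close>, this sum may be weighted by \<phi> and extended to all sites.
  Duality moves the operator to \<phi>; now \<open>adj r \<phi>\<close> vanishes off
  \<open>A\<close>, and on \<open>A\<close> the function \<open>h j\<close> is the indicator of
  \<open>j\<close>.\<close>

lemma drift_eq_adj:
  assumes A: "A \<noteq> {}" "\<And>k. k \<in> A \<Longrightarrow> \<phi> k = 1" "\<And>k. k \<notin> A \<Longrightarrow> adj r \<phi> k = 0" "j \<in> A"
  shows "drift r A j = adj r \<phi> j"
proof -
  define h where "h j k = measure clocks (first_hits r A j k)" for j k
  have h_on: "h j k = (if k = j then 1 else 0)" if "k \<in> A" for j k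
    by (simp add: h_def first_hits_start[OF that])
  \<comment> \<open>Unlike \<open>trace_rate\<close>, \<open>t\<close> has nonzero diagonal entries;
    they cancel in the drift.\<close>
  define t where "t i j = (\<Sum>k\<in>UNIV. r i k * h j k)" for i j
  have t: "t i j = r i j + (\<Sum>k\<in>-A. r i k * h j k)" if "j \<in> A" for i j
  proof -
    have "t i j = (\<Sum>k\<in>A. r i k * h j k) + (\<Sum>k\<in>-A. r i k * h j k)"
      unfolding t_def by (subst sum.union_disjoint[symmetric]) (auto intro!: sum.cong)
    also have "(\<Sum>k\<in>A. r i k * h j k) = (\<Sum>k\<in>A. if k = j then r i k else 0)"
      by (rule sum.cong) (simp_all add: h_on)
    finally show ?thesis using that by simp
  qed
  have tr: "trace_rate r A i j = t i j" if "j \<in> A" "i \<noteq> j" for i j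
    using that measure_hitting_time_eq[OF _ that(1)] by (simp add: trace_rate_def t[OF that(1)] h_def)
  have "drift r A j = (\<Sum>i\<in>A. t i j - t j i)"
    unfolding drift_def
  proof (rule sum.cong[OF refl])
    fix i assume "i \<in> A"
    then show "trace_rate r A i j - trace_rate r A j i = t i j - t j i"
      using tr[of j i] tr[of i j] A(4) by (cases "i = j") simp_all
  qed
  also have "\<dots> = (\<Sum>i\<in>A. t i j) - (\<Sum>k\<in>UNIV. r j k * (\<Sum>i\<in>A. h i k))"
    unfolding sum_subtractf t_def sum_distrib_left by (subst (3) sum.swap) simp
  also have "(\<Sum>k\<in>UNIV. r j k * (\<Sum>i\<in>A. h i k)) = sum (r j) UNIV"
    unfolding h_def sum_first_hits[OF A(1)] by simp
  also have "sum (r j) UNIV = (\<Sum>i\<in>A. sum (r i) UNIV * h j i)"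
  proof -
    have "(\<Sum>i\<in>A. sum (r i) UNIV * h j i) = (\<Sum>i\<in>A. if i = j then sum (r i) UNIV else 0)"
      by (rule sum.cong) (simp_all add: h_on)
    then show ?thesis using A(4) by simp
  qed
  also have "(\<Sum>i\<in>A. t i j) - (\<Sum>i\<in>A. sum (r i) UNIV * h j i) = (\<Sum>i\<in>A. gen r (h j) i)"
    unfolding sum_subtractf[symmetric]
    by (rule sum.cong) (simp_all add: t_def gen_def right_diff_distrib sum_subtractf sum_distrib_right)
  also have "\<dots> = (\<Sum>i\<in>UNIV. \<phi> i * gen r (h j) i)"
  proof (rule sum.mono_neutral_cong_left)
    show "\<forall>i\<in>UNIV - A. \<phi> i * gen r (h j) i = 0" using gen_first_hits[OF _ A(4)] by (simp add: h_def[abs_def])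
  qed (use A(2) in auto)
  also have "\<dots> = (\<Sum>i\<in>UNIV. h j i * adj r \<phi> i)" by (rule adj_gen_duality[symmetric])
  also have "\<dots> = (\<Sum>i\<in>A. h j i * adj r \<phi> i)"
    by (rule sum.mono_neutral_right) (use A(3) in auto)
  also have "\<dots> = (\<Sum>i\<in>A. if i = j then adj r \<phi> i else 0)"
    by (rule sum.cong) (simp_all add: h_on)
  also have "\<dots> = adj r \<phi> j" using A(4) by simp
  finally show ?thesis .
qed

end

section \<open>Absorbing hulls and the limit path\<close>

context irreducible_walk begin

text \<open>An obstacle problem. \<phi> is the vector of departure rates of a fluid that occupies
  \<open>S\<close>: a site off \<open>S\<close> either passes on all that it receives, or works at
  full rate 1 and fills up.\<close>

definition equilibrium :: "'v set \<Rightarrow> ('v \<Rightarrow> real) \<Rightarrow> bool" where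
  "equilibrium S \<phi> \<longleftrightarrow> (\<forall>k. 0 \<le> \<phi> k \<and> \<phi> k \<le> 1) \<and> (\<forall>k\<in>S. \<phi> k = 1) \<and>
     (\<forall>k. k \<notin> S \<longrightarrow> adj r \<phi> k \<ge> 0) \<and> (\<forall>k. k \<notin> S \<and> adj r \<phi> k > 0 \<longrightarrow> \<phi> k = 1)"

text \<open>A subsolution of largest total rate. If complementarity failed at \<open>k\<close>, the
  rate at \<open>k\<close> could be raised a little within the constraints: this uses part of the
  surplus at \<open>k\<close> and only increases the inflow elsewhere.\<close>

lemma equilibrium_exists: "\<exists>\<phi>. equilibrium S \<phi>"
proof -
  define K where "K = {x :: real^'v. (\<forall>k. 0 \<le> x $ k \<and> x $ k \<le> 1) \<and> (\<forall>k\<in>S. x $ k = 1) \<and>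
     (\<forall>k\<in>-S. adj r (($) x) k \<ge> 0)}"
  have K_eq: "K = (\<Inter>k. {x. 0 \<le> x $ k}) \<inter> (\<Inter>k. {x. x $ k \<le> 1}) \<inter> (\<Inter>k\<in>S. {x. x $ k = 1}) \<inter>
     (\<Inter>k\<in>-S. {x. 0 \<le> adj r (($) x) k})"
    by (auto simp: K_def)
  have "closed K"
    unfolding K_eq adj_def
    by (intro closed_Int closed_INT ballI closed_Collect_le closed_Collect_eq continuous_intros)
  moreover have "bounded K"
  proof (rule boundedI)
    fix x assume "x \<in> K"
    then have "norm (x $ k) \<le> 1" for k by (auto simp: K_def)
    then have "norm x \<le> (\<Sum>k\<in>(UNIV :: 'v set). 1)"
      by (intro order_trans[OF norm_le_l1_cart] sum_mono) auto
    then show "norm x \<le> (\<Sum>k\<in>(UNIV :: 'v set). 1)" .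
  qed
  ultimately have "compact K" by (simp add: compact_eq_bounded_closed)
  have adj_ind: "adj r (indicator S) k \<ge> 0" if "k \<notin> S" for k
    unfolding adj_def using that by (auto simp: r_nonneg intro!: sum_nonneg)
  have "($) ((\<chi> k. indicator S k) :: real^'v) = indicator S" by auto
  then have "(\<chi> k. indicator S k) \<in> K"
    unfolding K_def using adj_ind by (auto simp: indicator_def)
  then have "K \<noteq> {}" by blast
  have "continuous_on K (\<lambda>x. \<Sum>k\<in>UNIV. x $ k)" by (intro continuous_intros)
  from continuous_attains_sup[OF \<open>compact K\<close> \<open>K \<noteq> {}\<close> this]
  obtain x where x: "x \<in> K" and max: "\<And>y. y \<in> K \<Longrightarrow> (\<Sum>k\<in>UNIV. y $ k) \<le> (\<Sum>k\<in>UNIV. x $ k)" by blast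
  have "x $ k = 1" if k: "k \<notin> S" "adj r (($) x) k > 0" for k
  proof (rule ccontr)
    assume "x $ k \<noteq> 1"
    then have xk: "x $ k < 1" using x by (auto simp: K_def less_le)
    define R where "R = sum (r k) UNIV"
    have R: "R \<ge> 0" unfolding R_def by (intro sum_nonneg r_nonneg)
    \<comment> \<open>Small enough to keep the rate at \<open>k\<close> below 1 and to spend no more
      than the surplus there, which shrinks at rate \<open>R\<close>; \<open>R + 1\<close> avoids a
      zero denominator.\<close>
    define e where "e = min (1 - x $ k) (adj r (($) x) k / (R + 1))"
    have e: "e > 0" "e \<le> 1 - x $ k" using xk k R by (auto simp: e_def)
    have eR: "e * R \<le> adj r (($) x) k"
    proof -
      have "e * R \<le> e * (R + 1)" using e by simp
      also have "\<dots> \<le> adj r (($) x) k / (R + 1) * (R + 1)"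
        using R by (intro mult_right_mono) (auto simp: e_def)
      also have "\<dots> = adj r (($) x) k" using R by simp
      finally show ?thesis .
    qed
    define y where "y = (\<chi> l. x $ l + e * indicator {k} l)"
    have "($) y = (\<lambda>l. x $ l + e * indicator {k} l)" by (auto simp: y_def)
    then have ay: "adj r (($) y) l = adj r (($) x) l + e * adj r (indicator {k}) l" for l
      by (simp add: adj_add adj_scale)
    have ai: "adj r (indicator {k}) l = r k l - (if l = k then R else 0)" for l
      unfolding adj_alt R_def by (auto simp: indicator_def if_distrib sum.If_cases cong: if_cong)
    have "y \<in> K"
      unfolding K_def
    proof (intro CollectI conjI allI ballI)
      fix l
      show "0 \<le> y $ l" "y $ l \<le> 1" using x e by (auto simp: K_def y_def indicator_def)
      show "y $ l = 1" if "l \<in> S" using that x k by (auto simp: K_def y_def indicator_def)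
      show "adj r (($) y) l \<ge> 0" if "l \<in> -S"
      proof (cases "l = k")
        case True
        then show ?thesis using eR by (simp add: ay ai r_diag algebra_simps)
      next
        case False
        then show ?thesis using x that e r_nonneg by (auto simp: ay ai K_def)
      qed
    qed
    from max[OF this] have "(\<Sum>l\<in>UNIV. x $ l) + e \<le> (\<Sum>l\<in>UNIV. x $ l)"
      by (simp add: y_def sum.distrib indicator_def if_distrib sum.If_cases cong: if_cong)
    then show False using e by simp
  qed
  then have "equilibrium S (($) x)"
    using x by (auto simp: equilibrium_def K_def)
  then show ?thesis by blast
qed

lemma equilibrium_drift_set:
  assumes "equilibrium S \<phi>"
  defines "A \<equiv> S \<union> {k. adj r \<phi> k > 0}"
  shows "\<And>k. k \<in> A \<Longrightarrow> \<phi> k = 1" "\<And>k. k \<notin> A \<Longrightarrow> adj r \<phi> k = 0"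
proof -
  show "k \<in> A \<Longrightarrow> \<phi> k = 1" for k
    using assms unfolding equilibrium_def A_def by blast
  show "k \<notin> A \<Longrightarrow> adj r \<phi> k = 0" for k
    using assms unfolding equilibrium_def A_def by (simp add: antisym)
qed

text \<open>Let \<open>A\<close> be the set in question and \<phi>' the rates that are 1 on
  \<open>A\<close> and at \<open>j\<close>, balanced elsewhere. Then \<phi> \<le> \<phi>' with
  equality on \<open>A\<close>. If the drift at \<open>j\<close> were positive, \<open>adj r\<close>
  of the difference would be nonpositive everywhere and negative at \<open>j\<close>, although it
  sums to zero.\<close>

lemma equilibrium_absorbing:
  assumes "equilibrium S \<phi>" "S \<noteq> {}"
  shows "absorbing r (S \<union> {k. adj r \<phi> k > 0})" (is "absorbing r ?A")
proof -
  note A = equilibrium_drift_set[OF assms(1)]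
  have "drift r (?A \<union> {j}) j \<le> 0" if j: "j \<notin> ?A" for j
  proof (rule ccontr)
    assume neg: "\<not> drift r (?A \<union> {j}) j \<le> 0"
    have ne: "?A \<union> {j} \<noteq> {}" by simp
    obtain \<phi>' where p': "\<And>k. k \<in> ?A \<union> {j} \<Longrightarrow> \<phi>' k = 1" "\<And>k. k \<notin> ?A \<union> {j} \<Longrightarrow> adj r \<phi>' k = 0"
      using adj_solution_exists[OF ne, of "\<lambda>_. 1" "\<lambda>_. 0"] by blast
    have "drift r (?A \<union> {j}) j = adj r \<phi>' j"
      by (rule drift_eq_adj[OF ne p']) auto
    then have neg': "adj r \<phi>' j > 0" using neg by simp
    define \<psi> where "\<psi> k = \<phi> k - \<phi>' k" for k
    have apsi: "adj r \<psi> k = adj r \<phi> k - adj r \<phi>' k" for k unfolding \<psi>_def by (rule adj_diff)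
    have le: "\<psi> k \<le> 0" for k
    proof (rule adj_max_principle[OF ne])
      show "0 \<le> adj r \<psi> k" if "k \<notin> ?A \<union> {j}" for k using that A(2)[of k] p'(2)[of k] by (simp add: apsi)
      show "\<psi> k \<le> 0" if "k \<in> ?A \<union> {j}" for k
        using p'(1)[OF that] assms(1) by (simp add: \<psi>_def equilibrium_def)
    qed
    have "(\<Sum>k\<in>UNIV. adj r \<psi> k) < (\<Sum>k\<in>(UNIV::'v set). 0)"
    proof (rule sum_strict_mono_ex1)
      show "\<forall>k\<in>UNIV. adj r \<psi> k \<le> 0"
      proof
        fix k
        consider "k \<in> ?A" | "k = j" | "k \<notin> ?A \<union> {j}" by blast
        then show "adj r \<psi> k \<le> 0"
        proof cases
          case 1
          then have "\<psi> k = 0" using A(1)[OF 1] p'(1)[of k] by (simp add: \<psi>_def)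
          then show ?thesis unfolding adj_alt by (auto intro!: sum_nonpos mult_nonpos_nonneg le r_nonneg)
        next
          case 2
          then show ?thesis using A(2)[OF j] neg' by (simp add: apsi)
        next
          case 3
          then show ?thesis using A(2)[of k] p'(2)[of k] by (simp add: apsi)
        qed
      qed
      show "\<exists>k\<in>UNIV. adj r \<psi> k < 0"
        using A(2)[OF j] neg' by (intro bexI[of _ j]) (simp_all add: apsi)
    qed simp
    then show False by (simp add: sum_adj_zero)
  qed
  then show ?thesis unfolding absorbing_def by blast
qed

text \<open>If \<phi> exceeded 1 at \<open>j\<close>, imposing the value 1 there would give rates
  \<phi>' \<le> \<phi>, and absorption makes \<open>adj r\<close> of the difference nonpositive
  everywhere. Its sum is zero, so it vanishes, and then the maximum principle yields \<phi>' \<ge>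
  \<phi>, which is false at \<open>j\<close>.\<close>

lemma absorbing_equilibrium_le_1:
  assumes "absorbing r A" "A \<noteq> {}" "\<And>k. k \<in> A \<Longrightarrow> \<phi> k = 1" "\<And>k. k \<notin> A \<Longrightarrow> adj r \<phi> k = 0"
  shows "\<phi> j \<le> 1"
proof (rule ccontr)
  assume gt: "\<not> \<phi> j \<le> 1"
  then have j: "j \<notin> A" using assms(3)[of j] by auto
  then have dr: "drift r (A \<union> {j}) j \<le> 0" using assms(1) unfolding absorbing_def by blast
  have ne: "A \<union> {j} \<noteq> {}" by simp
  obtain \<phi>' where p': "\<And>k. k \<in> A \<union> {j} \<Longrightarrow> \<phi>' k = 1" "\<And>k. k \<notin> A \<union> {j} \<Longrightarrow> adj r \<phi>' k = 0"
    using adj_solution_exists[OF ne, of "\<lambda>_. 1" "\<lambda>_. 0"] by blast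
  have dr': "adj r \<phi>' j \<le> 0"
    using dr drift_eq_adj[OF ne p', of j] by auto
  define \<psi> where "\<psi> k = \<phi>' k - \<phi> k" for k
  have apsi: "adj r \<psi> k = adj r \<phi>' k - adj r \<phi> k" for k unfolding \<psi>_def by (rule adj_diff)
  have le: "\<psi> k \<le> 0" for k
  proof (rule adj_max_principle[OF ne])
    show "0 \<le> adj r \<psi> k" if "k \<notin> A \<union> {j}" for k using that assms(4)[of k] p'(2)[of k] by (simp add: apsi)
    show "\<psi> k \<le> 0" if "k \<in> A \<union> {j}" for k
      using p'(1)[OF that] that assms(3)[of k] gt by (auto simp: \<psi>_def)
  qed
  have nonpos: "adj r \<psi> k \<le> 0" for k
  proof -
    consider "k \<in> A" | "k = j" | "k \<notin> A \<union> {j}" by blast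
    then show "adj r \<psi> k \<le> 0"
    proof cases
      case 1
      then have "\<psi> k = 0" using assms(3)[OF 1] p'(1)[of k] by (simp add: \<psi>_def)
      then show ?thesis unfolding adj_alt by (auto intro!: sum_nonpos mult_nonpos_nonneg le r_nonneg)
    next
      case 2
      then show ?thesis using assms(4)[OF j] dr' by (simp add: apsi)
    next
      case 3
      then show ?thesis using assms(4)[of k] p'(2)[of k] by (simp add: apsi)
    qed
  qed
  have "(\<Sum>k\<in>UNIV. - adj r \<psi> k) = 0" by (simp add: sum_negf sum_adj_zero)
  then have zero: "adj r \<psi> k = 0" for k
    using sum_nonneg_eq_0_iff[of UNIV "\<lambda>k. - adj r \<psi> k"] nonpos by simp
  have "-1 * \<psi> j \<le> 0"
  proof (rule adj_max_principle[OF assms(2)])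
    show "0 \<le> adj r (\<lambda>k. -1 * \<psi> k) k" for k using adj_scale[of r "-1" \<psi> k] zero by simp
    show "-1 * \<psi> k \<le> 0" if "k \<in> A" for k using that assms(3)[of k] p'(1)[of k] by (simp add: \<psi>_def)
  qed
  moreover have "\<psi> j < 0" using gt p'(1)[of j] by (simp add: \<psi>_def)
  ultimately show False by simp
qed

text \<open>For an absorbing \<open>B\<close> above \<open>S\<close> the rates satisfy \<phi> \<le>
  \<open>\<phi>B\<close> \<le> 1. A filling site \<open>k\<close> outside \<open>B\<close> would
  have rate 1 in both, and with at least as much inflow under \<open>\<phi>B\<close> it could not be
  balanced there. In particular the hull, defined as an intersection, is itself absorbing.\<close>

lemma absorbing_hull_eq:
  assumes e: "equilibrium S \<phi>" and S: "S \<noteq> {}"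
  shows "absorbing_hull r S = S \<union> {k. adj r \<phi> k > 0}" (is "_ = ?A")
proof
  show "absorbing_hull r S \<subseteq> ?A"
    unfolding absorbing_hull_def using equilibrium_absorbing[OF e S] by blast
  have "?A \<subseteq> B" if B: "absorbing r B" "S \<subseteq> B" for B
  proof (rule ccontr)
    assume "\<not> ?A \<subseteq> B"
    then obtain k where k: "adj r \<phi> k > 0" "k \<notin> B" using B by blast
    have "B \<noteq> {}" using B S by blast
    then obtain \<phi>B where pB: "\<And>k. k \<in> B \<Longrightarrow> \<phi>B k = 1" "\<And>k. k \<notin> B \<Longrightarrow> adj r \<phi>B k = 0"
      using adj_solution_exists[of B "\<lambda>_. 1" "\<lambda>_. 0"] by blast
    have le1: "\<phi>B l \<le> 1" for l
      by (rule absorbing_equilibrium_le_1[OF B(1) \<open>B \<noteq> {}\<close> pB])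
    have "\<phi> l - \<phi>B l \<le> 0" for l
    proof (rule adj_max_principle[OF \<open>B \<noteq> {}\<close>])
      show "0 \<le> adj r (\<lambda>a. \<phi> a - \<phi>B a) k" if "k \<notin> B" for k
        using that B(2) e pB(2)[of k] unfolding adj_diff equilibrium_def by auto
      show "\<phi> k - \<phi>B k \<le> 0" if "k \<in> B" for k using pB(1)[OF that] e by (simp add: equilibrium_def)
    qed
    then have le: "\<phi> l \<le> \<phi>B l" for l by simp
    have pk: "\<phi> k = 1" using equilibrium_drift_set(1)[OF e, of k] k by simp
    then have "\<phi>B k = 1" using le[of k] le1[of k] by simp
    moreover have "(\<Sum>j\<in>UNIV. \<phi> j * r j k) \<le> (\<Sum>j\<in>UNIV. \<phi>B j * r j k)"
      by (intro sum_mono mult_right_mono le r_nonneg)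
    ultimately show False using pB(2)[OF k(2)] k(1) pk by (simp add: adj_alt)
  qed
  then show "?A \<subseteq> absorbing_hull r S" unfolding absorbing_hull_def by blast
qed

lemma absorbing_hull_absorbing:
  assumes "S \<noteq> {}" shows "absorbing r (absorbing_hull r S)"
  using equilibrium_exists[of S] equilibrium_absorbing absorbing_hull_eq assms by metis

lemma velocity_eq:
  assumes e: "equilibrium (support v) \<phi>" and S: "support v \<noteq> {}"
  shows "velocity r v $ i = adj r \<phi> i"
proof -
  note A = equilibrium_drift_set[OF e]
  note hull = absorbing_hull_eq[OF e S]
  show ?thesis
  proof (cases "i \<in> support v \<union> {k. adj r \<phi> k > 0}")
    case True
    then have "drift r (support v \<union> {k. adj r \<phi> k > 0}) i = adj r \<phi> i"
      by (intro drift_eq_adj A) (use S in auto)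
    then show ?thesis using True unfolding velocity_def hull by simp
  next
    case False
    then show ?thesis using A(2)[OF False] unfolding velocity_def hull by simp
  qed
qed

lemma velocity_off_support:
  assumes "support v \<noteq> {}" "i \<notin> support v" shows "velocity r v $ i \<ge> 0"
  using equilibrium_exists[of "support v"] velocity_eq[OF _ assms(1)] assms(2)
  unfolding equilibrium_def by metis

lemma velocity_sum:
  assumes "support v \<noteq> {}" shows "(\<Sum>i\<in>UNIV. velocity r v $ i) = 0"
proof -
  obtain \<phi> where "equilibrium (support v) \<phi>" using equilibrium_exists by blast
  then show ?thesis using velocity_eq[OF _ assms, of \<phi>] by (simp add: sum_adj_zero)
qed

lemma support_nonempty: "v \<in> prob_simplex \<Longrightarrow> support v \<noteq> {}"
proof
  assume v: "v \<in> prob_simplex" "support v = {}"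
  then have "v $ i \<le> 0" for i unfolding support_def by (metis (mono_tags) empty_iff mem_Collect_eq not_less)
  then have "(\<Sum>i\<in>UNIV. v $ i) \<le> 0" by (intro sum_nonpos) auto
  then show False using v by (simp add: prob_simplex_def)
qed

lemma prob_simplexI: "(\<And>i. v $ i \<ge> 0) \<Longrightarrow> (\<Sum>i\<in>UNIV. v $ i) = 1 \<Longrightarrow> v \<in> prob_simplex"
  using member_le_sum[of _ UNIV "($) v"] by (auto simp: prob_simplex_def)

lemma prob_simplexD: "v \<in> prob_simplex \<Longrightarrow> v $ i \<ge> 0" "v \<in> prob_simplex \<Longrightarrow> v $ i \<le> 1"
  "v \<in> prob_simplex \<Longrightarrow> (\<Sum>i\<in>UNIV. v $ i) = 1"
  by (auto simp: prob_simplex_def)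

section \<open>One linear piece of the limit path\<close>

context
  fixes v :: "real^'v"
  assumes v: "v \<in> prob_simplex" and vel: "velocity r v \<noteq> 0"
begin

lemma decreasing_sites_nonempty: "decreasing_sites r v \<noteq> {}"
proof
  assume emp: "decreasing_sites r v = {}"
  have nn: "velocity r v $ i \<ge> 0" for i
  proof (cases "i \<in> support v")
    case True
    then show ?thesis using emp unfolding decreasing_sites_def by (metis (mono_tags) empty_iff mem_Collect_eq not_less)
  qed (use velocity_off_support support_nonempty v in blast)
  have "velocity r v $ i = 0" for i
    using sum_nonneg_eq_0_iff[of UNIV "\<lambda>i. velocity r v $ i"] nn velocity_sum[OF support_nonempty[OF v]] by simp
  then show False using vel by (simp add: vec_eq_iff)
qed

lemma exit_time_pos: "exit_time r v > 0"
  unfolding exit_time_def using decreasing_sites_nonempty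
  by (subst Min_gr_iff) (auto simp: decreasing_sites_def support_def divide_pos_neg intro: divide_neg_neg)

lemma exit_time_site:
  obtains i where "i \<in> decreasing_sites r v" "v $ i + exit_time r v * velocity r v $ i = 0"
proof -
  have "exit_time r v \<in> (\<lambda>i. - v $ i / velocity r v $ i) ` decreasing_sites r v"
    unfolding exit_time_def by (rule Min_in) (use decreasing_sites_nonempty in auto)
  then obtain i where i: "i \<in> decreasing_sites r v" "exit_time r v = - v $ i / velocity r v $ i" by blast
  then have "velocity r v $ i \<noteq> 0" by (auto simp: decreasing_sites_def)
  then show ?thesis using i that by simp
qed

lemma segment_nonneg:
  assumes "0 \<le> s" "s \<le> exit_time r v"
  shows "v $ i + s * velocity r v $ i \<ge> 0"
proof (cases "velocity r v $ i \<ge> 0")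
  case True
  then show ?thesis using prob_simplexD[OF v] assms by simp
next
  case False
  then have i: "i \<in> decreasing_sites r v"
    using velocity_off_support[OF support_nonempty[OF v]] unfolding decreasing_sites_def by (simp add: not_le) (metis False)
  have "s \<le> - v $ i / velocity r v $ i"
    using assms(2) i unfolding exit_time_def by (auto intro: order_trans[OF _ Min_le])
  then have "s * velocity r v $ i \<ge> - v $ i" using False by (simp add: field_simps)
  then show ?thesis by simp
qed

lemma segment_simplex:
  assumes "0 \<le> s" "s \<le> exit_time r v"
  shows "v + s *\<^sub>R velocity r v \<in> prob_simplex"
proof (rule prob_simplexI)
  show "0 \<le> (v + s *\<^sub>R velocity r v) $ i" for i using segment_nonneg[OF assms] by simp
  show "(\<Sum>i\<in>UNIV. (v + s *\<^sub>R velocity r v) $ i) = 1"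
    using prob_simplexD(3)[OF v] velocity_sum[OF support_nonempty[OF v]]
    by (simp add: sum.distrib flip: sum_distrib_left)
qed

text \<open>The reason for termination. The new support lies in the old hull. If the hulls agreed,
  so would the velocities; but the site just emptied had negative velocity, whereas velocities off
  the support are nonnegative.\<close>

lemma hull_decreasing:
  defines "v' \<equiv> v + exit_time r v *\<^sub>R velocity r v"
  shows "absorbing_hull r (support v') \<subset> absorbing_hull r (support v)"
proof -
  have S: "support v \<noteq> {}" by (rule support_nonempty[OF v])
  have v': "v' \<in> prob_simplex" unfolding v'_def using exit_time_pos by (intro segment_simplex) auto
  have "support v' \<subseteq> absorbing_hull r (support v)"
  proof
    fix i assume i: "i \<in> support v'"
    show "i \<in> absorbing_hull r (support v)"
    proof (rule ccontr)
      assume n: "i \<notin> absorbing_hull r (support v)"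
      then have "velocity r v $ i = 0" by (simp add: velocity_def)
      moreover have "i \<notin> support v" using n unfolding absorbing_hull_def by blast
      ultimately show False using i unfolding v'_def support_def by simp
    qed
  qed
  then have sub: "absorbing_hull r (support v') \<subseteq> absorbing_hull r (support v)"
    using absorbing_hull_absorbing[OF S] unfolding absorbing_hull_def[of r "support v'"] by blast
  moreover have "absorbing_hull r (support v') \<noteq> absorbing_hull r (support v)"
  proof
    assume "absorbing_hull r (support v') = absorbing_hull r (support v)"
    then have eq: "velocity r v' = velocity r v" unfolding velocity_def by metis
    obtain i where i: "i \<in> decreasing_sites r v" "v $ i + exit_time r v * velocity r v $ i = 0"
      by (rule exit_time_site)
    then have "i \<notin> support v'" unfolding v'_def support_def by simp
    then have "velocity r v' $ i \<ge> 0" using velocity_off_support support_nonempty[OF v'] by blast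
    then show False using i eq by (simp add: decreasing_sites_def)
  qed
  ultimately show ?thesis by blast
qed

end

end

section \<open>The fluid equations, solved by the limit path\<close>

definition fluid :: "('v::finite \<Rightarrow> 'v \<Rightarrow> real) \<Rightarrow> real \<Rightarrow> (real \<Rightarrow> 'v \<Rightarrow> real) \<Rightarrow> (real \<Rightarrow> 'v \<Rightarrow> real) \<Rightarrow> bool" where
  "fluid r T z Y \<longleftrightarrow> (\<forall>i. Y 0 i = 0) \<and>
     (\<forall>t i. 0 \<le> t \<and> t \<le> T \<longrightarrow> z t i \<ge> 0 \<and> z t i = z 0 i + adj r (Y t) i) \<and>
     (\<forall>s t i. 0 \<le> s \<and> s \<le> t \<and> t \<le> T \<longrightarrow> 0 \<le> Y t i - Y s i \<and> Y t i - Y s i \<le> t - s) \<and>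
     (\<forall>s t i. 0 \<le> s \<and> s \<le> t \<and> t \<le> T \<and> (\<forall>q\<in>{s..t}. z q i > 0) \<longrightarrow> Y t i - Y s i = t - s)"

lemma fluidD:
  assumes "fluid r T z Y"
  shows "Y 0 i = 0"
    and "0 \<le> t \<Longrightarrow> t \<le> T \<Longrightarrow> z t i \<ge> 0"
    and "0 \<le> t \<Longrightarrow> t \<le> T \<Longrightarrow> z t i = z 0 i + adj r (Y t) i"
    and "0 \<le> s \<Longrightarrow> s \<le> t \<Longrightarrow> t \<le> T \<Longrightarrow> 0 \<le> Y t i - Y s i"
    and "0 \<le> s \<Longrightarrow> s \<le> t \<Longrightarrow> t \<le> T \<Longrightarrow> Y t i - Y s i \<le> t - s"
    and "0 \<le> s \<Longrightarrow> s \<le> t \<Longrightarrow> t \<le> T \<Longrightarrow> (\<And>q. q \<in> {s..t} \<Longrightarrow> z q i > 0) \<Longrightarrow> Y t i - Y s i = t - s"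
  using assms unfolding fluid_def by blast+

lemma fluid_mono: "fluid r T z Y \<Longrightarrow> T' \<le> T \<Longrightarrow> fluid r T' z Y"
  unfolding fluid_def by (meson order_trans)

lemma fluid_0: "(\<And>i. z 0 i \<ge> 0) \<Longrightarrow> fluid r 0 z (\<lambda>_ _. 0)"
  unfolding fluid_def by (auto simp: adj_def dest: order_antisym)

text \<open>Prolongs a solution by constant departure rates. Only sites that are positive at some
  time of the new piece have to work at rate 1. Each linear piece of the limit path is appended in
  this way, with \<phi> an equilibrium.\<close>

lemma fluid_extend:
  assumes f: "fluid r T z Y" and T: "0 \<le> T" "T \<le> T'"
    and z: "\<And>t i. T \<le> t \<Longrightarrow> t \<le> T' \<Longrightarrow> z t i = z T i + (t - T) * adj r \<phi> i"
    and nn: "\<And>t i. T \<le> t \<Longrightarrow> t \<le> T' \<Longrightarrow> z t i \<ge> 0"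
    and \<phi>: "\<And>i. 0 \<le> \<phi> i" "\<And>i. \<phi> i \<le> 1"
    and compl: "\<And>t i. T \<le> t \<Longrightarrow> t \<le> T' \<Longrightarrow> z t i > 0 \<Longrightarrow> \<phi> i = 1"
  shows "\<exists>Y'. fluid r T' z Y'"
proof -
  define Y' where "Y' t i = (if t \<le> T then Y t i else Y T i + (t - T) * \<phi> i)" for t i
  have Y'1: "Y' t i = Y t i" if "t \<le> T" for t i using that by (simp add: Y'_def)
  have Y'2: "Y' t i = Y T i + (t - T) * \<phi> i" if "T \<le> t" for t i using that by (cases "t = T") (auto simp: Y'_def)
  have inc1: "0 \<le> Y' t i - Y' s i \<and> Y' t i - Y' s i \<le> t - s" if "T \<le> s" "s \<le> t" "t \<le> T'" for s t i
  proof -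
    have "Y' t i - Y' s i = (t - s) * \<phi> i" using that by (simp add: Y'2 algebra_simps)
    moreover have "(t - s) * \<phi> i \<le> (t - s) * 1" using that \<phi> by (intro mult_left_mono) auto
    ultimately show ?thesis using that \<phi>(1)[of i] by simp
  qed
  have "fluid r T' z Y'"
    unfolding fluid_def
  proof (intro conjI allI impI; (elim conjE)?)
    show "Y' 0 i = 0" for i using fluidD(1)[OF f] T Y'1 by simp
  next
    fix t i assume t: "0 \<le> t" "t \<le> T'"
    show "z t i \<ge> 0" using fluidD(2)[OF f] nn t by (cases "t \<le> T") auto
    show "z t i = z 0 i + adj r (Y' t) i"
    proof (cases "t \<le> T")
      case True
      then have "Y' t = Y t" by (auto simp: Y'1)
      then show ?thesis using fluidD(3)[OF f, of t i] t True by simp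
    next
      case False
      then have "Y' t = (\<lambda>i. Y T i + (t - T) * \<phi> i)" by (auto simp: Y'2)
      then show ?thesis using fluidD(3)[OF f, of T i] z[of t i] t False T by (simp add: adj_add adj_scale)
    qed
  next
    fix s t i assume st: "0 \<le> s" "s \<le> t" "t \<le> T'"
    consider "t \<le> T" | "T \<le> s" | "s \<le> T" "T \<le> t" by linarith
    then have "0 \<le> Y' t i - Y' s i \<and> Y' t i - Y' s i \<le> t - s"
    proof cases
      case 1 then show ?thesis using fluidD(4,5)[OF f, of s t i] st by (simp add: Y'1)
    next
      case 2 then show ?thesis using inc1 st by simp
    next
      case 3 then show ?thesis using fluidD(4,5)[OF f, of s T i] inc1[of T t i] st by (simp add: Y'1)
    qed
    then show "0 \<le> Y' t i - Y' s i" "Y' t i - Y' s i \<le> t - s" by auto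
  next
    fix s t i assume st: "0 \<le> s" "s \<le> t" "t \<le> T'" and pos: "\<forall>q\<in>{s..t}. z q i > 0"
    have inc2: "Y' t i - Y' s i = t - s" if "T \<le> s" "s \<le> t" "t \<le> T'" "z t i > 0" for s t
      using compl[of t i] that by (simp add: Y'2 algebra_simps)
    consider "t \<le> T" | "T \<le> s" | "s \<le> T" "T \<le> t" by linarith
    then show "Y' t i - Y' s i = t - s"
    proof cases
      case 1 then show ?thesis using fluidD(6)[OF f, of s t i] st pos by (simp add: Y'1)
    next
      case 2 then show ?thesis using inc2 st pos by simp
    next
      case 3
      then have "Y T i - Y s i = T - s" using fluidD(6)[OF f, of s T i] st pos by simp
      moreover have "Y' t i - Y' T i = t - T" using inc2[of T t] 3 st pos by simp
      ultimately show ?thesis using 3 by (simp add: Y'1)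
    qed
  qed
  then show ?thesis by blast
qed

context irreducible_walk begin

context
  fixes u :: "real^'v"
  assumes u: "u \<in> prob_simplex"
begin

abbreviation "bt k \<equiv> fst (breakpoint r u k)"
abbreviation "bv k \<equiv> snd (breakpoint r u k)"
abbreviation "fin \<equiv> stop_index r u"

lemma breakpoint_step:
  assumes "velocity r (bv k) \<noteq> 0"
  shows "bt (Suc k) = bt k + exit_time r (bv k)" "bv (Suc k) = bv k + exit_time r (bv k) *\<^sub>R velocity r (bv k)"
  using assms by (auto simp: case_prod_beta)

lemma breakpoint_stop: "velocity r (bv k) = 0 \<Longrightarrow> bv (Suc k) = bv k"
  by (auto simp: case_prod_beta)

lemma breakpoint_simplex: "bv k \<in> prob_simplex"
proof (induction k)
  case (Suc k)
  show ?case
  proof (cases "velocity r (bv k) = 0")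
    case False
    have "bv k + exit_time r (bv k) *\<^sub>R velocity r (bv k) \<in> prob_simplex"
      using exit_time_pos[OF Suc False] by (intro segment_simplex[OF Suc False]) auto
    then show ?thesis using breakpoint_step(2)[OF False] by metis
  qed (use breakpoint_stop Suc in metis)
qed (use u in simp)

lemma velocity_stop: "velocity r (bv fin) = 0"
proof -
  have "\<exists>k. velocity r (bv k) = 0"
  proof (rule ccontr)
    assume "\<nexists>k. velocity r (bv k) = 0"
    then have vel: "velocity r (bv k) \<noteq> 0" for k by blast
    \<comment> \<open>The hull shrinks strictly at every step, so the number of its sites bounds the
      number of steps.\<close>
    define c where "c k = card (absorbing_hull r (support (bv k)))" for k
    have dec: "c (Suc k) < c k" for k
      unfolding c_def breakpoint_step(2)[OF vel]
      by (rule psubset_card_mono[OF _ hull_decreasing[OF breakpoint_simplex vel]]) simp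
    have "c k + k \<le> c 0" for k
    proof (induction k)
      case (Suc k)
      then show ?case using dec[of k] by linarith
    qed simp
    from this[of "Suc (c 0)"] show False by simp
  qed
  then show ?thesis unfolding stop_index_def by (rule LeastI_ex)
qed

lemma velocity_before_stop: "k < fin \<Longrightarrow> velocity r (bv k) \<noteq> 0"
  unfolding stop_index_def by (rule not_less_Least)

lemma breakpoint_time_less: "k < fin \<Longrightarrow> bt k < bt (Suc k)"
  using breakpoint_step(1)[OF velocity_before_stop] exit_time_pos[OF breakpoint_simplex velocity_before_stop, of k] by simp

lemma breakpoint_time_strict_mono: "k < l \<Longrightarrow> l \<le> fin \<Longrightarrow> bt k < bt l"
proof (induction l)
  case (Suc l)
  then have "bt l < bt (Suc l)" using breakpoint_time_less by simp
  with Suc show ?case by (metis Suc_leD less_Suc_eq less_trans)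
qed simp

lemma breakpoint_time_nonneg: "k \<le> fin \<Longrightarrow> bt k \<ge> 0"
  using breakpoint_time_strict_mono[of 0 k] by (cases k) (auto simp del: breakpoint.simps(2))

lemma limit_path_stopped: "t \<ge> bt fin \<Longrightarrow> limit_path r u t = bv fin"
  using breakpoint_time_nonneg[of fin] by (simp add: limit_path_def Let_def)

text \<open>At the right end the value is given by the next piece or by the stopped branch; both
  start at the next breakpoint, which is where the present piece ends.\<close>

lemma limit_path_segment:
  assumes k: "k < fin" and t: "bt k \<le> t" "t \<le> bt (Suc k)"
  shows "limit_path r u t = bv k + (t - bt k) *\<^sub>R velocity r (bv k)"
proof -
  have interior: "limit_path r u t = bv k + (t - bt k) *\<^sub>R velocity r (bv k)"
    if k: "k < fin" and t: "bt k \<le> t" "t < bt (Suc k)" for k t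
  proof -
    have "bt (Suc k) \<le> bt fin" using breakpoint_time_strict_mono[of "Suc k" fin] k
      by (cases "Suc k = fin") (auto simp del: breakpoint.simps(2))
    then have "\<not> t \<ge> bt fin" "t \<ge> 0" using t breakpoint_time_nonneg[of k] k by auto
    moreover have "(THE k. k < fin \<and> bt k \<le> t \<and> t < bt (Suc k)) = k"
    proof (rule the_equality)
      show "k < fin \<and> bt k \<le> t \<and> t < bt (Suc k)" using k t by blast
      fix l assume l: "l < fin \<and> bt l \<le> t \<and> t < bt (Suc l)"
      have mono: "bt a \<le> bt b" if "a \<le> b" "b \<le> fin" for a b
        using breakpoint_time_strict_mono[of a b] that by (cases "a = b") auto
      show "l = k"
      proof (rule ccontr)
        assume "l \<noteq> k"
        then consider "Suc l \<le> k" | "Suc k \<le> l" by linarith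
        then show False
        proof cases
          case 1 then show False using mono[of "Suc l" k] l k t by linarith
        next
          case 2 then show False using mono[of "Suc k" l] l k t by linarith
        qed
      qed
    qed
    ultimately show ?thesis unfolding limit_path_def Let_def by (simp del: breakpoint.simps(2))
  qed
  show ?thesis
  proof (cases "t < bt (Suc k)")
    case False
    then have t: "t = bt (Suc k)" using assms by simp
    have "limit_path r u (bt (Suc k)) = bv (Suc k)"
    proof (cases "Suc k = fin")
      case True
      then show ?thesis using limit_path_stopped by simp
    next
      case False
      then show ?thesis using interior[of "Suc k" "bt (Suc k)"] breakpoint_time_less[of "Suc k"] k by simp
    qed
    then show ?thesis using t breakpoint_step[OF velocity_before_stop[OF k]] by simp
  qed (use interior k t in blast)
qed

lemma fluid_until_stop: "k \<le> fin \<Longrightarrow> \<exists>Y. fluid r (bt k) (\<lambda>t. ($) (limit_path r u t)) Y"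
proof (induction k)
  case 0
  have "limit_path r u 0 = u"
  proof (cases "fin = 0")
    case True then show ?thesis using limit_path_stopped[of 0] by simp
  next
    case False then show ?thesis using limit_path_segment[of 0 0] breakpoint_time_less[of 0] by simp
  qed
  then show ?case using fluid_0[of "\<lambda>t. ($) (limit_path r u t)" r] prob_simplexD(1)[OF u] by auto
next
  case (Suc k)
  then have k: "k < fin" by simp
  obtain Y where Y: "fluid r (bt k) (\<lambda>t. ($) (limit_path r u t)) Y" using Suc by auto
  let ?v = "bv k"
  note v = breakpoint_simplex[of k] and vel = velocity_before_stop[OF k]
  note S = support_nonempty[OF v]
  obtain \<phi> where e: "equilibrium (support ?v) \<phi>" using equilibrium_exists by blast
  have Tk: "bt k < bt (Suc k)" by (rule breakpoint_time_less[OF k])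
  have lp: "limit_path r u t $ i = ?v $ i + (t - bt k) * adj r \<phi> i" if "bt k \<le> t" "t \<le> bt (Suc k)" for t i
    using limit_path_segment[OF k that] velocity_eq[OF e S] by simp
  show ?case
  proof (rule fluid_extend[OF Y])
    show "0 \<le> bt k" using breakpoint_time_nonneg k by simp
    show "bt k \<le> bt (Suc k)" using Tk by simp
    fix t i assume t: "bt k \<le> t" "t \<le> bt (Suc k)"
    show "limit_path r u t $ i = limit_path r u (bt k) $ i + (t - bt k) * adj r \<phi> i"
      using lp[OF t] lp[of "bt k"] Tk by simp
    show "limit_path r u t $ i \<ge> 0"
      using segment_nonneg[OF v vel, of "t - bt k" i] t breakpoint_step(1)[OF vel] limit_path_segment[OF k t] by simp
    show "\<phi> i = 1" if pos: "limit_path r u t $ i > 0"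
    proof (cases "i \<in> support ?v")
      case True then show ?thesis using e by (simp add: equilibrium_def)
    next
      case False
      \<comment> \<open>A site that is empty at the breakpoint and positive later must have grown,
        and at an equilibrium growing sites have rate 1.\<close>
      then have "?v $ i \<le> 0" by (simp add: support_def not_less)
      then have "0 < (t - bt k) * adj r \<phi> i" using pos lp[OF t, of i] by simp
      then have "adj r \<phi> i > 0" using t by (simp add: zero_less_mult_iff)
      then show ?thesis using e False by (simp add: equilibrium_def)
    qed
  qed (use e in \<open>auto simp: equilibrium_def\<close>)
qed

lemma limit_path_fluid: "\<exists>Y. fluid r T (\<lambda>t. ($) (limit_path r u t)) Y"
proof -
  obtain Y where Y: "fluid r (bt fin) (\<lambda>t. ($) (limit_path r u t)) Y" using fluid_until_stop by blast
  let ?v = "bv fin"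
  note v = breakpoint_simplex[of fin]
  note S = support_nonempty[OF v]
  obtain \<phi> where e: "equilibrium (support ?v) \<phi>" using equilibrium_exists by blast
  have zero: "adj r \<phi> i = 0" for i using velocity_eq[OF e S, of i] velocity_stop by simp
  \<comment> \<open>The maximum covers the case that \<open>T\<close> lies before the last
    breakpoint; a solution up to the later time is then restricted.\<close>
  have "\<exists>Y. fluid r (max T (bt fin)) (\<lambda>t. ($) (limit_path r u t)) Y"
  proof (rule fluid_extend[OF Y])
    show "0 \<le> bt fin" using breakpoint_time_nonneg by simp
    fix t i assume t: "bt fin \<le> t"
    note lp = limit_path_stopped[OF t]
    show "limit_path r u t $ i = limit_path r u (bt fin) $ i + (t - bt fin) * adj r \<phi> i"
      using lp limit_path_stopped[of "bt fin"] zero by simp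
    show "limit_path r u t $ i \<ge> 0" using lp prob_simplexD(1)[OF v] by simp
    show "\<phi> i = 1" if "limit_path r u t $ i > 0" using that e lp by (simp add: equilibrium_def support_def)
  qed (use e in \<open>auto simp: equilibrium_def\<close>)
  then show ?thesis using fluid_mono by (meson max.cobounded1)
qed

lemma limit_path_0: "limit_path r u 0 = u"
proof (cases "fin = 0")
  case True then show ?thesis using limit_path_stopped[of 0] by simp
next
  case False then show ?thesis using limit_path_segment[of 0 0] breakpoint_time_less[of 0] by simp
qed

end

end

section \<open>Semigroups and the zero-range process\<close>

abbreviation bounded_fun :: "('a \<Rightarrow> real) \<Rightarrow> bool" where
  "bounded_fun f \<equiv> bounded (range f)"

lemma bounded_funI: "(\<And>x. \<bar>f x\<bar> \<le> B) \<Longrightarrow> bounded_fun f"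
  unfolding bounded_iff by auto

lemma bounded_funE:
  assumes "bounded_fun f" obtains B where "B > 0" "\<And>x. \<bar>f x\<bar> \<le> B"
  using assms unfolding bounded_pos by auto

lemma bounded_fun_intros [intro]:
  "bounded_fun (\<lambda>_. c)" "bounded_fun f \<Longrightarrow> bounded_fun g \<Longrightarrow> bounded_fun (\<lambda>x. f x + g x)"
  "bounded_fun f \<Longrightarrow> bounded_fun g \<Longrightarrow> bounded_fun (\<lambda>x. f x - g x)"
  "bounded_fun f \<Longrightarrow> bounded_fun g \<Longrightarrow> bounded_fun (\<lambda>x. f x * g x)"
  "bounded_fun (indicator A)"
proof -
  show "bounded_fun (\<lambda>_. c)" by (rule bounded_funI[of _ "\<bar>c\<bar>"]) simp
  show "bounded_fun (indicator A)" by (rule bounded_funI[of _ 1]) (auto simp: indicator_def)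
  assume f: "bounded_fun f" and g: "bounded_fun g"
  obtain B where B: "\<And>x. \<bar>f x\<bar> \<le> B" using bounded_funE[OF f] by blast
  obtain C where C: "\<And>x. \<bar>g x\<bar> \<le> C" using bounded_funE[OF g] by blast
  show "bounded_fun (\<lambda>x. f x + g x)"
    by (rule bounded_funI[of _ "B + C"], rule order_trans[OF _ add_mono[OF B C]]) (rule abs_triangle_ineq)
  show "bounded_fun (\<lambda>x. f x - g x)"
    by (rule bounded_funI[of _ "B + C"], rule order_trans[OF _ add_mono[OF B C]]) (rule abs_triangle_ineq4)
  show "bounded_fun (\<lambda>x. f x * g x)"
    by (rule bounded_funI[of _ "B * C"]) (simp add: abs_mult mult_mono' B C)
qed

lemma bounded_fun_sum [intro]: "finite F \<Longrightarrow> (\<And>k. k \<in> F \<Longrightarrow> bounded_fun (f k)) \<Longrightarrow> bounded_fun (\<lambda>x. \<Sum>k\<in>F. f k x)"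
  by (induction F rule: finite_induct) auto

lemma integrable_bounded_fun [intro]: "bounded_fun f \<Longrightarrow> integrable (measure_pmf p) f"
  by (erule bounded_funE, rule measure_pmf.integrable_const_bound[where B="B" for B]) (auto simp: AE_measure_pmf_iff)

lemma expectation_diff:
  "bounded_fun f \<Longrightarrow> bounded_fun g \<Longrightarrow>
    measure_pmf.expectation p (\<lambda>x. f x - g x) = measure_pmf.expectation p f - measure_pmf.expectation p g"
  by (intro Bochner_Integration.integral_diff integrable_bounded_fun)

lemma expectation_add:
  "bounded_fun f \<Longrightarrow> bounded_fun g \<Longrightarrow>
    measure_pmf.expectation p (\<lambda>x. f x + g x) = measure_pmf.expectation p f + measure_pmf.expectation p g"
  by (intro Bochner_Integration.integral_add integrable_bounded_fun)

lemma expectation_return: "measure_pmf.expectation (return_pmf x) f = (f x :: real)"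
  by (subst integral_measure_pmf[of "{x}"]) auto

lemma expectation_le: "bounded_fun f \<Longrightarrow> bounded_fun g \<Longrightarrow> (\<And>x. x \<in> set_pmf p \<Longrightarrow> f x \<le> g x) \<Longrightarrow>
    measure_pmf.expectation p f \<le> measure_pmf.expectation p g"
  by (intro integral_mono_AE) (auto simp: AE_measure_pmf_iff)

lemma expectation_abs_le:
  fixes f :: "'a \<Rightarrow> real"
  assumes "\<And>x. \<bar>f x\<bar> \<le> B" shows "\<bar>measure_pmf.expectation p f\<bar> \<le> B"
proof -
  have f: "bounded_fun f" using assms by (rule bounded_funI)
  have "measure_pmf.expectation p f \<le> measure_pmf.expectation p (\<lambda>_. B)"
    using assms by (intro expectation_le f) (auto simp: abs_le_iff)
  moreover have "measure_pmf.expectation p (\<lambda>_. -B) \<le> measure_pmf.expectation p f"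
    by (intro expectation_le f) (use assms in \<open>auto simp: abs_le_iff minus_le_iff\<close>)
  ultimately show ?thesis by simp
qed

lemma expectation_bind:
  assumes "bounded_fun f"
  shows "measure_pmf.expectation (bind_pmf p K) f = measure_pmf.expectation p (\<lambda>x. measure_pmf.expectation (K x) f)"
proof -
  obtain B where B: "B > 0" "\<And>x. \<bar>f x\<bar> \<le> B" using bounded_funE[OF assms] by blast
  show ?thesis
    unfolding measure_pmf_bind
    by (rule integral_bind[where K="count_space UNIV" and B=B and B'=1])
      (use B in \<open>auto simp: AE_measure_pmf_iff measurable_count_space_eq1 space_subprob_algebra
         measure_pmf.subprob_space_axioms intro!: measure_pmf.emeasure_le_1\<close>)
qed

lemma bounded_fun_expectation [intro]: "bounded_fun f \<Longrightarrow> bounded_fun (\<lambda>x. measure_pmf.expectation (K x) f)"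
  by (erule bounded_funE) (rule bounded_funI, rule expectation_abs_le)

section \<open>Differentiation of a semigroup along its generator\<close>

locale generated_semigroup =
  fixes P :: "real \<Rightarrow> 's \<Rightarrow> 's pmf" and L :: "('s \<Rightarrow> real) \<Rightarrow> 's \<Rightarrow> real"
  assumes semigroup: "markov_semigroup P" and generator: "has_generator P L"
    and L_bounded: "\<And>f. bounded_fun f \<Longrightarrow> bounded_fun (L f)"
begin

abbreviation "E t x f \<equiv> measure_pmf.expectation (P t x) f"

lemma E_0: "E 0 x f = (f x :: real)"
  using semigroup by (simp add: markov_semigroup_def expectation_return)

lemma E_add: "bounded_fun f \<Longrightarrow> s \<ge> 0 \<Longrightarrow> t \<ge> 0 \<Longrightarrow> E (s + t) x f = E s x (\<lambda>y. E t y f)"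
  using semigroup by (simp add: markov_semigroup_def expectation_bind)

lemma small_time:
  assumes "bounded_fun f" "e > 0"
  shows "\<exists>d>0. \<forall>h x. 0 < h \<and> h < d \<longrightarrow> \<bar>E h x f - f x - h * L f x\<bar> \<le> e * h"
proof -
  have "\<forall>\<^sub>F h in at_right 0. \<forall>x\<in>UNIV. dist ((E h x f - f x) / h) (L f x) < e"
    by (rule uniform_limitD) (use generator assms in \<open>auto simp: has_generator_def\<close>)
  then obtain d where d: "d > 0" "\<And>h x. 0 < h \<Longrightarrow> h < d \<Longrightarrow> dist ((E h x f - f x) / h) (L f x) < e"
    unfolding eventually_at_right_field by auto
  have "\<bar>E h x f - f x - h * L f x\<bar> \<le> e * h" if "0 < h" "h < d" for h x
  proof -
    have "\<bar>E h x f - f x - h * L f x\<bar> = h * \<bar>(E h x f - f x) / h - L f x\<bar>"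
      using that by (simp add: abs_mult_pos' field_simps flip: abs_mult)
    also have "\<dots> \<le> h * e" using d(2)[OF that, of x] that by (intro mult_left_mono) (auto simp: dist_real_def)
    finally show ?thesis by (simp add: mult.commute)
  qed
  with d(1) show ?thesis by blast
qed

text \<open>The expansion at time 0 is uniform in the starting point, so averaging it over the state
  at time \<open>s\<close> moves it to time \<open>s\<close>.\<close>

lemma increment:
  assumes f: "bounded_fun f" "e > 0"
  shows "\<exists>d>0. \<forall>s t x. 0 \<le> s \<and> s < t \<and> t - s < d \<longrightarrow> \<bar>E t x f - E s x f - (t - s) * E s x (L f)\<bar> \<le> e * (t - s)"
proof -
  obtain d where d: "d > 0" "\<And>h x. 0 < h \<Longrightarrow> h < d \<Longrightarrow> \<bar>E h x f - f x - h * L f x\<bar> \<le> e * h"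
    using small_time[OF assms] by blast
  have "\<bar>E t x f - E s x f - (t - s) * E s x (L f)\<bar> \<le> e * (t - s)" if st: "0 \<le> s" "s < t" "t - s < d" for s t x
  proof -
    define D where "D y = E (t - s) y f - f y - (t - s) * L f y" for y
    note b = bounded_fun_expectation[OF f(1)] f(1) L_bounded[OF f(1)]
    have "E t x f = E s x (\<lambda>y. E (t - s) y f)" using E_add[OF f(1), of s "t - s" x] st by simp
    then have "E t x f - E s x f - (t - s) * E s x (L f) = E s x D"
      unfolding D_def by (simp add: expectation_diff b bounded_fun_intros)
    moreover have "\<bar>E s x D\<bar> \<le> e * (t - s)" unfolding D_def using d st by (intro expectation_abs_le) auto
    ultimately show ?thesis by simp
  qed
  with d(1) show ?thesis by blast
qed

text \<open>The generator describes increments to the right only. For the left derivative at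
  \<open>t\<close> the expansion starts at \<open>y < t\<close> and has the slope
  \<open>E y x (L f)\<close>; a second expansion, for \<open>L f\<close>, shows that this slope is
  close to the one at \<open>t\<close>.\<close>

lemma E_derivative:
  assumes f: "bounded_fun f" and t: "t \<ge> 0"
  shows "((\<lambda>t. E t x f) has_real_derivative E t x (L f)) (at t within {0..})"
  unfolding has_field_derivative_def has_derivative_within_alt
proof (intro conjI allI impI)
  show "bounded_linear ((*) (E t x (L f)))" by (rule bounded_linear_mult_right)
  fix e :: real assume e: "e > 0"
  note Lf = L_bounded[OF f]
  obtain d1 where d1: "d1 > 0" "\<And>s t x. 0 \<le> s \<Longrightarrow> s < t \<Longrightarrow> t - s < d1 \<Longrightarrow> \<bar>E t x f - E s x f - (t - s) * E s x (L f)\<bar> \<le> (e/2) * (t - s)"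
    using increment[OF f, of "e/2"] e by auto
  obtain d2 where d2: "d2 > 0" "\<And>s t x. 0 \<le> s \<Longrightarrow> s < t \<Longrightarrow> t - s < d2 \<Longrightarrow> \<bar>E t x (L f) - E s x (L f) - (t - s) * E s x (L (L f))\<bar> \<le> 1 * (t - s)"
    using increment[OF Lf, of 1] by auto
  obtain B where B: "B > 0" "\<And>x. \<bar>L (L f) x\<bar> \<le> B" using bounded_funE[OF L_bounded[OF Lf]] by blast
  \<comment> \<open>The last entry makes the change of the slope, at most
    \<open>(t - y) * (B + 1)\<close>, no larger than \<open>e / 2\<close>.\<close>
  define d where "d = min d1 (min d2 (e / (2 * (B + 1))))"
  have d: "d > 0" using d1 d2 e B by (simp add: d_def)
  show "\<exists>d>0. \<forall>y\<in>{0..}. norm (y - t) < d \<longrightarrow> norm (E y x f - E t x f - E t x (L f) * (y - t)) \<le> e * norm (y - t)"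
  proof (intro exI[of _ d] conjI ballI impI d)
    fix y :: real assume y: "y \<in> {0..}" "norm (y - t) < d"
    consider "y = t" | "t < y" | "y < t" by linarith
    then show "norm (E y x f - E t x f - E t x (L f) * (y - t)) \<le> e * norm (y - t)"
    proof cases
      case 2
      have "\<bar>E y x f - E t x f - (y - t) * E t x (L f)\<bar> \<le> (e/2) * (y - t)"
        using d1(2)[of t y x] t 2 y by (simp add: d_def)
      moreover have "(e/2) * (y - t) \<le> e * (y - t)" using 2 e by (intro mult_right_mono) auto
      ultimately show ?thesis using 2 by (simp add: mult.commute)
    next
      case 3
      have a: "\<bar>E t x f - E y x f - (t - y) * E y x (L f)\<bar> \<le> (e/2) * (t - y)"
        using d1(2)[of y t x] t 3 y by (simp add: d_def)
      have "\<bar>E t x (L f) - E y x (L f) - (t - y) * E y x (L (L f))\<bar> \<le> 1 * (t - y)"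
        using d2(2)[of y t x] t 3 y by (simp add: d_def)
      moreover have "\<bar>(t - y) * E y x (L (L f))\<bar> \<le> (t - y) * B"
        using 3 expectation_abs_le[OF B(2)] by (simp add: abs_mult mult_left_mono)
      ultimately have "\<bar>E t x (L f) - E y x (L f)\<bar> \<le> (t - y) * (B + 1)"
        by (simp add: algebra_simps abs_le_iff; linarith)
      also have "(t - y) * (B + 1) \<le> e / (2 * (B + 1)) * (B + 1)"
        using y 3 B by (intro mult_right_mono) (auto simp: d_def)
      also have "\<dots> = e / 2" using B by (simp add: field_simps)
      finally have "(t - y) * \<bar>E t x (L f) - E y x (L f)\<bar> \<le> (t - y) * (e / 2)"
        using 3 by (intro mult_left_mono) auto
      then have b: "\<bar>(t - y) * E t x (L f) - (t - y) * E y x (L f)\<bar> \<le> (e/2) * (t - y)"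
        using 3 by (simp add: abs_mult mult.commute flip: right_diff_distrib)
      have "E y x f - E t x f - E t x (L f) * (y - t) = - (E t x f - E y x f - (t - y) * E y x (L f)) + ((t - y) * E t x (L f) - (t - y) * E y x (L f))"
        by (simp add: algebra_simps)
      also have "\<bar>\<dots>\<bar> \<le> (e/2) * (t - y) + (e/2) * (t - y)"
        using a b by linarith
      also have "\<dots> = e * norm (y - t)" using 3 by (simp add: algebra_simps)
      finally show ?thesis by simp
    qed simp
  qed
qed

lemma E_continuous_on: "bounded_fun f \<Longrightarrow> 0 \<le> a \<Longrightarrow> continuous_on {a..b} (\<lambda>t. E t x f)"
  unfolding continuous_on_eq_continuous_within
  by (auto intro!: DERIV_continuous[OF DERIV_subset[OF E_derivative]])

lemma Dynkin:
  assumes "bounded_fun f" "0 \<le> t"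
  shows "((\<lambda>s. E s x (L f)) has_integral E t x f - f x) {0..t}"
proof -
  have "((\<lambda>s. E s x (L f)) has_integral E t x f - E 0 x f) {0..t}"
    using assms by (intro fundamental_theorem_of_calculus)
      (auto simp flip: has_real_derivative_iff_has_vector_derivative intro!: DERIV_subset[OF E_derivative])
  then show ?thesis by (simp add: E_0)
qed

text \<open>Gronwall: \<open>exp (- (c * s)) * E s x f\<close> does not increase with
  \<open>s\<close>.\<close>

lemma E_exp_growth:
  assumes f: "bounded_fun f" and le: "\<And>x. L f x \<le> c * f x" and t: "t \<ge> 0"
  shows "E t x f \<le> exp (c * t) * f x"
proof -
  have "((\<lambda>s. exp (- (c * s)) * E s x f) has_real_derivative
          exp (- (c * s)) * (E s x (L f) - c * E s x f)) (at s within {0..t})" if "s \<in> {0..t}" for s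
    by (rule derivative_eq_intros DERIV_subset[OF E_derivative] refl f | use that in \<open>auto simp: algebra_simps\<close>)+
  then have "((\<lambda>s. exp (- (c * s)) * (E s x (L f) - c * E s x f)) has_integral
        exp (- (c * t)) * E t x f - exp (- (c * 0)) * E 0 x f) {0..t}"
    using t by (intro fundamental_theorem_of_calculus) (auto simp flip: has_real_derivative_iff_has_vector_derivative)
  then have "exp (- (c * t)) * E t x f - exp (- (c * 0)) * E 0 x f \<le> 0"
  proof (rule has_integral_le[OF _ has_integral_0])
    fix s
    have "E s x (L f) \<le> E s x (\<lambda>y. c * f y)"
      using le by (intro expectation_le L_bounded f bounded_fun_intros)
    also have "\<dots> = c * E s x f" by simp
    finally show "exp (- (c * s)) * (E s x (L f) - c * E s x f) \<le> 0"
      by (intro mult_nonneg_nonpos) auto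
  qed
  then show ?thesis by (simp add: E_0 exp_minus field_simps)
qed

lemma E_const:
  assumes "bounded_fun f" "\<And>x. L f x = 0" "t \<ge> 0"
  shows "E t x f = f x"
proof -
  have "L f = (\<lambda>_. 0)" using assms(2) by auto
  then show ?thesis using has_integral_unique[OF Dynkin[OF assms(1,3), of x], of 0] by simp
qed

end

section \<open>Configurations and the zero-range generator\<close>

lemma move_particle_apply:
  "i \<noteq> j \<Longrightarrow> move_particle i j \<eta> k = (if k = i then \<eta> i - 1 else if k = j then \<eta> j + 1 else \<eta> k)"
  by (simp add: move_particle_def Let_def)

definition particles :: "('v::finite \<Rightarrow> nat) \<Rightarrow> nat" where "particles \<eta> = sum \<eta> UNIV"

lemma particles_move:
  assumes "i \<noteq> j" "\<eta> i \<noteq> 0" shows "particles (move_particle i j \<eta>) = particles \<eta>"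
proof -
  have s1: "sum \<eta> UNIV = \<eta> i + sum \<eta> (UNIV - {i})" by (rule sum.remove) auto
  have s2: "sum \<eta> (UNIV - {i}) = \<eta> j + sum \<eta> (UNIV - {i} - {j})" using assms(1) by (intro sum.remove) auto
  have "particles (move_particle i j \<eta>) = (\<Sum>k\<in>UNIV. if k = i then \<eta> i - 1 else if k = j then \<eta> j + 1 else \<eta> k)"
    unfolding particles_def move_particle_apply[OF assms(1)] ..
  also have "\<dots> = (\<eta> i - 1) + (\<Sum>k\<in>UNIV - {i}. if k = j then \<eta> j + 1 else \<eta> k)"
    by (subst sum.remove[of _ i]) (auto intro!: sum.cong)
  also have "(\<Sum>k\<in>UNIV - {i}. if k = j then \<eta> j + 1 else \<eta> k) = \<eta> j + 1 + (\<Sum>k\<in>UNIV - {i} - {j}. \<eta> k)"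
    using assms(1) by (subst sum.remove[of _ j]) (auto intro!: sum.cong)
  also have "(\<eta> i - 1) + (\<eta> j + 1 + (\<Sum>k\<in>UNIV - {i} - {j}. \<eta> k)) = \<eta> i + (\<eta> j + (\<Sum>k\<in>UNIV - {i} - {j}. \<eta> k))"
    using assms(2) by simp
  also have "\<dots> = particles \<eta>"
    unfolding particles_def s1 s2 ..
  finally show ?thesis .
qed

definition conf_dist :: "('v::finite \<Rightarrow> nat) \<Rightarrow> ('v \<Rightarrow> nat) \<Rightarrow> real" where
  "conf_dist x y = (\<Sum>i\<in>UNIV. \<bar>real (y i) - real (x i)\<bar>)"

lemma conf_dist_self [simp]: "conf_dist x x = 0" by (simp add: conf_dist_def)

lemma conf_dist_coord: "\<bar>real (y i) - real (x i)\<bar> \<le> conf_dist x y"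
  unfolding conf_dist_def by (rule member_le_sum) auto

lemma conf_dist_le_particles: "conf_dist x y \<le> real (particles x) + real (particles y)"
  unfolding conf_dist_def particles_def of_nat_sum sum.distrib[symmetric] by (rule sum_mono) auto

lemma conf_dist_triangle: "conf_dist x z \<le> conf_dist x y + conf_dist y z"
  unfolding conf_dist_def sum.distrib[symmetric] by (rule sum_mono) auto

lemma conf_dist_move:
  assumes "i \<noteq> j" shows "conf_dist y (move_particle i j y) \<le> 2"
proof -
  have "conf_dist y (move_particle i j y) \<le> (\<Sum>k\<in>UNIV. (if k = i then 1 else 0) + (if k = j then 1 else 0))"
    unfolding conf_dist_def by (rule sum_mono) (auto simp: move_particle_apply[OF assms])
  also have "\<dots> = 2" by (simp add: sum.distrib)
  finally show ?thesis .
qed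

locale zero_range = irreducible_walk r for r :: "'v::finite \<Rightarrow> 'v \<Rightarrow> real" +
  fixes g :: "nat \<Rightarrow> real"
  assumes g_nonneg: "\<And>n. 0 \<le> g n"
    and g_0: "g 0 = 0"
    and g_lim: "g \<longlonglongrightarrow> 1"
    and g_ge_1: "\<And>n. n \<ge> 1 \<Longrightarrow> g n \<ge> 1"
begin

abbreviation "L \<equiv> zrp_generator r g"

text \<open>Exists because \<open>g\<close> converges; it need not be the least bound.\<close>

definition gmax :: real where "gmax = (SOME B. \<forall>n. g n \<le> B)"

lemma g_le_gmax: "g n \<le> gmax"
proof -
  obtain B where "\<And>n. \<bar>g n\<bar> \<le> B"
    using convergent_imp_Bseq[OF convergentI[OF g_lim]] unfolding Bseq_def by auto
  then have "\<exists>B. \<forall>n. g n \<le> B" by (meson abs_le_iff)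
  then show ?thesis unfolding gmax_def by (rule someI2_ex) blast
qed

lemma gmax_ge_1: "gmax \<ge> 1" using g_ge_1[of 1] g_le_gmax[of 1] by simp

definition rtot :: real where "rtot = (\<Sum>i\<in>UNIV. \<Sum>j\<in>UNIV. r i j)"

lemma rtot_nonneg: "rtot \<ge> 0" unfolding rtot_def by (intro sum_nonneg r_nonneg)

lemma generator_le:
  assumes "\<And>i j. i \<noteq> j \<Longrightarrow> \<eta> i \<noteq> 0 \<Longrightarrow> \<bar>f (move_particle i j \<eta>) - f \<eta>\<bar> \<le> B" "B \<ge> 0"
  shows "\<bar>L f \<eta>\<bar> \<le> gmax * rtot * B"
proof -
  have "\<bar>L f \<eta>\<bar> \<le> (\<Sum>i\<in>UNIV. \<Sum>j\<in>UNIV. \<bar>g (\<eta> i) * r i j * (f (move_particle i j \<eta>) - f \<eta>)\<bar>)"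
    unfolding zrp_generator_def by (rule order_trans[OF sum_abs]) (intro sum_mono sum_abs)
  also have "\<dots> \<le> (\<Sum>i\<in>UNIV. \<Sum>j\<in>UNIV. gmax * r i j * B)"
  proof (intro sum_mono)
    fix i j
    show "\<bar>g (\<eta> i) * r i j * (f (move_particle i j \<eta>) - f \<eta>)\<bar> \<le> gmax * r i j * B"
    proof (cases "i = j \<or> \<eta> i = 0")
      case True
      then show ?thesis using assms(2) gmax_ge_1 by (auto simp: r_diag g_0 r_nonneg)
    next
      case False
      have "\<bar>g (\<eta> i) * r i j * (f (move_particle i j \<eta>) - f \<eta>)\<bar> = g (\<eta> i) * r i j * \<bar>f (move_particle i j \<eta>) - f \<eta>\<bar>"
        by (simp add: abs_mult g_nonneg r_nonneg)
      also have "\<dots> \<le> gmax * r i j * B"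
        using False assms gmax_ge_1 by (intro mult_mono g_le_gmax) (auto simp: g_nonneg r_nonneg)
      finally show ?thesis .
    qed
  qed
  also have "\<dots> = gmax * rtot * B" by (simp add: rtot_def sum_distrib_left sum_distrib_right)
  finally show ?thesis .
qed

lemma generator_bounded:
  assumes "bounded_fun f" shows "bounded_fun (L f)"
proof -
  obtain B where B: "B > 0" "\<And>x. \<bar>f x\<bar> \<le> B" using bounded_funE[OF assms] by blast
  have "\<bar>L f \<eta>\<bar> \<le> gmax * rtot * (B + B)" for \<eta>
  proof (rule generator_le)
    show "\<bar>f (move_particle i j \<eta>) - f \<eta>\<bar> \<le> B + B" for i j
      by (rule order_trans[OF abs_triangle_ineq4 add_mono[OF B(2) B(2)]])
  qed (use B in simp)
  then show ?thesis by (rule bounded_funI)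
qed

lemma generator_particles:
  assumes "\<And>x y. particles x = particles y \<Longrightarrow> f x = f y" shows "L f \<eta> = 0"
proof -
  have "\<bar>L f \<eta>\<bar> \<le> gmax * rtot * 0"
  proof (rule generator_le)
    show "\<bar>f (move_particle i j \<eta>) - f \<eta>\<bar> \<le> 0" if "i \<noteq> j" "\<eta> i \<noteq> 0" for i j
      using assms[OF particles_move[of i j \<eta>, OF that]] by simp
  qed simp
  then show ?thesis by simp
qed

text \<open>The semigroup is controlled on bounded functions only. Cutting off to the configurations
  with as many particles as \<open>x\<close> makes the exponential bounded, at no loss, as the
  dynamics never leaves this set.\<close>

definition exp_dist :: "('v \<Rightarrow> nat) \<Rightarrow> ('v \<Rightarrow> nat) \<Rightarrow> real" where
  "exp_dist x y = (if particles y = particles x then exp (conf_dist x y) else 0)"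

lemma exp_dist_bounded: "bounded_fun (exp_dist x)"
proof (rule bounded_funI)
  show "\<bar>exp_dist x y\<bar> \<le> exp (2 * real (particles x))" for y
    using conf_dist_le_particles[of x y] by (auto simp: exp_dist_def)
qed

definition cexp :: real where "cexp = gmax * rtot * exp 2"

lemma cexp_nonneg: "cexp \<ge> 0"
  unfolding cexp_def using gmax_ge_1 rtot_nonneg by simp

text \<open>A jump changes the distance from \<open>x\<close> by at most 2, hence the exponential by
  at most \<open>exp 2\<close> times itself. Summed over all jumps, with rates bounded by means of
  \<open>gmax\<close> and \<open>rtot\<close>, this is the origin of \<open>cexp\<close>.\<close>

lemma generator_exp_dist: "L (exp_dist x) y \<le> cexp * exp_dist x y"
proof (cases "particles y = particles x")
  case True
  have "\<bar>L (exp_dist x) y\<bar> \<le> gmax * rtot * (exp 2 * exp (conf_dist x y))"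
  proof (rule generator_le)
    fix i j assume ij: "i \<noteq> j" "y i \<noteq> 0"
    have a: "conf_dist x (move_particle i j y) \<le> conf_dist x y + 2"
      using conf_dist_triangle[of x "move_particle i j y" y] conf_dist_move[OF ij(1), of y] by linarith
    have "\<bar>exp a - exp b\<bar> \<le> exp 2 * exp b" if "a \<le> b + 2" for a b :: real
    proof -
      have "exp a \<le> exp 2 * exp b" using that by (simp flip: exp_add)
      moreover have "exp b \<le> exp 2 * exp b" by simp
      moreover have "exp a > 0" "exp b > 0" by auto
      ultimately show ?thesis by linarith
    qed
    from this[OF a] show "\<bar>exp_dist x (move_particle i j y) - exp_dist x y\<bar> \<le> exp 2 * exp (conf_dist x y)"
      using True particles_move[of i j y, OF ij] by (simp add: exp_dist_def)
  qed simp
  then show ?thesis using True by (simp add: cexp_def exp_dist_def)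
next
  case False
  have "\<bar>L (exp_dist x) y\<bar> \<le> gmax * rtot * 0"
  proof (rule generator_le)
    show "\<bar>exp_dist x (move_particle i j y) - exp_dist x y\<bar> \<le> 0" if "i \<noteq> j" "y i \<noteq> 0" for i j
      using False particles_move[of i j y, OF that] by (simp add: exp_dist_def)
  qed simp
  then show ?thesis using False by (simp add: exp_dist_def)
qed

end

locale zrp_semigroup = zero_range r g for r :: "'v::finite \<Rightarrow> 'v \<Rightarrow> real" and g +
  fixes P :: "real \<Rightarrow> ('v \<Rightarrow> nat) \<Rightarrow> ('v \<Rightarrow> nat) pmf"
  assumes P_semigroup: "markov_semigroup P" and P_generator: "has_generator P (zrp_generator r g)"
begin

sublocale generated_semigroup P "zrp_generator r g"
  by unfold_locales (fact P_semigroup P_generator generator_bounded)+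

text \<open>The indicator of a given number of particles is annihilated by \<open>L\<close>, so its
  expectation does not change in time.\<close>

lemma particles_preserved:
  assumes "t \<ge> 0" "y \<in> set_pmf (P t x)" shows "particles y = particles x"
proof -
  let ?A = "{y. particles y = particles x}"
  have "E t x (indicator ?A) = (indicator ?A x :: real)"
    by (intro E_const generator_particles assms(1) bounded_fun_intros) (auto simp: indicator_def)
  then have "measure_pmf.prob (P t x) ?A = 1" by simp
  then have "AE y in P t x. y \<in> ?A" by (subst measure_pmf.prob_eq_1[symmetric]) auto
  then show ?thesis using assms(2) by (auto simp: AE_measure_pmf_iff)
qed

lemma E_cong_particles:
  assumes "t \<ge> 0" "\<And>y. particles y = particles x \<Longrightarrow> f y = h y"
  shows "E t x f = E t x h"
proof (rule integral_cong_AE)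
  show "AE y in P t x. f y = h y"
    unfolding AE_measure_pmf_iff using assms(2)[OF particles_preserved[OF assms(1)]] by blast
qed auto

lemma E_le_particles:
  assumes "bounded_fun f" "bounded_fun h" "t \<ge> 0" "\<And>y. particles y = particles x \<Longrightarrow> f y \<le> h y"
  shows "E t x f \<le> E t x h"
  by (rule expectation_le[OF assms(1,2)]) (rule assms(4)[OF particles_preserved[OF assms(3)]])

lemma E_exp_dist: "t \<ge> 0 \<Longrightarrow> E t x (exp_dist z) \<le> exp (cexp * t) * exp_dist z x"
  by (rule E_exp_growth[OF exp_dist_bounded generator_exp_dist])

text \<open>Markov's inequality for \<open>exp_dist\<close>. Up to exponentially small probability a
  configuration moves by a distance at most linear in time, at a speed that does not depend on the
  number of particles.\<close>

lemma prob_conf_dist: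
  assumes "t \<ge> 0"
  shows "measure_pmf.prob (P t x) {y. conf_dist x y \<ge> a} \<le> exp (cexp * t - a)"
proof -
  have "exp a * measure_pmf.prob (P t x) {y. conf_dist x y \<ge> a} = E t x (\<lambda>y. exp a * indicator {y. conf_dist x y \<ge> a} y)"
    by simp
  also have "\<dots> \<le> E t x (exp_dist x)"
    by (intro E_le_particles bounded_fun_intros exp_dist_bounded assms) (auto simp: exp_dist_def indicator_def)
  also have "\<dots> \<le> exp (cexp * t)" using E_exp_dist[OF assms, of x x] by (simp add: exp_dist_def)
  finally show ?thesis by (simp add: exp_diff field_simps)
qed

end

section \<open>Asymptotic speed of the process\<close>

lemma has_sum_sum_fun:
  fixes f :: "'i \<Rightarrow> 'a \<Rightarrow> real"
  assumes "finite F" "\<And>i. i \<in> F \<Longrightarrow> (f i has_sum s i) A"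
  shows "((\<lambda>x. \<Sum>i\<in>F. f i x) has_sum (\<Sum>i\<in>F. s i)) A"
  using assms by (induction F rule: finite_induct) (auto intro!: has_sum_add has_sum_0)

text \<open>The sites of \<open>A\<close> stand for reservoirs with infinitely many particles. Their
  coordinates are normalised to 0, so that moving a particle into or out of a reservoir changes
  nothing there.\<close>

definition ext :: "'v set \<Rightarrow> ('v \<Rightarrow> nat) set" where
  "ext A = {\<xi>. \<forall>i\<in>A. \<xi> i = 0}"

definition insert_at :: "'v set \<Rightarrow> ('v \<Rightarrow> nat) \<Rightarrow> 'v \<Rightarrow> ('v \<Rightarrow> nat)" where
  "insert_at A \<xi> i = (if i \<in> A then \<xi> else \<xi>(i := \<xi> i + 1))"

definition remove_at :: "'v set \<Rightarrow> ('v \<Rightarrow> nat) \<Rightarrow> 'v \<Rightarrow> ('v \<Rightarrow> nat)" where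
  "remove_at A \<xi> j = (if j \<in> A then \<xi> else \<xi>(j := \<xi> j - 1))"

definition occupied :: "'v set \<Rightarrow> ('v \<Rightarrow> nat) \<Rightarrow> 'v \<Rightarrow> bool" where
  "occupied A \<xi> j \<longleftrightarrow> j \<in> A \<or> \<xi> j \<ge> 1"

lemma insert_at_ext [simp]: "\<xi> \<in> ext A \<Longrightarrow> insert_at A \<xi> i \<in> ext A"
  by (auto simp: ext_def insert_at_def)

lemma remove_at_ext [simp]: "\<xi> \<in> ext A \<Longrightarrow> remove_at A \<xi> i \<in> ext A"
  by (auto simp: ext_def remove_at_def)

lemma insert_remove [simp]: "occupied A \<xi> i \<Longrightarrow> insert_at A (remove_at A \<xi> i) i = \<xi>"
  by (auto simp: occupied_def insert_at_def remove_at_def)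

lemma remove_insert [simp]: "remove_at A (insert_at A \<xi> i) i = \<xi>"
  by (auto simp: insert_at_def remove_at_def)

lemma occupied_insert [simp]: "occupied A (insert_at A \<xi> i) i"
  by (auto simp: insert_at_def occupied_def)

lemma has_sum_remove_at:
  fixes f :: "('v \<Rightarrow> nat) \<Rightarrow> real"
  shows "((\<lambda>\<xi>. if occupied A \<xi> j then f (remove_at A \<xi> j) else 0) has_sum s) (ext A) \<longleftrightarrow> (f has_sum s) (ext A)"
proof -
  have "((\<lambda>\<xi>. if occupied A \<xi> j then f (remove_at A \<xi> j) else 0) has_sum s) (ext A) \<longleftrightarrow>
        ((\<lambda>\<xi>. f (remove_at A \<xi> j)) has_sum s) {\<xi> \<in> ext A. occupied A \<xi> j}"
    by (rule has_sum_cong_neutral) auto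
  also have "\<dots> \<longleftrightarrow> (f has_sum s) (ext A)"
    by (rule has_sum_reindex_bij_witness[where i="\<lambda>\<xi>. insert_at A \<xi> j" and j="\<lambda>\<xi>. remove_at A \<xi> j"]) auto
  finally show ?thesis .
qed

context zero_range begin

text \<open>The mass flow of departures from \<open>i\<close> that leave \<xi> behind: before such a
  departure the configuration was \<open>insert_at A \<xi> i\<close>. Reservoirs work at rate 1, the
  limit of \<open>g\<close>.\<close>

definition departure :: "'v set \<Rightarrow> (('v \<Rightarrow> nat) \<Rightarrow> real) \<Rightarrow> ('v \<Rightarrow> nat) \<Rightarrow> 'v \<Rightarrow> real" where
  "departure A m \<xi> i = (if i \<in> A then 1 else g (\<xi> i + 1)) * m (insert_at A \<xi> i)"

text \<open>The master equation of the network in which the sites of \<open>A\<close> act as reservoirs; \<open>\<xi>\<close> is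
  reached by, or left through, a departure that leaves the remaining configuration behind.\<close>

definition balance :: "'v set \<Rightarrow> (('v \<Rightarrow> nat) \<Rightarrow> real) \<Rightarrow> ('v \<Rightarrow> nat) \<Rightarrow> real" where
  "balance A m \<xi> = (\<Sum>j\<in>UNIV. if occupied A \<xi> j then adj r (departure A m (remove_at A \<xi> j)) j else 0)"

definition inflow :: "'v set \<Rightarrow> (('v \<Rightarrow> nat) \<Rightarrow> real) \<Rightarrow> ('v \<Rightarrow> nat) \<Rightarrow> real" where
  "inflow A m \<xi> = (\<Sum>j\<in>UNIV. if occupied A \<xi> j then (\<Sum>i\<in>UNIV. departure A m (remove_at A \<xi> j) i * r i j) else 0)"

definition exit_rate :: "'v set \<Rightarrow> ('v \<Rightarrow> nat) \<Rightarrow> real" where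
  "exit_rate A \<xi> = (\<Sum>j\<in>UNIV. if occupied A \<xi> j then (if j \<in> A then 1 else g (\<xi> j)) * sum (r j) UNIV else 0)"

lemma departure_remove:
  "occupied A \<xi> j \<Longrightarrow> departure A m (remove_at A \<xi> j) j = (if j \<in> A then 1 else g (\<xi> j)) * m \<xi>"
  by (auto simp: departure_def) (auto simp: remove_at_def occupied_def)

lemma exit_rate_departure:
  "exit_rate A \<xi> * m \<xi> = (\<Sum>j\<in>UNIV. if occupied A \<xi> j then departure A m (remove_at A \<xi> j) j * sum (r j) UNIV else 0)"
  unfolding exit_rate_def sum_distrib_right by (rule sum.cong) (auto simp: departure_remove)

lemma balance_eq: "balance A m \<xi> = inflow A m \<xi> - exit_rate A \<xi> * m \<xi>"
  unfolding exit_rate_departure balance_def inflow_def sum_subtractf[symmetric]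
  by (rule sum.cong) (auto simp: adj_alt)

lemma weight_bounds: "0 < (if i \<in> A then 1 else g (\<xi> i + 1))" "(if i \<in> A then 1 else g (\<xi> i + 1)) \<le> gmax"
  using g_ge_1[of "\<xi> i + 1"] g_le_gmax gmax_ge_1 by auto

lemma inflow_mono:
  assumes "\<And>\<xi>. \<xi> \<in> ext A \<Longrightarrow> m \<xi> \<le> m' \<xi>" "\<xi> \<in> ext A" shows "inflow A m \<xi> \<le> inflow A m' \<xi>"
proof -
  have "(\<Sum>i\<in>UNIV. departure A m (remove_at A \<xi> j) i * r i j) \<le> (\<Sum>i\<in>UNIV. departure A m' (remove_at A \<xi> j) i * r i j)" for j
    unfolding departure_def
    by (intro sum_mono mult_right_mono mult_left_mono assms r_nonneg less_imp_le[OF weight_bounds(1)]) (simp add: assms)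
  then show ?thesis unfolding inflow_def by (intro sum_mono) auto
qed

text \<open>Conservation of mass. Summed over all configurations, the departures from
  \<open>i\<close> have a finite total \<open>s i\<close>, because \<open>g\<close> is bounded.
  Reindexing by the configuration left behind turns the term of \<open>j\<close> into
  \<open>adj r s j\<close>, and these add up to zero.\<close>

lemma balance_has_sum_zero:
  assumes nn: "\<And>\<xi>. \<xi> \<in> ext A \<Longrightarrow> 0 \<le> m \<xi>" and sm: "m summable_on ext A"
  shows "(balance A m has_sum 0) (ext A)"
proof -
  have "\<exists>s. ((\<lambda>\<xi>. departure A m \<xi> i) has_sum s) (ext A)" for i
  proof -
    have "inj_on (\<lambda>\<xi>. insert_at A \<xi> i) (ext A)" by (rule inj_on_inverseI[where g="\<lambda>\<xi>. remove_at A \<xi> i"]) simp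
    moreover have "m summable_on (\<lambda>\<xi>. insert_at A \<xi> i) ` ext A"
      by (rule summable_on_subset[OF sm]) auto
    ultimately have "(\<lambda>\<xi>. m (insert_at A \<xi> i)) summable_on ext A"
      by (simp add: summable_on_reindex o_def)
    then have "(\<lambda>\<xi>. gmax * m (insert_at A \<xi> i)) summable_on ext A" by (rule summable_on_cmult_right)
    then have "(\<lambda>\<xi>. departure A m \<xi> i) summable_on ext A"
      by (rule summable_on_comparison_test; unfold departure_def)
        (simp_all only: mult_right_mono[OF weight_bounds(2)] mult_nonneg_nonneg[OF less_imp_le[OF weight_bounds(1)]] nn insert_at_ext)
    then show ?thesis unfolding summable_on_def .
  qed
  then obtain s where s: "\<And>i. ((\<lambda>\<xi>. departure A m \<xi> i) has_sum s i) (ext A)" by metis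
  have term_sum: "((\<lambda>\<xi>. if occupied A \<xi> j then adj r (departure A m (remove_at A \<xi> j)) j else 0) has_sum adj r s j) (ext A)" for j
  proof (subst has_sum_remove_at[where f="\<lambda>\<xi>. adj r (departure A m \<xi>) j"])
    have "((\<lambda>\<xi>. \<Sum>i\<in>UNIV. departure A m \<xi> i * r i j + - departure A m \<xi> j * r j i) has_sum (\<Sum>i\<in>UNIV. s i * r i j + - s j * r j i)) (ext A)"
      by (intro has_sum_sum_fun has_sum_add has_sum_cmult_left s has_sum_uminus[THEN iffD2]) (simp_all add: s)
    then show "((\<lambda>\<xi>. adj r (departure A m \<xi>) j) has_sum adj r s j) (ext A)"
      unfolding adj_def by simp
  qed
  have "(balance A m has_sum (\<Sum>j\<in>UNIV. adj r s j)) (ext A)"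
    unfolding balance_def by (rule has_sum_sum_fun) (auto intro: term_sum)
  then show ?thesis by (simp add: sum_adj_zero)
qed

text \<open>The unnormalised product measure with fugacities \<phi>, possibly of infinite total
  mass.\<close>

definition fugacity_weight :: "'v set \<Rightarrow> ('v \<Rightarrow> real) \<Rightarrow> ('v \<Rightarrow> nat) \<Rightarrow> real" where
  "fugacity_weight A \<phi> \<xi> = (\<Prod>i\<in>-A. \<phi> i ^ \<xi> i / (\<Prod>k<\<xi> i. g (Suc k)))"

lemma fugacity_weight_pos:
  assumes "\<And>i. \<phi> i > 0" shows "fugacity_weight A \<phi> \<xi> > 0"
proof -
  have "g (Suc k) > 0" for k using g_ge_1[of "Suc k"] by simp
  then show ?thesis unfolding fugacity_weight_def by (intro prod_pos ballI divide_pos_pos zero_less_power assms)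
qed

lemma departure_fugacity_weight:
  assumes "\<And>i. i \<in> A \<Longrightarrow> \<phi> i = 1"
  shows "departure A (fugacity_weight A \<phi>) \<xi> i = \<phi> i * fugacity_weight A \<phi> \<xi>"
proof (cases "i \<in> A")
  case True
  then show ?thesis using assms by (simp add: departure_def insert_at_def)
next
  case False
  define f where "f \<xi> i = \<phi> i ^ \<xi> i / (\<Prod>k<\<xi> i. g (Suc k))" for \<xi> :: "'v \<Rightarrow> nat" and i
  have gp: "g (Suc (\<xi> i)) \<noteq> 0" using g_ge_1[of "Suc (\<xi> i)"] by simp
  have split: "fugacity_weight A \<phi> \<xi> = f \<xi> i * (\<Prod>l\<in>-A-{i}. f \<xi> l)" for \<xi>
    unfolding fugacity_weight_def f_def using False by (intro prod.remove) auto
  have "(\<Prod>l\<in>-A-{i}. f (\<xi>(i := \<xi> i + 1)) l) = (\<Prod>l\<in>-A-{i}. f \<xi> l)"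
    by (rule prod.cong) (auto simp: f_def)
  moreover have "g (\<xi> i + 1) * f (\<xi>(i := \<xi> i + 1)) i = \<phi> i * f \<xi> i"
    using gp by (simp add: f_def)
  ultimately show ?thesis
    using False unfolding departure_def insert_at_def split by simp
qed

text \<open>A departure from \<open>i\<close> multiplies the weight by \<open>\<phi> i\<close>, so
  the term of \<open>j\<close> is a multiple of \<open>adj r \<phi> j\<close>, which vanishes off
  \<open>A\<close>. For \<open>j \<in> A\<close> removal changes nothing, so the remaining terms
  share one factor and add up to zero.\<close>

lemma balance_fugacity_weight:
  assumes "\<And>i. i \<in> A \<Longrightarrow> \<phi> i = 1" "\<And>i. i \<notin> A \<Longrightarrow> adj r \<phi> i = 0"
  shows "balance A (fugacity_weight A \<phi>) \<xi> = 0"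
proof -
  have d: "departure A (fugacity_weight A \<phi>) \<zeta> = (\<lambda>i. fugacity_weight A \<phi> \<zeta> * \<phi> i)" for \<zeta>
    using departure_fugacity_weight[OF assms(1)] by (auto simp: mult.commute)
  have "balance A (fugacity_weight A \<phi>) \<xi> = (\<Sum>j\<in>UNIV. fugacity_weight A \<phi> \<xi> * adj r \<phi> j)"
    unfolding balance_def d adj_scale
    by (rule sum.cong) (auto simp: assms(2) remove_at_def occupied_def)
  then show ?thesis by (simp add: sum_adj_zero flip: sum_distrib_left)
qed

text \<open>The minimum of two invariant measures is superinvariant, hence invariant if it is finite; so the
  set where one of them dominates the other is closed under undoing jumps.\<close>

lemma balanced_proportional:
  assumes A: "A \<noteq> {}"
    and nn: "\<And>\<xi>. \<xi> \<in> ext A \<Longrightarrow> 0 \<le> m \<xi>" and sm: "m summable_on ext A"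
    and m: "\<And>\<xi>. \<xi> \<in> ext A \<Longrightarrow> balance A m \<xi> = 0"
    and nn': "\<And>\<xi>. \<xi> \<in> ext A \<Longrightarrow> 0 \<le> m' \<xi>"
    and m': "\<And>\<xi>. \<xi> \<in> ext A \<Longrightarrow> balance A m' \<xi> = 0"
    and \<xi>0: "\<xi>0 \<in> ext A" "m' \<xi>0 \<le> m \<xi>0"
    and \<xi>: "\<xi> \<in> ext A"
  shows "m' \<xi> \<le> m \<xi>"
proof -
  define n where "n \<xi> = min (m \<xi>) (m' \<xi>)" for \<xi>
  have n_nn: "0 \<le> n \<xi>" if "\<xi> \<in> ext A" for \<xi> using nn nn' that by (simp add: n_def)
  have n_sm: "n summable_on ext A"
    by (rule summable_on_comparison_test[OF sm]) (auto simp: n_def nn nn')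
  have bal_le: "balance A n \<xi> \<le> 0" if \<xi>: "\<xi> \<in> ext A" for \<xi>
  proof -
    have "inflow A n \<xi> \<le> inflow A m \<xi>" "inflow A n \<xi> \<le> inflow A m' \<xi>"
      by (rule inflow_mono[OF _ \<xi>]; simp add: n_def)+
    then have "inflow A n \<xi> \<le> exit_rate A \<xi> * m \<xi>" "inflow A n \<xi> \<le> exit_rate A \<xi> * m' \<xi>"
      using m[OF \<xi>] m'[OF \<xi>] by (simp_all add: balance_eq)
    then show ?thesis by (auto simp: balance_eq n_def min_def)
  qed
  have bal0: "balance A n \<xi> = 0" if "\<xi> \<in> ext A" for \<xi>
  proof -
    have hs: "((\<lambda>\<xi>. - balance A n \<xi>) has_sum 0) (ext A)"
      using balance_has_sum_zero[OF n_nn n_sm] has_sum_uminus[of "balance A n" "ext A" 0] by simp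
    have "- balance A n \<xi> = 0"
    proof (rule nonneg_infsum_le_0D[where f="\<lambda>\<xi>. - balance A n \<xi>" and A="ext A"])
      show "(\<Sum>\<^sub>\<infinity>\<xi>\<in>ext A. - balance A n \<xi>) \<le> 0" using infsumI[OF hs] by simp
      show "(\<lambda>\<xi>. - balance A n \<xi>) summable_on ext A" using hs by (rule has_sum_imp_summable)
    qed (use bal_le that in auto)
    then show ?thesis by simp
  qed
  define Q where "Q = {\<xi> \<in> ext A. m' \<xi> \<le> m \<xi>}"
  \<comment> \<open>The flows of \<open>n\<close> and \<open>m'\<close> into this configuration are
    equal and ordered term by term, hence equal term by term. So domination passes from a
    configuration to every one that leads to it by a single jump.\<close>
  have closed: "insert_at A \<xi> i \<in> Q" if Q: "insert_at A \<xi> j \<in> Q" and rij: "r i j > 0" and \<xi>: "\<xi> \<in> ext A" for \<xi> i j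
  proof -
    let ?\<zeta> = "insert_at A \<xi> j"
    have z: "?\<zeta> \<in> ext A" using \<xi> by simp
    have nz: "n ?\<zeta> = m' ?\<zeta>" using Q by (simp add: Q_def n_def)
    have flow: "inflow A n ?\<zeta> = inflow A m' ?\<zeta>"
      using bal0[OF z] m'[OF z] nz by (simp add: balance_eq)
    define T where "T m k l = (if occupied A ?\<zeta> k then departure A m (remove_at A ?\<zeta> k) l * r l k else 0)" for m k l
    have T_le: "T n k l \<le> T m' k l" for k l
      using z by (auto simp: T_def departure_def n_def intro!: mult_right_mono mult_left_mono r_nonneg g_nonneg)
    have inT: "inflow A m ?\<zeta> = (\<Sum>k\<in>UNIV. \<Sum>l\<in>UNIV. T m k l)" for m
      unfolding inflow_def T_def by (rule sum.cong) auto
    have "(\<Sum>k\<in>UNIV. \<Sum>l\<in>UNIV. T m' k l - T n k l) = 0"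
      using flow unfolding inT by (simp add: sum_subtractf)
    then have "\<forall>k\<in>UNIV. (\<Sum>l\<in>UNIV. T m' k l - T n k l) = 0"
      by (subst (asm) sum_nonneg_eq_0_iff) (auto intro!: sum_nonneg simp: T_le)
    then have "\<forall>l\<in>UNIV. T m' j l - T n j l = 0"
      by (subst (asm) sum_nonneg_eq_0_iff) (auto simp: T_le)
    then have "T m' j i = T n j i" by simp
    then have "departure A m' \<xi> i * r i j = departure A n \<xi> i * r i j" by (simp add: T_def)
    then have "m' (insert_at A \<xi> i) = n (insert_at A \<xi> i)"
      using rij weight_bounds(1)[of i A \<xi>] by (simp add: departure_def)
    then show ?thesis using \<xi> by (simp add: Q_def n_def)
  qed
  have reach: "insert_at A \<xi> i \<in> Q" if "insert_at A \<xi> j \<in> Q" "\<xi> \<in> ext A" for \<xi> i j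
  proof -
    have "(i, j) \<in> {(a, b). 0 < r a b}\<^sup>*" using r_irred unfolding irreducible_rates_def by blast
    then show ?thesis
      by (induction rule: converse_rtrancl_induct) (use that closed in auto)
  qed
  \<comment> \<open>Inserting at the reservoir \<open>a\<close> leaves a configuration unchanged.
    Undoing jumps from or to \<open>a\<close> therefore adds or removes a particle at any site, and
    \<open>Q\<close> is everything as soon as it is nonempty.\<close>
  obtain a where a: "a \<in> A" using A by blast
  have ins_a: "insert_at A \<xi> a = \<xi>" for \<xi> using a by (simp add: insert_at_def)
  have up: "insert_at A \<xi> i \<in> Q" if "\<xi> \<in> Q" for \<xi> i
    using reach[of \<xi> a i] that ins_a by (simp add: Q_def)
  have down: "\<xi> \<in> Q" if "insert_at A \<xi> i \<in> Q" "\<xi> \<in> ext A" for \<xi> i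
    using reach[of \<xi> i a] that ins_a by simp
  have all_down: "(\<lambda>_. 0) \<in> Q" if "\<xi> \<in> Q" for \<xi>
    using that
  proof (induction "particles \<xi>" arbitrary: \<xi> rule: less_induct)
    case less
    show ?case
    proof (cases "\<exists>i. \<xi> i \<noteq> 0")
      case False
      then have "\<xi> = (\<lambda>_. 0)" by auto
      then show ?thesis using less by simp
    next
      case True
      then obtain i where i: "\<xi> i \<noteq> 0" by blast
      then have iA: "i \<notin> A" using less(2) by (auto simp: Q_def ext_def)
      have occ: "occupied A \<xi> i" using i by (simp add: occupied_def)
      have rm: "remove_at A \<xi> i \<in> Q"
        by (rule down[of _ i]) (use occ less(2) in \<open>auto simp: Q_def\<close>)
      have "particles (remove_at A \<xi> i) < particles \<xi>"
        unfolding particles_def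
        by (rule sum_strict_mono_ex1) (use iA i in \<open>auto simp: remove_at_def\<close>)
      then show ?thesis using less(1) rm by blast
    qed
  qed
  have all_up: "\<xi> \<in> Q" if "\<xi> \<in> ext A" "(\<lambda>_. 0) \<in> Q" for \<xi>
    using that(1)
  proof (induction "particles \<xi>" arbitrary: \<xi> rule: less_induct)
    case less
    show ?case
    proof (cases "\<exists>i. \<xi> i \<noteq> 0")
      case False
      then have "\<xi> = (\<lambda>_. 0)" by auto
      then show ?thesis using that by simp
    next
      case True
      then obtain i where i: "\<xi> i \<noteq> 0" by blast
      then have iA: "i \<notin> A" using less(2) by (auto simp: ext_def)
      have occ: "occupied A \<xi> i" using i by (simp add: occupied_def)
      have "particles (remove_at A \<xi> i) < particles \<xi>"
        unfolding particles_def
        by (rule sum_strict_mono_ex1) (use iA i in \<open>auto simp: remove_at_def\<close>)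
      then have "remove_at A \<xi> i \<in> Q" using less by simp
      then have "insert_at A (remove_at A \<xi> i) i \<in> Q" by (rule up)
      then show ?thesis using occ by simp
    qed
  qed
  have "\<xi>0 \<in> Q" using \<xi>0 by (simp add: Q_def)
  then have "\<xi> \<in> Q" using all_up[OF \<xi>] all_down by blast
  then show ?thesis by (simp add: Q_def)
qed

text \<open>By \<open>balanced_proportional\<close> the measure is a multiple \<open>c\<close> of
  the product measure, and the product form identifies the mean speed at \<open>i\<close> as
  \<open>\<phi> i\<close> times the total mass. If \<open>\<phi> i > 1\<close>, the ratios
  \<open>\<phi> i / g n\<close> of consecutive masses along configurations concentrated at
  \<open>i\<close> eventually exceed 1, as \<open>g\<close> tends to 1; this contradicts summability
  unless \<open>c = 0\<close>.\<close>

lemma balanced_mean_speed: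
  assumes A: "A \<noteq> {}" and i: "i \<notin> A"
    and nn: "\<And>\<xi>. \<xi> \<in> ext A \<Longrightarrow> 0 \<le> m \<xi>" and sm: "m summable_on ext A"
    and bal: "\<And>\<xi>. \<xi> \<in> ext A \<Longrightarrow> balance A m \<xi> = 0"
  shows "(\<Sum>\<^sub>\<infinity>\<xi>\<in>ext A. m \<xi> * (g (\<xi> i) - 1)) \<le> 0" "(\<lambda>\<xi>. m \<xi> * (g (\<xi> i) - 1)) summable_on ext A"
proof -
  obtain \<phi> where \<phi>: "\<And>k. k \<in> A \<Longrightarrow> \<phi> k = 1" "\<And>k. k \<notin> A \<Longrightarrow> adj r \<phi> k = 0"
    using adj_solution_exists[OF A, of "\<lambda>_. 1" "\<lambda>_. 0"] by blast
  have \<phi>_pos: "\<phi> k > 0" for k by (rule adj_solution_pos[OF A]) (use \<phi> in auto)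
  let ?\<nu> = "fugacity_weight A \<phi>"
  have \<nu>_pos: "?\<nu> \<xi> > 0" for \<xi> by (rule fugacity_weight_pos[OF \<phi>_pos])
  have balc: "balance A (\<lambda>\<xi>. c * ?\<nu> \<xi>) \<xi> = 0" for c \<xi>
  proof -
    have "departure A (\<lambda>\<xi>. c * ?\<nu> \<xi>) \<zeta> = (\<lambda>k. c * departure A ?\<nu> \<zeta> k)" for \<zeta>
      by (auto simp: departure_def)
    then have "balance A (\<lambda>\<xi>. c * ?\<nu> \<xi>) \<xi> = c * balance A ?\<nu> \<xi>"
      unfolding balance_def by (simp add: adj_scale sum_distrib_left if_distrib cong: if_cong)
    then show ?thesis by (simp add: balance_fugacity_weight \<phi>)
  qed
  have dominates: "m \<xi>0 / ?\<nu> \<xi>0 * ?\<nu> \<xi> \<le> m \<xi>" if "\<xi>0 \<in> ext A" "\<xi> \<in> ext A" for \<xi>0 \<xi>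
  proof -
    let ?m' = "\<lambda>\<xi>. m \<xi>0 / ?\<nu> \<xi>0 * ?\<nu> \<xi>"
    have "0 \<le> ?m' \<xi>" for \<xi>
      by (intro mult_nonneg_nonneg divide_nonneg_nonneg less_imp_le[OF \<nu>_pos] nn that)
    moreover have "balance A ?m' \<xi> = 0" for \<xi> by (rule balc)
    moreover have "?m' \<xi>0 \<le> m \<xi>0" using \<nu>_pos[of \<xi>0] by simp
    ultimately show ?thesis
      using balanced_proportional[of A m ?m' \<xi>0 \<xi>] A nn sm bal that by blast
  qed
  define c where "c = m (\<lambda>_. 0) / ?\<nu> (\<lambda>_. 0)"
  have zero: "(\<lambda>_. 0) \<in> ext A" by (simp add: ext_def)
  \<comment> \<open>Domination is used twice: with the empty configuration as reference point, and
    with \<xi> as reference point evaluated at the empty configuration.\<close>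
  have m_eq: "m \<xi> = c * ?\<nu> \<xi>" if \<xi>: "\<xi> \<in> ext A" for \<xi>
  proof (rule antisym)
    show "c * ?\<nu> \<xi> \<le> m \<xi>" using dominates[OF zero \<xi>] by (simp add: c_def)
    have "m \<xi> / ?\<nu> \<xi> \<le> c" using dominates[OF \<xi> zero] \<nu>_pos[of "\<lambda>_. 0"] by (simp add: c_def field_simps)
    then show "m \<xi> \<le> c * ?\<nu> \<xi>" using \<nu>_pos[of \<xi>] by (simp add: field_simps)
  qed
  have c: "c \<ge> 0" unfolding c_def using nn[OF zero] \<nu>_pos[of "\<lambda>_. 0"] by simp
  have dep: "g (\<xi> i + 1) * m (insert_at A \<xi> i) = \<phi> i * m \<xi>" if "\<xi> \<in> ext A" for \<xi>
    using departure_fugacity_weight[of A \<phi> \<xi> i] \<phi>(1) i that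
    by (simp add: m_eq departure_def)
  have \<phi>_le: "\<phi> i \<le> 1 \<or> c = 0"
  proof (rule ccontr)
    assume "\<not> (\<phi> i \<le> 1 \<or> c = 0)"
    then have gt: "\<phi> i > 1" and cpos: "c > 0" using c by auto
    have "\<forall>\<^sub>F n in sequentially. g n < \<phi> i" using order_tendstoD(2)[OF g_lim gt] .
    then obtain n0 where n0: "\<And>n. n \<ge> n0 \<Longrightarrow> g n < \<phi> i" unfolding eventually_sequentially by blast
    define e where "e n = (\<lambda>k. if k = i then n else 0)" for n :: nat
    have e_ext: "e n \<in> ext A" for n using i by (auto simp: e_def ext_def)
    have e_Suc: "insert_at A (e n) i = e (Suc n)" for n using i by (auto simp: insert_at_def e_def)
    have mpos: "m (e n) > 0" for n using m_eq[OF e_ext] cpos \<nu>_pos[of "e n"] by simp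
    have step: "m (e n) \<le> m (e (Suc n))" if "n \<ge> n0" for n
    proof -
      have "g (Suc n) * m (e (Suc n)) = \<phi> i * m (e n)"
        using dep[OF e_ext, of n] by (simp add: e_Suc) (simp add: e_def)
      moreover have "\<phi> i * m (e n) \<ge> g (Suc n) * m (e n)"
        using n0[of "Suc n"] that mpos[of n] by (intro mult_right_mono) auto
      ultimately have "g (Suc n) * m (e n) \<le> g (Suc n) * m (e (Suc n))" by simp
      then show ?thesis using g_ge_1[of "Suc n"] by simp
    qed
    have ge: "m (e n0) \<le> m (e n)" if "n \<ge> n0" for n
      using that by (induction n rule: dec_induct) (auto intro: order_trans step)
    obtain N :: nat where N: "infsum m (ext A) < real N * m (e n0)"
      using reals_Archimedean3[OF mpos[of n0]] by blast
    have "real N * m (e n0) = (\<Sum>n\<in>{n0..<n0+N}. m (e n0))" by simp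
    also have "\<dots> \<le> (\<Sum>n\<in>{n0..<n0+N}. m (e n))" by (intro sum_mono ge) auto
    also have "\<dots> = sum m (e ` {n0..<n0+N})"
      by (subst sum.reindex) (auto simp: inj_on_def e_def fun_eq_iff split: if_splits)
    also have "\<dots> \<le> infsum m (ext A)"
      by (rule finite_sum_le_infsum[OF sm]) (use e_ext nn in auto)
    finally show False using N by simp
  qed
  obtain s where s: "(m has_sum s) (ext A)" using sm unfolding summable_on_def by blast
  have "((\<lambda>\<xi>. if occupied A \<xi> i then \<phi> i * m (remove_at A \<xi> i) else 0) has_sum (\<phi> i * s)) (ext A)"
    by (subst has_sum_remove_at[where f="\<lambda>\<xi>. \<phi> i * m \<xi>"]) (rule has_sum_cmult_right[OF s])
  then have "((\<lambda>\<xi>. m \<xi> * g (\<xi> i)) has_sum (\<phi> i * s)) (ext A)"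
  proof (rule has_sum_cong[THEN iffD1, rotated])
    fix \<xi> assume \<xi>: "\<xi> \<in> ext A"
    show "(if occupied A \<xi> i then \<phi> i * m (remove_at A \<xi> i) else 0) = m \<xi> * g (\<xi> i)"
    proof (cases "occupied A \<xi> i")
      case True
      then have "remove_at A \<xi> i i + 1 = \<xi> i" using i by (auto simp: remove_at_def occupied_def)
      then show ?thesis using dep[of "remove_at A \<xi> i"] \<xi> True by (simp add: mult.commute)
    next
      case False
      then show ?thesis using i g_0 by (simp add: occupied_def not_le)
    qed
  qed
  from has_sum_add[OF this has_sum_cmult_left[OF s, of "-1"]]
  have hs: "((\<lambda>\<xi>. m \<xi> * (g (\<xi> i) - 1)) has_sum ((\<phi> i - 1) * s)) (ext A)"
    by (simp add: algebra_simps)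
  have "s \<ge> 0" by (rule has_sum_nonneg[OF s nn])
  moreover have "s = 0" if "c = 0"
  proof -
    have "(m has_sum 0) (ext A)" by (rule has_sum_0) (simp add: m_eq that)
    with s show ?thesis by (rule has_sum_unique)
  qed
  ultimately have "(\<phi> i - 1) * s \<le> 0" using \<phi>_le by (auto simp: mult_nonpos_nonneg)
  then show "(\<Sum>\<^sub>\<infinity>\<xi>\<in>ext A. m \<xi> * (g (\<xi> i) - 1)) \<le> 0" using infsumI[OF hs] by simp
  show "(\<lambda>\<xi>. m \<xi> * (g (\<xi> i) - 1)) summable_on ext A" using hs by (rule has_sum_imp_summable)
qed

end

section \<open>Strata of a finitely additive invariant mean\<close>

lemma particles_ge: "\<xi> k \<le> particles \<xi>"
  unfolding particles_def by (rule member_le_sum) auto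

text \<open>\<Lambda> is additive only for finite sums. It gives no mass to any bounded number of
  particles and total mass 1, so it is not a measure on configurations.\<close>

locale invariant_mean = zero_range r g for r :: "'v::finite \<Rightarrow> 'v \<Rightarrow> real" and g +
  fixes \<Lambda> :: "(('v \<Rightarrow> nat) \<Rightarrow> real) \<Rightarrow> real"
  assumes mean_add: "\<And>f h. bounded_fun f \<Longrightarrow> bounded_fun h \<Longrightarrow> \<Lambda> (\<lambda>x. f x + h x) = \<Lambda> f + \<Lambda> h"
    and mean_cmult: "\<And>c f. bounded_fun f \<Longrightarrow> \<Lambda> (\<lambda>x. c * f x) = c * \<Lambda> f"
    and mean_nonneg: "\<And>f. bounded_fun f \<Longrightarrow> (\<And>x. f x \<ge> 0) \<Longrightarrow> \<Lambda> f \<ge> 0"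
    and mean_one: "\<Lambda> (\<lambda>_. 1) = 1"
    and mean_generator: "\<And>f. bounded_fun f \<Longrightarrow> \<Lambda> (zrp_generator r g f) = 0"
    and mean_few_particles: "\<And>K. \<Lambda> (indicator {x. particles x \<le> K}) = 0"
begin

lemma mean_diff: "bounded_fun f \<Longrightarrow> bounded_fun h \<Longrightarrow> \<Lambda> (\<lambda>x. f x - h x) = \<Lambda> f - \<Lambda> h"
  using mean_add[of f "\<lambda>x. -1 * h x"] mean_cmult[of h "-1"] bounded_fun_intros(4)[OF bounded_fun_intros(1)[of "-1"], of h] by simp

lemma mean_mono:
  assumes "bounded_fun f" "bounded_fun h" "\<And>x. f x \<le> h x" shows "\<Lambda> f \<le> \<Lambda> h"
proof -
  have "0 \<le> \<Lambda> (\<lambda>x. h x - f x)" by (rule mean_nonneg) (use assms in \<open>auto intro: bounded_fun_intros\<close>)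
  then show ?thesis by (simp add: mean_diff assms)
qed

lemma mean_sum: "finite F \<Longrightarrow> (\<And>k. k \<in> F \<Longrightarrow> bounded_fun (f k)) \<Longrightarrow> \<Lambda> (\<lambda>x. \<Sum>k\<in>F. f k x) = (\<Sum>k\<in>F. \<Lambda> (f k))"
proof (induction F rule: finite_induct)
  case empty
  have "\<Lambda> (\<lambda>x. 0 * 1) = 0 * \<Lambda> (\<lambda>_. 1)" by (rule mean_cmult) (rule bounded_fun_intros)
  then show ?case by simp
next
  case (insert k F)
  then show ?case by (simp add: mean_add bounded_fun_sum)
qed

lemma mean_const: "\<Lambda> (\<lambda>_. c) = c"
  using mean_cmult[of "\<lambda>_. 1" c] mean_one bounded_fun_intros(1) by simp

text \<open>\<open>K\<close> is a stand-in for infinity: in the limit, \<open>mass A \<xi>\<close>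
  collects the part of \<Lambda> with infinitely many particles at each site of \<open>A\<close> and
  the configuration \<xi> elsewhere.\<close>

definition stratum :: "'v set \<Rightarrow> ('v \<Rightarrow> nat) \<Rightarrow> nat \<Rightarrow> ('v \<Rightarrow> nat) set" where
  "stratum A \<xi> K = {\<eta>. \<forall>k. if k \<in> A then K \<le> \<eta> k else \<eta> k = \<xi> k}"

definition pmass :: "'v set \<Rightarrow> ('v \<Rightarrow> nat) \<Rightarrow> nat \<Rightarrow> real" where
  "pmass A \<xi> K = \<Lambda> (indicator (stratum A \<xi> K))"

definition mass :: "'v set \<Rightarrow> ('v \<Rightarrow> nat) \<Rightarrow> real" where
  "mass A \<xi> = lim (pmass A \<xi>)"

lemma stratum_mono: "K \<le> K' \<Longrightarrow> stratum A \<xi> K' \<subseteq> stratum A \<xi> K"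
  unfolding stratum_def by (auto split: if_splits intro: order_trans)

lemma pmass_nonneg: "0 \<le> pmass A \<xi> K"
  unfolding pmass_def by (rule mean_nonneg) (auto intro: bounded_fun_intros)

lemma pmass_antimono: "K \<le> K' \<Longrightarrow> pmass A \<xi> K' \<le> pmass A \<xi> K"
  unfolding pmass_def using stratum_mono[of K K' A \<xi>]
  by (intro mean_mono bounded_fun_intros) (auto simp: indicator_def)

lemma pmass_tendsto: "pmass A \<xi> \<longlonglongrightarrow> mass A \<xi>"
proof -
  have "decseq (pmass A \<xi>)" by (simp add: decseq_def pmass_antimono)
  then obtain L where "pmass A \<xi> \<longlonglongrightarrow> L" by (rule decseq_convergent[where B=0]) (auto intro: pmass_nonneg)
  then show ?thesis unfolding mass_def by (simp add: limI)
qed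

lemma mass_nonneg: "0 \<le> mass A \<xi>"
  by (rule LIMSEQ_le_const[OF pmass_tendsto]) (auto simp: pmass_nonneg)

text \<open>On the stratum at level \<open>K + 2\<close> the functions are close to
  \<open>G\<close>, and outside the one at level \<open>K\<close> they vanish. The layer between has
  mass \<open>pmass A \<xi> K - pmass A \<xi> (K + 2)\<close>, which tends to zero. Two levels are
  left because the flows refer to level \<open>K + 1\<close> and a jump changes a coordinate by one
  in either direction.\<close>

lemma flux_limit:
  assumes bd: "\<And>K \<eta>. 0 \<le> f K \<eta>" "\<And>K \<eta>. f K \<eta> \<le> C"
    and out: "\<And>K \<eta>. \<eta> \<notin> stratum A \<xi> K \<Longrightarrow> f K \<eta> = 0"
    and G: "0 \<le> G" "G \<le> C"
    and inside: "\<And>e. e > 0 \<Longrightarrow> \<forall>\<^sub>F K in sequentially. \<forall>\<eta>\<in>stratum A \<xi> (K + 2). \<bar>f K \<eta> - G\<bar> \<le> e"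
  shows "(\<lambda>K. \<Lambda> (f K)) \<longlonglongrightarrow> G * mass A \<xi>"
proof -
  have bf: "bounded_fun (f K)" for K by (rule bounded_funI[of _ C]) (use bd in \<open>auto simp: abs_le_iff intro: order_trans\<close>)
  have p2: "(\<lambda>K. pmass A \<xi> (K + 2)) \<longlonglongrightarrow> mass A \<xi>" by (rule LIMSEQ_ignore_initial_segment[OF pmass_tendsto])
  have "(\<lambda>K. C * (pmass A \<xi> K - pmass A \<xi> (K + 2))) \<longlonglongrightarrow> C * (mass A \<xi> - mass A \<xi>)"
    by (intro tendsto_intros pmass_tendsto p2)
  then have diff0: "(\<lambda>K. C * (pmass A \<xi> K - pmass A \<xi> (K + 2))) \<longlonglongrightarrow> 0" by simp
  have key: "\<bar>\<Lambda> (f K) - G * pmass A \<xi> (K + 2)\<bar> \<le> e + C * (pmass A \<xi> K - pmass A \<xi> (K + 2))"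
    if e: "e > 0" "\<forall>\<eta>\<in>stratum A \<xi> (K + 2). \<bar>f K \<eta> - G\<bar> \<le> e" for e K
  proof -
    let ?I = "\<lambda>K. indicator (stratum A \<xi> K) :: _ \<Rightarrow> real"
    note bi = bounded_fun_intros bf
    define D where "D \<eta> = e + C * (?I K \<eta> - ?I (K + 2) \<eta>)" for \<eta>
    have bD: "bounded_fun D" unfolding D_def by (intro bi)
    have LD: "\<Lambda> D = e + C * (pmass A \<xi> K - pmass A \<xi> (K + 2))"
      unfolding D_def pmass_def by (simp add: mean_add mean_cmult mean_diff mean_const bi)
    have le: "\<bar>f K \<eta> - G * ?I (K + 2) \<eta>\<bar> \<le> D \<eta>" for \<eta>
    proof -
      consider "\<eta> \<in> stratum A \<xi> (K + 2)" | "\<eta> \<in> stratum A \<xi> K" "\<eta> \<notin> stratum A \<xi> (K + 2)" | "\<eta> \<notin> stratum A \<xi> K"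
        by blast
      then show ?thesis
      proof cases
        case 1 then show ?thesis using e stratum_mono[of K "K + 2" A \<xi>] by (auto simp: D_def)
      next
        case 2 then show ?thesis using e(1) bd[of K \<eta>] by (simp add: D_def)
      next
        case 3 then show ?thesis using e(1) out[OF 3] stratum_mono[of K "K + 2" A \<xi>] by (auto simp: D_def indicator_def)
      qed
    qed
    have h: "bounded_fun (\<lambda>\<eta>. G * ?I (K + 2) \<eta>)" by (intro bi)
    have "\<Lambda> (\<lambda>\<eta>. G * ?I (K + 2) \<eta>) = G * pmass A \<xi> (K + 2)" by (simp add: pmass_def mean_cmult bi)
    moreover have "\<Lambda> (\<lambda>\<eta>. f K \<eta> - G * ?I (K + 2) \<eta>) \<le> \<Lambda> D"
      by (intro mean_mono bD bounded_fun_intros(3) bf h) (use le in \<open>auto simp: abs_le_iff\<close>)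
    moreover have "\<Lambda> (\<lambda>\<eta>. G * ?I (K + 2) \<eta> - f K \<eta>) \<le> \<Lambda> D"
      by (intro mean_mono bD bounded_fun_intros(3) bf h) (use le in \<open>auto simp: abs_le_iff\<close>)
    ultimately show ?thesis unfolding mean_diff[OF bf h] mean_diff[OF h bf] LD abs_le_iff by linarith
  qed
  have "(\<lambda>K. \<Lambda> (f K) - G * pmass A \<xi> (K + 2)) \<longlonglongrightarrow> 0"
  proof (rule tendstoI)
    fix e :: real assume e: "e > 0"
    have "\<forall>\<^sub>F K in sequentially. C * (pmass A \<xi> K - pmass A \<xi> (K + 2)) < e / 2"
      using order_tendstoD(2)[OF diff0, of "e / 2"] e by simp
    moreover have "\<forall>\<^sub>F K in sequentially. \<forall>\<eta>\<in>stratum A \<xi> (K + 2). \<bar>f K \<eta> - G\<bar> \<le> e / 2"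
      using inside[of "e / 2"] e by simp
    ultimately show "\<forall>\<^sub>F K in sequentially. dist (\<Lambda> (f K) - G * pmass A \<xi> (K + 2)) 0 < e"
    proof eventually_elim
      case (elim K)
      then show ?case using key[of "e / 2" K] e by (simp add: dist_real_def)
    qed
  qed
  from tendsto_add[OF this tendsto_mult_left[OF p2, of G]] show ?thesis by simp
qed

definition gain :: "'v set \<Rightarrow> ('v \<Rightarrow> nat) \<Rightarrow> 'v \<Rightarrow> 'v \<Rightarrow> nat \<Rightarrow> ('v \<Rightarrow> nat) \<Rightarrow> real" where
  "gain A \<xi> i j K \<eta> = g (\<eta> i) * indicator {\<eta>. \<eta> i \<ge> 1 \<and> move_particle i j \<eta> \<in> stratum A \<xi> (K + 1)} \<eta>"

definition loss :: "'v set \<Rightarrow> ('v \<Rightarrow> nat) \<Rightarrow> 'v \<Rightarrow> nat \<Rightarrow> ('v \<Rightarrow> nat) \<Rightarrow> real" where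
  "loss A \<xi> i K \<eta> = g (\<eta> i) * indicator (stratum A \<xi> (K + 1)) \<eta>"

lemma g_large:
  assumes "e > 0" "c > 0" shows "\<forall>\<^sub>F K in sequentially. \<forall>n\<ge>K. \<bar>g n - 1\<bar> * c \<le> e"
proof -
  obtain K0 where "\<forall>n\<ge>K0. dist (g n) 1 < e / c"
    using metric_LIMSEQ_D[OF g_lim, of "e / c"] assms by auto
  then show ?thesis unfolding eventually_sequentially
    by (intro exI[of _ K0]) (use assms in \<open>auto simp: dist_real_def field_simps intro: less_imp_le\<close>)
qed

lemma g_indicator_bounds: "0 \<le> g n * indicator S x" "g n * indicator S x \<le> gmax"
  using g_nonneg[of n] g_le_gmax[of n] gmax_ge_1 by (auto simp: indicator_def)

text \<open>Before the jump the configuration off \<open>A\<close> has one particle more at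
  \<open>i\<close> and one less at \<open>j\<close>. If \<open>j\<close> is neither a reservoir nor
  occupied in \<xi>, no jump to \<open>j\<close> can end in the stratum.\<close>

lemma gain_limit:
  assumes ij: "i \<noteq> j"
  shows "(\<lambda>K. \<Lambda> (gain A \<xi> i j K)) \<longlonglongrightarrow>
    (if occupied A \<xi> j then departure A (mass A) (remove_at A \<xi> j) i else 0)"
proof (cases "occupied A \<xi> j")
  case True
  define \<xi>' where "\<xi>' = insert_at A (remove_at A \<xi> j) i"
  define G where "G = (if i \<in> A then 1 else g (remove_at A \<xi> j i + 1))"
  have "(\<lambda>K. \<Lambda> (gain A \<xi> i j K)) \<longlonglongrightarrow> G * mass A \<xi>'"
  proof (rule flux_limit[where C=gmax])
    show "0 \<le> gain A \<xi> i j K \<eta>" "gain A \<xi> i j K \<eta> \<le> gmax" for K \<eta>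
      unfolding gain_def by (rule g_indicator_bounds)+
    show "0 \<le> G" "G \<le> gmax" unfolding G_def using g_nonneg g_le_gmax gmax_ge_1 by auto
    show "gain A \<xi> i j K \<eta> = 0" if "\<eta> \<notin> stratum A \<xi>' K" for K \<eta>
    proof (rule ccontr)
      assume "gain A \<xi> i j K \<eta> \<noteq> 0"
      then have 1: "\<eta> i \<ge> 1" and 2: "\<And>k. if k \<in> A then K + 1 \<le> move_particle i j \<eta> k else move_particle i j \<eta> k = \<xi> k"
        by (auto simp: gain_def indicator_def stratum_def split: if_splits)
      have "if k \<in> A then K \<le> \<eta> k else \<eta> k = \<xi>' k" for k
        using 1 2[of k] ij
        by (auto simp: move_particle_apply[OF ij] \<xi>'_def insert_at_def remove_at_def split: if_splits)
      then have "\<eta> \<in> stratum A \<xi>' K" unfolding stratum_def by blast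
      then show False using that by contradiction
    qed
    have inS: "\<eta> i \<ge> 1 \<and> move_particle i j \<eta> \<in> stratum A \<xi> (K + 1)" if "\<eta> \<in> stratum A \<xi>' (K + 2)" for K \<eta>
    proof -
      have 1: "if k \<in> A then K + 2 \<le> \<eta> k else \<eta> k = \<xi>' k" for k using that by (simp add: stratum_def)
      have "\<eta> i \<ge> 1" using 1[of i] by (auto simp: \<xi>'_def insert_at_def split: if_splits)
      moreover have "if k \<in> A then K + 1 \<le> move_particle i j \<eta> k else move_particle i j \<eta> k = \<xi> k" for k
        using 1[of k] ij True
        by (auto simp: move_particle_apply[OF ij] \<xi>'_def insert_at_def remove_at_def occupied_def split: if_splits)
      ultimately show ?thesis unfolding stratum_def by blast
    qed
    fix e :: real assume e: "e > 0"
    show "\<forall>\<^sub>F K in sequentially. \<forall>\<eta>\<in>stratum A \<xi>' (K + 2). \<bar>gain A \<xi> i j K \<eta> - G\<bar> \<le> e"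
      using g_large[OF e zero_less_one]
    proof eventually_elim
      case (elim K)
      show ?case
      proof
        fix \<eta> assume \<eta>: "\<eta> \<in> stratum A \<xi>' (K + 2)"
        then have 1: "if i \<in> A then K + 2 \<le> \<eta> i else \<eta> i = \<xi>' i" by (simp add: stratum_def)
        have "gain A \<xi> i j K \<eta> = g (\<eta> i)" using inS[OF \<eta>] by (simp add: gain_def)
        then show "\<bar>gain A \<xi> i j K \<eta> - G\<bar> \<le> e"
          using 1 elim e by (auto simp: G_def \<xi>'_def insert_at_def split: if_splits)
      qed
    qed
  qed
  then show ?thesis using True by (simp add: departure_def G_def \<xi>'_def)
next
  case False
  have "gain A \<xi> i j K = (\<lambda>_. 0)" for K
  proof
    fix \<eta>
    have "move_particle i j \<eta> \<notin> stratum A \<xi> (K + 1)"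
      using False ij by (auto simp: stratum_def occupied_def move_particle_apply[OF ij] intro!: exI[of _ j])
    then show "gain A \<xi> i j K \<eta> = 0" by (simp add: gain_def)
  qed
  then show ?thesis using False mean_const[of 0] by simp
qed

lemma loss_limit:
  "(\<lambda>K. \<Lambda> (loss A \<xi> i K)) \<longlonglongrightarrow>
    (if occupied A \<xi> i then departure A (mass A) (remove_at A \<xi> i) i else 0)"
proof -
  define G where "G = (if i \<in> A then 1 else g (\<xi> i))"
  have "(\<lambda>K. \<Lambda> (loss A \<xi> i K)) \<longlonglongrightarrow> G * mass A \<xi>"
  proof (rule flux_limit[where C=gmax])
    show "0 \<le> loss A \<xi> i K \<eta>" "loss A \<xi> i K \<eta> \<le> gmax" for K \<eta>
      unfolding loss_def by (rule g_indicator_bounds)+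
    show "0 \<le> G" "G \<le> gmax" unfolding G_def using g_nonneg g_le_gmax gmax_ge_1 by auto
    show "loss A \<xi> i K \<eta> = 0" if "\<eta> \<notin> stratum A \<xi> K" for K \<eta>
      using that stratum_mono[of K "K + 1" A \<xi>] by (auto simp: loss_def indicator_def)
    fix e :: real assume e: "e > 0"
    show "\<forall>\<^sub>F K in sequentially. \<forall>\<eta>\<in>stratum A \<xi> (K + 2). \<bar>loss A \<xi> i K \<eta> - G\<bar> \<le> e"
      using g_large[OF e zero_less_one]
    proof eventually_elim
      case (elim K)
      show ?case
      proof
        fix \<eta> assume \<eta>: "\<eta> \<in> stratum A \<xi> (K + 2)"
        then have 1: "if i \<in> A then K + 2 \<le> \<eta> i else \<eta> i = \<xi> i" by (simp add: stratum_def)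
        have "loss A \<xi> i K \<eta> = g (\<eta> i)" using stratum_mono[of "K + 1" "K + 2" A \<xi>] \<eta> by (auto simp: loss_def)
        then show "\<bar>loss A \<xi> i K \<eta> - G\<bar> \<le> e"
          using 1 elim e by (auto simp: G_def split: if_splits)
      qed
    qed
  qed
  moreover have "G * mass A \<xi> = (if occupied A \<xi> i then departure A (mass A) (remove_at A \<xi> i) i else 0)"
    by (auto simp: departure_remove G_def occupied_def g_0 not_le)
  ultimately show ?thesis by simp
qed

text \<open>Stationarity of \<Lambda> for the indicator of a stratum. As the level grows, its gain
  and loss terms converge to the flows of the network with reservoirs \<open>A\<close>, so the mass
  that has escaped at \<open>A\<close> acts as an invariant measure for the other sites.\<close>

lemma mass_balance: "balance A (mass A) \<xi> = 0"
proof -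
  define D where "D i j = (if occupied A \<xi> j then departure A (mass A) (remove_at A \<xi> j) i else 0)" for i j
  have "(\<Sum>i\<in>UNIV. \<Sum>j\<in>UNIV. r i j * (\<Lambda> (gain A \<xi> i j K) - \<Lambda> (loss A \<xi> i K))) = 0" for K
  proof -
    have bg: "bounded_fun (gain A \<xi> i j K)" "bounded_fun (loss A \<xi> i K)" for i j
      unfolding gain_def loss_def
      by (rule bounded_funI[of _ gmax], subst abs_of_nonneg; rule g_indicator_bounds)+
    note bi = bounded_fun_intros bg
    let ?f = "indicator (stratum A \<xi> (K + 1)) :: _ \<Rightarrow> real"
    have "zrp_generator r g ?f = (\<lambda>\<eta>. \<Sum>i\<in>UNIV. \<Sum>j\<in>UNIV. r i j * (gain A \<xi> i j K \<eta> - loss A \<xi> i K \<eta>))"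
    proof
      fix \<eta>
      have "g (\<eta> i) * r i j * (?f (move_particle i j \<eta>) - ?f \<eta>) = r i j * (gain A \<xi> i j K \<eta> - loss A \<xi> i K \<eta>)" for i j
        by (cases "\<eta> i = 0") (auto simp: gain_def loss_def g_0 indicator_def)
      then show "zrp_generator r g ?f \<eta> = (\<Sum>i\<in>UNIV. \<Sum>j\<in>UNIV. r i j * (gain A \<xi> i j K \<eta> - loss A \<xi> i K \<eta>))"
        unfolding zrp_generator_def by (intro sum.cong refl)
    qed
    moreover have "\<Lambda> (zrp_generator r g ?f) = 0" by (rule mean_generator) (rule bounded_fun_intros)
    moreover have "\<Lambda> (\<lambda>\<eta>. \<Sum>i\<in>UNIV. \<Sum>j\<in>UNIV. r i j * (gain A \<xi> i j K \<eta> - loss A \<xi> i K \<eta>)) =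
        (\<Sum>i\<in>UNIV. \<Sum>j\<in>UNIV. r i j * (\<Lambda> (gain A \<xi> i j K) - \<Lambda> (loss A \<xi> i K)))"
      by (subst mean_sum; (subst mean_sum)?; simp add: mean_cmult mean_diff bi bounded_fun_sum)
    ultimately show ?thesis by simp
  qed
  moreover have "(\<lambda>K. \<Sum>i\<in>UNIV. \<Sum>j\<in>UNIV. r i j * (\<Lambda> (gain A \<xi> i j K) - \<Lambda> (loss A \<xi> i K)))
     \<longlonglongrightarrow> (\<Sum>i\<in>UNIV. \<Sum>j\<in>UNIV. r i j * (D i j - D i i))"
  proof (intro tendsto_sum)
    fix i j
    show "(\<lambda>K. r i j * (\<Lambda> (gain A \<xi> i j K) - \<Lambda> (loss A \<xi> i K))) \<longlonglongrightarrow> r i j * (D i j - D i i)"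
    proof (cases "i = j")
      case False
      then show ?thesis unfolding D_def by (intro tendsto_intros gain_limit loss_limit)
    qed (simp add: r_diag)
  qed
  ultimately have z: "(\<Sum>i\<in>UNIV. \<Sum>j\<in>UNIV. r i j * (D i j - D i i)) = 0"
    using LIMSEQ_unique[of "\<lambda>_. 0" "\<Sum>i\<in>UNIV. \<Sum>j\<in>UNIV. r i j * (D i j - D i i)" 0] by simp
  have "balance A (mass A) \<xi> = (\<Sum>j\<in>UNIV. \<Sum>i\<in>UNIV. D i j * r i j - D j j * r j i)"
    unfolding balance_def by (rule sum.cong) (auto simp: adj_def D_def)
  also have "\<dots> = (\<Sum>j\<in>UNIV. \<Sum>i\<in>UNIV. D i j * r i j) - (\<Sum>j\<in>UNIV. \<Sum>i\<in>UNIV. D j j * r j i)"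
    by (simp add: sum_subtractf)
  also have "(\<Sum>j\<in>UNIV. \<Sum>i\<in>UNIV. D i j * r i j) = (\<Sum>i\<in>UNIV. \<Sum>j\<in>UNIV. D i j * r i j)" by (rule sum.swap)
  finally show ?thesis using z by (simp add: sum_subtractf algebra_simps)
qed

lemma stratum_disjoint:
  assumes "\<xi> \<in> ext A" "\<xi>' \<in> ext A" "\<eta> \<in> stratum A \<xi> K" "\<eta> \<in> stratum A \<xi>' K"
  shows "\<xi> = \<xi>'"
proof
  fix k
  have "if k \<in> A then K \<le> \<eta> k else \<eta> k = \<xi> k" "if k \<in> A then K \<le> \<eta> k else \<eta> k = \<xi>' k"
    using assms(3,4) unfolding stratum_def by blast+
  then show "\<xi> k = \<xi>' k" using assms(1,2) by (cases "k \<in> A") (auto simp: ext_def)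
qed

text \<open>Strata with the same \<open>A\<close> and \<open>K\<close> are disjoint, so finite sums
  are bounded by the total mass 1.\<close>

lemma mass_summable: "mass A summable_on ext A"
proof (rule nonneg_bdd_above_summable_on)
  have "sum (mass A) F \<le> 1" if F: "F \<subseteq> ext A" "finite F" for F
  proof (rule LIMSEQ_le_const2)
    show "(\<lambda>K. \<Sum>\<xi>\<in>F. pmass A \<xi> K) \<longlonglongrightarrow> sum (mass A) F" by (intro tendsto_sum pmass_tendsto)
    have "(\<Sum>\<xi>\<in>F. pmass A \<xi> K) \<le> 1" for K
    proof -
      have "(\<Sum>\<xi>\<in>F. pmass A \<xi> K) = \<Lambda> (\<lambda>\<eta>. \<Sum>\<xi>\<in>F. indicator (stratum A \<xi> K) \<eta>)"
        unfolding pmass_def by (rule mean_sum[symmetric]) (use F in \<open>auto intro: bounded_fun_intros\<close>)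
      also have "\<dots> \<le> \<Lambda> (\<lambda>_. 1)"
      proof (rule mean_mono)
        fix \<eta>
        show "(\<Sum>\<xi>\<in>F. indicator (stratum A \<xi> K) \<eta> :: real) \<le> 1"
        proof (cases "\<exists>\<xi>\<in>F. \<eta> \<in> stratum A \<xi> K")
          case True
          then obtain \<xi> where \<xi>: "\<xi> \<in> F" "\<eta> \<in> stratum A \<xi> K" by blast
          have "(\<Sum>\<xi>'\<in>F. indicator (stratum A \<xi>' K) \<eta> :: real) = (\<Sum>\<xi>'\<in>F. if \<xi>' = \<xi> then 1 else 0)"
            by (rule sum.cong) (use \<xi> F stratum_disjoint[of \<xi> A _ \<eta> K] in \<open>auto simp: indicator_def\<close>)
          then show ?thesis using \<xi> F by simp
        next
          case False
          then have "(\<Sum>\<xi>\<in>F. indicator (stratum A \<xi> K) \<eta> :: real) = 0" by (intro sum.neutral) auto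
          then show ?thesis by simp
        qed
      qed (use F in \<open>auto intro!: bounded_fun_intros bounded_fun_sum\<close>)
      finally show ?thesis by (simp add: mean_one)
    qed
    then show "\<exists>N. \<forall>n\<ge>N. (\<Sum>\<xi>\<in>F. pmass A \<xi> n) \<le> 1" by blast
  qed
  then show "bdd_above (sum (mass A) ` {F. F \<subseteq> ext A \<and> finite F})"
    by (auto simp: bdd_above_def)
qed (rule mass_nonneg)

text \<open>Without reservoirs a stratum has a fixed number of particles, and such sets carry no
  mass. This disposes of the closed network, to which \<open>balanced_mean_speed\<close> does not
  apply.\<close>

lemma mass_empty: "mass {} \<xi> = 0"
proof -
  have "stratum {} \<xi> K \<subseteq> {x. particles x \<le> particles \<xi>}" for K
    by (auto simp: stratum_def particles_def)
  then have "pmass {} \<xi> K \<le> \<Lambda> (indicator {x. particles x \<le> particles \<xi>})" for K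
    unfolding pmass_def by (intro mean_mono bounded_fun_intros) (auto simp: indicator_def)
  then have "pmass {} \<xi> K = 0" for K using pmass_nonneg[of "{}" \<xi> K] by (simp add: mean_few_particles antisym)
  then have "pmass {} \<xi> = (\<lambda>_. 0)" by blast
  then show ?thesis using pmass_tendsto[of "{}" \<xi>] by (simp add: LIMSEQ_const_iff)
qed

lemma mass_mean_speed:
  assumes "i \<notin> A"
  shows "(\<Sum>\<^sub>\<infinity>\<xi>\<in>ext A. mass A \<xi> * (g (\<xi> i) - 1)) \<le> 0" "(\<lambda>\<xi>. mass A \<xi> * (g (\<xi> i) - 1)) summable_on ext A"
proof -
  have "(\<Sum>\<^sub>\<infinity>\<xi>\<in>ext A. mass A \<xi> * (g (\<xi> i) - 1)) \<le> 0 \<and> (\<lambda>\<xi>. mass A \<xi> * (g (\<xi> i) - 1)) summable_on ext A"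
  proof (cases "A = {}")
    case False
    then show ?thesis
      using balanced_mean_speed[of A i "mass A"] assms mass_nonneg mass_summable mass_balance by blast
  qed (simp add: mass_empty)
  then show "(\<Sum>\<^sub>\<infinity>\<xi>\<in>ext A. mass A \<xi> * (g (\<xi> i) - 1)) \<le> 0" "(\<lambda>\<xi>. mass A \<xi> * (g (\<xi> i) - 1)) summable_on ext A"
    by auto
qed

definition box :: "'v set \<Rightarrow> nat \<Rightarrow> ('v \<Rightarrow> nat) set" where
  "box A K = {\<xi> \<in> ext A. \<forall>k. \<xi> k < K}"

lemma finite_box: "finite (box A K)"
proof (rule finite_subset)
  show "box A K \<subseteq> Pi\<^sub>E UNIV (\<lambda>_. {..<K})" by (auto simp: box_def)
qed (rule finite_PiE; simp)

lemma box_sum_le: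
  assumes "i \<notin> A" "e > 0"
  shows "\<forall>\<^sub>F K in sequentially. (\<Sum>\<xi>\<in>box A K. mass A \<xi> * (g (\<xi> i) - 1)) \<le> e"
proof -
  define S where "S = (\<Sum>\<^sub>\<infinity>\<xi>\<in>ext A. mass A \<xi> * (g (\<xi> i) - 1))"
  have "((\<lambda>\<xi>. mass A \<xi> * (g (\<xi> i) - 1)) has_sum S) (ext A)"
    unfolding S_def by (rule has_sum_infsum[OF mass_mean_speed(2)[OF assms(1)]])
  then have "\<forall>\<^sub>F X in finite_subsets_at_top (ext A). dist (\<Sum>\<xi>\<in>X. mass A \<xi> * (g (\<xi> i) - 1)) S < e"
    unfolding has_sum_def using assms(2) by (rule tendstoD)
  then obtain X where X: "finite X \<and> X \<subseteq> ext A \<and>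
    (\<forall>Y. finite Y \<and> X \<subseteq> Y \<and> Y \<subseteq> ext A \<longrightarrow> dist (\<Sum>\<xi>\<in>Y. mass A \<xi> * (g (\<xi> i) - 1)) S < e)"
    unfolding eventually_finite_subsets_at_top by (elim exE)
  show ?thesis
    unfolding eventually_sequentially
  proof (intro exI allI impI)
    fix K assume K: "Suc (\<Sum>\<xi>\<in>X. particles \<xi>) \<le> K"
    have "X \<subseteq> box A K"
    proof
      fix \<xi> assume \<xi>: "\<xi> \<in> X"
      have "\<xi> k < K" for k
        using particles_ge[of \<xi> k] member_le_sum[of \<xi> X particles] \<xi> X K by simp
      then show "\<xi> \<in> box A K" using X \<xi> by (auto simp: box_def)
    qed
    then have "dist (\<Sum>\<xi>\<in>box A K. mass A \<xi> * (g (\<xi> i) - 1)) S < e"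
      using X finite_box by (simp add: box_def)
    moreover have "S \<le> 0" unfolding S_def by (rule mass_mean_speed(1)[OF assms(1)])
    ultimately show "(\<Sum>\<xi>\<in>box A K. mass A \<xi> * (g (\<xi> i) - 1)) \<le> e" by (simp add: dist_real_def)
  qed
qed

text \<open>The mass of \<open>{\<eta>. K \<le> \<eta> l}\<close> decreases with \<open>K\<close> to
  a limit, the mass at infinity. Layers that start far out are therefore small, uniformly in their
  upper end.\<close>

lemma layer_mass_small:
  assumes "e > 0"
  shows "\<forall>\<^sub>F K0 in sequentially. \<forall>K. \<Lambda> (indicator {\<eta>. K0 \<le> \<eta> l \<and> \<eta> l < K}) \<le> e"
proof -
  define q where "q K = \<Lambda> (indicator {\<eta>. K \<le> \<eta> l})" for K
  have dec: "decseq q"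
    unfolding decseq_def q_def by (auto intro!: mean_mono bounded_fun_intros simp: indicator_def)
  have q0: "\<forall>K. 0 \<le> q K" unfolding q_def by (intro allI mean_nonneg) (auto intro: bounded_fun_intros)
  obtain L where "q \<longlonglongrightarrow> L" "\<forall>K. L \<le> q K" by (rule decseq_convergent[OF dec q0])
  then have L: "q \<longlonglongrightarrow> L" "\<And>K. L \<le> q K" by auto
  have "\<forall>\<^sub>F K0 in sequentially. q K0 < L + e" using order_tendstoD(2)[OF L(1), of "L + e"] assms by simp
  then show ?thesis
  proof eventually_elim
    case (elim K0)
    show ?case
    proof
      fix K
      have "\<Lambda> (indicator {\<eta>. K0 \<le> \<eta> l \<and> \<eta> l < K}) \<le> \<Lambda> (\<lambda>\<eta>. indicator {\<eta>. K0 \<le> \<eta> l} \<eta> - indicator {\<eta>. max K K0 \<le> \<eta> l} \<eta>)"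
        by (intro mean_mono bounded_fun_intros) (auto simp: indicator_def)
      also have "\<dots> = q K0 - q (max K K0)" unfolding q_def by (rule mean_diff; rule bounded_fun_intros)
      also have "\<dots> \<le> e" using elim L(2)[of "max K K0"] by simp
      finally show "\<Lambda> (indicator {\<eta>. K0 \<le> \<eta> l \<and> \<eta> l < K}) \<le> e" .
    qed
  qed
qed

lemma g_bounded: "bounded_fun (\<lambda>\<eta>. g (\<eta> i))"
  by (rule bounded_funI[of _ gmax]) (simp add: g_nonneg g_le_gmax)

text \<open>Two thresholds separate finite from infinite. If a coordinate lies between them, the
  crude bound \<open>gmax\<close> is charged to its layer. Otherwise \<eta> lies in exactly one
  stratum with remainder in the box: if \<open>i\<close> is among the large sites its speed is
  within \<open>e\<close> of 1, and if not, the sum over strata contains precisely its excess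
  speed.\<close>

lemma speed_decomposition:
  assumes K: "K0 \<le> K" and e: "e \<ge> 0" "\<And>n. n \<ge> K0 \<Longrightarrow> \<bar>g n - 1\<bar> \<le> e"
  shows "g (\<eta> i) - 1 \<le> gmax * (\<Sum>l\<in>UNIV. indicator {\<eta>. K0 \<le> \<eta> l \<and> \<eta> l < K} \<eta>) + e +
    (\<Sum>A\<in>{A. i \<notin> A}. \<Sum>\<xi>\<in>box A K0. (g (\<xi> i) - 1) * indicator (stratum A \<xi> K) \<eta>)" (is "_ \<le> ?layers + e + ?strata")
proof (cases "\<exists>l. K0 \<le> \<eta> l \<and> \<eta> l < K")
  case True
  then obtain l where l: "K0 \<le> \<eta> l" "\<eta> l < K" by blast
  have "indicator (stratum A \<xi> K) \<eta> = (0::real)" if "\<xi> \<in> box A K0" for A \<xi>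
  proof -
    have "\<xi> l < K0" using that by (simp add: box_def)
    then have "\<not> (if l \<in> A then K \<le> \<eta> l else \<eta> l = \<xi> l)" using l by auto
    then have "\<eta> \<notin> stratum A \<xi> K" unfolding stratum_def by blast
    then show ?thesis by simp
  qed
  then have "?strata = 0" by (intro sum.neutral ballI) simp
  moreover have "?layers \<ge> gmax * 1"
  proof (rule mult_left_mono)
    have "indicator {\<eta>. K0 \<le> \<eta> l \<and> \<eta> l < K} \<eta> \<le> (\<Sum>l\<in>UNIV. indicator {\<eta>. K0 \<le> \<eta> l \<and> \<eta> l < K} \<eta> :: real)"
      by (rule member_le_sum) auto
    then show "1 \<le> (\<Sum>l\<in>UNIV. indicator {\<eta>. K0 \<le> \<eta> l \<and> \<eta> l < K} \<eta> :: real)" using l by simp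
  qed (use gmax_ge_1 in simp)
  ultimately show ?thesis using g_le_gmax[of "\<eta> i"] e(1) by simp
next
  case False
  define A0 where "A0 = {l. K \<le> \<eta> l}"
  define \<xi>0 where "\<xi>0 l = (if l \<in> A0 then 0 else \<eta> l)" for l
  have small: "\<eta> l < K0" if "l \<notin> A0" for l using False that by (auto simp: A0_def not_le)
  have iff: "\<eta> \<in> stratum A \<xi> K \<longleftrightarrow> A = A0 \<and> \<xi> = \<xi>0" if "\<xi> \<in> box A K0" for A \<xi>
  proof
    assume \<eta>: "\<eta> \<in> stratum A \<xi> K"
    then have s: "if k \<in> A then K \<le> \<eta> k else \<eta> k = \<xi> k" for k by (simp add: stratum_def)
    have "\<xi> k < K0" for k using that by (simp add: box_def)
    then have "k \<in> A \<longleftrightarrow> k \<in> A0" for k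
      using s[of k] K less_le_trans[of "\<xi> k" K0 K] by (auto simp: A0_def split: if_splits)
    then have "A = A0" by blast
    moreover have "\<xi> k = \<xi>0 k" for k using s[of k] that \<open>A = A0\<close> by (auto simp: \<xi>0_def box_def ext_def split: if_splits)
    ultimately show "A = A0 \<and> \<xi> = \<xi>0" by blast
  next
    assume "A = A0 \<and> \<xi> = \<xi>0"
    then show "\<eta> \<in> stratum A \<xi> K" by (auto simp: stratum_def \<xi>0_def A0_def)
  qed
  have layers: "?layers \<ge> 0" using gmax_ge_1 by (intro mult_nonneg_nonneg sum_nonneg) auto
  have "?strata = (\<Sum>A\<in>{A. i \<notin> A}. \<Sum>\<xi>\<in>box A K0. if A = A0 \<and> \<xi> = \<xi>0 then g (\<xi> i) - 1 else 0)"
    by (intro sum.cong refl) (simp add: indicator_def iff)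
  also have "\<dots> = (\<Sum>A\<in>{A. i \<notin> A}. if A = A0 then (\<Sum>\<xi>\<in>box A0 K0. if \<xi> = \<xi>0 then g (\<xi> i) - 1 else 0) else 0)"
    by (intro sum.cong refl) auto
  also have "\<dots> = (if i \<notin> A0 then (\<Sum>\<xi>\<in>box A0 K0. if \<xi> = \<xi>0 then g (\<xi> i) - 1 else 0) else 0)"
    by (simp add: sum.delta')
  finally have strata: "?strata = (if i \<notin> A0 then (\<Sum>\<xi>\<in>box A0 K0. if \<xi> = \<xi>0 then g (\<xi> i) - 1 else 0) else 0)" .
  show ?thesis
  proof (cases "i \<in> A0")
    case True
    then have "\<bar>g (\<eta> i) - 1\<bar> \<le> e" using e(2)[of "\<eta> i"] K by (simp add: A0_def)
    then show ?thesis using strata True layers by simp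
  next
    case False
    have K0: "K0 > 0" using small[OF False] by simp
    have "\<xi>0 \<in> box A0 K0" using small K0 by (auto simp: box_def ext_def \<xi>0_def)
    then have "?strata = g (\<eta> i) - 1" using strata False by (simp add: sum.delta' finite_box \<xi>0_def)
    then show ?thesis using layers e(1) by simp
  qed
qed

theorem mean_speed_le_1: "\<Lambda> (\<lambda>\<eta>. g (\<eta> i)) \<le> 1"
proof (rule field_le_epsilon)
  fix \<epsilon> :: real assume \<epsilon>: "\<epsilon> > 0"
  \<comment> \<open>Counts the errors: a layer for each site, weighted by \<open>gmax\<close>, the
    error of \<open>g\<close> near infinity, and one for each set \<open>A\<close> that avoids
    \<open>i\<close>.\<close>
  define c where "c = gmax * real CARD('v) + 1 + real (card {A. i \<notin> A})"
  have c: "c > 0" unfolding c_def using gmax_ge_1 by (intro add_pos_nonneg) auto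
  define e where "e = \<epsilon> / c"
  have e: "e > 0" unfolding e_def using \<epsilon> c by simp
  have "\<forall>\<^sub>F K0 in sequentially. (\<forall>l. \<forall>K. \<Lambda> (indicator {\<eta>. K0 \<le> \<eta> l \<and> \<eta> l < K}) \<le> e) \<and>
      (\<forall>A\<in>{A. i \<notin> A}. (\<Sum>\<xi>\<in>box A K0. mass A \<xi> * (g (\<xi> i) - 1)) \<le> e) \<and> (\<forall>n\<ge>K0. \<bar>g n - 1\<bar> * 1 \<le> e)"
    using e by (intro eventually_conj eventually_all_finite eventually_ball_finite ballI layer_mass_small box_sum_le g_large) auto
  from eventually_happens'[OF sequentially_bot this]
  obtain K0 where K0: "\<And>l K. \<Lambda> (indicator {\<eta>. K0 \<le> \<eta> l \<and> \<eta> l < K}) \<le> e"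
      "\<And>A. i \<notin> A \<Longrightarrow> (\<Sum>\<xi>\<in>box A K0. mass A \<xi> * (g (\<xi> i) - 1)) \<le> e" "\<And>n. n \<ge> K0 \<Longrightarrow> \<bar>g n - 1\<bar> \<le> e"
    by auto
  have bound: "\<Lambda> (\<lambda>\<eta>. g (\<eta> i)) - 1 \<le> gmax * (real CARD('v) * e) + e + (\<Sum>A\<in>{A. i \<notin> A}. \<Sum>\<xi>\<in>box A K0. (g (\<xi> i) - 1) * pmass A \<xi> K)"
    if "K0 \<le> K" for K
  proof -
    note bi = bounded_fun_intros bounded_fun_sum g_bounded
    have "\<Lambda> (\<lambda>\<eta>. g (\<eta> i)) - 1 = \<Lambda> (\<lambda>\<eta>. g (\<eta> i) - 1)" using mean_diff[of "\<lambda>\<eta>. g (\<eta> i)" "\<lambda>_. 1"] mean_one by (simp add: bi)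
    also have "\<dots> \<le> \<Lambda> (\<lambda>\<eta>. (gmax * (\<Sum>l\<in>UNIV. indicator {\<eta>. K0 \<le> \<eta> l \<and> \<eta> l < K} \<eta>) + e) +
       (\<Sum>A\<in>{A. i \<notin> A}. \<Sum>\<xi>\<in>box A K0. (g (\<xi> i) - 1) * indicator (stratum A \<xi> K) \<eta>))"
      by (intro mean_mono bi finite_box speed_decomposition that) (use e K0(3) in auto)
    also have "\<dots> = (gmax * (\<Sum>l\<in>UNIV. \<Lambda> (indicator {\<eta>. K0 \<le> \<eta> l \<and> \<eta> l < K})) + e) +
       (\<Sum>A\<in>{A. i \<notin> A}. \<Sum>\<xi>\<in>box A K0. (g (\<xi> i) - 1) * pmass A \<xi> K)"
      unfolding pmass_def by (simp add: mean_add mean_sum mean_cmult mean_const bi finite_box del: sum_mult_indicator)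
    also have "(\<Sum>l\<in>UNIV. \<Lambda> (indicator {\<eta>. K0 \<le> \<eta> l \<and> \<eta> l < K})) \<le> (\<Sum>l\<in>(UNIV::'v set). e)"
      by (intro sum_mono K0(1))
    finally show ?thesis using gmax_ge_1 by simp
  qed
  \<comment> \<open>\<open>K0\<close> stays fixed while \<open>K\<close> tends to infinity; this
    replaces the masses at level \<open>K\<close> by their limits, to which the network bound
    applies.\<close>
  have "(\<lambda>K. gmax * (real CARD('v) * e) + e + (\<Sum>A\<in>{A. i \<notin> A}. \<Sum>\<xi>\<in>box A K0. (g (\<xi> i) - 1) * pmass A \<xi> K))
      \<longlonglongrightarrow> gmax * (real CARD('v) * e) + e + (\<Sum>A\<in>{A. i \<notin> A}. \<Sum>\<xi>\<in>box A K0. (g (\<xi> i) - 1) * mass A \<xi>)"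
    by (intro tendsto_intros pmass_tendsto)
  then have "\<Lambda> (\<lambda>\<eta>. g (\<eta> i)) - 1 \<le> gmax * (real CARD('v) * e) + e + (\<Sum>A\<in>{A. i \<notin> A}. \<Sum>\<xi>\<in>box A K0. (g (\<xi> i) - 1) * mass A \<xi>)"
    by (rule LIMSEQ_le_const) (use bound in blast)
  also have "(\<Sum>A\<in>{A. i \<notin> A}. \<Sum>\<xi>\<in>box A K0. (g (\<xi> i) - 1) * mass A \<xi>) \<le> (\<Sum>A\<in>{A. i \<notin> A}. e)"
    by (intro sum_mono) (use K0(2) in \<open>simp add: mult.commute\<close>)
  also have "gmax * (real CARD('v) * e) + e + (\<Sum>A\<in>{A. i \<notin> A}. e) = c * e" by (simp add: c_def algebra_simps)
  also have "\<dots> = \<epsilon>" using c by (simp add: e_def)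
  finally show "\<Lambda> (\<lambda>\<eta>. g (\<eta> i)) \<le> 1 + \<epsilon>" by simp
qed

end

section \<open>Time means and their cluster points\<close>

context zero_range begin

text \<open>The value 0 at unbounded functions makes a time mean a point in a product of compact
  intervals indexed by all functions, ready for Tychonoff's theorem.\<close>

definition time_mean :: "(real \<Rightarrow> ('v \<Rightarrow> nat) \<Rightarrow> ('v \<Rightarrow> nat) pmf) \<Rightarrow> ('v \<Rightarrow> nat) \<Rightarrow> real \<Rightarrow> (('v \<Rightarrow> nat) \<Rightarrow> real) \<Rightarrow> real" where
  "time_mean P x \<tau> f = (if bounded_fun f then integral {0..\<tau>} (\<lambda>s. measure_pmf.expectation (P s x) f) / \<tau> else 0)"

lemma zrp_semigroupI:
  "markov_semigroup P \<Longrightarrow> has_generator P (zrp_generator r g) \<Longrightarrow> zrp_semigroup r g P"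
  by unfold_locales

end

context zrp_semigroup begin

lemma E_integrable: "bounded_fun f \<Longrightarrow> (\<lambda>s. E s x f) integrable_on {0..\<tau>}"
  by (rule integrable_continuous_interval[OF E_continuous_on]) auto

lemma time_mean_add:
  "bounded_fun f \<Longrightarrow> bounded_fun h \<Longrightarrow> time_mean P x \<tau> (\<lambda>y. f y + h y) = time_mean P x \<tau> f + time_mean P x \<tau> h"
  by (simp add: time_mean_def bounded_fun_intros expectation_add Henstock_Kurzweil_Integration.integral_add E_integrable add_divide_distrib)

lemma time_mean_cmult:
  "bounded_fun f \<Longrightarrow> time_mean P x \<tau> (\<lambda>y. c * f y) = c * time_mean P x \<tau> f"
  by (simp add: time_mean_def bounded_fun_intros)

lemma time_mean_const:
  assumes "\<tau> > 0" "\<And>y. particles y = particles x \<Longrightarrow> f y = c" "bounded_fun f"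
  shows "time_mean P x \<tau> f = c"
proof -
  have "E s x f = c" if "s \<in> {0..\<tau>}" for s
    using E_cong_particles[of s x f "\<lambda>_. c"] assms(2) that by simp
  then have "integral {0..\<tau>} (\<lambda>s. E s x f) = integral {0..\<tau>} (\<lambda>s. c)" by (intro Henstock_Kurzweil_Integration.integral_cong)
  then show ?thesis using assms by (simp add: time_mean_def)
qed

lemma time_mean_mono:
  assumes "\<tau> > 0" "bounded_fun f" "bounded_fun h" "\<And>y. particles y = particles x \<Longrightarrow> f y \<le> h y"
  shows "time_mean P x \<tau> f \<le> time_mean P x \<tau> h"
proof -
  have "integral {0..\<tau>} (\<lambda>s. E s x f) \<le> integral {0..\<tau>} (\<lambda>s. E s x h)"
    using assms by (intro integral_le E_integrable E_le_particles) auto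
  then show ?thesis using assms by (simp add: time_mean_def divide_right_mono)
qed

lemma time_mean_abs_le:
  assumes "\<tau> > 0" "\<And>y. \<bar>f y\<bar> \<le> B" shows "\<bar>time_mean P x \<tau> f\<bar> \<le> B"
proof -
  have f: "bounded_fun f" using assms(2) by (rule bounded_funI)
  have "time_mean P x \<tau> f \<le> time_mean P x \<tau> (\<lambda>_. B)"
    using assms by (intro time_mean_mono f bounded_fun_intros) (auto simp: abs_le_iff)
  moreover have "time_mean P x \<tau> (\<lambda>_. -B) \<le> time_mean P x \<tau> f"
    using assms by (intro time_mean_mono f bounded_fun_intros) (auto simp: abs_le_iff minus_le_iff)
  ultimately show ?thesis using assms(1) by (simp add: time_mean_const bounded_fun_intros)
qed

lemma time_mean_generator:
  assumes "\<tau> > 0" "bounded_fun f"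
  shows "time_mean P x \<tau> (L f) = (E \<tau> x f - f x) / \<tau>"
  using integral_unique[OF Dynkin[OF assms(2), of \<tau> x]] assms generator_bounded[OF assms(2)] by (simp add: time_mean_def)

end

context zero_range begin

text \<open>Otherwise a cluster point of the time means would be an invariant mean of speed larger than 1.\<close>

lemma speed_mean_le:
  assumes "\<epsilon> > 0"
  shows "\<exists>n. \<forall>P x \<tau> i. markov_semigroup P \<and> has_generator P (zrp_generator r g) \<and> particles x \<ge> n \<and> \<tau> \<ge> real n
     \<longrightarrow> time_mean P x \<tau> (\<lambda>\<eta>. g (\<eta> i)) \<le> 1 + \<epsilon>"
proof (rule ccontr)
  assume "\<not> ?thesis"
  then have "\<forall>n. \<exists>P x \<tau> i. markov_semigroup P \<and> has_generator P (zrp_generator r g) \<and> particles x \<ge> n \<and> \<tau> \<ge> real n \<and>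
     time_mean P x \<tau> (\<lambda>\<eta>. g (\<eta> i)) > 1 + \<epsilon>" by (auto simp: not_le)
  then obtain P x \<tau> I where seq: "\<And>n. markov_semigroup (P n)" "\<And>n. has_generator (P n) (zrp_generator r g)"
      "\<And>n. particles (x n) \<ge> n" "\<And>n. \<tau> n \<ge> real n"
      "\<And>n. time_mean (P n) (x n) (\<tau> n) (\<lambda>\<eta>. g (\<eta> (I n))) > 1 + \<epsilon>"
    by metis
  \<comment> \<open>There are finitely many sites, so one of them is the offending site infinitely
    often. The filter \<open>F\<close> runs along these indices and drops index 0, where the time
    may be 0.\<close>
  have "\<exists>i. \<exists>\<^sub>F n in sequentially. I n = i"
  proof (rule ccontr)
    assume "\<nexists>i. \<exists>\<^sub>F n in sequentially. I n = i"
    then have "\<forall>\<^sub>F n in sequentially. \<forall>i. I n \<noteq> i"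
      by (intro eventually_all_finite) (simp add: frequently_def)
    then show False by (simp add: eventually_sequentially)
  qed
  then obtain i where i: "\<exists>\<^sub>F n in sequentially. I n = i" by blast
  define F where "F = inf sequentially (principal {n. I n = i \<and> n > 0})"
  have F_bot: "F \<noteq> bot"
  proof
    assume "F = bot"
    then have "\<forall>\<^sub>F n in sequentially. \<not> (I n = i \<and> n > 0)"
      by (simp add: F_def trivial_limit_def eventually_inf_principal)
    moreover have "\<forall>\<^sub>F n in sequentially. n > (0::nat)" by (rule eventually_gt_at_top)
    ultimately have "\<forall>\<^sub>F n in sequentially. I n \<noteq> i" by eventually_elim blast
    then show False using i by (simp add: frequently_def)
  qed
  have F_le: "F \<le> sequentially" by (simp add: F_def)
  have F_ev: "\<forall>\<^sub>F n in F. I n = i \<and> n > 0" by (simp add: F_def eventually_inf_principal)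
  define T where "T n = time_mean (P n) (x n) (\<tau> n)" for n
  have sg: "zrp_semigroup r g (P n)" for n by (rule zrp_semigroupI[OF seq(1,2)])
  have \<tau>: "\<tau> n > 0" if "n > 0" for n using seq(4)[of n] that by linarith
  define B where "B f = (if bounded_fun f then SUP y. \<bar>f y\<bar> else 0)" for f :: "('v \<Rightarrow> nat) \<Rightarrow> real"
  have T_B: "T n f \<in> {- B f..B f}" if "n > 0" for n f
  proof (cases "bounded_fun f")
    case True
    then obtain C where "\<And>y. \<bar>f y\<bar> \<le> C" using bounded_funE by blast
    then have "bdd_above (range (\<lambda>y. \<bar>f y\<bar>))" by (auto simp: bdd_above_def)
    then have "\<bar>f y\<bar> \<le> B f" for y using True unfolding B_def by (auto intro: cSUP_upper)
    then have "\<bar>T n f\<bar> \<le> B f" unfolding T_def by (intro zrp_semigroup.time_mean_abs_le[OF sg] \<tau> that)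
    then show ?thesis by (auto simp: abs_le_iff)
  qed (simp add: T_def time_mean_def B_def)
  define K where "K = Pi\<^sub>E UNIV (\<lambda>f. {- B f..B f})"
  have "compactin (product_topology (\<lambda>_. euclidean) UNIV) K"
    unfolding K_def compactin_PiE by simp
  then have "compact K" by (simp add: euclidean_product_topology)
  moreover have "filtermap T F \<noteq> bot" using F_bot by (simp add: filtermap_bot_iff)
  moreover have "eventually (\<lambda>\<Lambda>. \<Lambda> \<in> K) (filtermap T F)"
    unfolding eventually_filtermap
    using F_ev by eventually_elim (use T_B in \<open>auto simp: K_def\<close>)
  ultimately obtain \<Lambda> where \<Lambda>: "inf (nhds \<Lambda>) (filtermap T F) \<noteq> bot"
    unfolding compact_filter by blast
  \<comment> \<open>Compactness of the product provides a cluster point but no convergent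
    subsequence; the filter \<open>H\<close>, finer than the image of \<open>F\<close>, takes its
    place.\<close>
  define H where "H = inf (nhds \<Lambda>) (filtermap T F)"
  have ev: "((\<lambda>\<Phi>. \<Phi> f) \<longlongrightarrow> \<Lambda> f) H" for f
  proof -
    have "continuous_on UNIV (\<lambda>\<Phi> :: (('v \<Rightarrow> nat) \<Rightarrow> real) \<Rightarrow> real. \<Phi> f)"
      by (rule continuous_on_product_coordinates)
    from open_vimage[OF _ this] have "((\<lambda>\<Phi>. \<Phi> f) \<longlongrightarrow> \<Lambda> f) (nhds \<Lambda>)"
      unfolding tendsto_def eventually_nhds by (metis vimage_eq)
    then show ?thesis by (rule filterlim_mono) (auto simp: H_def)
  qed
  have H_le: "H \<le> filtermap T F" by (simp add: H_def)
  have lim: "\<Lambda> f = c" if "((\<lambda>n. T n f) \<longlongrightarrow> c) F" for f c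
  proof -
    have "((\<lambda>\<Phi>. \<Phi> f) \<longlongrightarrow> c) (filtermap T F)" using that by (simp add: filterlim_filtermap)
    then have "((\<lambda>\<Phi>. \<Phi> f) \<longlongrightarrow> c) H" using H_le by (rule filterlim_mono[OF _ order_refl])
    with ev show ?thesis using \<Lambda> tendsto_unique H_def by metis
  qed
  have lim_eq: "\<Lambda> f = c" if "\<And>n. n > 0 \<Longrightarrow> T n f = c" for f c
    by (rule lim, rule tendsto_eventually) (use F_ev that in \<open>auto elim: eventually_mono\<close>)
  have lim_ge: "c \<le> \<Lambda> f" if "\<And>n. n > 0 \<Longrightarrow> I n = i \<Longrightarrow> c \<le> T n f" for f c
  proof (rule tendsto_lowerbound[OF ev])
    have "\<forall>\<^sub>F \<Phi> in filtermap T F. c \<le> \<Phi> f"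
      unfolding eventually_filtermap using F_ev by eventually_elim (use that in blast)
    then show "\<forall>\<^sub>F \<Phi> in H. c \<le> \<Phi> f" using H_le by (simp add: filter_leD)
  qed (use \<Lambda> H_def in simp)
  have lim_rel: "R (\<Lambda> f) (\<Lambda> h) (\<Lambda> k)" if "\<And>n. n > 0 \<Longrightarrow> T n k = a * T n f + b * T n h" "\<And>p q. R p q (a * p + b * q)" for R f h k a b
  proof -
    have "\<forall>\<^sub>F \<Phi> in filtermap T F. \<Phi> k = a * \<Phi> f + b * \<Phi> h"
      unfolding eventually_filtermap using F_ev by eventually_elim (use that(1) in blast)
    then have e: "\<forall>\<^sub>F \<Phi> in H. \<Phi> k = a * \<Phi> f + b * \<Phi> h" using H_le by (simp add: filter_leD)
    have "((\<lambda>\<Phi>. a * \<Phi> f + b * \<Phi> h) \<longlongrightarrow> a * \<Lambda> f + b * \<Lambda> h) H" by (intro tendsto_intros ev)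
    then have "((\<lambda>\<Phi>. \<Phi> k) \<longlongrightarrow> a * \<Lambda> f + b * \<Lambda> h) H" using e by (subst tendsto_cong[of _ "\<lambda>\<Phi>. a * \<Phi> f + b * \<Phi> h"])
    then have "\<Lambda> k = a * \<Lambda> f + b * \<Lambda> h" using ev \<Lambda> tendsto_unique H_def by metis
    then show ?thesis using that(2) by simp
  qed
  have "invariant_mean r g \<Lambda>"
  proof unfold_locales
    fix f h :: "('v \<Rightarrow> nat) \<Rightarrow> real" assume f: "bounded_fun f"
    show "\<Lambda> (\<lambda>x. f x + h x) = \<Lambda> f + \<Lambda> h" if h: "bounded_fun h"
      by (rule lim_rel[where R="\<lambda>p q s. s = p + q" and a=1 and b=1])
        (simp_all add: T_def zrp_semigroup.time_mean_add[OF sg f h])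
    show "\<Lambda> (\<lambda>x. c * f x) = c * \<Lambda> f" for c
      by (rule lim_rel[where R="\<lambda>p q s. s = c * p" and a=c and b=0])
        (simp_all add: T_def zrp_semigroup.time_mean_cmult[OF sg f])
    show "0 \<le> \<Lambda> f" if "\<And>x. 0 \<le> f x"
    proof (rule lim_ge)
      fix n :: nat assume n: "n > 0"
      have "time_mean (P n) (x n) (\<tau> n) (\<lambda>_. 0) \<le> T n f"
        unfolding T_def by (intro zrp_semigroup.time_mean_mono[OF sg] \<tau>[OF n] f bounded_fun_intros that)
      then show "0 \<le> T n f" by (simp add: zrp_semigroup.time_mean_const[OF sg \<tau>[OF n]] bounded_fun_intros)
    qed
    show "\<Lambda> (zrp_generator r g f) = 0"
    proof (rule lim)
      obtain C where C: "C > 0" "\<And>y. \<bar>f y\<bar> \<le> C" using bounded_funE[OF f] by blast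
      \<comment> \<open>By Dynkin's formula the time mean of a generator is a difference of two
        bounded terms divided by \<open>\<tau> n\<close>, which is at least
        \<open>n\<close>.\<close>
      have bnd: "\<bar>T n (zrp_generator r g f)\<bar> \<le> 2 * C / real n" if n: "n > 0" for n
      proof -
        have "\<bar>measure_pmf.expectation (P n (\<tau> n) (x n)) f - f (x n)\<bar> \<le> C + C"
          by (rule order_trans[OF abs_triangle_ineq4 add_mono[OF expectation_abs_le[OF C(2)] C(2)]])
        then have "\<bar>T n (zrp_generator r g f)\<bar> \<le> (C + C) / \<tau> n"
          unfolding T_def zrp_semigroup.time_mean_generator[OF sg \<tau>[OF n] f]
          using \<tau>[OF n] by (simp add: divide_right_mono)
        also have "\<dots> \<le> (C + C) / real n"
          using seq(4)[of n] n C by (intro divide_left_mono mult_pos_pos) auto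
        finally show ?thesis by simp
      qed
      have "((\<lambda>n. 2 * C / real n) \<longlongrightarrow> 0) sequentially" by (rule lim_const_over_n)
      then have z: "((\<lambda>n. 2 * C / real n) \<longlongrightarrow> 0) F" using F_le by (rule filterlim_mono[OF _ order_refl])
      show "((\<lambda>n. T n (zrp_generator r g f)) \<longlongrightarrow> 0) F"
        by (rule Lim_null_comparison[OF _ z]) (use F_ev bnd in \<open>auto elim!: eventually_mono\<close>)
    qed
  next
    show "\<Lambda> (\<lambda>_. 1) = 1"
      by (rule lim_eq) (simp add: T_def zrp_semigroup.time_mean_const[OF sg \<tau>] bounded_fun_intros)
    show "\<Lambda> (indicator {y. particles y \<le> k}) = 0" for k
    proof (rule lim, rule tendsto_eventually)
      have "\<forall>\<^sub>F n in F. n > k" using F_le eventually_gt_at_top[of k] by (rule filter_leD)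
      then show "\<forall>\<^sub>F n in F. T n (indicator {y. particles y \<le> k}) = 0"
      proof eventually_elim
        case (elim n)
        have "k < particles (x n)" using seq(3)[of n] elim by simp
        then show ?case
          unfolding T_def using elim
          by (intro zrp_semigroup.time_mean_const[OF sg \<tau>]) (auto simp: bounded_fun_intros)
      qed
    qed
  qed
  then have "\<Lambda> (\<lambda>\<eta>. g (\<eta> i)) \<le> 1" by (rule invariant_mean.mean_speed_le_1)
  moreover have "1 + \<epsilon> \<le> \<Lambda> (\<lambda>\<eta>. g (\<eta> i))"
    by (rule lim_ge) (use seq(5) in \<open>auto simp: T_def less_imp_le\<close>)
  ultimately show False using assms by simp
qed

end

section \<open>Stability of the fluid equations\<close>

context irreducible_walk begin

definition rmax :: real where "rmax = (\<Sum>i\<in>UNIV. \<Sum>j\<in>UNIV. r i j)"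

lemma rmax_nonneg: "rmax \<ge> 0" unfolding rmax_def by (intro sum_nonneg r_nonneg)

lemma row_sum_le_rmax: "sum (r i) UNIV \<le> rmax"
  unfolding rmax_def by (rule member_le_sum) (auto intro!: sum_nonneg r_nonneg)

lemma rate_le_rmax: "r i j \<le> rmax"
  by (rule order_trans[OF member_le_sum[of j UNIV "r i"] row_sum_le_rmax]) (auto intro: r_nonneg)

lemma col_sum_le_rmax: "(\<Sum>i\<in>UNIV. r i j) \<le> rmax"
  unfolding rmax_def by (rule sum_mono) (rule member_le_sum; auto intro: r_nonneg)

lemma adj_abs_le:
  assumes "\<And>k. \<bar>\<phi> k\<bar> \<le> c" shows "\<bar>adj r \<phi> i\<bar> \<le> 2 * rmax * c"
proof -
  have c: "c \<ge> 0" using assms[of undefined] by linarith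
  have "\<bar>\<Sum>j\<in>UNIV. \<phi> j * r j i\<bar> \<le> (\<Sum>j\<in>UNIV. c * r j i)"
    by (rule order_trans[OF sum_abs]) (auto intro!: sum_mono mult_right_mono assms r_nonneg simp: abs_mult r_nonneg)
  also have "\<dots> = c * (\<Sum>j\<in>UNIV. r j i)" by (simp add: sum_distrib_left)
  also have "\<dots> \<le> c * rmax" using c by (intro mult_left_mono col_sum_le_rmax)
  finally have 1: "\<bar>\<Sum>j\<in>UNIV. \<phi> j * r j i\<bar> \<le> c * rmax" .
  have "\<bar>\<phi> i * sum (r i) UNIV\<bar> = \<bar>\<phi> i\<bar> * sum (r i) UNIV" by (simp add: abs_mult sum_nonneg r_nonneg)
  also have "\<dots> \<le> c * rmax" using c by (intro mult_mono assms row_sum_le_rmax) (auto intro: sum_nonneg r_nonneg)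
  finally have 2: "\<bar>\<phi> i * sum (r i) UNIV\<bar> \<le> c * rmax" .
  have "\<bar>adj r \<phi> i\<bar> \<le> c * rmax + c * rmax"
    unfolding adj_alt by (rule order_trans[OF abs_triangle_ineq4 add_mono[OF 1 2]])
  then show ?thesis by (simp add: mult.commute mult.left_commute)
qed

text \<open>\<open>w i\<close> is the expected time that the walk spends at \<open>i\<close> before
  it reaches \<open>s\<close>, summed over all starting sites other than \<open>s\<close>. It is a
  strict supersolution off \<open>s\<close>, which is what makes it the right unit for measuring an
  excess.\<close>

lemma weight_exists: "\<exists>w. w s = 0 \<and> (\<forall>i. i \<noteq> s \<longrightarrow> w i > 0 \<and> adj r w i = -1)"
proof -
  obtain w where w: "w s = 0" "\<And>k. k \<noteq> s \<Longrightarrow> adj r w k = -1"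
    using adj_solution_exists[of "{s}" "\<lambda>_. 0" "\<lambda>_. -1"] by auto
  have "-1 * w k \<le> 0" for k
  proof (rule adj_max_principle[of "{s}"])
    show "0 \<le> adj r (\<lambda>k. -1 * w k) k" if "k \<notin> {s}" for k using adj_scale[of r "-1" w k] w(2)[of k] that by simp
  qed (use w in auto)
  then have nn: "w k \<ge> 0" for k by simp
  have "w i > 0" if "i \<noteq> s" for i
  proof -
    have "(\<Sum>j\<in>UNIV. w j * r j i) \<ge> 0" by (intro sum_nonneg mult_nonneg_nonneg nn r_nonneg)
    then have "w i * sum (r i) UNIV \<ge> 1" using w(2)[OF that] by (simp add: adj_alt)
    then have "w i \<noteq> 0" by auto
    then show ?thesis using nn[of i] by simp
  qed
  then show ?thesis using w by blast
qed

definition weight :: "'v \<Rightarrow> 'v \<Rightarrow> real" where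
  "weight s = (SOME w. w s = 0 \<and> (\<forall>i. i \<noteq> s \<longrightarrow> w i > 0 \<and> adj r w i = -1))"

lemma weight: "weight s s = 0" "i \<noteq> s \<Longrightarrow> weight s i > 0" "i \<noteq> s \<Longrightarrow> adj r (weight s) i = -1"
  using someI_ex[OF weight_exists[of s]] unfolding weight_def by blast+

definition wmax :: real where "wmax = (\<Sum>s\<in>UNIV. \<Sum>i\<in>UNIV. weight s i)"

text \<open>The terms with \<open>i = s\<close> are \<open>1 / 0 = 0\<close>.\<close>

definition winv :: real where "winv = (\<Sum>s\<in>UNIV. \<Sum>i\<in>UNIV. 1 / weight s i)"

lemma weight_nonneg: "weight s i \<ge> 0"
  by (cases "i = s") (auto simp: weight less_imp_le)

lemma weight_le_wmax: "weight s i \<le> wmax"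
  unfolding wmax_def
  by (rule order_trans[OF member_le_sum[of i UNIV "weight s"] member_le_sum[of s UNIV "\<lambda>s. sum (weight s) UNIV"]])
    (auto intro!: sum_nonneg weight_nonneg)

lemma inverse_weight_le_winv: "1 / weight s i \<le> winv"
  unfolding winv_def
  by (rule order_trans[OF member_le_sum[of i UNIV "\<lambda>i. 1 / weight s i"] member_le_sum[of s UNIV "\<lambda>s. \<Sum>i\<in>UNIV. 1 / weight s i"]])
    (auto intro!: sum_nonneg divide_nonneg_nonneg weight_nonneg)

lemma wmax_nonneg: "wmax \<ge> 0" unfolding wmax_def by (intro sum_nonneg weight_nonneg)

lemma winv_nonneg: "winv \<ge> 0" unfolding winv_def by (intro sum_nonneg divide_nonneg_nonneg weight_nonneg) auto

text \<open>An approximate solution, sampled at times \<open>k \<delta>\<close>, of the fluid equations: \<open>Y\<close> is the cumulative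
  departure, which grows at rate one where \<open>x\<close> is at least \<open>\<theta>\<close>.\<close>

definition approx_fluid :: "real \<Rightarrow> real \<Rightarrow> nat \<Rightarrow> (nat \<Rightarrow> 'v \<Rightarrow> real) \<Rightarrow> (nat \<Rightarrow> 'v \<Rightarrow> real) \<Rightarrow> bool" where
  "approx_fluid \<theta> \<delta> n x Y \<longleftrightarrow>
    (\<forall>k\<le>n. \<forall>i. x k i \<ge> 0) \<and>
    (\<forall>k\<le>n. \<forall>l\<le>n. \<forall>i. \<bar>x k i - x l i - adj r (\<lambda>j. Y k j - Y l j) i\<bar> \<le> \<theta>) \<and>
    (\<forall>k<n. \<forall>i. 0 \<le> Y (Suc k) i - Y k i \<and> Y (Suc k) i - Y k i \<le> \<delta> * (1 + \<theta>) \<and>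
       (x k i \<ge> \<theta> \<longrightarrow> Y (Suc k) i - Y k i \<ge> \<delta> * (1 - \<theta>)))"

lemma approx_fluidD:
  assumes "approx_fluid \<theta> \<delta> n x Y"
  shows "k \<le> n \<Longrightarrow> x k i \<ge> 0"
    and "k \<le> n \<Longrightarrow> l \<le> n \<Longrightarrow> \<bar>x k i - x l i - adj r (\<lambda>j. Y k j - Y l j) i\<bar> \<le> \<theta>"
    and "k < n \<Longrightarrow> 0 \<le> Y (Suc k) i - Y k i"
    and "k < n \<Longrightarrow> Y (Suc k) i - Y k i \<le> \<delta> * (1 + \<theta>)"
    and "k < n \<Longrightarrow> x k i \<ge> \<theta> \<Longrightarrow> Y (Suc k) i - Y k i \<ge> \<delta> * (1 - \<theta>)"
  using assms unfolding approx_fluid_def by blast+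

lemma approx_fluid_shift:
  assumes "approx_fluid \<theta> \<delta> n x Y" "m + n' \<le> n"
  shows "approx_fluid \<theta> \<delta> n' (\<lambda>k. x (m + k)) (\<lambda>k. Y (m + k))"
  using assms unfolding approx_fluid_def by auto

text \<open>Off \<open>s\<close>, \<open>d\<close> lies below the supersolution
  \<open>D * weight s\<close> and touches it at \<open>i\<close> up to \<open>c\<close>. So at
  \<open>i\<close> it has, up to errors, no more inflow and no less outflow than the supersolution,
  whose net loss there is exactly \<open>D\<close>. The slack at \<open>i\<close> and the one at
  \<open>s\<close> cost at most \<open>rmax * c\<close> each.\<close>

lemma adj_uminus_ge:
  assumes i: "i \<noteq> s" and D: "D \<ge> 0"
    and di: "d i \<ge> D * weight s i - c" and dj: "\<And>j. j \<noteq> s \<Longrightarrow> d j \<le> D * weight s j" and ds: "d s \<le> c" and c: "c \<ge> 0"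
  shows "- adj r d i \<ge> D - 2 * rmax * c"
proof -
  have ds': "d j \<le> D * weight s j + (if j = s then c else 0)" for j
    using dj[of j] ds by (cases "j = s") (auto simp: weight)
  have "(\<Sum>j\<in>UNIV. d j * r j i) \<le> (\<Sum>j\<in>UNIV. (D * weight s j + (if j = s then c else 0)) * r j i)"
    by (intro sum_mono mult_right_mono ds' r_nonneg)
  also have "\<dots> = D * (\<Sum>j\<in>UNIV. weight s j * r j i) + c * r s i"
    by (simp add: distrib_right sum.distrib sum_distrib_left mult.assoc if_distrib[of "\<lambda>a. a * _"] cong: if_cong)
  finally have 1: "(\<Sum>j\<in>UNIV. d j * r j i) \<le> D * (\<Sum>j\<in>UNIV. weight s j * r j i) + c * r s i" .
  have 2: "d i * sum (r i) UNIV \<ge> (D * weight s i - c) * sum (r i) UNIV"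
    by (intro mult_right_mono di sum_nonneg r_nonneg)
  have 3: "(\<Sum>j\<in>UNIV. weight s j * r j i) = weight s i * sum (r i) UNIV - 1"
    using weight(3)[OF i] by (simp add: adj_alt)
  have "- adj r d i \<ge> (D * weight s i - c) * sum (r i) UNIV - (D * (weight s i * sum (r i) UNIV - 1) + c * r s i)"
    using 1 2 unfolding adj_alt 3 by linarith
  moreover have "c * sum (r i) UNIV \<le> c * rmax" "c * r s i \<le> c * rmax"
    using c by (intro mult_left_mono row_sum_le_rmax rate_le_rmax; simp)+
  ultimately show ?thesis by (simp add: algebra_simps)
qed

text \<open>Follow the site where the weighted excess of idle time is maximal backwards in time: as long as the
  excess persists, the site is occupied in the first solution, so that the excess did not arise there.\<close>

lemma departure_excess_le:
  assumes x: "approx_fluid \<theta> \<delta> n x Y" and z: "approx_fluid \<theta> \<delta> n z U"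
    and \<delta>: "0 < \<delta>" "\<delta> \<le> \<theta>" "real n * \<delta> \<le> 1"
    and s: "\<And>k. k < n \<Longrightarrow> x k s \<ge> \<theta>" "\<And>k. k < n \<Longrightarrow> z k s \<ge> \<theta>"
    and e: "\<And>i. \<bar>x 0 i - z 0 i\<bar> \<le> e" "e \<ge> 0" and \<theta>: "\<theta> \<le> 1"
    and k: "k \<le> n" and i: "i \<noteq> s"
  shows "(U k i - U 0 i) - (Y k i - Y 0 i) \<le> (e + 3 * \<theta> + 12 * rmax * \<theta> + 4 * \<theta> * winv) * weight s i"
proof -
  define d where "d k i = (U k i - U 0 i) - (Y k i - Y 0 i)" for k i
  define D0 where "D0 = e + 3 * \<theta> + 12 * rmax * \<theta> + 4 * \<theta> * winv"
  define S where "S = {..n} \<times> (- {s})"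
  define q where "q = (\<lambda>(k, i). d k i / weight s i)"
  have \<theta>0: "\<theta> > 0" using \<delta> by simp
  have nn: "rmax * \<theta> \<ge> 0" "\<theta> * winv \<ge> 0" using rmax_nonneg winv_nonneg \<theta>0 by auto
  have D0_nn: "D0 \<ge> 0" and D0_ge: "2 * \<theta> * winv \<le> D0"
    unfolding D0_def using nn e(2) \<theta>0 by (simp_all add: mult.assoc)
  have S: "finite S" "S \<noteq> {}" using i by (auto simp: S_def)
  \<comment> \<open>The largest excess in units of the weight, over all times and all sites but
    \<open>s\<close>; it is attained at time \<open>m\<close> and site \<open>a\<close>.\<close>
  define D where "D = Max (q ` S)"
  have "D \<in> q ` S" unfolding D_def using S by (intro Max_in) auto
  then obtain m a where ma: "m \<le> n" "a \<noteq> s" "D = d m a / weight s a" by (auto simp: S_def q_def)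
  have le_D: "d k j \<le> D * weight s j" if "k \<le> n" "j \<noteq> s" for k j
  proof -
    have "q (k, j) \<le> D" unfolding D_def using S that by (intro Max_ge) (auto simp: S_def)
    then show ?thesis using weight(2)[OF that(2)] by (simp add: q_def field_simps)
  qed
  have D_eq: "d m a = D * weight s a" using ma weight(2)[OF ma(2)] by simp
  have step_up: "d (Suc l) j - d l j \<le> 2 * \<delta>" if "l < n" for l j
  proof -
    have "d (Suc l) j - d l j \<le> \<delta> * (1 + \<theta>)"
      using approx_fluidD(4)[OF z that, of j] approx_fluidD(3)[OF x that, of j] by (simp add: d_def)
    also have "\<dots> \<le> \<delta> * 2" using \<delta> \<theta> by (intro mult_left_mono) auto
    finally show ?thesis by simp
  qed
  have busy_step: "d (Suc l) j - d l j \<le> 2 * \<delta> * \<theta>" if "l < n" "x l j \<ge> \<theta>" for l j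
    using approx_fluidD(4)[OF z that(1), of j] approx_fluidD(5)[OF x that(1,2)] by (simp add: d_def algebra_simps)
  \<comment> \<open>The first solution is busy at \<open>s\<close> throughout, so the excess at
    \<open>s\<close> only accumulates the tolerance.\<close>
  have ds: "d l s \<le> 2 * \<delta> * \<theta> * real l" if "l \<le> n" for l
    using that
  proof (induction l)
    case (Suc l)
    then show ?case using busy_step[of l s] s(1)[of l] by (simp add: algebra_simps)
  qed (simp add: d_def)
  have nd: "\<delta> * real l \<le> 1" if "l \<le> n" for l
  proof -
    have "\<delta> * real l \<le> \<delta> * real n" using that \<delta> by (intro mult_left_mono) auto
    then show ?thesis using \<delta>(3) by (simp add: mult.commute)
  qed
  have nd2: "2 * \<delta> * \<theta> * real l \<le> 2 * \<theta>" if "l \<le> n" for l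
  proof -
    have "2 * \<theta> * (\<delta> * real l) \<le> 2 * \<theta> * 1" using nd[OF that] \<theta>0 by (intro mult_left_mono) auto
    then show ?thesis by (simp add: algebra_simps)
  qed
  have "D \<le> D0"
  proof (rule ccontr)
    assume gt: "\<not> D \<le> D0"
    then have Dpos: "D \<ge> 0" using D0_nn by simp
    \<comment> \<open>Induction backwards from \<open>m\<close>. A nearly maximal excess at
      \<open>a\<close> makes \<open>- adj r (d l) a\<close> almost \<open>D\<close>, which forces
      \<open>x l a \<ge> \<theta>\<close>. The first solution is then busy, and the step from
      \<open>l\<close> to \<open>Suc l\<close> raised the excess by at most
      \<open>2 * \<delta> * \<theta>\<close>.\<close>
    have persist: "d l a \<ge> D * weight s a - 2 * \<delta> * \<theta> * real (m - l)" if "l \<le> m" for l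
      using that
    proof (induction "m - l" arbitrary: l)
      case 0
      then have "l = m" by simp
      then show ?case using D_eq by simp
    next
      case (Suc p)
      then have l: "l < m" "p = m - Suc l" by auto
      then have IH: "d (Suc l) a \<ge> D * weight s a - 2 * \<delta> * \<theta> * real (m - Suc l)" by (intro Suc.hyps(1)) (use l in auto)
      have ln: "l < n" using l ma by simp
      \<comment> \<open>\<open>2 * \<theta>\<close> for the tolerance accumulated after
        \<open>Suc l\<close>, and \<open>2 * \<delta> \<le> 2 * \<theta>\<close> for the present
        step, which is not yet known to be a busy one.\<close>
      define c where "c = 4 * \<theta>"
      have "2 * \<delta> * \<theta> * real (m - Suc l) \<le> 2 * \<theta>" by (rule nd2) (use ma in simp)
      then have da: "d l a \<ge> D * weight s a - c" using IH step_up[OF ln, of a] \<delta>(2) by (simp add: c_def)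
      have dsl: "d l s \<le> c" using ds[of l] nd2[of l] ln \<theta>0 unfolding c_def by linarith
      have adj: "- adj r (d l) a \<ge> D - 2 * rmax * c"
        by (rule adj_uminus_ge[OF ma(2) Dpos da _ dsl]) (use le_D ln \<theta>0 in \<open>auto simp: c_def\<close>)
      have "d l = (\<lambda>j. (U l j - U 0 j) - (Y l j - Y 0 j))" by (auto simp: d_def)
      then have dl: "adj r (d l) a = adj r (\<lambda>j. U l j - U 0 j) a - adj r (\<lambda>j. Y l j - Y 0 j) a"
        by (simp only: adj_diff)
      have "x l a - z l a \<ge> - adj r (d l) a - e - 2 * \<theta>"
        using approx_fluidD(2)[OF x, of l 0 a] approx_fluidD(2)[OF z, of l 0 a] ln e(1)[of a]
        unfolding dl abs_le_iff by linarith
      moreover have "z l a \<ge> 0" using approx_fluidD(1)[OF z] ln by simp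
      moreover have "D > e + 3 * \<theta> + 2 * rmax * c"
      proof -
        show ?thesis using gt nn unfolding D0_def c_def by (simp add: algebra_simps)
      qed
      ultimately have "x l a \<ge> \<theta>" using adj by linarith
      then have "d l a \<ge> d (Suc l) a - 2 * \<delta> * \<theta>" using busy_step[OF ln, of a] by simp
      moreover have "real (m - l) = real (m - Suc l) + 1" using l by simp
      ultimately show ?case using IH by (simp add: algebra_simps)
    qed
    \<comment> \<open>The excess at time 0 is zero, so the maximum cannot be larger than what the
      tolerance explains.\<close>
    have "0 \<ge> D * weight s a - 2 * \<theta>"
      using persist[of 0] nd2[OF ma(1)] by (simp add: d_def)
    then have "D \<le> 2 * \<theta> * (1 / weight s a)" using weight(2)[OF ma(2)] by (simp add: field_simps)
    also have "\<dots> \<le> 2 * \<theta> * winv" using \<theta>0 by (intro mult_left_mono inverse_weight_le_winv) auto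
    also have "\<dots> \<le> D0" by (rule D0_ge)
    finally show False using gt by simp
  qed
  then have "D * weight s i \<le> D0 * weight s i" by (intro mult_right_mono weight_nonneg)
  then show ?thesis using le_D[OF k i] by (simp add: d_def D0_def)
qed

definition kappa :: real where
  "kappa = 2 * rmax * ((15 + 12 * rmax + 4 * winv) * (wmax + 1)) + 3"

lemma kappa_ge: "kappa \<ge> 3"
  unfolding kappa_def using rmax_nonneg winv_nonneg wmax_nonneg by simp

text \<open>Exchanging the two solutions bounds the excess from both sides, and at \<open>s\<close>
  it is controlled directly. Hence, while one common site stays occupied, the departures differ by a
  fixed multiple of \<open>e + \<theta>\<close>, and by \<open>adj_abs_le\<close> so do the
  contents.\<close>

lemma window_bound:
  assumes x: "approx_fluid \<theta> \<delta> n x Y" and z: "approx_fluid \<theta> \<delta> n z U"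
    and \<delta>: "0 < \<delta>" "\<delta> \<le> \<theta>" "real n * \<delta> \<le> 1"
    and s: "\<And>k. k < n \<Longrightarrow> x k s \<ge> \<theta>" "\<And>k. k < n \<Longrightarrow> z k s \<ge> \<theta>"
    and e: "\<And>i. \<bar>x 0 i - z 0 i\<bar> \<le> e" "e \<ge> 0" and \<theta>: "\<theta> \<le> 1"
    and k: "k \<le> n"
  shows "\<bar>x k i - z k i\<bar> \<le> kappa * (e + \<theta>)"
proof -
  define d where "d i = (U k i - U 0 i) - (Y k i - Y 0 i)" for i
  define D where "D = e + 3 * \<theta> + 12 * rmax * \<theta> + 4 * \<theta> * winv"
  define c where "c = (15 + 12 * rmax + 4 * winv) * (wmax + 1) * (e + \<theta>)"
  have \<theta>0: "\<theta> > 0" using \<delta> by simp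
  have nn: "rmax * \<theta> \<ge> 0" "\<theta> * winv \<ge> 0" "rmax * e \<ge> 0" "e * winv \<ge> 0" using rmax_nonneg winv_nonneg \<theta>0 e by auto
  have D0: "D \<ge> 0" unfolding D_def using nn \<theta>0 e by (simp add: mult.assoc)
  have Dc: "D + 4 * \<theta> \<le> (15 + 12 * rmax + 4 * winv) * (e + \<theta>)"
    unfolding D_def using nn \<theta>0 e by (simp add: algebra_simps)
  have Dw: "D * weight s j \<le> c" for j
  proof -
    have "D * weight s j \<le> ((15 + 12 * rmax + 4 * winv) * (e + \<theta>)) * (wmax + 1)"
      using D0 Dc \<theta>0 weight_le_wmax[of s j] e rmax_nonneg winv_nonneg by (intro mult_mono) (auto intro: weight_nonneg)
    then show ?thesis by (simp add: c_def algebra_simps)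
  qed
  have sc: "4 * \<theta> \<le> c"
  proof -
    have "4 * \<theta> \<le> (15 + 12 * rmax + 4 * winv) * (e + \<theta>)" using Dc D0 by simp
    also have "\<dots> \<le> ((15 + 12 * rmax + 4 * winv) * (e + \<theta>)) * (wmax + 1)"
      using wmax_nonneg rmax_nonneg winv_nonneg e \<theta>0
        mult_left_mono[of 1 "wmax + 1" "(15 + 12 * rmax + 4 * winv) * (e + \<theta>)"] by simp
    finally show ?thesis by (simp add: c_def algebra_simps)
  qed
  have dle: "d j \<le> c" "- d j \<le> c" if "j \<noteq> s" for j
  proof -
    have "d j \<le> D * weight s j" unfolding d_def D_def
      by (rule departure_excess_le[OF x z \<delta> s e \<theta> k that])
    then show "d j \<le> c" using Dw[of j] by simp
    have e': "\<bar>z 0 i - x 0 i\<bar> \<le> e" for i using e(1)[of i] by (simp add: abs_minus_commute)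
    have "- d j \<le> D * weight s j"
      using departure_excess_le[OF z x \<delta> s(2) s(1) e' e(2) \<theta> k that] by (simp add: d_def D_def)
    then show "- d j \<le> c" using Dw[of j] by simp
  qed
  have ind: "\<bar>(U l s - U 0 s) - (Y l s - Y 0 s)\<bar> \<le> 2 * \<delta> * \<theta> * real l" if "l \<le> n" for l
    using that
  proof (induction l)
    case (Suc l)
    then have l: "l < n" by simp
    have "\<bar>(U (Suc l) s - U l s) - (Y (Suc l) s - Y l s)\<bar> \<le> 2 * \<delta> * \<theta>"
      using approx_fluidD(4,5)[OF x l, of s] approx_fluidD(4,5)[OF z l, of s] s[OF l]
      by (simp add: abs_le_iff algebra_simps)
    then show ?case using Suc by (simp add: algebra_simps abs_le_iff)
  qed simp
  have "2 * \<delta> * \<theta> * real k \<le> 2 * \<theta>"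
  proof -
    have "\<delta> * real k \<le> \<delta> * real n" using k \<delta> by (intro mult_left_mono) auto
    then have "2 * \<theta> * (\<delta> * real k) \<le> 2 * \<theta> * 1" using \<delta>(3) \<theta>0 by (intro mult_left_mono) (auto simp: mult.commute)
    then show ?thesis by (simp add: algebra_simps)
  qed
  then have "\<bar>d s\<bar> \<le> c" using ind[OF k] sc \<theta>0 unfolding d_def by linarith
  then have dabs: "\<bar>d j\<bar> \<le> c" for j using dle[of j] by (cases "j = s") (auto simp: abs_le_iff)
  have "d = (\<lambda>j. (U k j - U 0 j) - (Y k j - Y 0 j))" by (auto simp: d_def)
  then have deq: "adj r d i = adj r (\<lambda>j. U k j - U 0 j) i - adj r (\<lambda>j. Y k j - Y 0 j) i"
    by (simp only: adj_diff)
  have "\<bar>x k i - z k i\<bar> \<le> \<bar>adj r d i\<bar> + e + 2 * \<theta>"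
    using approx_fluidD(2)[OF x, of k 0 i] approx_fluidD(2)[OF z, of k 0 i] k e(1)[of i]
    unfolding deq by linarith
  also have "\<bar>adj r d i\<bar> \<le> 2 * rmax * c" by (rule adj_abs_le[OF dabs])
  also have "2 * rmax * c + e + 2 * \<theta> \<le> kappa * (e + \<theta>)"
    using e \<theta>0 by (simp add: kappa_def c_def algebra_simps)
  finally show ?thesis by simp
qed

end

lemma nat_floor_bounds:
  fixes y :: real assumes "y \<ge> 1"
  shows "real (nat \<lfloor>y\<rfloor>) \<le> y" "real (nat \<lfloor>y\<rfloor>) \<ge> y / 2"
proof -
  have "\<lfloor>y\<rfloor> \<ge> 1" using assms by (simp add: le_floor_iff)
  then have "real (nat \<lfloor>y\<rfloor>) = of_int \<lfloor>y\<rfloor>" "real (nat \<lfloor>y\<rfloor>) \<ge> 1" by auto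
  moreover have "of_int \<lfloor>y\<rfloor> \<le> y" "y < of_int \<lfloor>y\<rfloor> + 1" by linarith+
  ultimately show "real (nat \<lfloor>y\<rfloor>) \<le> y" "real (nat \<lfloor>y\<rfloor>) \<ge> y / 2" by linarith+
qed

context irreducible_walk begin

text \<open>The factor 4 is 2 from \<open>adj_abs_le\<close> times 2 from the bound
  \<open>1 + \<theta> \<le> 2\<close> on the departure rates.\<close>

lemma approx_fluid_lipschitz:
  assumes x: "approx_fluid \<theta> \<delta> n x Y" and k: "k \<le> n" and \<delta>: "0 < \<delta>" and \<theta>: "0 \<le> \<theta>" "\<theta> \<le> 1"
  shows "\<bar>x k i - x 0 i\<bar> \<le> \<theta> + 4 * rmax * (real k * \<delta>)"
proof -
  have inc: "0 \<le> Y k j - Y 0 j \<and> Y k j - Y 0 j \<le> 2 * (real k * \<delta>)" for j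
    using k
  proof (induction k)
    case (Suc k)
    then have k: "k < n" by simp
    have "\<delta> * (1 + \<theta>) \<le> \<delta> * 2" using \<delta> \<theta> by (intro mult_left_mono) auto
    then show ?case using Suc approx_fluidD(3,4)[OF x k, of j] by (simp add: algebra_simps)
  qed simp
  then have "\<bar>Y k j - Y 0 j\<bar> \<le> 2 * (real k * \<delta>)" for j by (simp add: abs_of_nonneg)
  then have "\<bar>adj r (\<lambda>j. Y k j - Y 0 j) i\<bar> \<le> 2 * rmax * (2 * (real k * \<delta>))" by (rule adj_abs_le)
  moreover have "\<bar>x k i - x 0 i - adj r (\<lambda>j. Y k j - Y 0 j) i\<bar> \<le> \<theta>"
    by (rule approx_fluidD(2)[OF x k]) simp
  ultimately show ?thesis by (simp add: abs_le_iff)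
qed

text \<open>Time is cut into windows during which some site stays occupied in both solutions; the
  site may differ from window to window. A window multiplies the error by at most
  \<open>2 * kappa\<close>, and the number of windows does not depend on \<delta>.\<close>

lemma approx_fluid_stable:
  assumes \<epsilon>: "\<epsilon> > 0" and T: "T \<ge> 0"
  shows "\<exists>\<theta>>0. \<theta> \<le> 1 \<and> (\<forall>\<delta> n x Y z U. 0 < \<delta> \<and> \<delta> \<le> \<theta> \<and> real n * \<delta> \<le> T \<and> approx_fluid \<theta> \<delta> n x Y \<and>
      approx_fluid \<theta> \<delta> n z U \<and> (\<forall>i. \<bar>x 0 i - z 0 i\<bar> \<le> \<theta>) \<and> (\<forall>k\<le>n. (\<Sum>i\<in>UNIV. z k i) = 1) \<longrightarrow>
      (\<forall>k\<le>n. \<forall>i. \<bar>x k i - z k i\<bar> \<le> \<epsilon>))"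
proof -
  define V where "V = real CARD('v)"
  have V: "V \<ge> 1" unfolding V_def by (simp add: Suc_leI card_gt_0_iff)
  \<comment> \<open>A site holding at least \<open>1 / V\<close> at the start of a window changes,
    apart from the tolerance, by at most \<open>4 * rmax * \<tau> \<le> 1 / (4 * V)\<close> during
    it, and so stays occupied.\<close>
  define \<tau> where "\<tau> = 1 / (16 * V * (rmax + 1))"
  have \<tau>: "0 < \<tau>" unfolding \<tau>_def using V rmax_nonneg by simp
  have \<tau>1: "\<tau> \<le> 1"
  proof -
    have "1 * 1 \<le> V * (rmax + 1)" using V rmax_nonneg by (intro mult_mono) auto
    then show ?thesis unfolding \<tau>_def by (subst divide_le_eq_1) auto
  qed
  have r\<tau>: "4 * rmax * \<tau> \<le> 1 / (4 * V)"
  proof -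
    have "4 * rmax * \<tau> = rmax / (rmax + 1) * (1 / (4 * V))" unfolding \<tau>_def by simp
    also have "\<dots> \<le> 1 * (1 / (4 * V))" using rmax_nonneg V by (intro mult_right_mono) auto
    finally show ?thesis by simp
  qed
  \<comment> \<open>Rounding to the grid may halve a window, hence the factor 2.\<close>
  define Q where "Q = nat \<lceil>2 * T / \<tau>\<rceil>"
  \<comment> \<open>Even after \<open>Q\<close> windows the error is at most \<epsilon>, and at most
    \<open>1 / (8 * V)\<close>, so that the chosen site is occupied in the first solution as
    well.\<close>
  define \<theta> where "\<theta> = min (min \<epsilon> (1 / (8 * V))) \<tau> / (2 * kappa) ^ Q"
  have kap: "2 * kappa \<ge> 1" using kappa_ge by simp
  have kpow: "(2 * kappa) ^ q \<ge> 1" for q by (rule one_le_power[OF kap])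
  have \<theta>: "\<theta> > 0" unfolding \<theta>_def using \<epsilon> V \<tau> kpow[of Q] by (intro divide_pos_pos) auto
  have \<theta>Q: "(2 * kappa) ^ Q * \<theta> = min (min \<epsilon> (1 / (8 * V))) \<tau>" unfolding \<theta>_def using kap by simp
  have \<theta>q: "(2 * kappa) ^ q * \<theta> \<le> min (min \<epsilon> (1 / (8 * V))) \<tau>" if "q \<le> Q" for q
    unfolding \<theta>Q[symmetric] using that \<theta> kap by (intro mult_right_mono power_increasing) auto
  have \<theta>le: "\<theta> \<le> 1 / (8 * V)" "\<theta> \<le> \<tau>" using \<theta>q[of 0] by auto
  show ?thesis
  proof (intro exI[of _ \<theta>] conjI allI impI; (elim conjE)?)
    show "\<theta> > 0" by (rule \<theta>)
    show \<theta>1: "\<theta> \<le> 1" using \<theta>le \<tau>1 by simp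
    fix \<delta> n x Y z U k0 i0
    assume \<delta>: "0 < \<delta>" "\<delta> \<le> \<theta>" "real n * \<delta> \<le> T" and x: "approx_fluid \<theta> \<delta> n x Y"
      and z: "approx_fluid \<theta> \<delta> n z U" and e0: "\<forall>i. \<bar>x 0 i - z 0 i\<bar> \<le> \<theta>"
      and sum1: "\<forall>k\<le>n. (\<Sum>i\<in>UNIV. z k i) = 1" and k0: "k0 \<le> n"
    define w where "w = nat \<lfloor>\<tau> / \<delta>\<rfloor>"
    have ratio: "\<tau> / \<delta> \<ge> 1" using \<delta> \<theta>le by simp
    have w: "real w \<le> \<tau> / \<delta>" "real w \<ge> \<tau> / \<delta> / 2"
      unfolding w_def by (intro nat_floor_bounds[OF ratio])+
    have w\<delta>: "real w * \<delta> \<le> \<tau>" "real w * \<delta> \<ge> \<tau> / 2" using w \<delta> by (simp_all add: field_simps)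
    have main: "\<forall>k\<le>n. k \<le> q * w \<longrightarrow> (\<forall>i. \<bar>x k i - z k i\<bar> \<le> (2 * kappa) ^ q * \<theta>)" if "q \<le> Q" for q
      using that
    proof (induction q)
      case 0
      then show ?case using e0 by simp
    next
      case (Suc q)
      define e where "e = (2 * kappa) ^ q * \<theta>"
      have IH: "\<And>k i. k \<le> n \<Longrightarrow> k \<le> q * w \<Longrightarrow> \<bar>x k i - z k i\<bar> \<le> e" using Suc by (simp add: e_def)
      have e: "e \<ge> 0" "e \<le> 1 / (8 * V)" "e \<ge> \<theta>"
        using \<theta>q[of q] Suc(2) \<theta> kpow[of q] by (auto simp: e_def intro: mult_nonneg_nonneg)
      have e_Suc: "kappa * (e + \<theta>) \<le> (2 * kappa) ^ Suc q * \<theta>"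
      proof -
        have "kappa * (e + \<theta>) \<le> kappa * (e + e)" using e kappa_ge by (intro mult_left_mono) auto
        then show ?thesis by (simp add: e_def algebra_simps)
      qed
      have e_le: "e \<le> (2 * kappa) ^ Suc q * \<theta>" using mult_right_mono[OF kap e(1)] by (simp add: e_def mult.assoc)
      show ?case
      proof (intro allI impI)
        fix k i assume k: "k \<le> n" "k \<le> Suc q * w"
        show "\<bar>x k i - z k i\<bar> \<le> (2 * kappa) ^ Suc q * \<theta>"
        proof (cases "k \<le> q * w")
          case True
          then show ?thesis using IH[OF k(1) True, of i] e_le by simp
        next
          case False
          define m where "m = q * w"
          define n' where "n' = min w (n - m)"
          have mn: "m \<le> n" "m + n' \<le> n" "n' \<le> w" using k False by (auto simp: m_def n'_def)
          have km: "k = m + (k - m)" "k - m \<le> n'" using k False by (auto simp: m_def n'_def)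
          have n'\<delta>: "real n' * \<delta> \<le> \<tau>"
          proof -
            have "real n' * \<delta> \<le> real w * \<delta>" using mn(3) \<delta> by (intro mult_right_mono) auto
            then show ?thesis using w\<delta>(1) by simp
          qed
          note xs = approx_fluid_shift[OF x mn(2)] and zs = approx_fluid_shift[OF z mn(2)]
          \<comment> \<open>Pigeonhole: the total mass 1 is spread over \<open>V\<close>
            sites.\<close>
          have "\<exists>s. z m s \<ge> 1 / V"
          proof (rule ccontr)
            assume "\<nexists>s. z m s \<ge> 1 / V"
            then have "(\<Sum>i\<in>UNIV. z m i) < (\<Sum>i\<in>(UNIV::'v set). 1 / V)"
              by (intro sum_strict_mono) (auto simp: not_le)
            also have "\<dots> = 1" using V by (simp add: V_def)
            finally show False using sum1 mn(1) by simp
          qed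
          then obtain s where s: "z m s \<ge> 1 / V" by blast
          have lip: "4 * rmax * (real l * \<delta>) \<le> 1 / (4 * V)" if "l \<le> n'" for l
          proof -
            have "real l * \<delta> \<le> real n' * \<delta>" using that \<delta> by (intro mult_right_mono) auto
            then have "4 * rmax * (real l * \<delta>) \<le> 4 * rmax * \<tau>" using n'\<delta> rmax_nonneg by (intro mult_left_mono) auto
            then show ?thesis using r\<tau> by simp
          qed
          have V4: "1 / (4 * V) = (1 / V) / 4" "1 / (8 * V) = (1 / V) / 8" "1 / V > 0" using V by auto
          have zpos: "z (m + l) s \<ge> \<theta>" if "l < n'" for l
            using approx_fluid_lipschitz[OF zs, of l s] lip[of l] that \<delta> \<theta> \<theta>1 s \<theta>le V4 by (simp add: abs_le_iff)
          have xpos: "x (m + l) s \<ge> \<theta>" if "l < n'" for l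
          proof -
            have "\<bar>x m s - z m s\<bar> \<le> e" by (rule IH) (use mn in \<open>auto simp: m_def\<close>)
            then show ?thesis
              using approx_fluid_lipschitz[OF xs, of l s] lip[of l] that \<delta> \<theta> \<theta>1 s \<theta>le V4 e(2) by (simp add: abs_le_iff)
          qed
          have "\<bar>x (m + (k - m)) i - z (m + (k - m)) i\<bar> \<le> kappa * (e + \<theta>)"
          proof (rule window_bound[OF xs zs \<delta>(1,2) _ xpos zpos _ e(1) \<theta>1 km(2)])
            show "real n' * \<delta> \<le> 1" using n'\<delta> \<tau>1 by simp
            show "\<bar>x (m + 0) i - z (m + 0) i\<bar> \<le> e" for i using IH[of m i] mn by (simp add: m_def)
          qed
          then show ?thesis using km(1) e_Suc by simp
        qed
      qed
    qed
    have "real Q \<ge> 2 * T / \<tau>" unfolding Q_def by linarith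
    then have "T \<le> real Q * (\<tau> / 2)" using \<tau> by (simp add: field_simps)
    also have "\<dots> \<le> real Q * (real w * \<delta>)" using w\<delta> by (intro mult_left_mono) auto
    finally have "real n * \<delta> \<le> real (Q * w) * \<delta>" using \<delta>(3) unfolding of_nat_mult mult.assoc by linarith
    then have "real n \<le> real (Q * w)" using \<delta>(1) by (rule mult_right_le_imp_le)
    then have "n \<le> Q * w" unfolding of_nat_le_iff .
    then have "\<bar>x k0 i0 - z k0 i0\<bar> \<le> (2 * kappa) ^ Q * \<theta>" using main[of Q] k0 by simp
    then show "\<bar>x k0 i0 - z k0 i0\<bar> \<le> \<epsilon>" using \<theta>Q by simp
  qed
qed

end

section \<open>Convergence along a grid\<close>

primrec walk :: "('s \<Rightarrow> 's pmf) \<Rightarrow> nat \<Rightarrow> 's \<Rightarrow> 's list pmf" where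
  "walk K 0 x = return_pmf [x]"
| "walk K (Suc m) x = map_pmf ((#) x) (bind_pmf (K x) (walk K m))"

lemma walk_support:
  assumes "l \<in> set_pmf (walk K m x)"
  shows "length l = Suc m" "l ! 0 = x"
  using assms by (induction m arbitrary: x l) auto

lemma walk_invariant:
  assumes "\<And>y. y \<in> I \<Longrightarrow> set_pmf (K y) \<subseteq> I" "x \<in> I" "l \<in> set_pmf (walk K m x)"
  shows "set l \<subseteq> I"
  using assms(2,3) by (induction m arbitrary: x l) (use assms(1) in fastforce)+

lemma prob_walk_Suc:
  "measure_pmf.prob (walk K (Suc m) x) A = measure_pmf.expectation (K x) (\<lambda>y. measure_pmf.prob (walk K m y) {l. x # l \<in> A})"
proof -
  have "measure_pmf.prob (walk K (Suc m) x) A = measure_pmf.prob (bind_pmf (K x) (walk K m)) {l. x # l \<in> A}"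
    by (simp add: vimage_def)
  also have "\<dots> = measure_pmf.expectation (bind_pmf (K x) (walk K m)) (indicator {l. x # l \<in> A})" by simp
  also have "\<dots> = measure_pmf.expectation (K x) (\<lambda>y. measure_pmf.expectation (walk K m y) (indicator {l. x # l \<in> A}))"
    by (rule expectation_bind) (rule bounded_fun_intros)
  finally show ?thesis by simp
qed

lemma prob_mono_support:
  assumes "\<And>x. x \<in> set_pmf p \<Longrightarrow> x \<in> A \<Longrightarrow> x \<in> B"
  shows "measure_pmf.prob p A \<le> measure_pmf.prob p B"
  by (rule measure_pmf.finite_measure_mono_AE) (use assms in \<open>auto simp: AE_measure_pmf_iff\<close>)

lemma bounded_fun_prob: "bounded_fun (\<lambda>y. measure_pmf.prob (K y) (A y))"
  by (rule bounded_funI[of _ 1]) simp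

text \<open>Kolmogorov's inequality for martingale differences. The offset \<open>c\<close> is there
  for the induction on the first step: unless it is already too large, the first increment is added
  to it, and the square of the new offset has mean at most \<open>c^2 + v\<close>.\<close>

lemma walk_noise_bound:
  fixes D :: "'s \<Rightarrow> 's \<Rightarrow> real"
  assumes inv: "\<And>y. y \<in> I \<Longrightarrow> set_pmf (K y) \<subseteq> I"
    and bd: "\<And>x. bounded_fun (D x)"
    and mean: "\<And>x. x \<in> I \<Longrightarrow> measure_pmf.expectation (K x) (D x) = 0"
    and var: "\<And>x. x \<in> I \<Longrightarrow> measure_pmf.expectation (K x) (\<lambda>y. (D x y)\<^sup>2) \<le> v"
    and a: "a > 0" and v: "v \<ge> 0"
  shows "x \<in> I \<Longrightarrow> measure_pmf.prob (walk K m x) {l. \<exists>k\<le>m. \<bar>c + (\<Sum>j<k. D (l ! j) (l ! Suc j))\<bar> \<ge> a} \<le> (c\<^sup>2 + real m * v) / a\<^sup>2"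
proof (induction m arbitrary: c x)
  case 0
  show ?case
  proof (cases "\<bar>c\<bar> \<ge> a")
    case True
    then have "1 \<le> c\<^sup>2 / a\<^sup>2" using a by (simp add: abs_le_square_iff[symmetric])
    then show ?thesis by (intro order_trans[OF measure_pmf.prob_le_1]) simp
  qed simp
next
  case (Suc m)
  show ?case
  proof (cases "\<bar>c\<bar> \<ge> a")
    case True
    then have "a\<^sup>2 \<le> c\<^sup>2 + real (Suc m) * v" using a v abs_le_square_iff[of a c] by (simp add: add_increasing2)
    then have "1 \<le> (c\<^sup>2 + real (Suc m) * v) / a\<^sup>2" using a by simp
    then show ?thesis by (intro order_trans[OF measure_pmf.prob_le_1])
  next
    case False
    let ?A = "\<lambda>m c. {l. \<exists>k\<le>m. \<bar>c + (\<Sum>j<k. D (l ! j) (l ! Suc j))\<bar> \<ge> a}"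
    have step: "measure_pmf.prob (walk K m y) {l. x # l \<in> ?A (Suc m) c} \<le> ((c + D x y)\<^sup>2 + real m * v) / a\<^sup>2"
      if y: "y \<in> set_pmf (K x)" for y
    proof -
      have "measure_pmf.prob (walk K m y) {l. x # l \<in> ?A (Suc m) c} \<le> measure_pmf.prob (walk K m y) (?A m (c + D x y))"
      proof (rule prob_mono_support)
        fix l assume l: "l \<in> set_pmf (walk K m y)" "l \<in> {l. x # l \<in> ?A (Suc m) c}"
        then obtain k where k: "k \<le> Suc m" "\<bar>c + (\<Sum>j<k. D ((x # l) ! j) ((x # l) ! Suc j))\<bar> \<ge> a" by auto
        then obtain k' where k': "k = Suc k'" using False by (cases k) auto
        have "(\<Sum>j<Suc k'. D ((x # l) ! j) ((x # l) ! Suc j)) = D x y + (\<Sum>j<k'. D (l ! j) (l ! Suc j))"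
          using walk_support(2)[OF l(1)] by (subst sum.lessThan_Suc_shift) simp
        then show "l \<in> ?A m (c + D x y)" using k k' by (auto simp: add.assoc)
      qed
      also have "\<dots> \<le> ((c + D x y)\<^sup>2 + real m * v) / a\<^sup>2"
        by (rule Suc.IH) (use inv[OF Suc.prems] y in auto)
      finally show ?thesis .
    qed
    note bi = bounded_fun_intros bd[of x]
    have b2: "bounded_fun (\<lambda>y. (D x y)\<^sup>2)" unfolding power2_eq_square by (intro bi)
    have "measure_pmf.prob (walk K (Suc m) x) (?A (Suc m) c) \<le>
      measure_pmf.expectation (K x) (\<lambda>y. (c\<^sup>2 + real m * v + (2 * c) * D x y + (D x y)\<^sup>2) * (1 / a\<^sup>2))"
      unfolding prob_walk_Suc
      by (rule expectation_le[OF bounded_fun_prob])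
        (use step in \<open>auto intro!: bi b2 simp: power2_sum algebra_simps divide_inverse\<close>)
    also have "\<dots> = (c\<^sup>2 + real m * v + (2 * c) * 0 + measure_pmf.expectation (K x) (\<lambda>y. (D x y)\<^sup>2)) * (1 / a\<^sup>2)"
      using mean[OF Suc.prems] by (simp add: expectation_add bi b2)
    also have "\<dots> \<le> (c\<^sup>2 + real m * v + (2 * c) * 0 + v) * (1 / a\<^sup>2)"
      using var[OF Suc.prems] by (intro mult_right_mono) auto
    also have "\<dots> = (c\<^sup>2 + real (Suc m) * v) / a\<^sup>2" by (simp add: field_simps)
    finally show ?thesis .
  qed
qed

text \<open>Doob's maximal inequality for the nonnegative supermartingale
  \<open>f (l ! k) / \<rho> ^ k\<close>, by conditioning on the first step.\<close>

lemma walk_maximal_inequality: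
  assumes bd: "bounded_fun f" and nn: "\<And>x. f x \<ge> 0"
    and growth: "\<And>x. measure_pmf.expectation (K x) f \<le> \<rho> * f x" and \<rho>: "\<rho> \<ge> 1" and a: "a > 0"
  shows "measure_pmf.prob (walk K m x) {l. \<exists>k\<le>m. f (l ! k) \<ge> a} \<le> \<rho> ^ m * f x / a"
proof (induction m arbitrary: x)
  case 0
  show ?case
  proof (cases "f x \<ge> a")
    case True
    then have "1 \<le> f x / a" using a by simp
    then show ?thesis by (intro order_trans[OF measure_pmf.prob_le_1]) simp
  qed (use nn a in simp)
next
  case (Suc m)
  show ?case
  proof (cases "f x \<ge> a")
    case True
    have "1 * f x \<le> \<rho> ^ Suc m * f x" using \<rho> nn by (intro mult_right_mono one_le_power)
    then have "a \<le> \<rho> ^ Suc m * f x" using True by linarith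
    then have "1 \<le> \<rho> ^ Suc m * f x / a" using a by (simp del: power_Suc)
    then show ?thesis by (intro order_trans[OF measure_pmf.prob_le_1])
  next
    case False
    have step: "measure_pmf.prob (walk K m y) {l. x # l \<in> {l. \<exists>k\<le>Suc m. f (l ! k) \<ge> a}} \<le> \<rho> ^ m / a * f y" for y
    proof -
      have "{l. x # l \<in> {l. \<exists>k\<le>Suc m. f (l ! k) \<ge> a}} \<subseteq> {l. \<exists>k\<le>m. f (l ! k) \<ge> a}"
      proof
        fix l assume "l \<in> {l. x # l \<in> {l. \<exists>k\<le>Suc m. f (l ! k) \<ge> a}}"
        then obtain k where k: "k \<le> Suc m" "f ((x # l) ! k) \<ge> a" by auto
        then show "l \<in> {l. \<exists>k\<le>m. f (l ! k) \<ge> a}" using False by (cases k) auto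
      qed
      then have "measure_pmf.prob (walk K m y) {l. x # l \<in> {l. \<exists>k\<le>Suc m. f (l ! k) \<ge> a}} \<le> measure_pmf.prob (walk K m y) {l. \<exists>k\<le>m. f (l ! k) \<ge> a}"
        by (intro measure_pmf.finite_measure_mono) auto
      also have "\<dots> \<le> \<rho> ^ m * f y / a" by (rule Suc.IH)
      finally show ?thesis by simp
    qed
    have "measure_pmf.prob (walk K (Suc m) x) {l. \<exists>k\<le>Suc m. f (l ! k) \<ge> a} \<le> measure_pmf.expectation (K x) (\<lambda>y. \<rho> ^ m / a * f y)"
      unfolding prob_walk_Suc by (rule expectation_le[OF bounded_fun_prob _ step]) (intro bounded_fun_intros bd)
    also have "\<dots> = \<rho> ^ m / a * measure_pmf.expectation (K x) f" by simp
    also have "\<dots> \<le> \<rho> ^ m / a * (\<rho> * f x)" using growth a \<rho> by (intro mult_left_mono) auto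
    finally show ?thesis by (simp add: mult.assoc mult.left_commute)
  qed
qed

lemma pmf_walk:
  "pmf (walk K m x) l = (if length l = Suc m \<and> l ! 0 = x then \<Prod>k<m. pmf (K (l ! k)) (l ! Suc k) else 0)"
proof (induction m arbitrary: x l)
  case 0
  show ?case by (cases l) (auto simp: pmf_return)
next
  case (Suc m)
  show ?case
  proof (cases "length l = Suc (Suc m) \<and> l ! 0 = x")
    case False
    then have "l \<notin> set_pmf (walk K (Suc m) x)" using walk_support[of l K "Suc m" x] by blast
    then have "pmf (walk K (Suc m) x) l = 0" by (simp only: set_pmf_iff not_not)
    then show ?thesis using False by (simp only: if_False)
  next
    case True
    then obtain l' where l: "l = x # l'" "length l' = Suc m" by (cases l) auto
    let ?c = "\<Prod>k<m. pmf (K (l' ! k)) (l' ! Suc k)"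
    have "pmf (walk K (Suc m) x) l = pmf (bind_pmf (K x) (walk K m)) l'"
      unfolding l walk.simps by (rule pmf_map_inj') (simp add: inj_def)
    also have "\<dots> = measure_pmf.expectation (K x) (\<lambda>y. pmf (walk K m y) l')" by (rule pmf_bind)
    also have "\<dots> = measure_pmf.expectation (K x) (\<lambda>y. ?c * indicator {l' ! 0} y)"
      by (rule Bochner_Integration.integral_cong) (use l in \<open>auto simp: Suc.IH indicator_def\<close>)
    also have "\<dots> = ?c * pmf (K x) (l' ! 0)" by (simp add: measure_pmf_single)
    finally show ?thesis using l by (simp add: prod.lessThan_Suc_shift mult.commute del: prod.lessThan_Suc)
  qed
qed

section \<open>Drift and fluctuation over one time block\<close>

context zrp_semigroup begin

abbreviation "speed \<tau> x i \<equiv> time_mean P x \<tau> (\<lambda>\<eta>. g (\<eta> i))"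

lemma g_bounded: "bounded_fun (\<lambda>\<eta>. g (\<eta> i))"
  by (rule bounded_funI[of _ gmax]) (simp add: g_nonneg g_le_gmax)

lemma speed_nonneg: "\<tau> > 0 \<Longrightarrow> 0 \<le> speed \<tau> x i"
  using time_mean_mono[of \<tau> "\<lambda>_. 0" "\<lambda>\<eta>. g (\<eta> i)" x] g_bounded[of i] g_nonneg
  by (simp add: time_mean_const bounded_fun_intros)

text \<open>The site can become empty only if the configuration moves by a distance of at least
  \<open>c\<close>; otherwise it is occupied and its speed is at least 1 by
  \<open>g_ge_1\<close>.\<close>

lemma speed_ge:
  assumes \<tau>: "\<tau> > 0" and c: "real (x i) \<ge> c"
  shows "speed \<tau> x i \<ge> 1 - exp (cexp * \<tau> - c)"
proof -
  have "1 - exp (cexp * \<tau> - c) \<le> E s x (\<lambda>\<eta>. g (\<eta> i))" if s: "s \<in> {0..\<tau>}" for s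
  proof -
    have "E s x (\<lambda>\<eta>. 1 - indicator {y. conf_dist x y \<ge> c} \<eta>) \<le> E s x (\<lambda>\<eta>. g (\<eta> i))"
    proof (intro expectation_le bounded_fun_intros g_bounded)
      fix y
      show "1 - indicator {y. conf_dist x y \<ge> c} y \<le> g (y i)"
      proof (cases "conf_dist x y \<ge> c")
        case False
        then have "y i \<noteq> 0" using conf_dist_coord[of y i x] c by auto
        then show ?thesis using False g_ge_1[of "y i"] by simp
      qed (simp add: g_nonneg)
    qed
    also have "E s x (\<lambda>\<eta>. 1 - indicator {y. conf_dist x y \<ge> c} \<eta>) = 1 - measure_pmf.prob (P s x) {y. conf_dist x y \<ge> c}"
      by (simp add: expectation_diff bounded_fun_intros)
    finally have "1 - measure_pmf.prob (P s x) {y. conf_dist x y \<ge> c} \<le> E s x (\<lambda>\<eta>. g (\<eta> i))" .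
    moreover have "measure_pmf.prob (P s x) {y. conf_dist x y \<ge> c} \<le> exp (cexp * s - c)"
      using prob_conf_dist s by simp
    moreover have "exp (cexp * s - c) \<le> exp (cexp * \<tau> - c)"
      using s cexp_nonneg by (simp add: mult_left_mono)
    ultimately show ?thesis by linarith
  qed
  then have "integral {0..\<tau>} (\<lambda>s. 1 - exp (cexp * \<tau> - c)) \<le> integral {0..\<tau>} (\<lambda>s. E s x (\<lambda>\<eta>. g (\<eta> i)))"
    by (intro integral_le E_integrable g_bounded) auto
  then show ?thesis using \<tau> by (simp add: time_mean_def g_bounded field_simps)
qed

lemma time_mean_sum:
  "finite F \<Longrightarrow> (\<And>k. k \<in> F \<Longrightarrow> bounded_fun (f k)) \<Longrightarrow> \<tau> > 0 \<Longrightarrow>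
    time_mean P x \<tau> (\<lambda>y. \<Sum>k\<in>F. f k y) = (\<Sum>k\<in>F. time_mean P x \<tau> (f k))"
proof (induction F rule: finite_induct)
  case empty
  then show ?case by (simp add: time_mean_const bounded_fun_intros)
next
  case (insert k F)
  then show ?case by (simp add: time_mean_add bounded_fun_sum)
qed

lemma time_mean_cong:
  assumes "\<tau> > 0" "bounded_fun f" "bounded_fun h" "\<And>y. particles y = particles x \<Longrightarrow> f y = h y"
  shows "time_mean P x \<tau> f = time_mean P x \<tau> h"
  by (rule antisym; rule time_mean_mono) (use assms in auto)

lemma particles_ge: "\<eta> i \<le> particles \<eta>"
  unfolding particles_def by (rule member_le_sum) auto

text \<open>Dynkin's formula for the number of particles at \<open>i\<close>. Truncation at the
  total number makes this function bounded and changes nothing on the configurations that can be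
  reached.\<close>

lemma mean_displacement:
  assumes \<tau>: "\<tau> > 0"
  shows "E \<tau> x (\<lambda>\<eta>. real (min (\<eta> i) (particles x))) = real (x i) + \<tau> * adj r (speed \<tau> x) i"
proof -
  let ?f = "\<lambda>\<eta>. real (min (\<eta> i) (particles x))"
  have f: "bounded_fun ?f" by (rule bounded_funI[of _ "real (particles x)"]) simp
  have Lf: "L ?f y = (\<Sum>j\<in>UNIV. g (y j) * r j i + (-1) * (g (y i) * r i j))" if y: "particles y = particles x" for y
  proof -
    have term_eq: "g (y a) * r a b * (?f (move_particle a b y) - ?f y) =
       (if b = i then g (y a) * r a b else 0) - (if a = i then g (y a) * r a b else 0)" for a b
    proof (cases "a = b \<or> y a = 0")
      case True
      then show ?thesis by (auto simp: r_diag g_0)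
    next
      case False
      then have "particles (move_particle a b y) = particles x" using particles_move[of a b y] y by simp
      then have "move_particle a b y i \<le> particles x" "y i \<le> particles x"
        using particles_ge[of "move_particle a b y" i] particles_ge[of y i] y by simp_all
      then have "?f (move_particle a b y) - ?f y = real (move_particle a b y i) - real (y i)" by simp
      also have "\<dots> = (if b = i then 1 else 0) - (if a = i then 1 else 0)"
        using False by (auto simp: move_particle_apply)
      finally show ?thesis by simp
    qed
    have inner: "(\<Sum>b\<in>UNIV. if a = i then g (y a) * r a b else 0) = (if a = i then \<Sum>b\<in>UNIV. g (y a) * r a b else 0)" for a
      by simp
    have "L ?f y = (\<Sum>a\<in>UNIV. \<Sum>b\<in>UNIV. (if b = i then g (y a) * r a b else 0) - (if a = i then g (y a) * r a b else 0))"
      unfolding zrp_generator_def term_eq ..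
    also have "\<dots> = (\<Sum>a\<in>UNIV. g (y a) * r a i) - (\<Sum>a\<in>UNIV. if a = i then \<Sum>b\<in>UNIV. g (y a) * r a b else 0)"
      unfolding sum_subtractf inner by simp
    finally show ?thesis by (simp add: sum_subtractf)
  qed
  have b: "bounded_fun (\<lambda>y. g (y j) * r j i + (-1) * (g (y i) * r i j))" for j
    by (intro bounded_fun_intros g_bounded)
  have "(E \<tau> x ?f - ?f x) / \<tau> = time_mean P x \<tau> (L ?f)" using time_mean_generator[OF \<tau> f] ..
  also have "\<dots> = time_mean P x \<tau> (\<lambda>y. \<Sum>j\<in>UNIV. g (y j) * r j i + (-1) * (g (y i) * r i j))"
    by (rule time_mean_cong[OF \<tau> generator_bounded[OF f] bounded_fun_sum]) (use b Lf in auto)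
  also have "\<dots> = (\<Sum>j\<in>UNIV. speed \<tau> x j * r j i + (-1) * (speed \<tau> x i * r i j))"
  proof (subst time_mean_sum[OF _ b \<tau>]; (intro sum.cong refl)?)
    fix j
    have "time_mean P x \<tau> (\<lambda>y. r j i * g (y j) + (- r i j) * g (y i)) = r j i * speed \<tau> x j + (- r i j) * speed \<tau> x i"
      by (simp only: time_mean_add time_mean_cmult bounded_fun_intros g_bounded)
    then show "time_mean P x \<tau> (\<lambda>y. g (y j) * r j i + (-1) * (g (y i) * r i j)) = speed \<tau> x j * r j i + (-1) * (speed \<tau> x i * r i j)"
      by (simp add: mult.commute)
  qed simp
  also have "\<dots> = adj r (speed \<tau> x) i" by (simp add: adj_def)
  finally have "(E \<tau> x ?f - ?f x) / \<tau> = adj r (speed \<tau> x) i" .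
  moreover have "?f x = real (x i)" using particles_ge[of x i] by simp
  ultimately show ?thesis using \<tau> by (simp add: field_simps)
qed

text \<open>Either the configuration moves by less than \<open>c * \<tau>\<close>, or the square is
  bounded by that of the number of particles; with \<open>c = cexp + 1\<close> the latter event has
  probability at most \<open>exp (- \<tau>)\<close>.\<close>

lemma second_moment:
  assumes \<tau>: "\<tau> > 0" and c: "c = cexp + 1"
  shows "E \<tau> x (\<lambda>\<eta>. (real (min (\<eta> i) (particles x)) - real (x i))\<^sup>2) \<le> (c * \<tau>)\<^sup>2 + (real (particles x))\<^sup>2 * exp (- \<tau>)"
proof -
  let ?n = "real (particles x)"
  let ?B = "{y. conf_dist x y \<ge> c * \<tau>}"
  have xi: "real (x i) \<le> ?n" "real (x i) \<ge> 0" using particles_ge[of x i] by simp_all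
  have d: "\<bar>real (min (y i) (particles x)) - real (x i)\<bar> \<le> ?n" for y :: "'v \<Rightarrow> nat"
    using xi by (auto simp: abs_le_iff)
  have d2: "(real (min (y i) (particles x)) - real (x i))\<^sup>2 \<le> ?n\<^sup>2" for y :: "'v \<Rightarrow> nat"
    using d[of y] by (simp add: abs_le_square_iff[symmetric])
  have b: "bounded_fun (\<lambda>\<eta>. (real (min (\<eta> i) (particles x)) - real (x i))\<^sup>2)"
    by (rule bounded_funI[of _ "?n\<^sup>2"]) (use d2 in simp)
  have "E \<tau> x (\<lambda>\<eta>. (real (min (\<eta> i) (particles x)) - real (x i))\<^sup>2) \<le> E \<tau> x (\<lambda>\<eta>. (c * \<tau>)\<^sup>2 + ?n\<^sup>2 * indicator ?B \<eta>)"
  proof (rule E_le_particles[OF b])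
    fix y :: "'v \<Rightarrow> nat" assume y: "particles y = particles x"
    show "(real (min (y i) (particles x)) - real (x i))\<^sup>2 \<le> (c * \<tau>)\<^sup>2 + ?n\<^sup>2 * indicator ?B y"
    proof (cases "y \<in> ?B")
      case True
      then show ?thesis using d2[of y] by (simp add: add_increasing)
    next
      case False
      have "min (y i) (particles x) = y i" using particles_ge[of y i] y by simp
      then have "\<bar>real (min (y i) (particles x)) - real (x i)\<bar> \<le> c * \<tau>"
        using conf_dist_coord[of y i x] False by simp
      then have "\<bar>real (min (y i) (particles x)) - real (x i)\<bar> \<le> \<bar>c * \<tau>\<bar>" by linarith
      then have "(real (min (y i) (particles x)) - real (x i))\<^sup>2 \<le> (c * \<tau>)\<^sup>2" by (simp only: abs_le_square_iff)
      then show ?thesis using False by simp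
    qed
  qed (use \<tau> in \<open>auto intro!: bounded_fun_intros\<close>)
  also have "\<dots> = (c * \<tau>)\<^sup>2 + ?n\<^sup>2 * measure_pmf.prob (P \<tau> x) ?B"
    by (simp add: expectation_add bounded_fun_intros)
  also have "\<dots> \<le> (c * \<tau>)\<^sup>2 + ?n\<^sup>2 * exp (cexp * \<tau> - c * \<tau>)"
    using prob_conf_dist[of \<tau> x "c * \<tau>"] \<tau> by (intro add_left_mono mult_left_mono) auto
  also have "cexp * \<tau> - c * \<tau> = - \<tau>" by (simp add: c algebra_simps)
  finally show ?thesis .
qed

text \<open>The rescaled displacement over one block minus its mean, hence a martingale difference;
  the truncation by \<open>min\<close> makes it bounded.\<close>

definition noise :: "real \<Rightarrow> nat \<Rightarrow> 'v \<Rightarrow> ('v \<Rightarrow> nat) \<Rightarrow> ('v \<Rightarrow> nat) \<Rightarrow> real" where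
  "noise \<delta> N i x y = (real (min (y i) N) - real (min (x i) N)) / real N - \<delta> * adj r (speed (\<delta> * real N) x) i"

text \<open>The conditional variance of a block is at most the second moment of its displacement, of
  order \<open>\<delta>^2\<close>. The summands \<open>0\<close> and \<open>0\<^sup>2\<close> are
  the offset \<open>c = 0\<close> in \<open>walk_noise_bound\<close>.\<close>

lemma noise_prob:
  assumes \<delta>: "\<delta> > 0" and N: "N > 0" and a: "a > 0" and x: "particles x = N"
  shows "measure_pmf.prob (walk (P (\<delta> * real N)) m x) {l. \<exists>k\<le>m. \<bar>0 + (\<Sum>j<k. noise \<delta> N i (l ! j) (l ! Suc j))\<bar> \<ge> a}
    \<le> (0\<^sup>2 + real m * (((cexp + 1) * \<delta>)\<^sup>2 + exp (- (\<delta> * real N)))) / a\<^sup>2"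
proof -
  let ?\<tau> = "\<delta> * real N"
  have \<tau>: "?\<tau> > 0" using \<delta> N by simp
  have bmin: "bounded_fun (\<lambda>y. real (min (y i) N))" by (rule bounded_funI[of _ "real N"]) simp
  have noise_eq: "noise \<delta> N i x = (\<lambda>y. (1 / real N) * real (min (y i) N) + (- real (min (x i) N) / real N - \<delta> * adj r (speed ?\<tau> x) i))" for x
    by (auto simp: noise_def diff_divide_distrib)
  have bn: "bounded_fun (noise \<delta> N i x)" for x
    unfolding noise_eq by (intro bounded_fun_intros bmin)
  have mean0: "E ?\<tau> x (noise \<delta> N i x) = 0" if "particles x = N" for x
  proof -
    have xi: "min (x i) N = x i" using particles_ge[of x i] that by simp
    have "E ?\<tau> x (noise \<delta> N i x) = (1 / real N) * E ?\<tau> x (\<lambda>y. real (min (y i) N)) + (- real (x i) / real N - \<delta> * adj r (speed ?\<tau> x) i)"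
      unfolding noise_eq xi by (simp only: expectation_add bounded_fun_intros bmin) simp
    also have "E ?\<tau> x (\<lambda>y. real (min (y i) N)) = real (x i) + ?\<tau> * adj r (speed ?\<tau> x) i"
      using mean_displacement[OF \<tau>, of x i] that by simp
    finally show ?thesis using N by (simp add: field_simps)
  qed
  have var: "E ?\<tau> x (\<lambda>y. (noise \<delta> N i x y)\<^sup>2) \<le> ((cexp + 1) * \<delta>)\<^sup>2 + exp (- ?\<tau>)" if x: "particles x = N" for x
  proof -
    let ?h = "\<lambda>y. (real (min (y i) N) - real (x i)) / real N"
    define b where "b = \<delta> * adj r (speed ?\<tau> x) i"
    have xi: "min (x i) N = x i" using particles_ge[of x i] x by simp
    have h_eq: "?h = (\<lambda>y. (1 / real N) * real (min (y i) N) + - real (x i) / real N)" by (auto simp: diff_divide_distrib)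
    have bh: "bounded_fun ?h" unfolding h_eq by (intro bounded_fun_intros bmin)
    have bh2: "bounded_fun (\<lambda>y. (?h y)\<^sup>2)" unfolding power2_eq_square by (intro bounded_fun_intros bh)
    have nh: "noise \<delta> N i x y = ?h y - b" for y by (simp add: noise_def xi b_def)
    have sq: "(q - b)\<^sup>2 = q\<^sup>2 + ((- 2 * b) * q + b\<^sup>2)" for q
      by (simp add: power2_diff algebra_simps)
    have "E ?\<tau> x (\<lambda>y. ?h y - b) = 0" using mean0[OF x] unfolding nh .
    then have Eh: "E ?\<tau> x ?h = b" by (simp add: expectation_diff bh bounded_fun_intros)
    have "E ?\<tau> x (\<lambda>y. (noise \<delta> N i x y)\<^sup>2) = E ?\<tau> x (\<lambda>y. (?h y)\<^sup>2 + ((- 2 * b) * ?h y + b\<^sup>2))"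
      unfolding nh sq ..
    also have "\<dots> = E ?\<tau> x (\<lambda>y. (?h y)\<^sup>2) + ((- 2 * b) * b + b\<^sup>2)"
    proof -
      have "E ?\<tau> x (\<lambda>y. (- 2 * b) * ?h y) = (- 2 * b) * b"
        using Eh by (simp only: integral_mult_right_zero)
      moreover have "E ?\<tau> x (\<lambda>_. b\<^sup>2) = b\<^sup>2" by simp
      ultimately show ?thesis by (simp only: expectation_add bh bh2 bounded_fun_intros)
    qed
    also have "\<dots> \<le> E ?\<tau> x (\<lambda>y. (?h y)\<^sup>2)" by (simp add: power2_eq_square)
    also have "\<dots> = (1 / (real N)\<^sup>2) * E ?\<tau> x (\<lambda>y. (real (min (y i) N) - real (x i))\<^sup>2)"
      by (simp add: power_divide)
    also have "\<dots> \<le> (1 / (real N)\<^sup>2) * (((cexp + 1) * ?\<tau>)\<^sup>2 + (real N)\<^sup>2 * exp (- ?\<tau>))"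
      using second_moment[OF \<tau> refl, of x i] x by (intro mult_left_mono) auto
    also have "\<dots> = ((cexp + 1) * \<delta>)\<^sup>2 + exp (- ?\<tau>)" using N by (simp add: field_simps power2_eq_square)
    finally show ?thesis .
  qed
  have "x \<in> {y. particles y = N}" using x by simp
  then show ?thesis
  proof (rule walk_noise_bound[where I="{y. particles y = N}", rotated 6])
    show "set_pmf (P ?\<tau> y) \<subseteq> {y. particles y = N}" if "y \<in> {y. particles y = N}" for y
      using that particles_preserved[of ?\<tau> _ y] \<tau> by auto
  qed (use bn mean0 var a in auto)
qed

end

lemma (in irreducible_walk) fluid_lipschitz:
  assumes "fluid r T z Y" "0 \<le> s" "s \<le> t" "t \<le> T"
  shows "\<bar>z t i - z s i\<bar> \<le> 2 * rmax * (t - s)"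
proof -
  note f = fluidD[OF assms(1)]
  have "z t i - z s i = adj r (\<lambda>j. Y t j - Y s j) i"
    using f(3)[of t i] f(3)[of s i] assms by (simp add: adj_diff)
  also have "\<bar>\<dots>\<bar> \<le> 2 * rmax * (t - s)"
    by (rule adj_abs_le) (use f(4,5)[of s t] assms in \<open>simp add: abs_of_nonneg\<close>)
  finally show ?thesis .
qed

text \<open>Within a cell a solution moves by at most \<open>2 * rmax * \<delta> < \<theta>\<close>,
  so a site that holds at least \<theta> at a grid time stays positive through the next cell and
  works at full rate.\<close>

lemma (in irreducible_walk) fluid_approx_fluid:
  assumes f: "fluid r T z Y" and \<delta>: "0 < \<delta>" "2 * rmax * \<delta> < \<theta>" "real n * \<delta> \<le> T" and \<theta>: "0 < \<theta>"
  shows "approx_fluid \<theta> \<delta> n (\<lambda>k. z (real k * \<delta>)) (\<lambda>k. Y (real k * \<delta>))"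
proof -
  note fD = fluidD[OF f]
  have T: "real k * \<delta> \<le> T" if "k \<le> n" for k
  proof -
    have "real k * \<delta> \<le> real n * \<delta>" using that \<delta> by (intro mult_right_mono) auto
    then show ?thesis using \<delta>(3) by linarith
  qed
  show ?thesis
    unfolding approx_fluid_def
  proof (intro conjI allI impI)
    fix k i assume "k \<le> n" then show "0 \<le> z (real k * \<delta>) i" using fD(2) T \<delta> by simp
  next
    fix k l i assume "k \<le> n" "l \<le> n"
    then have "z (real k * \<delta>) i - z (real l * \<delta>) i = adj r (\<lambda>j. Y (real k * \<delta>) j - Y (real l * \<delta>) j) i"
      using fD(3)[of "real k * \<delta>" i] fD(3)[of "real l * \<delta>" i] T \<delta> by (simp add: adj_diff)
    then show "\<bar>z (real k * \<delta>) i - z (real l * \<delta>) i - adj r (\<lambda>j. Y (real k * \<delta>) j - Y (real l * \<delta>) j) i\<bar> \<le> \<theta>"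
      using \<theta> by simp
  next
    fix k i assume k: "k < n"
    have le: "real k * \<delta> \<le> real (Suc k) * \<delta>" "real (Suc k) * \<delta> \<le> T" "0 \<le> real k * \<delta>"
      using \<delta> T[of "Suc k"] k by (auto simp: algebra_simps)
    have d: "real (Suc k) * \<delta> - real k * \<delta> = \<delta>" by (simp add: algebra_simps)
    note inc = fD(4)[OF le(3,1,2), of i] fD(5)[OF le(3,1,2), of i, unfolded d]
    show "0 \<le> Y (real (Suc k) * \<delta>) i - Y (real k * \<delta>) i" by (rule inc(1))
    have "\<delta> * 1 \<le> \<delta> * (1 + \<theta>)" using \<delta> \<theta> by (intro mult_left_mono) auto
    then show "Y (real (Suc k) * \<delta>) i - Y (real k * \<delta>) i \<le> \<delta> * (1 + \<theta>)" using inc(2) by simp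
    assume ge: "z (real k * \<delta>) i \<ge> \<theta>"
    have "z q i > 0" if q: "q \<in> {real k * \<delta>..real (Suc k) * \<delta>}" for q
    proof -
      have "\<bar>z q i - z (real k * \<delta>) i\<bar> \<le> 2 * rmax * (q - real k * \<delta>)"
        by (rule fluid_lipschitz[OF f]) (use q le in auto)
      also have "\<dots> \<le> 2 * rmax * \<delta>" using q rmax_nonneg d by (intro mult_left_mono) auto
      finally show ?thesis using ge \<delta> by linarith
    qed
    then have "Y (real (Suc k) * \<delta>) i - Y (real k * \<delta>) i = \<delta>"
      using fD(6)[OF le(3,1,2), of i] d by simp
    moreover have "\<delta> * (1 - \<theta>) \<le> \<delta> * 1" using \<delta> \<theta> by (intro mult_left_mono) auto
    ultimately show "\<delta> * (1 - \<theta>) \<le> Y (real (Suc k) * \<delta>) i - Y (real k * \<delta>) i" by simp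
  qed
qed

context zrp_semigroup begin

text \<open>No probability is left here: the content minus the initial content minus
  \<open>adj r\<close> of the departures telescopes to the summed noise. The bound is
  \<open>\<theta> / 2\<close> because two times are compared.\<close>

lemma skeleton_approx_fluid:
  assumes \<delta>: "0 < \<delta>" and N: "N > 0" and \<theta>: "0 < \<theta>"
    and l: "\<And>k. k \<le> m \<Longrightarrow> particles (l ! k) = N"
    and noise: "\<And>k i. k \<le> m \<Longrightarrow> \<bar>\<Sum>j<k. noise \<delta> N i (l ! j) (l ! Suc j)\<bar> \<le> \<theta> / 2"
    and speed: "\<And>x i. particles x = N \<Longrightarrow> speed (\<delta> * real N) x i \<le> 1 + \<theta>"
    and busy: "exp (cexp * (\<delta> * real N) - \<theta> * real N) \<le> \<theta>"
  shows "approx_fluid \<theta> \<delta> m (\<lambda>k i. real ((l ! k) i) / real N) (\<lambda>k i. \<Sum>j<k. \<delta> * speed (\<delta> * real N) (l ! j) i)"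
  unfolding approx_fluid_def
proof (intro conjI allI impI)
  let ?\<tau> = "\<delta> * real N"
  let ?Y = "\<lambda>k i. \<Sum>j<k. \<delta> * speed ?\<tau> (l ! j) i"
  have \<tau>: "?\<tau> > 0" using \<delta> N by simp
  have tele: "(\<Sum>j<k. noise \<delta> N i (l ! j) (l ! Suc j)) = real ((l ! k) i) / real N - real ((l ! 0) i) / real N - adj r (?Y k) i"
    if "k \<le> m" for k i
    using that
  proof (induction k)
    case 0
    then show ?case by (simp add: adj_def)
  next
    case (Suc k)
    have mn: "min ((l ! k) i) N = (l ! k) i" "min ((l ! Suc k) i) N = (l ! Suc k) i"
      using particles_ge[of "l ! k" i] particles_ge[of "l ! Suc k" i] l[of k] l[of "Suc k"] Suc(2) by simp_all
    have "adj r (?Y (Suc k)) i = adj r (?Y k) i + \<delta> * adj r (speed ?\<tau> (l ! k)) i"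
      by (simp add: adj_add adj_scale)
    then show ?case using Suc mn by (simp add: noise_def diff_divide_distrib)
  qed
  fix k i
  show "0 \<le> real ((l ! k) i) / real N" by simp
  show "\<bar>real ((l ! k) i) / real N - real ((l ! k') i) / real N - adj r (\<lambda>j. ?Y k j - ?Y k' j) i\<bar> \<le> \<theta>" if "k \<le> m" "k' \<le> m" for k'
    unfolding adj_diff
    using noise[OF that(1), of i, unfolded tele[OF that(1)]] noise[OF that(2), of i, unfolded tele[OF that(2)]]
    by linarith
  assume k: "k < m"
  have inc: "?Y (Suc k) i - ?Y k i = \<delta> * speed ?\<tau> (l ! k) i" by simp
  show "0 \<le> ?Y (Suc k) i - ?Y k i" unfolding inc using \<delta> speed_nonneg[OF \<tau>] by simp
  show "?Y (Suc k) i - ?Y k i \<le> \<delta> * (1 + \<theta>)"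
    unfolding inc using \<delta> speed[OF l] k by (intro mult_left_mono) auto
  assume "\<theta> \<le> real ((l ! k) i) / real N"
  then have "\<theta> * real N \<le> real ((l ! k) i)" using N by (simp add: field_simps)
  then have "1 - exp (cexp * ?\<tau> - \<theta> * real N) \<le> speed ?\<tau> (l ! k) i" by (rule speed_ge[OF \<tau>])
  then have "1 - \<theta> \<le> speed ?\<tau> (l ! k) i" using busy by simp
  then show "\<delta> * (1 - \<theta>) \<le> ?Y (Suc k) i - ?Y k i"
    unfolding inc using \<delta> by (intro mult_left_mono) auto
qed

end

lemma exp_minus_eventually:
  assumes "c > (0::real)" "e > 0"
  shows "\<forall>\<^sub>F N in sequentially. exp (- (c * real N)) \<le> e"
proof -
  have "filterlim (\<lambda>N. c * real N) at_top sequentially"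
    by (rule filterlim_tendsto_pos_mult_at_top[OF tendsto_const assms(1) filterlim_real_sequentially])
  then have "((\<lambda>N. exp (- (c * real N))) \<longlongrightarrow> 0) sequentially"
    by (intro filterlim_compose[OF exp_at_bot] filterlim_compose[OF filterlim_uminus_at_bot_at_top])
  then show ?thesis using assms(2) by (auto dest: order_tendstoD(2) elim!: eventually_mono)
qed

context zero_range begin

text \<open>The noise over \<open>T / \<delta>\<close> blocks has variance of order \<open>\<delta>\<close>.\<close>

lemma skeleton_convergence:
  assumes T: "T > 0" and \<epsilon>: "\<epsilon> > 0" and p: "p > 0"
  shows "\<exists>\<delta>>0. \<delta> \<le> \<epsilon> \<and> (\<exists>\<theta>>0. \<forall>\<^sub>F N in sequentially. \<forall>P (x :: 'v \<Rightarrow> nat) u. markov_semigroup P \<and> has_generator P (zrp_generator r g) \<and>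
     particles x = N \<and> u \<in> prob_simplex \<and> (\<forall>i. \<bar>real (x i) / real N - u $ i\<bar> \<le> \<theta>) \<longrightarrow>
     measure_pmf.prob (walk (P (\<delta> * real N)) (nat \<lfloor>T / \<delta>\<rfloor>) x)
       {l. \<exists>k\<le>nat \<lfloor>T / \<delta>\<rfloor>. \<exists>i. \<bar>real ((l ! k) i) / real N - limit_path r u (real k * \<delta>) $ i\<bar> > \<epsilon>} \<le> p)"
proof -
  obtain \<theta> where \<theta>: "\<theta> > 0" "\<theta> \<le> 1" and stable: "\<And>\<delta> n x Y z U k i. 0 < \<delta> \<Longrightarrow> \<delta> \<le> \<theta> \<Longrightarrow> real n * \<delta> \<le> T \<Longrightarrow>
      approx_fluid \<theta> \<delta> n x Y \<Longrightarrow> approx_fluid \<theta> \<delta> n z U \<Longrightarrow> (\<And>i. \<bar>x 0 i - z 0 i\<bar> \<le> \<theta>) \<Longrightarrow>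
      (\<And>k. k \<le> n \<Longrightarrow> (\<Sum>i\<in>UNIV. z k i) = 1) \<Longrightarrow> k \<le> n \<Longrightarrow> \<bar>x k i - z k i\<bar> \<le> \<epsilon>"
    using approx_fluid_stable[OF \<epsilon>, of T] T by (metis less_imp_le)
  define V where "V = real CARD('v)"
  have V: "V > 0" unfolding V_def by simp
  define c where "c = cexp + 1"
  have c: "c > 0" using cexp_nonneg by (simp add: c_def)
  \<comment> \<open>Union bound over \<open>V\<close> sites: at most \<open>T / \<delta>\<close>
    blocks of variance at most \<open>\<delta>^2 * (c^2 + 1)\<close>, against the level
    \<open>\<theta> / 2\<close>, give the probability \<open>C * \<delta>\<close>.\<close>
  define C where "C = V * (T * (c\<^sup>2 + 1)) / (\<theta> / 2)\<^sup>2"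
  have C: "C > 0" unfolding C_def using V T \<theta> by (intro divide_pos_pos mult_pos_pos add_nonneg_pos) auto
  \<comment> \<open>\<open>\<theta> / (2 * c)\<close> keeps occupied sites from being emptied within
    a block, \<open>\<theta> / (2 * rmax + 1) / 2\<close> makes the limit path an approximate
    solution, and \<open>p / C\<close> makes large noise unlikely.\<close>
  define \<delta> where "\<delta> = min (min \<epsilon> \<theta>) (min (min T 1) (min (\<theta> / (2 * c)) (min (\<theta> / (2 * rmax + 1) / 2) (p / C))))"
  have \<delta>: "\<delta> > 0" unfolding \<delta>_def using \<epsilon> \<theta> T c rmax_nonneg p C by simp
  have \<delta>_le: "\<delta> \<le> \<epsilon>" "\<delta> \<le> \<theta>" "\<delta> \<le> T" "\<delta> \<le> \<theta> / (2 * c)" "\<delta> \<le> \<theta> / (2 * rmax + 1) / 2" "\<delta> \<le> p / C"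
    unfolding \<delta>_def by auto
  define M where "M = nat \<lfloor>T / \<delta>\<rfloor>"
  have M: "real M * \<delta> \<le> T"
  proof -
    have "real M \<le> T / \<delta>" unfolding M_def using T \<delta> by (simp add: of_nat_floor)
    then show ?thesis using \<delta> by (simp add: field_simps)
  qed
  obtain n0 where n0: "\<And>P x \<tau> i. markov_semigroup P \<Longrightarrow> has_generator P (zrp_generator r g) \<Longrightarrow> particles x \<ge> n0 \<Longrightarrow> \<tau> \<ge> real n0 \<Longrightarrow>
     time_mean P x \<tau> (\<lambda>\<eta>. g (\<eta> i)) \<le> 1 + \<theta>"
    using speed_mean_le[OF \<theta>(1)] by blast
  \<comment> \<open>With \<delta> fixed, the exponentially small part of the variance is absorbed
    into \<open>\<delta>^2\<close> for large \<open>N\<close>.\<close>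
  have "\<forall>\<^sub>F N in sequentially. N \<ge> n0 \<and> N > 0 \<and> \<delta> * real N \<ge> real n0 \<and> exp (- (\<theta> / 2 * real N)) \<le> \<theta> \<and> exp (- (\<delta> * real N)) \<le> \<delta>\<^sup>2"
  proof (intro eventually_conj)
    show "\<forall>\<^sub>F N in sequentially. n0 \<le> N" by (rule eventually_ge_at_top)
    show "\<forall>\<^sub>F N in sequentially. 0 < N" by (rule eventually_gt_at_top)
    have "\<forall>\<^sub>F N in sequentially. N \<ge> nat \<lceil>real n0 / \<delta>\<rceil>" by (rule eventually_ge_at_top)
    then show "\<forall>\<^sub>F N in sequentially. real n0 \<le> \<delta> * real N"
    proof eventually_elim
      case (elim N)
      then have "real n0 / \<delta> \<le> real N" by linarith
      then show ?case using \<delta> by (simp add: field_simps)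
    qed
    show "\<forall>\<^sub>F N in sequentially. exp (- (\<theta> / 2 * real N)) \<le> \<theta>" by (rule exp_minus_eventually) (use \<theta> in auto)
    show "\<forall>\<^sub>F N in sequentially. exp (- (\<delta> * real N)) \<le> \<delta>\<^sup>2" by (rule exp_minus_eventually) (use \<delta> in auto)
  qed
  then have "\<forall>\<^sub>F N in sequentially. \<forall>P (x :: 'v \<Rightarrow> nat) u. markov_semigroup P \<and> has_generator P (zrp_generator r g) \<and>
     particles x = N \<and> u \<in> prob_simplex \<and> (\<forall>i. \<bar>real (x i) / real N - u $ i\<bar> \<le> \<theta>) \<longrightarrow>
     measure_pmf.prob (walk (P (\<delta> * real N)) M x)
       {l. \<exists>k\<le>M. \<exists>i. \<bar>real ((l ! k) i) / real N - limit_path r u (real k * \<delta>) $ i\<bar> > \<epsilon>} \<le> p"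
  proof eventually_elim
    case (elim N)
    show ?case
    proof (intro allI impI; elim conjE)
      fix P and x :: "'v \<Rightarrow> nat" and u
      assume P: "markov_semigroup P" "has_generator P (zrp_generator r g)" and x: "particles x = N"
        and u: "u \<in> prob_simplex" and xu: "\<forall>i. \<bar>real (x i) / real N - u $ i\<bar> \<le> \<theta>"
      interpret zrp_semigroup r g P by (rule zrp_semigroupI[OF P])
      have N: "N > 0" using elim by simp
      let ?W = "walk (P (\<delta> * real N)) M x"
      let ?B = "\<lambda>i. {l. \<exists>k\<le>M. \<bar>0 + (\<Sum>j<k. noise \<delta> N i (l ! j) (l ! Suc j))\<bar> \<ge> \<theta> / 2}"
      obtain Y where f: "fluid r T (\<lambda>t. ($) (limit_path r u t)) Y" using limit_path_fluid[OF u] by blast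
      have fa: "approx_fluid \<theta> \<delta> M (\<lambda>k. ($) (limit_path r u (real k * \<delta>))) (\<lambda>k. Y (real k * \<delta>))"
      proof (rule fluid_approx_fluid[OF f \<delta> _ M \<theta>(1)])
        have "2 * rmax * \<delta> \<le> (2 * rmax + 1) * \<delta>" using \<delta> by (intro mult_right_mono) auto
        also have "\<dots> \<le> (2 * rmax + 1) * (\<theta> / (2 * rmax + 1) / 2)" using \<delta>_le rmax_nonneg by (intro mult_left_mono) auto
        also have "\<dots> = \<theta> / 2" using rmax_nonneg by (simp add: field_simps)
        finally show "2 * rmax * \<delta> < \<theta>" using \<theta> by simp
      qed
      \<comment> \<open>Off the noise events the skeleton and the limit path are both approximate
        solutions with nearby starting points, so that stability applies.\<close>
      have bad: "measure_pmf.prob ?W {l. \<exists>k\<le>M. \<exists>i. \<bar>real ((l ! k) i) / real N - limit_path r u (real k * \<delta>) $ i\<bar> > \<epsilon>}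
        \<le> measure_pmf.prob ?W (\<Union>i. ?B i)"
      proof (rule prob_mono_support, rule ccontr)
        fix l assume l: "l \<in> set_pmf ?W" "l \<in> {l. \<exists>k\<le>M. \<exists>i. \<bar>real ((l ! k) i) / real N - limit_path r u (real k * \<delta>) $ i\<bar> > \<epsilon>}"
          and ok: "l \<notin> (\<Union>i. ?B i)"
        have len: "length l = Suc M" and l0: "l ! 0 = x" using walk_support[OF l(1)] by auto
        have sub: "set l \<subseteq> {y. particles y = N}"
          by (rule walk_invariant[OF _ _ l(1)]) (use x particles_preserved[of "\<delta> * real N"] \<delta> in auto)
        have part: "particles (l ! k) = N" if "k \<le> M" for k
        proof -
          have "l ! k \<in> set l" using len that by simp
          then show ?thesis using sub by blast
        qed
        have ax: "approx_fluid \<theta> \<delta> M (\<lambda>k i. real ((l ! k) i) / real N) (\<lambda>k i. \<Sum>j<k. \<delta> * speed (\<delta> * real N) (l ! j) i)"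
        proof (rule skeleton_approx_fluid[OF \<delta> N \<theta>(1) part])
          show "\<bar>\<Sum>j<k. noise \<delta> N i (l ! j) (l ! Suc j)\<bar> \<le> \<theta> / 2" if "k \<le> M" for k i
          proof -
            have "\<not> \<bar>0 + (\<Sum>j<k. noise \<delta> N i (l ! j) (l ! Suc j))\<bar> \<ge> \<theta> / 2" using ok that by blast
            then show ?thesis by simp
          qed
          show "speed (\<delta> * real N) y i \<le> 1 + \<theta>" if "particles y = N" for y i
            by (rule n0[OF P]) (use that elim in auto)
          have "cexp * \<delta> \<le> \<theta> / 2"
          proof -
            have "cexp * \<delta> \<le> c * (\<theta> / (2 * c))" using \<delta>_le \<delta> cexp_nonneg by (intro mult_mono) (auto simp: c_def)
            then show ?thesis using c by simp
          qed
          then have "cexp * \<delta> * real N \<le> \<theta> / 2 * real N" by (rule mult_right_mono) simp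
          then have "cexp * (\<delta> * real N) - \<theta> * real N \<le> - (\<theta> / 2 * real N)" by (simp add: algebra_simps)
          then have "exp (cexp * (\<delta> * real N) - \<theta> * real N) \<le> exp (- (\<theta> / 2 * real N))" by simp
          then show "exp (cexp * (\<delta> * real N) - \<theta> * real N) \<le> \<theta>" using elim by linarith
        qed
        have close: "\<bar>real ((l ! k) i) / real N - limit_path r u (real k * \<delta>) $ i\<bar> \<le> \<epsilon>" if "k \<le> M" for k i
        proof (rule stable[OF \<delta> \<delta>_le(2) M ax fa _ _ that])
          show "\<bar>real ((l ! 0) i) / real N - limit_path r u (real 0 * \<delta>) $ i\<bar> \<le> \<theta>" for i
            using xu l0 limit_path_0[OF u] by simp
          show "(\<Sum>i\<in>UNIV. limit_path r u (real k * \<delta>) $ i) = 1" if k: "k \<le> M" for k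
          proof -
            have "real k * \<delta> \<le> real M * \<delta>" using k \<delta> by (intro mult_right_mono) auto
            then have "real k * \<delta> \<le> T" "0 \<le> real k * \<delta>" using M \<delta> by (linarith, simp)
            then have "limit_path r u (real k * \<delta>) $ i = u $ i + adj r (Y (real k * \<delta>)) i" for i
              using fluidD(3)[OF f, of "real k * \<delta>" i] limit_path_0[OF u] by simp
            then show ?thesis using prob_simplexD(3)[OF u] by (simp add: sum.distrib sum_adj_zero)
          qed
        qed
        obtain k i where "k \<le> M" "\<bar>real ((l ! k) i) / real N - limit_path r u (real k * \<delta>) $ i\<bar> > \<epsilon>"
          using l(2) by blast
        then show False using close[of k i] by linarith
      qed
      have "measure_pmf.prob ?W (\<Union>i. ?B i) \<le> (\<Sum>i\<in>UNIV. measure_pmf.prob ?W (?B i))"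
        by (rule measure_pmf.finite_measure_subadditive_finite) auto
      also have "\<dots> \<le> (\<Sum>i\<in>(UNIV::'v set). (0\<^sup>2 + real M * (((cexp + 1) * \<delta>)\<^sup>2 + exp (- (\<delta> * real N)))) / (\<theta> / 2)\<^sup>2)"
        by (intro sum_mono noise_prob \<delta> N x) (use \<theta> in auto)
      also have "\<dots> = V * (real M * ((c * \<delta>)\<^sup>2 + exp (- (\<delta> * real N)))) / (\<theta> / 2)\<^sup>2" by (simp add: V_def c_def)
      also have "\<dots> \<le> V * (real M * ((c * \<delta>)\<^sup>2 + \<delta>\<^sup>2)) / (\<theta> / 2)\<^sup>2"
        using elim V by (intro divide_right_mono mult_left_mono) auto
      also have "real M * ((c * \<delta>)\<^sup>2 + \<delta>\<^sup>2) = (real M * \<delta>) * (\<delta> * (c\<^sup>2 + 1))" by (simp add: power2_eq_square algebra_simps)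
      also have "V * ((real M * \<delta>) * (\<delta> * (c\<^sup>2 + 1))) / (\<theta> / 2)\<^sup>2 \<le> V * (T * (\<delta> * (c\<^sup>2 + 1))) / (\<theta> / 2)\<^sup>2"
        using M V \<delta> by (intro divide_right_mono mult_left_mono mult_right_mono) auto
      also have "\<dots> = C * \<delta>" by (simp add: C_def)
      also have "\<dots> \<le> C * (p / C)" using \<delta>_le C by (intro mult_left_mono) auto
      also have "\<dots> = p" using C by simp
      finally show "measure_pmf.prob ?W {l. \<exists>k\<le>M. \<exists>i. \<bar>real ((l ! k) i) / real N - limit_path r u (real k * \<delta>) $ i\<bar> > \<epsilon>} \<le> p"
        using bad by simp
    qed
  qed
  then show ?thesis using \<delta> \<delta>_le(1) \<theta>(1) unfolding M_def by blast
qed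

end

section \<open>Control of the whole path\<close>

context
  fixes G :: "(('s::{countable,topological_space} \<Rightarrow> real) \<Rightarrow> 's \<Rightarrow> real)" and M :: "'w measure" and X :: "real \<Rightarrow> 'w \<Rightarrow> 's"
    and P :: "real \<Rightarrow> 's \<Rightarrow> 's pmf" and x0 :: 's
  assumes prob: "prob_space M" and meas: "\<And>t. t \<ge> 0 \<Longrightarrow> X t \<in> M \<rightarrow>\<^sub>M count_space UNIV"
    and semigroup: "markov_semigroup P"
    and markov: "\<And>s t (f :: 's \<Rightarrow> real). s \<ge> 0 \<Longrightarrow> t \<ge> 0 \<Longrightarrow> bounded (range f) \<Longrightarrow>
        AE \<omega> in M. real_cond_exp M (natural_filtration M X s) (\<lambda>\<omega>. f (X (s + t) \<omega>)) \<omega> = measure_pmf.expectation (P t (X s \<omega>)) f"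
    and initial: "AE \<omega> in M. X 0 \<omega> = x0"
begin

interpretation prob_space M by (rule prob)

lemma sets_filtration: "sets (natural_filtration M X s) = sigma_sets (space M) {X t -` B \<inter> space M |t B. 0 \<le> t \<and> t \<le> s}"
  unfolding natural_filtration_def by (rule sets_measure_of) auto

lemma space_filtration: "space (natural_filtration M X s) = space M"
  unfolding natural_filtration_def by (rule space_measure_of) auto

lemma subalgebra_filtration: "subalgebra M (natural_filtration M X s)"
  unfolding subalgebra_def space_filtration sets_filtration
  by (intro conjI refl sets.sigma_sets_subset) (auto intro: measurable_sets[OF meas])

lemma sigma_finite_filtration: "sigma_finite_subalgebra M (natural_filtration M X s)"
proof -
  interpret F: finite_measure_subalgebra M "natural_filtration M X s"
    by unfold_locales (rule subalgebra_filtration)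
  show ?thesis by (rule F.sigma_finite_subalgebra_axioms)
qed

text \<open>The Markov property is given through conditional expectations; on a past event that
  fixes the state at time \<open>t\<close> it becomes multiplication by a transition
  probability.\<close>

lemma markov_step:
  assumes "0 \<le> t" "0 \<le> h" "A \<in> sets (natural_filtration M X t)" "\<And>\<omega>. \<omega> \<in> A \<Longrightarrow> X t \<omega> = x"
  shows "prob (A \<inter> {\<omega> \<in> space M. X (t + h) \<omega> = y}) = prob A * pmf (P h x) y"
proof -
  interpret F: sigma_finite_subalgebra M "natural_filtration M X t" by (rule sigma_finite_filtration)
  have A: "A \<in> sets M" using assms(3) subalgebra_filtration[of t] unfolding subalgebra_def by blast
  have AM: "A \<subseteq> space M" using sets.sets_into_space[OF A] .
  have m: "X (t + h) \<in> M \<rightarrow>\<^sub>M count_space UNIV" using meas assms by simp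
  let ?f = "indicator {y} :: 's \<Rightarrow> real"
  have fm: "(\<lambda>\<omega>. ?f (X (t + h) \<omega>)) \<in> borel_measurable M" by (rule measurable_compose[OF m]) simp
  have int: "integrable M (\<lambda>\<omega>. ?f (X (t + h) \<omega>))"
    by (rule integrable_const_bound[where B=1]) (use fm in auto)
  have "prob (A \<inter> {\<omega> \<in> space M. X (t + h) \<omega> = y}) = (\<integral>\<omega>. indicator (A \<inter> {\<omega> \<in> space M. X (t + h) \<omega> = y}) \<omega> \<partial>M)"
    using AM by (simp add: Int_absorb2 le_infI1)
  also have "\<dots> = (\<integral>\<omega>\<in>A. ?f (X (t + h) \<omega>) \<partial>M)"
    unfolding set_lebesgue_integral_def by (rule Bochner_Integration.integral_cong) (auto simp: indicator_def)
  also have "\<dots> = (\<integral>\<omega>\<in>A. real_cond_exp M (natural_filtration M X t) (\<lambda>\<omega>. ?f (X (t + h) \<omega>)) \<omega> \<partial>M)"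
    by (rule F.real_cond_exp_intA[OF int assms(3)])
  also have "\<dots> = (\<integral>\<omega>\<in>A. pmf (P h x) y \<partial>M)"
  proof (rule set_lebesgue_integral_cong_AE)
    have "AE \<omega> in M. real_cond_exp M (natural_filtration M X t) (\<lambda>\<omega>. ?f (X (t + h) \<omega>)) \<omega> = measure_pmf.expectation (P h (X t \<omega>)) ?f"
      by (rule markov[OF assms(1,2)]) (rule bounded_fun_intros)
    then show "AE \<omega>\<in>A in M. real_cond_exp M (natural_filtration M X t) (\<lambda>\<omega>. ?f (X (t + h) \<omega>)) \<omega> = pmf (P h x) y"
      by eventually_elim (auto simp: assms(4) measure_pmf_single)
  qed (use A in auto)
  also have "\<dots> = prob A * pmf (P h x) y" using A by (simp add: set_lebesgue_integral_def)
  finally show ?thesis .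
qed

lemma cylinder_prob:
  assumes t: "\<And>k. k \<le> m \<Longrightarrow> 0 \<le> t k" "\<And>k. k < m \<Longrightarrow> t k \<le> t (Suc k)"
  shows "prob {\<omega> \<in> space M. \<forall>k\<le>m. X (t k) \<omega> = l k} = prob {\<omega> \<in> space M. X (t 0) \<omega> = l 0} * (\<Prod>k<m. pmf (P (t (Suc k) - t k) (l k)) (l (Suc k)))"
  using t
proof (induction m)
  case (Suc m)
  define A where "A = {\<omega> \<in> space M. \<forall>k\<le>m. X (t k) \<omega> = l k}"
  have mono: "t k \<le> t m" if "k \<le> m" for k
    using that by (induction rule: inc_induct) (auto intro: order_trans[OF Suc.prems(2)])
  have "A = (\<Inter>k\<in>{..m}. X (t k) -` {l k} \<inter> space M)" by (auto simp: A_def)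
  also have "\<dots> \<in> sets (natural_filtration M X (t m))"
  proof (rule sets.finite_INT)
    fix k assume "k \<in> {..m}"
    then have "X (t k) -` {l k} \<inter> space M \<in> {X t' -` B \<inter> space M |t' B. 0 \<le> t' \<and> t' \<le> t m}"
      using Suc.prems(1)[of k] mono by auto
    then show "X (t k) -` {l k} \<inter> space M \<in> sets (natural_filtration M X (t m))"
      unfolding sets_filtration by (rule sigma_sets.Basic)
  qed auto
  finally have A: "A \<in> sets (natural_filtration M X (t m))" .
  have step: "prob (A \<inter> {\<omega> \<in> space M. X (t m + (t (Suc m) - t m)) \<omega> = l (Suc m)}) = prob A * pmf (P (t (Suc m) - t m) (l m)) (l (Suc m))"
    by (rule markov_step[OF _ _ A]) (use Suc.prems in \<open>auto simp: A_def\<close>)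
  have "{\<omega> \<in> space M. \<forall>k\<le>Suc m. X (t k) \<omega> = l k} = A \<inter> {\<omega> \<in> space M. X (t m + (t (Suc m) - t m)) \<omega> = l (Suc m)}"
    by (auto simp: A_def le_Suc_eq)
  then show ?case using step Suc.IH Suc.prems by (simp add: A_def)
qed simp

lemma initial_prob: "s \<ge> 0 \<Longrightarrow> prob {\<omega> \<in> space M. X s \<omega> = x} = pmf (P s x0) x"
proof -
  assume s: "s \<ge> 0"
  define t where "t k = (if k = 0 then 0 else s)" for k :: nat
  have A: "{\<omega> \<in> space M. X 0 \<omega> = x0} \<in> sets M"
    using measurable_sets[OF meas[of 0], of "{x0}"] by (simp add: vimage_def Int_def conj_commute)
  have "prob {\<omega> \<in> space M. X s \<omega> = x} = prob {\<omega> \<in> space M. \<forall>k\<le>1. X (t k) \<omega> = (if k = 0 then x0 else x)}"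
  proof (rule measure_eq_AE)
    show "AE \<omega> in M. (\<omega> \<in> {\<omega> \<in> space M. X s \<omega> = x}) = (\<omega> \<in> {\<omega> \<in> space M. \<forall>k\<le>1. X (t k) \<omega> = (if k = 0 then x0 else x)})"
      using initial by eventually_elim (auto simp: t_def le_Suc_eq)
    have single: "{\<omega> \<in> space M. X q \<omega> = z} \<in> sets M" if "q \<ge> 0" for q z
      using measurable_sets[OF meas[OF that], of "{z}"] by (simp add: vimage_def Int_def conj_commute)
    show "{\<omega> \<in> space M. X s \<omega> = x} \<in> sets M" using single s by simp
    have "{\<omega> \<in> space M. \<forall>k\<le>1. X (t k) \<omega> = (if k = 0 then x0 else x)} = {\<omega> \<in> space M. X 0 \<omega> = x0} \<inter> {\<omega> \<in> space M. X s \<omega> = x}"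
      by (auto simp: t_def le_Suc_eq)
    then show "{\<omega> \<in> space M. \<forall>k\<le>1. X (t k) \<omega> = (if k = 0 then x0 else x)} \<in> sets M" using single s by simp
  qed
  also have "\<dots> = prob {\<omega> \<in> space M. X (t 0) \<omega> = x0} * pmf (P s x0) x"
    using cylinder_prob[of 1 t "\<lambda>k. if k = 0 then x0 else x"] s by (simp add: t_def)
  also have "prob {\<omega> \<in> space M. X (t 0) \<omega> = x0} = 1"
    using initial A by (subst prob_eq_1) (auto simp: t_def)
  finally show ?thesis by simp
qed

text \<open>Lists over a countable set form a countable space, so measurability and equality of laws
  need only be checked at single lists, whose events are cylinders. The chain is started at time
  \<open>s\<close>, from the law \<open>P s x0\<close>, since blocks begin at arbitrary
  times.\<close>

lemma skeleton_law:
  assumes s: "s \<ge> 0" and h: "h \<ge> 0"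
  shows "prob {\<omega> \<in> space M. map (\<lambda>k. X (s + real k * h) \<omega>) [0..<Suc m] \<in> E} = measure_pmf.prob (bind_pmf (P s x0) (walk (P h) m)) E"
    and "{\<omega> \<in> space M. map (\<lambda>k. X (s + real k * h) \<omega>) [0..<Suc m] \<in> E} \<in> events"
proof -
  let ?Z = "\<lambda>\<omega>. map (\<lambda>k. X (s + real k * h) \<omega>) [0..<Suc m]"
  have tpos: "0 \<le> s + real k * h" for k using s h by simp
  have single_eq: "{\<omega> \<in> space M. ?Z \<omega> = l} = (if length l = Suc m then {\<omega> \<in> space M. \<forall>k\<le>m. X (s + real k * h) \<omega> = l ! k} else {})" for l
    by (auto simp: list_eq_iff_nth_eq less_Suc_eq_le simp del: upt_Suc)
  have single_meas: "{\<omega> \<in> space M. \<forall>k\<le>m. X (s + real k * h) \<omega> = l ! k} \<in> events" for l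
  proof -
    have "{\<omega> \<in> space M. \<forall>k\<le>m. X (s + real k * h) \<omega> = l ! k} = (\<Inter>k\<in>{..m}. X (s + real k * h) -` {l ! k} \<inter> space M)" by auto
    also have "\<dots> \<in> events" by (rule sets.finite_INT) (auto intro: measurable_sets[OF meas[OF tpos]])
    finally show ?thesis .
  qed
  have Zm: "?Z \<in> M \<rightarrow>\<^sub>M count_space UNIV"
  proof (rule measurable_count_space_eq_countable[THEN iffD2, rotated])
    show "?Z \<in> space M \<rightarrow> UNIV \<and> (\<forall>l\<in>UNIV. ?Z -` {l} \<inter> space M \<in> events)"
    proof (intro conjI ballI)
      fix l
      have "?Z -` {l} \<inter> space M = {\<omega> \<in> space M. ?Z \<omega> = l}" by auto
      also have "\<dots> \<in> events"
      proof (cases "length l = Suc m")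
        case True
        show ?thesis by (subst single_eq) (simp only: True simp_thms if_True single_meas)
      next
        case False
        show ?thesis by (subst single_eq) (simp only: False if_False sets.empty_sets)
      qed
      finally show "?Z -` {l} \<inter> space M \<in> events" .
    qed simp
  qed simp
  have "distr M (count_space UNIV) ?Z = measure_pmf (bind_pmf (P s x0) (walk (P h) m))"
  proof (rule measure_eqI_countable[where A=UNIV])
    fix l
    have pb: "pmf (bind_pmf (P s x0) (walk (P h) m)) l = (if length l = Suc m then pmf (P s x0) (l ! 0) * (\<Prod>k<m. pmf (P h (l ! k)) (l ! Suc k)) else 0)"
    proof -
      have "pmf (bind_pmf (P s x0) (walk (P h) m)) l = measure_pmf.expectation (P s x0) (\<lambda>y. pmf (walk (P h) m y) l)" by (rule pmf_bind)
      also have "\<dots> = measure_pmf.expectation (P s x0) (\<lambda>y. (if length l = Suc m then (\<Prod>k<m. pmf (P h (l ! k)) (l ! Suc k)) else 0) * indicator {l ! 0} y)"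
        by (rule Bochner_Integration.integral_cong) (auto simp: pmf_walk indicator_def)
      also have "\<dots> = (if length l = Suc m then (\<Prod>k<m. pmf (P h (l ! k)) (l ! Suc k)) else 0) * pmf (P s x0) (l ! 0)"
        by (simp only: integral_mult_right_zero) (simp add: measure_pmf_single)
      finally show ?thesis by (simp add: mult.commute)
    qed
    have "emeasure (distr M (count_space UNIV) ?Z) {l} = emeasure M {\<omega> \<in> space M. ?Z \<omega> = l}"
      using Zm by (simp add: emeasure_distr vimage_def Int_def conj_commute del: upt_Suc)
    also have "\<dots> = ennreal (prob {\<omega> \<in> space M. ?Z \<omega> = l})" by (rule emeasure_eq_measure)
    also have "prob {\<omega> \<in> space M. ?Z \<omega> = l} = pmf (bind_pmf (P s x0) (walk (P h) m)) l"
    proof (cases "length l = Suc m")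
      case True
      have "prob {\<omega> \<in> space M. \<forall>k\<le>m. X (s + real k * h) \<omega> = l ! k} =
         prob {\<omega> \<in> space M. X (s + real 0 * h) \<omega> = l ! 0} * (\<Prod>k<m. pmf (P (s + real (Suc k) * h - (s + real k * h)) (l ! k)) (l ! Suc k))"
        by (rule cylinder_prob) (use s h in \<open>auto simp: mult_right_mono\<close>)
      moreover have "s + real (Suc k) * h - (s + real k * h) = h" for k by (simp add: algebra_simps)
      ultimately show ?thesis using True initial_prob[OF s] unfolding single_eq pb by simp
    next
      case False
      then show ?thesis by (simp only: single_eq pb if_False measure_empty)
    qed
    finally show "emeasure (distr M (count_space UNIV) ?Z) {l} = emeasure (measure_pmf (bind_pmf (P s x0) (walk (P h) m))) {l}"
      by (simp add: emeasure_pmf_single)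
  qed auto
  then have "measure (distr M (count_space UNIV) ?Z) E = measure_pmf.prob (bind_pmf (P s x0) (walk (P h) m)) E" by simp
  then show "prob {\<omega> \<in> space M. ?Z \<omega> \<in> E} = measure_pmf.prob (bind_pmf (P s x0) (walk (P h) m)) E"
    using Zm by (simp add: measure_distr vimage_def Int_def conj_commute del: upt_Suc)
  show "{\<omega> \<in> space M. ?Z \<omega> \<in> E} \<in> events"
    using measurable_sets[OF Zm, of E] by (simp add: vimage_def Int_def conj_commute del: upt_Suc)
qed

end

section \<open>Oscillation between grid times\<close>

lemma open_singleton_fun: "open {x :: 'v::finite \<Rightarrow> nat}"
proof -
  have "{x} = Pi\<^sub>E UNIV (\<lambda>i. {x i})" by (auto simp: PiE_UNIV_domain)
  moreover have "open (Pi\<^sub>E UNIV (\<lambda>i. {x i}))" by (rule open_PiE) (rule Topological_Spaces.open_discrete, simp)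
  ultimately show ?thesis by simp
qed

lemma cadlag_right_const:
  fixes x :: "real \<Rightarrow> 'v::finite \<Rightarrow> nat"
  assumes "cadlag x" "t \<ge> 0"
  obtains e where "e > 0" "\<And>s. t \<le> s \<Longrightarrow> s < t + e \<Longrightarrow> x s = x t"
proof -
  have "(x \<longlongrightarrow> x t) (at_right t)" using assms by (simp add: cadlag_def)
  then have "\<forall>\<^sub>F s in at_right t. x s \<in> {x t}"
    by (rule topological_tendstoD) (auto simp: open_singleton_fun)
  then obtain b where b: "b > t" "\<And>s. s > t \<Longrightarrow> s < b \<Longrightarrow> x s = x t"
    unfolding eventually_at_right_field by auto
  have right: "x s = x t" if "t \<le> s" "s < t + (b - t)" for s
    using b(2)[of s] that by (cases "s = t") auto
  show ?thesis
  proof (rule that)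
    show "b - t > 0" using b(1) by simp
  qed (rule right)
qed

lemma dyadic_between:
  assumes "0 \<le> a" "a < b" "b \<le> (1::real)"
  obtains q j where "j \<le> 2 ^ q" "a < real j / 2 ^ q" "real j / 2 ^ q < b"
proof -
  obtain q where q: "(1/2) ^ q < b - a" using real_arch_pow_inv[of "b - a" "1/2"] assms by auto
  define j where "j = nat \<lfloor>a * 2 ^ q\<rfloor> + 1"
  have nn: "a * 2 ^ q \<ge> 0" using assms by simp
  have "real j = of_int \<lfloor>a * 2 ^ q\<rfloor> + 1" unfolding j_def using nn by simp
  then have j: "a * 2 ^ q < real j" "real j \<le> a * 2 ^ q + 1" by linarith+
  have 1: "a < real j / 2 ^ q" using j(1) by (simp add: field_simps)
  have "real j / 2 ^ q \<le> a + (1/2) ^ q" using j(2) by (simp add: field_simps)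
  then have 2: "real j / 2 ^ q < b" using q by linarith
  then have "real j / 2 ^ q \<le> 1" using assms by linarith
  then have "real j \<le> 2 ^ q" by (simp add: field_simps)
  then have "j \<le> 2 ^ q" by (metis of_nat_le_iff of_nat_numeral of_nat_power)
  then show ?thesis using 1 2 that by blast
qed

locale started_zrp = zrp_semigroup r g P for r :: "'v::finite \<Rightarrow> 'v \<Rightarrow> real" and g P +
  fixes M :: "'w measure" and X :: "real \<Rightarrow> 'w \<Rightarrow> 'v \<Rightarrow> nat" and x0 :: "'v \<Rightarrow> nat"
  assumes prob: "prob_space M" and meas: "\<And>t. t \<ge> 0 \<Longrightarrow> X t \<in> M \<rightarrow>\<^sub>M count_space UNIV"
    and paths: "\<And>\<omega>. \<omega> \<in> space M \<Longrightarrow> cadlag (\<lambda>t. X t \<omega>)"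
    and markov: "\<And>s t (f :: ('v \<Rightarrow> nat) \<Rightarrow> real). s \<ge> 0 \<Longrightarrow> t \<ge> 0 \<Longrightarrow> bounded (range f) \<Longrightarrow>
        AE \<omega> in M. real_cond_exp M (natural_filtration M X s) (\<lambda>\<omega>. f (X (s + t) \<omega>)) \<omega> = measure_pmf.expectation (P t (X s \<omega>)) f"
    and initial: "AE \<omega> in M. X 0 \<omega> = x0"
begin

sublocale prob_space M by (rule prob)

lemma skeleton:
  assumes "s \<ge> 0" "h \<ge> 0"
  shows "prob {\<omega> \<in> space M. map (\<lambda>k. X (s + real k * h) \<omega>) [0..<Suc m] \<in> F} = measure_pmf.prob (bind_pmf (P s x0) (walk (P h) m)) F"
    and "{\<omega> \<in> space M. map (\<lambda>k. X (s + real k * h) \<omega>) [0..<Suc m] \<in> F} \<in> events"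
  using skeleton_law[OF prob meas P_semigroup markov initial assms] by blast+

lemma law: "t \<ge> 0 \<Longrightarrow> prob {\<omega> \<in> space M. X t \<omega> \<in> F} = measure_pmf.prob (P t x0) F"
  and law_event: "t \<ge> 0 \<Longrightarrow> {\<omega> \<in> space M. X t \<omega> \<in> F} \<in> events"
proof -
  assume t: "t \<ge> 0"
  have e: "{\<omega> \<in> space M. map (\<lambda>k. X (t + real k * 0) \<omega>) [0..<Suc 0] \<in> {l. hd l \<in> F}} = {\<omega> \<in> space M. X t \<omega> \<in> F}"
    by simp
  have "walk (P 0) 0 = (\<lambda>x. return_pmf [x])" by auto
  then have "measure_pmf.prob (bind_pmf (P t x0) (walk (P 0) 0)) {l. hd l \<in> F} = measure_pmf.prob (map_pmf (\<lambda>x. [x]) (P t x0)) {l. hd l \<in> F}"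
    by (simp add: map_pmf_def)
  also have "\<dots> = measure_pmf.prob (P t x0) F" by (simp add: vimage_def)
  finally show "prob {\<omega> \<in> space M. X t \<omega> \<in> F} = measure_pmf.prob (P t x0) F"
    using skeleton(1)[OF t order_refl, of 0 "{l. hd l \<in> F}"] unfolding e by simp
  show "{\<omega> \<in> space M. X t \<omega> \<in> F} \<in> events"
    using skeleton(2)[OF t order_refl, of 0 "{l. hd l \<in> F}"] unfolding e .
qed

text \<open>At a given time conservation holds almost surely; rational times cover all times,
  because a path is constant to the right of every time.\<close>

lemma AE_particles: "AE \<omega> in M. \<forall>t\<ge>0. particles (X t \<omega>) = particles x0"
proof -
  have "AE \<omega> in M. particles (X t \<omega>) = particles x0" if t: "t \<ge> 0" for t
  proof -
    have "prob {\<omega> \<in> space M. X t \<omega> \<in> {y. particles y = particles x0}} = measure_pmf.prob (P t x0) {y. particles y = particles x0}"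
      by (rule law[OF t])
    also have "\<dots> = 1"
      by (subst measure_pmf.prob_eq_1) (auto simp: AE_measure_pmf_iff particles_preserved[OF t])
    finally have "AE \<omega> in M. \<omega> \<in> {\<omega> \<in> space M. X t \<omega> \<in> {y. particles y = particles x0}}"
      by (subst (asm) prob_eq_1[OF law_event[OF t]])
    then show ?thesis by eventually_elim auto
  qed
  then have "AE \<omega> in M. \<forall>q\<in>\<rat> \<inter> {0..}. particles (X q \<omega>) = particles x0"
    by (subst AE_ball_countable) (auto intro: countable_subset[OF _ countable_rat])
  with AE_space show ?thesis
  proof eventually_elim
    case (elim \<omega>)
    show ?case
    proof (intro allI impI)
      fix t :: real assume t: "t \<ge> 0"
      obtain e where e: "e > 0" "\<And>s. t \<le> s \<Longrightarrow> s < t + e \<Longrightarrow> X s \<omega> = X t \<omega>"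
        using cadlag_right_const[OF paths[OF elim(1)] t] by blast
      obtain q where q: "q \<in> \<rat>" "t < q" "q < t + e" using Rats_dense_in_real[of t "t + e"] e(1) by auto
      then have "X q \<omega> = X t \<omega>" using e(2)[of q] by simp
      moreover have "particles (X q \<omega>) = particles x0" using elim(2) q t by auto
      ultimately show "particles (X t \<omega>) = particles x0" by simp
    qed
  qed
qed

text \<open>The dyadic grids of mesh \<open>\<tau> / 2 ^ q\<close> become finer with
  \<open>q\<close>, and together they see every value that the path takes between \<open>s\<close>
  and \<open>s + \<tau>\<close>, since paths are constant to the right.\<close>

definition jump_event :: "real \<Rightarrow> real \<Rightarrow> real \<Rightarrow> nat \<Rightarrow> 'w set" where
  "jump_event s \<tau> a q = {\<omega> \<in> space M. map (\<lambda>k. X (s + real k * (\<tau> / 2 ^ q)) \<omega>) [0..<Suc (2 ^ q)] \<in>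
     {l. \<exists>k\<le>2 ^ q. exp_dist (l ! 0) (l ! k) \<ge> exp a}}"

lemma jump_event_iff: "\<omega> \<in> jump_event s \<tau> a q \<longleftrightarrow> \<omega> \<in> space M \<and> (\<exists>k\<le>2 ^ q. exp_dist (X s \<omega>) (X (s + real k * (\<tau> / 2 ^ q)) \<omega>) \<ge> exp a)"
proof -
  have "map (\<lambda>k. X (s + real k * (\<tau> / 2 ^ q)) \<omega>) [0..<Suc (2 ^ q)] ! k = X (s + real k * (\<tau> / 2 ^ q)) \<omega>" if "k \<le> 2 ^ q" for k
    using that by (subst nth_map) (auto simp del: upt_Suc)
  then show ?thesis unfolding jump_event_def by (auto simp del: upt_Suc)
qed

text \<open>A step of the grid costs a factor \<open>exp (cexp * (\<tau> / 2 ^ q))\<close>. Over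
  \<open>2 ^ q\<close> steps this multiplies to \<open>exp (cexp * \<tau>)\<close>, free of the
  mesh, so the bound survives the union over \<open>q\<close>.\<close>

lemma prob_jump_event:
  assumes s: "s \<ge> 0" and \<tau>: "\<tau> \<ge> 0"
  shows "prob (jump_event s \<tau> a q) \<le> exp (cexp * \<tau> - a)" and "jump_event s \<tau> a q \<in> events"
proof -
  let ?h = "\<tau> / 2 ^ q" and ?E = "{l. \<exists>k\<le>2 ^ q. exp_dist (l ! 0) (l ! k) \<ge> exp a}"
  have h: "?h \<ge> 0" using \<tau> by simp
  show "jump_event s \<tau> a q \<in> events" unfolding jump_event_def by (rule skeleton(2)[OF s h])
  have bound: "measure_pmf.prob (walk (P ?h) (2 ^ q) x) ?E \<le> exp (cexp * \<tau> - a)" for x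
  proof -
    have "measure_pmf.prob (walk (P ?h) (2 ^ q) x) ?E \<le> measure_pmf.prob (walk (P ?h) (2 ^ q) x) {l. \<exists>k\<le>2 ^ q. exp_dist x (l ! k) \<ge> exp a}"
      by (rule prob_mono_support) (use walk_support(2) in fastforce)
    also have "\<dots> \<le> exp (cexp * ?h) ^ (2 ^ q) * exp_dist x x / exp a"
    proof (rule walk_maximal_inequality[OF exp_dist_bounded])
      show "1 \<le> exp (cexp * ?h)" unfolding one_le_exp_iff by (rule mult_nonneg_nonneg[OF cexp_nonneg h])
      show "E ?h y (exp_dist x) \<le> exp (cexp * ?h) * exp_dist x y" for y by (rule E_exp_dist[OF h])
    qed (auto simp: exp_dist_def)
    also have "exp (cexp * ?h) ^ (2 ^ q) = exp (cexp * \<tau>)" by (simp flip: exp_of_nat_mult)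
    finally show ?thesis by (simp add: exp_diff exp_dist_def)
  qed
  have "prob (jump_event s \<tau> a q) = measure_pmf.prob (bind_pmf (P s x0) (walk (P ?h) (2 ^ q))) ?E"
    unfolding jump_event_def by (rule skeleton(1)[OF s h])
  also have "\<dots> = measure_pmf.expectation (bind_pmf (P s x0) (walk (P ?h) (2 ^ q))) (indicator ?E)" by simp
  also have "\<dots> = measure_pmf.expectation (P s x0) (\<lambda>x. measure_pmf.expectation (walk (P ?h) (2 ^ q) x) (indicator ?E))"
    by (rule expectation_bind) (rule bounded_fun_intros)
  also have "\<dots> \<le> measure_pmf.expectation (P s x0) (\<lambda>_. exp (cexp * \<tau> - a))"
    by (intro expectation_le bounded_fun_intros bounded_fun_expectation) (use bound in simp)
  finally show "prob (jump_event s \<tau> a q) \<le> exp (cexp * \<tau> - a)" by simp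
qed

lemma prob_jump_event_Union:
  assumes s: "s \<ge> 0" and \<tau>: "\<tau> \<ge> 0"
  shows "prob (\<Union>q. jump_event s \<tau> a q) \<le> exp (cexp * \<tau> - a)" and "(\<Union>q. jump_event s \<tau> a q) \<in> events"
proof -
  show "(\<Union>q. jump_event s \<tau> a q) \<in> events" using prob_jump_event(2)[OF assms] by blast
  have "incseq (jump_event s \<tau> a)"
  proof (rule incseq_SucI, rule subsetI)
    fix q \<omega> assume "\<omega> \<in> jump_event s \<tau> a q"
    then obtain k where k: "\<omega> \<in> space M" "k \<le> 2 ^ q" "exp_dist (X s \<omega>) (X (s + real k * (\<tau> / 2 ^ q)) \<omega>) \<ge> exp a"
      by (auto simp: jump_event_iff)
    have "real (2 * k) * (\<tau> / 2 ^ Suc q) = real k * (\<tau> / 2 ^ q)" by simp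
    then show "\<omega> \<in> jump_event s \<tau> a (Suc q)" unfolding jump_event_iff using k by (intro conjI exI[of _ "2 * k"]) auto
  qed
  then have "(\<lambda>q. prob (jump_event s \<tau> a q)) \<longlonglongrightarrow> prob (\<Union>q. jump_event s \<tau> a q)"
    by (intro finite_Lim_measure_incseq) (use prob_jump_event(2)[OF assms] in auto)
  then show "prob (\<Union>q. jump_event s \<tau> a q) \<le> exp (cexp * \<tau> - a)"
    by (rule LIMSEQ_le_const2) (use prob_jump_event(1)[OF assms] in auto)
qed

lemma displacement_off_jump_event:
  assumes \<omega>: "\<omega> \<in> space M" "\<omega> \<notin> (\<Union>q. jump_event s \<tau> a q)" and part: "\<And>t. t \<ge> 0 \<Longrightarrow> particles (X t \<omega>) = particles x0"
    and s: "s \<ge> 0" and \<tau>: "\<tau> > 0" and t: "s \<le> t" "t < s + \<tau>"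
  shows "conf_dist (X s \<omega>) (X t \<omega>) \<le> a"
proof -
  obtain e where e: "e > 0" "\<And>q. t \<le> q \<Longrightarrow> q < t + e \<Longrightarrow> X q \<omega> = X t \<omega>"
    using cadlag_right_const[OF paths[OF \<omega>(1)] order_trans[OF s t(1)]] by blast
  define b where "b = min (s + \<tau>) (t + e)"
  have b: "t < b" "b \<le> s + \<tau>" "b \<le> t + e" using t e by (auto simp: b_def)
  obtain q j where j: "j \<le> 2 ^ q" "(t - s) / \<tau> < real j / 2 ^ q" "real j / 2 ^ q < (b - s) / \<tau>"
    by (rule dyadic_between[of "(t - s) / \<tau>" "(b - s) / \<tau>"]) (use b t \<tau> in \<open>auto simp: divide_strict_right_mono\<close>)
  define t' where "t' = s + real j * (\<tau> / 2 ^ q)"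
  have "t < t'" "t' < b"
  proof -
    have "(t - s) / \<tau> * \<tau> < real j / 2 ^ q * \<tau>" using j(2) \<tau> by (rule mult_strict_right_mono)
    then show "t < t'" using \<tau> by (simp add: t'_def)
    have "real j / 2 ^ q * \<tau> < (b - s) / \<tau> * \<tau>" using j(3) \<tau> by (rule mult_strict_right_mono)
    then show "t' < b" using \<tau> by (simp add: t'_def)
  qed
  then have "X t' \<omega> = X t \<omega>" using e(2)[of t'] b by simp
  moreover have "\<not> exp_dist (X s \<omega>) (X t' \<omega>) \<ge> exp a" using \<omega> j(1) unfolding t'_def by (auto simp: jump_event_iff)
  moreover have "particles (X t \<omega>) = particles (X s \<omega>)" using part[of s] part[of t] s t by simp
  ultimately show ?thesis by (simp add: exp_dist_def)
qed

end

context zero_range begin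

text \<open>The quantifiers over processes and semigroups stand inside the limit in
  \<open>N\<close>, because each \<open>N\<close> brings its own. Three errors add up: the skeleton
  against the limit path at grid times, the movement of the process within a block, and that of the
  limit path within a cell.\<close>

lemma path_convergence:
  assumes T: "T > 0" and \<epsilon>: "\<epsilon> > 0" and p: "p > 0"
  shows "\<exists>\<theta>>0. \<forall>\<^sub>F N in sequentially. \<forall>P (M :: 'w measure) X x0 u. started_zrp r g P M X x0 \<and> particles x0 = N \<and> u \<in> prob_simplex \<and>
     (\<forall>i. \<bar>real (x0 i) / real N - u $ i\<bar> \<le> \<theta>) \<longrightarrow>
     (\<exists>B\<in>sets M. measure M B \<le> p \<and> (\<forall>\<omega>\<in>space M - B. (\<forall>t\<ge>0. particles (X t \<omega>) = N) \<and>
        (\<forall>t i. 0 \<le> t \<and> t \<le> T \<longrightarrow> \<bar>real (X (t * real N) \<omega> i) / real N - limit_path r u t $ i\<bar> \<le> \<epsilon>)))"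
proof -
  define c where "c = cexp + 1"
  \<comment> \<open>The denominator weighs the three errors: 1 for the grid times, \<open>c\<close>
    for the movement within a block, \<open>2 * rmax\<close> for the Lipschitz constant of the limit
    path.\<close>
  define \<epsilon>1 where "\<epsilon>1 = \<epsilon> / (1 + c + 2 * rmax)"
  have c: "c > 0" using cexp_nonneg by (simp add: c_def)
  have den: "1 + c + 2 * rmax > 0" using c rmax_nonneg by simp
  have \<epsilon>1: "\<epsilon>1 > 0" using \<epsilon> den by (simp add: \<epsilon>1_def)
  obtain \<delta> \<theta> where \<delta>: "\<delta> > 0" "\<delta> \<le> \<epsilon>1" and \<theta>: "\<theta> > 0"
    and conv: "\<forall>\<^sub>F N in sequentially. \<forall>P (x :: 'v \<Rightarrow> nat) u. markov_semigroup P \<and> has_generator P (zrp_generator r g) \<and>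
     particles x = N \<and> u \<in> prob_simplex \<and> (\<forall>i. \<bar>real (x i) / real N - u $ i\<bar> \<le> \<theta>) \<longrightarrow>
     measure_pmf.prob (walk (P (\<delta> * real N)) (nat \<lfloor>T / \<delta>\<rfloor>) x)
       {l. \<exists>k\<le>nat \<lfloor>T / \<delta>\<rfloor>. \<exists>i. \<bar>real ((l ! k) i) / real N - limit_path r u (real k * \<delta>) $ i\<bar> > \<epsilon>1} \<le> p / 2"
    using skeleton_convergence[OF T \<epsilon>1, of "p / 2"] p by auto
  define m where "m = nat \<lfloor>T / \<delta>\<rfloor>"
  have "\<forall>\<^sub>F N in sequentially. exp (- (\<delta> * real N)) \<le> p / 2 / real (Suc m)"
    by (rule exp_minus_eventually) (use \<delta> p in auto)
  with conv eventually_gt_at_top[of 0]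
  have "\<forall>\<^sub>F N in sequentially. \<forall>P (M :: 'w measure) X x0 u. started_zrp r g P M X x0 \<and> particles x0 = N \<and> u \<in> prob_simplex \<and>
     (\<forall>i. \<bar>real (x0 i) / real N - u $ i\<bar> \<le> \<theta>) \<longrightarrow>
     (\<exists>B\<in>sets M. measure M B \<le> p \<and> (\<forall>\<omega>\<in>space M - B. (\<forall>t\<ge>0. particles (X t \<omega>) = N) \<and>
        (\<forall>t i. 0 \<le> t \<and> t \<le> T \<longrightarrow> \<bar>real (X (t * real N) \<omega> i) / real N - limit_path r u t $ i\<bar> \<le> \<epsilon>)))"
  proof eventually_elim
    case (elim N)
    show ?case
    proof (intro allI impI; elim conjE)
      fix P and M :: "'w measure" and X x0 u
      assume "started_zrp r g P M X x0" and x0: "particles x0 = N" and u: "u \<in> prob_simplex"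
        and x0u: "\<forall>i. \<bar>real (x0 i) / real N - u $ i\<bar> \<le> \<theta>"
      then interpret started_zrp r g P M X x0 by simp
      have N: "real N > 0" using elim by simp
      let ?\<tau> = "\<delta> * real N"
      have \<tau>: "?\<tau> > 0" using \<delta> N by simp
      let ?F = "{l. \<exists>k\<le>m. \<exists>i. \<bar>real ((l ! k) i) / real N - limit_path r u (real k * \<delta>) $ i\<bar> > \<epsilon>1}"
      define B1 where "B1 = {\<omega> \<in> space M. map (\<lambda>k. X (0 + real k * ?\<tau>) \<omega>) [0..<Suc m] \<in> ?F}"
      have B1: "B1 \<in> events" "prob B1 \<le> p / 2"
      proof -
        show "B1 \<in> events" unfolding B1_def by (rule skeleton(2)) (use \<tau> in auto)
        have "prob B1 = measure_pmf.prob (bind_pmf (P 0 x0) (walk (P ?\<tau>) m)) ?F"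
          unfolding B1_def by (rule skeleton(1)) (use \<tau> in auto)
        also have "bind_pmf (P 0 x0) (walk (P ?\<tau>) m) = walk (P ?\<tau>) m x0"
          using P_semigroup by (simp add: markov_semigroup_def bind_return_pmf)
        also have "measure_pmf.prob (walk (P ?\<tau>) m x0) ?F \<le> p / 2"
          using elim(1) P_semigroup P_generator x0 u x0u unfolding m_def by blast
        finally show "prob B1 \<le> p / 2" .
      qed
      define J where "J k = (\<Union>q. jump_event (real k * ?\<tau>) ?\<tau> (c * ?\<tau>) q)" for k
      have J: "J k \<in> events" "prob (J k) \<le> exp (- ?\<tau>)" for k
      proof -
        have kt: "0 \<le> real k * ?\<tau>" using \<tau> by simp
        show "J k \<in> events" unfolding J_def by (rule prob_jump_event_Union(2)[OF kt less_imp_le[OF \<tau>]])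
        have "prob (J k) \<le> exp (cexp * ?\<tau> - c * ?\<tau>)" unfolding J_def by (rule prob_jump_event_Union(1)[OF kt less_imp_le[OF \<tau>]])
        also have "cexp * ?\<tau> - c * ?\<tau> = - ?\<tau>" by (simp add: c_def algebra_simps)
        finally show "prob (J k) \<le> exp (- ?\<tau>)" .
      qed
      obtain Z where Z: "Z \<in> null_sets M" "{\<omega> \<in> space M. \<not> (\<forall>t\<ge>0. particles (X t \<omega>) = particles x0)} \<subseteq> Z"
        using AE_particles unfolding eventually_ae_filter by auto
      \<comment> \<open>Either the skeleton strays, or one of the \<open>m + 1\<close> blocks that
        cover the time up to \<open>T\<close> has a large displacement, or particles are not
        conserved, the last on a null set \<open>Z\<close>.\<close>
      define B where "B = (B1 \<union> (\<Union>k\<in>{..m}. J k)) \<union> Z"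
      have Jm: "(\<Union>k\<in>{..m}. J k) \<in> events" using J(1) by blast
      have B: "B \<in> events" unfolding B_def using B1(1) Jm Z(1) by blast
      have "prob B \<le> prob (B1 \<union> (\<Union>k\<in>{..m}. J k)) + prob Z"
        unfolding B_def using B1(1) Jm Z(1) by (intro measure_Un_le) auto
      also have "prob Z = 0" using Z(1) by (simp add: measure_eq_0_null_sets)
      also have "prob (B1 \<union> (\<Union>k\<in>{..m}. J k)) \<le> prob B1 + prob (\<Union>k\<in>{..m}. J k)"
        by (rule measure_Un_le[OF B1(1) Jm])
      also have "prob (\<Union>k\<in>{..m}. J k) \<le> (\<Sum>k\<in>{..m}. prob (J k))"
        by (rule finite_measure_subadditive_finite) (use J in auto)
      also have "(\<Sum>k\<in>{..m}. prob (J k)) \<le> (\<Sum>k\<in>{..m}. p / 2 / real (Suc m))"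
        by (intro sum_mono order_trans[OF J(2)]) (use elim in simp)
      also have "(\<Sum>k\<in>{..m}. p / 2 / real (Suc m)) = p / 2" by (simp add: field_simps)
      finally have pB: "prob B \<le> p" using B1(2) by simp
      have close: "\<bar>real (X (t * real N) \<omega> i) / real N - limit_path r u t $ i\<bar> \<le> \<epsilon>"
        if \<omega>: "\<omega> \<in> space M - B" and part: "\<forall>t\<ge>0. particles (X t \<omega>) = particles x0" and t: "0 \<le> t" "t \<le> T" for \<omega> t i
      proof -
        define k where "k = nat \<lfloor>t / \<delta>\<rfloor>"
        have td: "t / \<delta> \<ge> 0" using t \<delta> by simp
        have rk: "real k \<le> t / \<delta>" "t / \<delta> < real k + 1" unfolding k_def using td by linarith+
        then have kt: "real k * \<delta> \<le> t" "t < real k * \<delta> + \<delta>" using \<delta> by (simp_all add: field_simps)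
        have "t / \<delta> \<le> T / \<delta>" using t \<delta> by (simp add: divide_right_mono)
        then have km: "k \<le> m" unfolding k_def m_def by (intro nat_mono floor_mono)
        have "\<omega> \<notin> B1" "\<omega> \<in> space M" using \<omega> by (auto simp: B_def)
        then have "\<not> (\<bar>real ((map (\<lambda>k. X (0 + real k * ?\<tau>) \<omega>) [0..<Suc m] ! k) i) / real N - limit_path r u (real k * \<delta>) $ i\<bar> > \<epsilon>1)"
          unfolding B1_def using km by blast
        moreover have "map (\<lambda>k. X (0 + real k * ?\<tau>) \<omega>) [0..<Suc m] ! k = X (real k * ?\<tau>) \<omega>"
          using km by (subst nth_map) (auto simp del: upt_Suc)
        ultimately have 1: "\<bar>real (X (real k * ?\<tau>) \<omega> i) / real N - limit_path r u (real k * \<delta>) $ i\<bar> \<le> \<epsilon>1" by simp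
        have "conf_dist (X (real k * ?\<tau>) \<omega>) (X (t * real N) \<omega>) \<le> c * ?\<tau>"
        proof (rule displacement_off_jump_event[where s="real k * ?\<tau>" and \<tau>="?\<tau>"])
          show "\<omega> \<notin> (\<Union>q. jump_event (real k * ?\<tau>) ?\<tau> (c * ?\<tau>) q)" using \<omega> km by (auto simp: B_def J_def)
          show "real k * ?\<tau> \<le> t * real N" using mult_right_mono[OF kt(1), of "real N"] by (simp add: mult.assoc)
          show "t * real N < real k * ?\<tau> + ?\<tau>" using mult_strict_right_mono[OF kt(2) N] by (simp add: algebra_simps)
        qed (use \<omega> part \<tau> in auto)
        then have "\<bar>real (X (t * real N) \<omega> i) - real (X (real k * ?\<tau>) \<omega> i)\<bar> \<le> c * ?\<tau>"
          using conf_dist_coord order_trans by blast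
        then have "\<bar>real (X (t * real N) \<omega> i) - real (X (real k * ?\<tau>) \<omega> i)\<bar> / real N \<le> c * ?\<tau> / real N"
          by (rule divide_right_mono) simp
        then have 2: "\<bar>real (X (t * real N) \<omega> i) / real N - real (X (real k * ?\<tau>) \<omega> i) / real N\<bar> \<le> c * \<delta>"
          using N by (simp add: diff_divide_distrib flip: abs_divide) (simp add: abs_divide flip: diff_divide_distrib)
        obtain Y where f: "fluid r T (\<lambda>t. ($) (limit_path r u t)) Y" using limit_path_fluid[OF u] by blast
        have "\<bar>limit_path r u t $ i - limit_path r u (real k * \<delta>) $ i\<bar> \<le> 2 * rmax * (t - real k * \<delta>)"
          by (rule fluid_lipschitz[OF f]) (use kt t \<delta> in auto)
        also have "\<dots> \<le> 2 * rmax * \<delta>" using kt rmax_nonneg by (intro mult_left_mono) auto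
        finally have 3: "\<bar>limit_path r u t $ i - limit_path r u (real k * \<delta>) $ i\<bar> \<le> 2 * rmax * \<delta>" .
        have "\<epsilon>1 + c * \<delta> + 2 * rmax * \<delta> \<le> \<epsilon>1 + c * \<epsilon>1 + 2 * rmax * \<epsilon>1"
          using \<delta> c rmax_nonneg by (intro add_mono mult_left_mono) auto
        also have "\<dots> = (1 + c + 2 * rmax) * \<epsilon>1" by (simp add: algebra_simps)
        also have "\<dots> = \<epsilon>" using den by (simp add: \<epsilon>1_def)
        finally show ?thesis using 1 2 3 by linarith
      qed
      show "\<exists>B\<in>sets M. measure M B \<le> p \<and> (\<forall>\<omega>\<in>space M - B. (\<forall>t\<ge>0. particles (X t \<omega>) = N) \<and>
        (\<forall>t i. 0 \<le> t \<and> t \<le> T \<longrightarrow> \<bar>real (X (t * real N) \<omega> i) / real N - limit_path r u t $ i\<bar> \<le> \<epsilon>))"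
      proof (intro bexI[OF _ B] conjI pB ballI)
        fix \<omega> assume \<omega>: "\<omega> \<in> space M - B"
        then have part: "\<forall>t\<ge>0. particles (X t \<omega>) = particles x0" using Z(2) by (auto simp: B_def)
        then show "\<forall>t\<ge>0. particles (X t \<omega>) = N" using x0 by simp
        show "\<forall>t i. 0 \<le> t \<and> t \<le> T \<longrightarrow> \<bar>real (X (t * real N) \<omega> i) / real N - limit_path r u t $ i\<bar> \<le> \<epsilon>"
          using close[OF \<omega> part] by blast
      qed
    qed
  qed
  then show ?thesis using \<theta> by blast
qed

end

section \<open>Skorokhod topology\<close>

definition right_constant :: "(real \<Rightarrow> 's) \<Rightarrow> bool" where
  "right_constant p \<longleftrightarrow> (\<forall>t\<ge>0. \<exists>t'>t. \<forall>s. t \<le> s \<and> s < t' \<longrightarrow> p s = p t)"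

definition left_constant :: "(real \<Rightarrow> 's) \<Rightarrow> bool" where
  "left_constant p \<longleftrightarrow> (\<forall>t>0. \<exists>l. \<exists>t'<t. \<forall>s. t' < s \<and> s < t \<longrightarrow> p s = l)"

text \<open>No metric for the Skorokhod topology is available, so the event that a step path lies in an open set
  is written as a countable union over codes. A code is a partition at rational times, latest point first,
  with the values of the path at these times; a path with at most one jump in each cell, strictly
  inside the cell, is determined by its code up to a small time change.
  By right-continuity, \<open>one_jump\<close> needs to look at rational times only.\<close>

definition one_jump :: "(real \<Rightarrow> 's) \<Rightarrow> real \<Rightarrow> real \<Rightarrow> bool" where
  "one_jump p a b \<longleftrightarrow>
    (\<forall>q q' :: rat. a \<le> of_rat q \<and> q \<le> q' \<and> of_rat q' \<le> b \<longrightarrow> p (of_rat q) = p a \<or> p (of_rat q') = p b) \<and>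
    (\<exists>d :: rat. a < of_rat d \<and> of_rat d < b \<and> p (of_rat d) = p b)"

definition code_end :: "(rat \<times> 's) list \<Rightarrow> real" where
  "code_end c = (case c of [] \<Rightarrow> 0 | (q, v) # _ \<Rightarrow> of_rat q)"

lemma code_end_simps [simp]: "code_end [] = 0" "code_end ((q, v) # c) = of_rat q"
  by (simp_all add: code_end_def)

fun coded :: "real \<Rightarrow> 's \<Rightarrow> (real \<Rightarrow> 's) \<Rightarrow> (rat \<times> 's) list \<Rightarrow> bool" where
  "coded h x0 p [] \<longleftrightarrow> p 0 = x0"
| "coded h x0 p ((q, v) # c) \<longleftrightarrow> coded h x0 p c \<and> code_end c < of_rat q \<and> of_rat q \<le> code_end c + h \<and>
     p (of_rat q) = v \<and> one_jump p (code_end c) (of_rat q)"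

lemma coded_end_nonneg: "coded h x0 p c \<Longrightarrow> code_end c \<ge> 0"
  by (induction h x0 p c rule: coded.induct) (auto simp del: zero_le_of_rat_iff)

text \<open>Right-constancy extends the dichotomy in \<open>one_jump\<close> from rational to all
  times, and the jump time is the infimum of the times at which the final value is taken. The
  rational \<open>d\<close> keeps it strictly before \<open>b\<close>. If the end values agree, the
  path is constant and \<open>d\<close> itself serves.\<close>

lemma one_jump_time:
  assumes p: "right_constant p" and "one_jump p a b" "0 \<le> a"
  obtains s where "a < s" "s < b" "\<And>t. a \<le> t \<Longrightarrow> t < s \<Longrightarrow> p t = p a" "\<And>t. s \<le> t \<Longrightarrow> t \<le> b \<Longrightarrow> p t = p b"
proof -
  obtain d :: rat where d: "a < of_rat d" "of_rat d < b" "p (of_rat d) = p b"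
    using assms(2) by (auto simp: one_jump_def)
  have rc: "\<exists>t'>t. \<forall>s. t \<le> s \<and> s < t' \<longrightarrow> p s = p t" if "0 \<le> t" for t
    using p that by (simp add: right_constant_def)
  have dich: "p t = p a \<or> p t' = p b" if t: "a \<le> t" "t \<le> t'" "t' \<le> b" for t t'
  proof (cases "t' = b")
    case False
    have "0 \<le> t'" "0 \<le> t" using t assms(3) by linarith+
    then obtain u u' where u: "t < u" "\<And>s. t \<le> s \<Longrightarrow> s < u \<Longrightarrow> p s = p t"
      and u': "t' < u'" "\<And>s. t' \<le> s \<Longrightarrow> s < u' \<Longrightarrow> p s = p t'" using rc by metis
    have "t' < min u' b" using u' t False by simp
    from of_rat_dense[OF this] obtain q' where q': "t' < of_rat q'" "of_rat q' < min u' b" by blast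
    have "t < min u (of_rat q')" using u(1) q'(1) t by simp
    from of_rat_dense[OF this] obtain q where q: "t < of_rat q" "of_rat q < min u (of_rat q')" by blast
    have "q \<le> q'" using q(2) by (simp add: of_rat_less)
    then have "p (of_rat q) = p a \<or> p (of_rat q') = p b"
      using assms(2) t q q' unfolding one_jump_def by auto
    then show ?thesis using u(2)[of "of_rat q"] u'(2)[of "of_rat q'"] q q' by simp
  qed simp
  show ?thesis
  proof (cases "p a = p b")
    case True
    have const: "p t = p a" if "a \<le> t" "t \<le> b" for t using dich[of t t] that True by auto
    show ?thesis
    proof (rule that[of "of_rat d"])
      fix t
      show "p t = p a" if "a \<le> t" "t < of_rat d" using that d by (intro const) linarith+
      have "p t = p a" if "of_rat d \<le> t" "t \<le> b" using that d by (intro const) linarith+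
      then show "p t = p b" if "of_rat d \<le> t" "t \<le> b" using that True by simp
    qed (use d in blast)+
  next
    case False
    define S where "S = {t. a \<le> t \<and> t \<le> b \<and> p t = p b}"
    have dS: "of_rat d \<in> S" using d by (simp add: S_def)
    have bdd: "bdd_below S" by (auto simp: S_def bdd_below_def)
    define s where "s = Inf S"
    have sa: "a \<le> s" unfolding s_def by (rule cInf_greatest) (use dS in \<open>auto simp: S_def\<close>)
    have sd: "s \<le> of_rat d" unfolding s_def by (rule cInf_lower[OF dS bdd])
    obtain u where u: "s < u" "\<And>t. s \<le> t \<Longrightarrow> t < u \<Longrightarrow> p t = p s" using rc[of s] sa assms(3) by auto
    obtain t where t: "t \<in> S" "t < u" using u(1) cInf_lessD[of S u] dS unfolding s_def by blast
    have "s \<le> t" unfolding s_def by (rule cInf_lower[OF t(1) bdd])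
    then have "p t = p s" by (rule u(2)[OF _ t(2)])
    then have ps: "p s = p b" using t(1) by (simp add: S_def)
    show ?thesis
    proof (rule that[of s])
      have "s \<noteq> a" using ps False by metis
      then show "a < s" using sa by simp
      show "s < b" using sd d by simp
      fix t show "p t = p a" if h: "a \<le> t" "t < s"
      proof -
        have "t \<notin> S"
        proof
          assume "t \<in> S"
          then have "s \<le> t" unfolding s_def by (rule cInf_lower[OF _ bdd])
          then show False using h by simp
        qed
        moreover have "t \<le> b" using h sd d by linarith
        ultimately show ?thesis using dich[OF h(1) order_refl] h(1) by (auto simp: S_def)
      qed
      show "p t = p b" if "s \<le> t" "t \<le> b"
      proof -
        have "p s \<noteq> p a" using ps False by metis
        then show ?thesis using dich[OF sa that] by blast
      qed
    qed
  qed
qed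

text \<open>The piecewise linear time change that takes \<open>s\<close> to \<open>s'\<close> and
  fixes all points outside the interval from \<open>a\<close> to \<open>b\<close>; exchanging
  \<open>s\<close> and \<open>s'\<close> inverts it.\<close>

definition bump :: "real \<Rightarrow> real \<Rightarrow> real \<Rightarrow> real \<Rightarrow> real \<Rightarrow> real" where
  "bump a s s' b t = (if t \<le> a \<or> b \<le> t then t
     else if t \<le> s then a + (t - a) * ((s' - a) / (s - a))
     else b - (b - t) * ((b - s') / (b - s)))"

lemma bump_props:
  assumes o: "a < s" "s < b" "a < s'" "s' < b"
  shows "t \<le> a \<Longrightarrow> bump a s s' b t = t" "b \<le> t \<Longrightarrow> bump a s s' b t = t"
    and "a < t \<Longrightarrow> t < s \<Longrightarrow> a < bump a s s' b t \<and> bump a s s' b t < s'"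
    and "s \<le> t \<Longrightarrow> t < b \<Longrightarrow> s' \<le> bump a s s' b t \<and> bump a s s' b t < b"
    and "bump a s' s b (bump a s s' b t) = t"
proof -
  show out: "t \<le> a \<Longrightarrow> bump a s s' b t = t" "b \<le> t \<Longrightarrow> bump a s s' b t = t" by (auto simp: bump_def)
  show lo: "a < bump a s s' b t \<and> bump a s s' b t < s'" if "a < t" "t < s"
  proof -
    have "bump a s s' b t = a + (t - a) * ((s' - a) / (s - a))" using that o by (simp add: bump_def)
    moreover have "0 < (t - a) * ((s' - a) / (s - a))" using that o by simp
    moreover have "(t - a) * ((s' - a) / (s - a)) < s' - a"
    proof -
      have "(t - a) / (s - a) < 1" using that by simp
      then have "(t - a) / (s - a) * (s' - a) < 1 * (s' - a)" by (rule mult_strict_right_mono) (use o in simp)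
      then show ?thesis by (simp add: field_simps)
    qed
    ultimately show ?thesis by simp
  qed
  have at: "bump a s s' b s = s'" using o by (simp add: bump_def)
  have hi': "s' < bump a s s' b t \<and> bump a s s' b t < b" if "s < t" "t < b"
  proof -
    have "bump a s s' b t = b - (b - t) * ((b - s') / (b - s))" using that o by (simp add: bump_def)
    moreover have "0 < (b - t) * ((b - s') / (b - s))" using that o by simp
    moreover have "(b - t) * ((b - s') / (b - s)) < b - s'"
    proof -
      have "(b - t) / (b - s) < 1" using that by simp
      then have "(b - t) / (b - s) * (b - s') < 1 * (b - s')" by (rule mult_strict_right_mono) (use o in simp)
      then show ?thesis by (simp add: field_simps)
    qed
    ultimately show ?thesis by simp
  qed
  show hi: "s' \<le> bump a s s' b t \<and> bump a s s' b t < b" if "s \<le> t" "t < b"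
    using hi' at that o by (cases "t = s") auto
  show "bump a s' s b (bump a s s' b t) = t"
  proof -
    consider "t \<le> a \<or> b \<le> t" | "a < t" "t < s" | "t = s" | "s < t" "t < b" by linarith
    then show ?thesis
    proof cases
      case 1
      then show ?thesis by (auto simp: bump_def)
    next
      case 2
      have "bump a s s' b t = a + (t - a) * ((s' - a) / (s - a))" using 2 o by (simp add: bump_def)
      moreover have "bump a s' s b x = a + (x - a) * ((s - a) / (s' - a))" if "a < x" "x < s'" for x
        using that o by (simp add: bump_def)
      ultimately show ?thesis using lo[OF 2] o by simp
    next
      case 3
      have "bump a s' s b s' = s" using o by (simp add: bump_def)
      then show ?thesis using 3 at by simp
    next
      case 4
      have "bump a s s' b t = b - (b - t) * ((b - s') / (b - s))" using 4 o by (simp add: bump_def)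
      moreover have "bump a s' s b x = b - (b - x) * ((b - s) / (b - s'))" if "s' < x" "x < b" for x
        using that o by (simp add: bump_def)
      ultimately show ?thesis using hi'[OF 4] o by simp
    qed
  qed
qed

lemma bump_strict_mono:
  assumes o: "a < s" "s < b" "a < s'" "s' < b" and "t < u"
  shows "bump a s s' b t < bump a s s' b u"
proof -
  note B = bump_props[OF o]
  consider "t \<le> a" | "b \<le> u" | "a < t" "t < s" "s \<le> u" "u < b" | "a < t" "u \<le> s" | "s < t" "u < b" | "t = s" "u < b"
    using assms by linarith
  then show ?thesis
  proof cases
    case 1
    then show ?thesis using B(1)[of t] B(1,2,3,4)[of u] \<open>t < u\<close> o by (cases "u \<le> a"; cases "b \<le> u"; cases "u < s") auto
  next
    case 2
    then show ?thesis using B(2)[of u] B(1,2,3,4)[of t] \<open>t < u\<close> o by (cases "t \<le> a"; cases "b \<le> t"; cases "t < s") auto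
  next
    case 3
    then show ?thesis using B(3)[of t] B(4)[of u] by auto
  next
    case 4
    have "(t - a) * ((s' - a) / (s - a)) < (u - a) * ((s' - a) / (s - a))"
      by (rule mult_strict_right_mono) (use o \<open>t < u\<close> in auto)
    then show ?thesis using 4 o \<open>t < u\<close> by (simp add: bump_def)
  next
    case 5
    have "(b - u) * ((b - s') / (b - s)) < (b - t) * ((b - s') / (b - s))"
      by (rule mult_strict_right_mono) (use o \<open>t < u\<close> in auto)
    then show ?thesis using 5 o \<open>t < u\<close> by (simp add: bump_def)
  next
    case 6
    have "(b - u) * ((b - s') / (b - s)) < (b - s) * ((b - s') / (b - s))"
      by (rule mult_strict_right_mono) (use o \<open>t < u\<close> 6 in auto)
    then show ?thesis using 6 o \<open>t < u\<close> by (simp add: bump_def)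
  qed
qed

lemma bump_dist:
  assumes o: "a < s" "s < b" "a < s'" "s' < b"
  shows "\<bar>bump a s s' b t - t\<bar> \<le> b - a"
proof (cases "t \<le> a \<or> b \<le> t")
  case True
  then show ?thesis using o bump_props(1,2)[OF o] by auto
next
  case False
  then have "a < bump a s s' b t \<and> bump a s s' b t < b"
    using bump_props(3,4)[OF o, of t] o by (cases "t < s") auto
  then show ?thesis using False by auto
qed

lemma bump_bij:
  assumes o: "a < s" "s < b" "a < s'" "s' < b" and "0 \<le> a"
  shows "bij_betw (bump a s s' b) {0..} {0..}"
proof (rule bij_betw_byWitness[where f'="bump a s' s b"])
  have nn: "0 \<le> bump a s s' b t" if "0 \<le> t" "a < s" "s < b" "a < s'" "s' < b" for t s s'
    using bump_props[OF that(2-5), of t] that \<open>0 \<le> a\<close> by (cases "t \<le> a"; cases "b \<le> t"; cases "t < s") auto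
  show "bump a s s' b ` {0..} \<subseteq> {0..}" using nn[of _ s s'] o by auto
  show "bump a s' s b ` {0..} \<subseteq> {0..}" using nn[of _ s' s] o by auto
qed (use bump_props(5) o in auto)

text \<open>One bump per cell matches the two jump times. The time change built for the earlier
  cells is the identity after their end, and the bump of the new cell is the identity before it, so
  composition disturbs neither.\<close>

lemma coded_time_change:
  assumes "coded h x0 p c" "coded h x0 p' c" "right_constant p" "right_constant p'" "0 < h"
  shows "\<exists>\<tau>\<in>time_changes. (\<forall>t\<ge>0. \<bar>\<tau> t - t\<bar> \<le> h) \<and> (\<forall>t\<ge>code_end c. \<tau> t = t) \<and> (\<forall>t. 0 \<le> t \<and> t \<le> code_end c \<longrightarrow> p' (\<tau> t) = p t)"
  using assms
proof (induction h x0 p c rule: coded.induct)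
  case (1 h x0 p)
  then show ?case by (intro bexI[of _ "\<lambda>t. t"]) (auto simp: time_changes_def strict_mono_on_def bij_betw_def inj_on_def)
next
  case (2 h x0 p q v c)
  let ?a = "code_end c" and ?b = "of_rat q :: real"
  have a0: "0 \<le> ?a" using coded_end_nonneg 2(2) by auto
  obtain \<tau> where \<tau>: "\<tau> \<in> time_changes" "\<And>t. 0 \<le> t \<Longrightarrow> \<bar>\<tau> t - t\<bar> \<le> h" "\<And>t. ?a \<le> t \<Longrightarrow> \<tau> t = t"
    "\<And>t. 0 \<le> t \<Longrightarrow> t \<le> ?a \<Longrightarrow> p' (\<tau> t) = p t"
    using 2 by auto
  have mono: "strict_mono_on {0..} \<tau>" and bij: "bij_betw \<tau> {0..} {0..}" using \<tau>(1) by (auto simp: time_changes_def)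
  have eqa: "p' ?a = p ?a" using \<tau>(3)[of ?a] \<tau>(4)[of ?a] a0 by simp
  have eqb: "p' ?b = p ?b" using 2(2,3) by simp
  have ab: "?a < ?b" "?b \<le> ?a + h" using 2(2) by auto
  have oj: "one_jump p ?a ?b" "one_jump p' ?a ?b" using 2(2,3) by auto
  obtain s where s: "?a < s" "s < ?b" "\<And>t. ?a \<le> t \<Longrightarrow> t < s \<Longrightarrow> p t = p ?a" "\<And>t. s \<le> t \<Longrightarrow> t \<le> ?b \<Longrightarrow> p t = p ?b"
    by (rule one_jump_time[OF 2(4) oj(1) a0]) (rule that)
  obtain s' where s': "?a < s'" "s' < ?b" "\<And>t. ?a \<le> t \<Longrightarrow> t < s' \<Longrightarrow> p' t = p' ?a" "\<And>t. s' \<le> t \<Longrightarrow> t \<le> ?b \<Longrightarrow> p' t = p' ?b"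
    by (rule one_jump_time[OF 2(5) oj(2) a0]) (rule that)
  note o = s(1,2) s'(1,2)
  let ?\<sigma> = "bump ?a s s' ?b"
  note B = bump_props[OF o]
  have low: "\<tau> t < ?a" if "0 \<le> t" "t < ?a" for t
    using strict_mono_onD[OF mono, of t ?a] \<tau>(3)[of ?a] that by simp
  show ?case
  proof (intro bexI[of _ "?\<sigma> \<circ> \<tau>"] conjI allI impI)
    show "?\<sigma> \<circ> \<tau> \<in> time_changes"
      unfolding time_changes_def
    proof (intro CollectI conjI)
      show "bij_betw (?\<sigma> \<circ> \<tau>) {0..} {0..}" by (rule bij_betw_trans[OF bij bump_bij[OF o a0]])
      show "strict_mono_on {0..} (?\<sigma> \<circ> \<tau>)"
        using mono bump_strict_mono[OF o] by (auto simp: strict_mono_on_def)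
    qed
    fix t :: real assume t: "0 \<le> t"
    show "\<bar>(?\<sigma> \<circ> \<tau>) t - t\<bar> \<le> h"
    proof (cases "?a \<le> t")
      case True
      then show ?thesis using bump_dist[OF o, of t] ab \<tau>(3)[of t] by simp
    next
      case False
      then show ?thesis using low[OF t] B(1)[of "\<tau> t"] \<tau>(2)[OF t] by simp
    qed
  next
    fix t assume "code_end ((q, v) # c) \<le> t"
    then show "(?\<sigma> \<circ> \<tau>) t = t" using \<tau>(3)[of t] B(2)[of t] ab by simp
  next
    fix t assume t: "0 \<le> t \<and> t \<le> code_end ((q, v) # c)"
    consider "t \<le> ?a" | "?a < t" "t < s" | "s \<le> t" "t < ?b" | "t = ?b" using t by force
    then show "p' ((?\<sigma> \<circ> \<tau>) t) = p t"
    proof cases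
      case 1
      then have "\<tau> t \<le> ?a" using low[of t] \<tau>(3)[of t] t by (cases "t = ?a") auto
      then show ?thesis using B(1) \<tau>(4)[of t] t 1 by simp
    next
      case 2
      then show ?thesis using \<tau>(3)[of t] B(3)[of t] s(3)[of t] s'(3)[of "?\<sigma> t"] eqa by simp
    next
      case 3
      then show ?thesis using \<tau>(3)[of t] B(4)[of t] s(4)[of t] s'(4)[of "?\<sigma> t"] eqb o by simp
    next
      case 4
      then show ?thesis using \<tau>(3)[of t] B(2)[of t] eqb ab by simp
    qed
  qed
qed

text \<open>Let \<sigma> be the supremum of the ends of codes. Left-constancy yields a code that
  ends just before \<sigma> with no jump in between, for \<sigma> = 0 the empty one; right-constancy
  yields a rational point after \<sigma> with no jump in between. The cell from one to the other has
  at most the jump at \<sigma>, so the code can be prolonged past the supremum.\<close>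

lemma code_exists:
  assumes p: "right_constant p" "left_constant p" and h: "0 < h"
  shows "\<exists>c. coded h (p 0) p c \<and> T \<le> code_end c"
proof (rule ccontr)
  assume none: "\<nexists>c. coded h (p 0) p c \<and> T \<le> code_end c"
  define E where "E = code_end ` {c. coded h (p 0) p c}"
  have E0: "0 \<in> E" unfolding E_def by (rule image_eqI[of _ _ "[]"]) auto
  have bdd: "bdd_above E" unfolding bdd_above_def E_def using none by (intro exI[of _ T]) force
  define \<sigma> where "\<sigma> = Sup E"
  have \<sigma>0: "0 \<le> \<sigma>" unfolding \<sigma>_def by (rule cSup_upper[OF E0 bdd])
  obtain u where u: "\<sigma> < u" "\<And>s. \<sigma> \<le> s \<Longrightarrow> s < u \<Longrightarrow> p s = p \<sigma>"
    using p(1) \<sigma>0 unfolding right_constant_def by meson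
  have "\<exists>c. coded h (p 0) p c \<and> code_end c \<le> \<sigma> \<and> \<sigma> - h / 2 < code_end c
    \<and> (\<forall>t. code_end c \<le> t \<and> t < \<sigma> \<longrightarrow> p t = p (code_end c))"
  proof (cases "\<sigma> = 0")
    case True
    then show ?thesis using h by (intro exI[of _ "[]"]) auto
  next
    case False
    then obtain l u' where u': "u' < \<sigma>" "\<And>s. u' < s \<Longrightarrow> s < \<sigma> \<Longrightarrow> p s = l"
      using p(2) \<sigma>0 unfolding left_constant_def by (metis order_less_le)
    have "max u' (\<sigma> - h / 2) < Sup E" using u'(1) h by (simp add: \<sigma>_def[symmetric])
    then obtain e where e: "e \<in> E" "max u' (\<sigma> - h / 2) < e" using less_cSupD[of E] E0 by blast
    then obtain c where c: "coded h (p 0) p c" "e = code_end c" by (auto simp: E_def)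
    show ?thesis
    proof (intro exI[of _ c] conjI allI impI)
      show "code_end c \<le> \<sigma>" using cSup_upper[OF e(1) bdd] c by (simp add: \<sigma>_def)
      fix t assume "code_end c \<le> t \<and> t < \<sigma>"
      then show "p t = p (code_end c)"
        using u'(2)[of t] u'(2)[of "code_end c"] e(2) c(2) by simp
    qed (use c e in auto)
  qed
  then obtain c where c: "coded h (p 0) p c" "code_end c \<le> \<sigma>" "\<sigma> - h / 2 < code_end c"
    and const: "\<And>t. code_end c \<le> t \<Longrightarrow> t < \<sigma> \<Longrightarrow> p t = p (code_end c)" by blast
  have "\<sigma> < min u (\<sigma> + h / 2)" using u h by simp
  from of_rat_dense[OF this] obtain q where q: "\<sigma> < of_rat q" "of_rat q < min u (\<sigma> + h / 2)" by blast
  from of_rat_dense[OF q(1)] obtain d where d: "\<sigma> < of_rat d" "(of_rat d :: real) < of_rat q" by blast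
  have right: "p t = p (of_rat q)" if "\<sigma> \<le> t" "t \<le> of_rat q" for t
    using u(2)[of t] u(2)[of "of_rat q"] that q by simp
  have "one_jump p (code_end c) (of_rat q)"
    unfolding one_jump_def
  proof (intro conjI allI impI)
    fix x y :: rat assume xy: "code_end c \<le> of_rat x \<and> x \<le> y \<and> of_rat y \<le> (of_rat q :: real)"
    have "(of_rat x :: real) \<le> of_rat y" using xy by (simp add: of_rat_less_eq)
    then show "p (of_rat x) = p (code_end c) \<or> p (of_rat y) = p (of_rat q)"
      using const[of "of_rat x"] right[of "of_rat y"] xy by (cases "of_rat x < \<sigma>") auto
  next
    show "\<exists>d. code_end c < of_rat d \<and> of_rat d < (of_rat q :: real) \<and> p (of_rat d) = p (of_rat q)"
      using d c right[of "of_rat d"] by (intro exI[of _ d]) auto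
  qed
  then have "coded h (p 0) p ((q, p (of_rat q)) # c)" using c q by auto
  then have "code_end ((q, p (of_rat q)) # c) \<in> E" unfolding E_def by blast
  then have "of_rat q \<le> \<sigma>" unfolding \<sigma>_def using cSup_upper[OF _ bdd] by fastforce
  then show False using q by simp
qed

lemma coded_measurable:
  fixes Y :: "real \<Rightarrow> 'w \<Rightarrow> 's::countable"
  assumes Y: "\<And>t. t \<ge> 0 \<Longrightarrow> Y t \<in> M \<rightarrow>\<^sub>M count_space UNIV"
  shows "{\<omega> \<in> space M. coded h x0 (\<lambda>t. Y t \<omega>) c} \<in> sets M"
proof (induction c)
  case Nil
  show ?case using measurable_sets[OF Y[of 0], of "{x0}"] by (simp add: vimage_def Int_def conj_commute)
next
  case (Cons a c)
  obtain q v where a: "a = (q, v)" by force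
  have eq: "{\<omega> \<in> space M. Y s \<omega> = Y t \<omega>} \<in> sets M" if "0 \<le> s" "0 \<le> t" for s t
  proof -
    have [measurable]: "Y s \<in> M \<rightarrow>\<^sub>M count_space UNIV" "Y t \<in> M \<rightarrow>\<^sub>M count_space UNIV" using Y that by auto
    show ?thesis by measurable
  qed
  have val: "{\<omega> \<in> space M. Y t \<omega> = v} \<in> sets M" if "0 \<le> t" for t v
    using measurable_sets[OF Y[OF that], of "{v}"] by (simp add: vimage_def Int_def conj_commute)
  have oj: "{\<omega> \<in> space M. one_jump (\<lambda>t. Y t \<omega>) e (of_rat q)} \<in> sets M" if e: "0 \<le> e" "e < of_rat q" for e
  proof -
    have q0: "0 \<le> (of_rat q :: real)" using e by linarith
    have 1: "{\<omega> \<in> space M. e \<le> of_rat x \<and> x \<le> y \<and> of_rat y \<le> (of_rat q :: real) \<longrightarrow> Y (of_rat x) \<omega> = Y e \<omega> \<or> Y (of_rat y) \<omega> = Y (of_rat q) \<omega>} \<in> sets M" for x y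
    proof (cases "e \<le> of_rat x \<and> x \<le> y \<and> of_rat y \<le> (of_rat q :: real)")
      case True
      have "(of_rat x :: real) \<le> of_rat y" using True by (simp add: of_rat_less_eq)
      then have "0 \<le> (of_rat x :: real)" "0 \<le> (of_rat y :: real)" using True e by linarith+
      then have "{\<omega> \<in> space M. Y (of_rat x) \<omega> = Y e \<omega> \<or> Y (of_rat y) \<omega> = Y (of_rat q) \<omega>} \<in> sets M"
        using e q0 by (intro sets.sets_Collect_disj eq) auto
      then show ?thesis using True by simp
    next
      case False
      then have "{\<omega> \<in> space M. e \<le> of_rat x \<and> x \<le> y \<and> of_rat y \<le> (of_rat q :: real) \<longrightarrow> Y (of_rat x) \<omega> = Y e \<omega> \<or> Y (of_rat y) \<omega> = Y (of_rat q) \<omega>} = space M" by auto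
      then show ?thesis by simp
    qed
    have 2: "{\<omega> \<in> space M. e < of_rat d \<and> of_rat d < (of_rat q :: real) \<and> Y (of_rat d) \<omega> = Y (of_rat q) \<omega>} \<in> sets M" for d
    proof (cases "e < of_rat d \<and> of_rat d < (of_rat q :: real)")
      case True
      then have "0 \<le> (of_rat d :: real)" using e by linarith
      then have "{\<omega> \<in> space M. Y (of_rat d) \<omega> = Y (of_rat q) \<omega>} \<in> sets M" by (rule eq[OF _ q0])
      then show ?thesis using True by simp
    next
      case False
      then have "{\<omega> \<in> space M. e < of_rat d \<and> of_rat d < (of_rat q :: real) \<and> Y (of_rat d) \<omega> = Y (of_rat q) \<omega>} = {}" by auto
      then show ?thesis by (simp only: sets.empty_sets)
    qed
    show ?thesis unfolding one_jump_def
      by (intro sets.sets_Collect_conj sets.sets_Collect_countable_All sets.sets_Collect_countable_Ex 1 2)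
  qed
  show ?case
  proof (cases "0 \<le> code_end c \<and> code_end c < of_rat q")
    case True
    then have q0: "0 \<le> (of_rat q :: real)" by linarith
    have "{\<omega> \<in> space M. coded h x0 (\<lambda>t. Y t \<omega>) c \<and> code_end c < of_rat q \<and> of_rat q \<le> code_end c + h \<and>
       Y (of_rat q) \<omega> = v \<and> one_jump (\<lambda>t. Y t \<omega>) (code_end c) (of_rat q)} \<in> sets M"
      by (intro sets.sets_Collect_conj Cons oj val) (use True q0 in auto)
    then show ?thesis by (simp add: a)
  next
    case False
    then have "{\<omega> \<in> space M. coded h x0 (\<lambda>t. Y t \<omega>) (a # c)} = {}"
      using coded_end_nonneg[of h x0 _ c] by (auto simp: a)
    then show ?thesis by (simp only: sets.empty_sets)
  qed
qed

text \<open>Otherwise each \<open>n\<close> has a code of mesh \<open>1 / (n + 1)\<close> reaching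
  up to \<open>n\<close> or beyond, and a step path with this code outside \<open>U\<close>. The
  time changes between equal codes match these paths exactly with the given one up to time
  \<open>n\<close> and tend to the identity, so the paths converge to it and eventually lie in the
  open set.\<close>

lemma skorokhod_open_coded:
  fixes e :: "'s \<Rightarrow> 'a::metric_space"
  defines "L \<equiv> \<lambda>p. \<lambda>t\<in>{0..}. e (p t)"
  assumes U: "skorokhod_open S U" and p: "right_constant p" "left_constant p" "L p \<in> U"
  shows "\<exists>n c. coded (1 / real (Suc n)) (p 0) p c \<and>
     (\<forall>p'. right_constant p' \<and> L p' \<in> cadlag_paths S \<and> coded (1 / real (Suc n)) (p 0) p' c \<longrightarrow> L p' \<in> U)"
proof (rule ccontr)
  assume neg: "\<not> ?thesis"
  have "\<exists>c. coded (1 / real (Suc n)) (p 0) p c \<and> real n \<le> code_end c" for n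
    by (rule code_exists[OF p(1,2)]) simp
  then obtain c where c: "\<And>n. coded (1 / real (Suc n)) (p 0) p (c n)" "\<And>n. real n \<le> code_end (c n)" by metis
  have "\<exists>p'. right_constant p' \<and> L p' \<in> cadlag_paths S \<and> coded (1 / real (Suc n)) (p 0) p' (c n) \<and> L p' \<notin> U" for n
    using neg c(1)[of n] by blast
  then obtain p' where p': "\<And>n. right_constant (p' n)" "\<And>n. L (p' n) \<in> cadlag_paths S"
    "\<And>n. coded (1 / real (Suc n)) (p 0) (p' n) (c n)" "\<And>n. L (p' n) \<notin> U" by metis
  have "\<exists>\<tau>\<in>time_changes. (\<forall>t\<ge>0. \<bar>\<tau> t - t\<bar> \<le> 1 / real (Suc n)) \<and> (\<forall>t\<ge>code_end (c n). \<tau> t = t) \<and>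
     (\<forall>t. 0 \<le> t \<and> t \<le> code_end (c n) \<longrightarrow> p' n (\<tau> t) = p t)" for n
    by (rule coded_time_change[OF c(1) p'(3) p(1) p'(1)]) simp
  then obtain \<tau> where \<tau>: "\<And>n. \<tau> n \<in> time_changes" "\<And>n t. 0 \<le> t \<Longrightarrow> \<bar>\<tau> n t - t\<bar> \<le> 1 / real (Suc n)"
    "\<And>n t. 0 \<le> t \<Longrightarrow> t \<le> code_end (c n) \<Longrightarrow> p' n (\<tau> n t) = p t" by metis
  have "skorokhod_converges (\<lambda>n. L (p' n)) (L p)"
    unfolding skorokhod_converges_def
  proof (intro exI[of _ \<tau>] conjI allI)
    show "\<tau> n \<in> time_changes" for n by (rule \<tau>)
    show "uniform_limit {0..} \<tau> (\<lambda>t. t) sequentially"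
    proof (rule uniform_limitI)
      fix \<epsilon> :: real assume \<epsilon>: "0 < \<epsilon>"
      have "\<forall>\<^sub>F n in sequentially. 1 / real (Suc n) < \<epsilon>" using \<epsilon> LIMSEQ_inverse_real_of_nat
        by (auto simp: inverse_eq_divide dest: order_tendstoD)
      then show "\<forall>\<^sub>F n in sequentially. \<forall>t\<in>{0..}. dist (\<tau> n t) t < \<epsilon>"
        by eventually_elim (use \<tau>(2) in \<open>auto simp: dist_real_def intro: le_less_trans\<close>)
    qed
    fix T
    have "\<forall>\<^sub>F n in sequentially. T \<le> real n"
      using filterlim_real_sequentially by (auto simp: filterlim_at_top)
    then have ev: "\<forall>\<^sub>F n in sequentially. \<forall>t\<in>{0..T}. L (p' n) (\<tau> n t) = L p t"
    proof eventually_elim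
      case (elim n)
      have "0 \<le> \<tau> n t" if "0 \<le> t" for t
        using \<tau>(1)[of n] that by (auto simp: time_changes_def dest: bij_betw_apply)
      then show ?case using \<tau>(3)[of _ n] c(2)[of n] elim by (auto simp: L_def)
    qed
    show "uniform_limit {0..T} (\<lambda>n t. L (p' n) (\<tau> n t)) (L p) sequentially"
      by (rule uniform_limitI) (use ev in \<open>auto elim: eventually_mono\<close>)
  qed
  then have "\<forall>\<^sub>F n in sequentially. L (p' n) \<in> U"
    using U p(3) p'(2) unfolding skorokhod_open_def by (auto dest!: bspec spec[of _ "\<lambda>n. L (p' n)"])
  then show False using p'(4) by simp
qed

text \<open>\<open>G\<close> consists of the codes that force membership in \<open>U\<close>. By
  \<open>skorokhod_open_coded\<close> the event is the union over \<open>G\<close> of the events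
  that the path has the given code, and there are only countably many codes.\<close>

lemma skorokhod_open_measurable:
  fixes Y :: "real \<Rightarrow> 'w \<Rightarrow> 's::countable" and e :: "'s \<Rightarrow> 'a::metric_space"
  defines "L \<equiv> \<lambda>\<omega>. \<lambda>t\<in>{0..}. e (Y t \<omega>)"
  assumes Y: "\<And>t. t \<ge> 0 \<Longrightarrow> Y t \<in> M \<rightarrow>\<^sub>M count_space UNIV"
    and p: "\<And>\<omega>. \<omega> \<in> space M \<Longrightarrow> right_constant (\<lambda>t. Y t \<omega>)" "\<And>\<omega>. \<omega> \<in> space M \<Longrightarrow> left_constant (\<lambda>t. Y t \<omega>)"
    and \<Omega>: "\<Omega> \<in> sets M" "\<And>\<omega>. \<omega> \<in> \<Omega> \<Longrightarrow> L \<omega> \<in> cadlag_paths S"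
    and U: "skorokhod_open S U"
  shows "{\<omega> \<in> \<Omega>. L \<omega> \<in> U} \<in> sets M"
proof -
  define G where "G = {(n :: nat, x0, c). \<forall>p'. right_constant p' \<and> (\<lambda>t\<in>{0..}. e (p' t)) \<in> cadlag_paths S \<and>
    coded (1 / real (Suc n)) x0 p' c \<longrightarrow> (\<lambda>t\<in>{0..}. e (p' t)) \<in> U}"
  have sub: "\<Omega> \<subseteq> space M" using \<Omega>(1) by (rule sets.sets_into_space)
  have "{\<omega> \<in> \<Omega>. L \<omega> \<in> U} = (\<Union>(n, x0, c)\<in>G. \<Omega> \<inter> {\<omega> \<in> space M. coded (1 / real (Suc n)) x0 (\<lambda>t. Y t \<omega>) c})"
  proof (intro equalityI subsetI)
    fix \<omega> assume "\<omega> \<in> {\<omega> \<in> \<Omega>. L \<omega> \<in> U}"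
    then have \<omega>: "\<omega> \<in> \<Omega>" "\<omega> \<in> space M" "L \<omega> \<in> U" using sub by auto
    obtain n c where "coded (1 / real (Suc n)) (Y 0 \<omega>) (\<lambda>t. Y t \<omega>) c" "(n, Y 0 \<omega>, c) \<in> G"
      using skorokhod_open_coded[OF U p(1)[OF \<omega>(2)] p(2)[OF \<omega>(2)], of e] \<omega>(3) unfolding G_def L_def by blast
    then show "\<omega> \<in> (\<Union>(n, x0, c)\<in>G. \<Omega> \<inter> {\<omega> \<in> space M. coded (1 / real (Suc n)) x0 (\<lambda>t. Y t \<omega>) c})" using \<omega> by blast
  next
    fix \<omega> assume "\<omega> \<in> (\<Union>(n, x0, c)\<in>G. \<Omega> \<inter> {\<omega> \<in> space M. coded (1 / real (Suc n)) x0 (\<lambda>t. Y t \<omega>) c})"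
    then obtain n x0 c where h: "(n, x0, c) \<in> G" "\<omega> \<in> \<Omega>" "coded (1 / real (Suc n)) x0 (\<lambda>t. Y t \<omega>) c" by blast
    have "L \<omega> \<in> U" using h p(1)[of \<omega>] \<Omega>(2)[OF h(2)] sub unfolding G_def L_def by blast
    then show "\<omega> \<in> {\<omega> \<in> \<Omega>. L \<omega> \<in> U}" using h(2) by simp
  qed
  also have "\<dots> \<in> sets M"
    by (rule sets.countable_UN') (auto simp: split_beta' intro!: sets.Int \<Omega>(1) coded_measurable Y)
  finally show ?thesis .
qed

text \<open>Locally uniform convergence is Skorokhod convergence with the identity as time change,
  so a sequence of counterexamples would converge to \<open>z\<close>.\<close>

lemma uniform_neighbourhood:
  fixes F :: "(real \<Rightarrow> 'a::metric_space) \<Rightarrow> real"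
  assumes F: "continuous_map (skorokhod_topology S) euclidean F" and z: "z \<in> cadlag_paths S" and \<epsilon>: "0 < \<epsilon>"
  shows "\<exists>n::nat. \<forall>y\<in>cadlag_paths S. (\<forall>t. 0 \<le> t \<and> t \<le> real (Suc n) \<longrightarrow> dist (y t) (z t) \<le> 1 / real (Suc n)) \<longrightarrow> \<bar>F y - F z\<bar> < \<epsilon>"
proof (rule ccontr)
  assume neg: "\<not> ?thesis"
  define U where "U = {x \<in> topspace (skorokhod_topology S). F x \<in> ball (F z) \<epsilon>}"
  have U: "skorokhod_open S U"
    using openin_continuous_map_preimage[OF F, of "ball (F z) \<epsilon>"] by (simp add: U_def)
  have zU: "z \<in> U" using z \<epsilon> by (simp add: U_def)
  have "\<exists>y\<in>cadlag_paths S. (\<forall>t. 0 \<le> t \<and> t \<le> real (Suc n) \<longrightarrow> dist (y t) (z t) \<le> 1 / real (Suc n)) \<and> \<not> \<bar>F y - F z\<bar> < \<epsilon>" for n :: nat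
    using neg by blast
  then obtain y where y: "\<And>n. y n \<in> cadlag_paths S"
    "\<And>n t. 0 \<le> t \<Longrightarrow> t \<le> real (Suc n) \<Longrightarrow> dist (y n t) (z t) \<le> 1 / real (Suc n)" "\<And>n. \<not> \<bar>F (y n) - F z\<bar> < \<epsilon>" by metis
  have "skorokhod_converges y z"
    unfolding skorokhod_converges_def
  proof (intro exI[of _ "\<lambda>n t. t"] conjI allI)
    show "(\<lambda>t. t) \<in> time_changes" by (auto simp: time_changes_def strict_mono_on_def bij_betw_def inj_on_def)
    show "uniform_limit {0..} (\<lambda>n t. t) (\<lambda>t. t) sequentially" by (rule uniform_limitI) simp
    fix T :: real
    show "uniform_limit {0..T} (\<lambda>n t. y n t) z sequentially"
    proof (rule uniform_limitI)
      fix d :: real assume d: "0 < d"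
      have 1: "\<forall>\<^sub>F n in sequentially. T \<le> real n"
        using filterlim_real_sequentially by (auto simp: filterlim_at_top)
      have 2: "\<forall>\<^sub>F n in sequentially. 1 / real (Suc n) < d" using d LIMSEQ_inverse_real_of_nat
        by (auto simp: inverse_eq_divide dest: order_tendstoD)
      from 1 2 show "\<forall>\<^sub>F n in sequentially. \<forall>t\<in>{0..T}. dist (y n t) (z t) < d"
      proof eventually_elim
        case (elim n)
        show ?case
        proof
          fix t assume "t \<in> {0..T}"
          then have "dist (y n t) (z t) \<le> 1 / real (Suc n)" using elim by (intro y(2)) auto
          then show "dist (y n t) (z t) < d" using elim by simp
        qed
      qed
    qed
  qed
  then have "\<forall>\<^sub>F n in sequentially. y n \<in> U"
    using U zU y(1) unfolding skorokhod_open_def by blast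
  then have "\<forall>\<^sub>F n in sequentially. False"
    by eventually_elim (use y(3) in \<open>auto simp: U_def dist_real_def abs_minus_commute\<close>)
  then show False by simp
qed

lemma skorokhod_borel_measurable_continuous:
  fixes F :: "(real \<Rightarrow> 'a::metric_space) \<Rightarrow> real"
  assumes F: "continuous_map (skorokhod_topology S) euclidean F"
  shows "F \<in> borel_measurable (skorokhod_borel S)"
proof (rule borel_measurableI)
  fix V :: "real set" assume "open V"
  then have "openin (skorokhod_topology S) {x \<in> topspace (skorokhod_topology S). F x \<in> V}"
    by (intro openin_continuous_map_preimage[OF F]) simp
  then have "{x \<in> cadlag_paths S. F x \<in> V} \<in> sets (skorokhod_borel S)"
    unfolding skorokhod_borel_def by (intro in_measure_of) (auto simp: skorokhod_open_def)
  moreover have "space (skorokhod_borel S) = cadlag_paths S"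
    unfolding skorokhod_borel_def by (rule space_measure_of) (auto simp: skorokhod_open_def)
  ultimately show "F -` V \<inter> space (skorokhod_borel S) \<in> sets (skorokhod_borel S)"
    by (simp add: vimage_def Int_def conj_commute)
qed

section \<open>Convergence of the laws\<close>

lemma cadlag_left_const:
  fixes x :: "real \<Rightarrow> 'v::finite \<Rightarrow> nat"
  assumes "cadlag x" shows "left_constant x"
  unfolding left_constant_def
proof (intro allI impI)
  fix t :: real assume "t > 0"
  then obtain l where "(x \<longlongrightarrow> l) (at_left t)" using assms by (auto simp: cadlag_def)
  then have "\<forall>\<^sub>F s in at_left t. x s \<in> {l}"
    by (rule topological_tendstoD) (auto simp: open_singleton_fun)
  then obtain b where "b < t" "\<forall>s>b. s < t \<longrightarrow> x s = l" unfolding eventually_at_left_field by auto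
  then show "\<exists>l. \<exists>t'<t. \<forall>s. t' < s \<and> s < t \<longrightarrow> x s = l"
    by (intro exI[of _ l] exI[of _ b]) simp
qed

lemma cadlag_right_constant:
  fixes x :: "real \<Rightarrow> 'v::finite \<Rightarrow> nat"
  assumes "cadlag x" shows "right_constant x"
  unfolding right_constant_def
proof (intro allI impI)
  fix t :: real assume "t \<ge> 0"
  then obtain e where "e > 0" "\<And>s. t \<le> s \<Longrightarrow> s < t + e \<Longrightarrow> x s = x t"
    using cadlag_right_const[OF assms] by blast
  note e = this
  show "\<exists>t'>t. \<forall>s. t \<le> s \<and> s < t' \<longrightarrow> x s = x t"
  proof (intro exI[of _ "t + e"] conjI allI impI)
    show "x s = x t" if "t \<le> s \<and> s < t + e" for s using that by (intro e(2)) auto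
  qed (use e(1) in simp)
qed

lemma right_constant_scale:
  assumes "right_constant p" "c > 0" shows "right_constant (\<lambda>t. p (t * c))"
  unfolding right_constant_def
proof (intro allI impI)
  fix t :: real assume "t \<ge> 0"
  then have "0 \<le> t * c" using assms by simp
  then obtain u where u: "u > t * c" "\<forall>s. t * c \<le> s \<and> s < u \<longrightarrow> p s = p (t * c)"
    using assms(1) unfolding right_constant_def by blast
  show "\<exists>t'>t. \<forall>s. t \<le> s \<and> s < t' \<longrightarrow> p (s * c) = p (t * c)"
  proof (intro exI[of _ "u / c"] conjI allI impI)
    show "t < u / c" using u(1) assms(2) by (simp add: field_simps)
    fix s assume s: "t \<le> s \<and> s < u / c"
    then have "t * c \<le> s * c" "s * c < u" using assms(2) by (auto simp: field_simps)
    then show "p (s * c) = p (t * c)" using u(2) by blast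
  qed
qed

lemma left_constant_scale:
  assumes "left_constant p" "c > 0" shows "left_constant (\<lambda>t. p (t * c))"
  unfolding left_constant_def
proof (intro allI impI)
  fix t :: real assume "t > 0"
  then have "0 < t * c" using assms by simp
  then obtain l u where u: "u < t * c" "\<forall>s. u < s \<and> s < t * c \<longrightarrow> p s = l"
    using assms(1) unfolding left_constant_def by blast
  show "\<exists>l. \<exists>t'<t. \<forall>s. t' < s \<and> s < t \<longrightarrow> p (s * c) = l"
  proof (intro exI[of _ l] exI[of _ "u / c"] conjI allI impI)
    show "u / c < t" using u(1) assms(2) by (simp add: field_simps)
    fix s assume s: "u / c < s \<and> s < t"
    then have "u < s * c" "s * c < t * c" using assms(2) by (auto simp: field_simps)
    then show "p (s * c) = l" using u(2) by blast
  qed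
qed

lemma cadlag_paths_of_constant:
  fixes e :: "'s \<Rightarrow> 'a::metric_space"
  assumes p: "right_constant p" "left_constant p" and S: "\<And>t. t \<ge> 0 \<Longrightarrow> e (p t) \<in> S"
  shows "(\<lambda>t\<in>{0..}. e (p t)) \<in> cadlag_paths S"
  unfolding cadlag_paths_def
proof (intro CollectI conjI)
  show "(\<lambda>t\<in>{0..}. e (p t)) \<in> {0..} \<rightarrow>\<^sub>E S" using S by auto
  show "cadlag (\<lambda>t\<in>{0..}. e (p t))"
    unfolding cadlag_def
  proof (intro conjI allI impI)
    fix t :: real assume t: "0 \<le> t"
    then obtain u where u: "u > t" "\<forall>s. t \<le> s \<and> s < u \<longrightarrow> p s = p t" using p(1) unfolding right_constant_def by blast
    have "\<forall>\<^sub>F s in at_right t. (\<lambda>t\<in>{0..}. e (p t)) s = (\<lambda>t\<in>{0..}. e (p t)) t"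
      unfolding eventually_at_right_field
    proof (intro exI[of _ u] conjI allI impI)
      fix s assume "t < s" "s < u"
      then have "p s = p t" by (intro u(2)[rule_format]) simp
      then show "(\<lambda>t\<in>{0..}. e (p t)) s = (\<lambda>t\<in>{0..}. e (p t)) t" using \<open>t < s\<close> t by simp
    qed (rule u)
    then show "((\<lambda>t\<in>{0..}. e (p t)) \<longlongrightarrow> (\<lambda>t\<in>{0..}. e (p t)) t) (at_right t)" by (rule tendsto_eventually)
  next
    fix t :: real assume t: "0 < t"
    then obtain l u where u: "u < t" "\<forall>s. u < s \<and> s < t \<longrightarrow> p s = l" using p(2) unfolding left_constant_def by blast
    have "\<forall>\<^sub>F s in at_left t. (\<lambda>t\<in>{0..}. e (p t)) s = e l"
      unfolding eventually_at_left_field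
    proof (intro exI[of _ "max u 0"] conjI allI impI)
      fix s assume s: "max u 0 < s" "s < t"
      then have "p s = l" by (intro u(2)[rule_format]) simp
      then show "(\<lambda>t\<in>{0..}. e (p t)) s = e l" using s by simp
    qed (use u t in auto)
    then show "\<exists>l. ((\<lambda>t\<in>{0..}. e (p t)) \<longlongrightarrow> l) (at_left t)" by (blast intro: tendsto_eventually)
  qed
qed

lemma space_skorokhod_borel: "space (skorokhod_borel S) = cadlag_paths S"
  unfolding skorokhod_borel_def by (rule space_measure_of) (auto simp: skorokhod_open_def)

lemma norm_vec_le_sup:
  fixes x :: "real ^ 'v::finite"
  assumes "\<And>i. \<bar>x $ i\<bar> \<le> d"
  shows "norm x \<le> real CARD('v) * d"
proof -
  have "norm x \<le> (\<Sum>i\<in>UNIV. \<bar>x $ i\<bar>)" by (rule norm_le_l1_cart)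
  also have "\<dots> \<le> (\<Sum>i\<in>(UNIV::'v set). d)" by (rule sum_mono) (rule assms)
  finally show ?thesis by simp
qed

text \<open>The fluid equations make the path Lipschitz, hence continuous, and keep its total
  mass.\<close>

lemma (in irreducible_walk) limit_path_cadlag:
  assumes u: "u \<in> prob_simplex"
  shows "limit_path r u \<in> cadlag_paths prob_simplex"
proof -
  let ?z = "limit_path r u"
  have step: "\<bar>?z t $ i - ?z s $ i\<bar> \<le> 2 * rmax * (t - s)" if "0 \<le> s" "s \<le> t" for s t i
  proof -
    obtain Y where "fluid r t (\<lambda>t. ($) (?z t)) Y" using limit_path_fluid[OF u] by blast
    then show ?thesis by (rule fluid_lipschitz) (use that in auto)
  qed
  have "(2 * rmax * real CARD('v))-lipschitz_on {0..} ?z"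
  proof (rule lipschitz_onI)
    fix s t :: real assume st: "s \<in> {0..}" "t \<in> {0..}"
    have "\<bar>(?z s - ?z t) $ i\<bar> \<le> 2 * rmax * \<bar>s - t\<bar>" for i
      using step[of s t i] step[of t s i] st by (cases "s \<le> t") (auto simp: abs_minus_commute)
    from norm_vec_le_sup[of "?z s - ?z t", OF this]
    show "dist (?z s) (?z t) \<le> 2 * rmax * real CARD('v) * dist s t" by (simp add: dist_norm mult_ac)
  qed (use rmax_nonneg in simp)
  then have cont: "continuous_on {0..} ?z" by (rule lipschitz_on_continuous_on)
  have simplex: "?z t \<in> prob_simplex" if "0 \<le> t" for t
  proof -
    obtain Y where Y: "fluid r t (\<lambda>t. ($) (?z t)) Y" using limit_path_fluid[OF u] by blast
    show ?thesis
    proof (rule prob_simplexI)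
      show "0 \<le> ?z t $ i" for i using fluidD(2)[OF Y, of t i] that by simp
      have "(\<Sum>i\<in>UNIV. ?z t $ i) = (\<Sum>i\<in>UNIV. u $ i + adj r (Y t) i)"
        using fluidD(3)[OF Y, of t] that by (simp add: limit_path_0[OF u])
      then show "(\<Sum>i\<in>UNIV. ?z t $ i) = 1" using prob_simplexD(3)[OF u] by (simp add: sum.distrib sum_adj_zero)
    qed
  qed
  show ?thesis
    unfolding cadlag_paths_def
  proof (intro CollectI conjI)
    have "?z \<in> extensional {0..}" unfolding limit_path_def by (rule restrict_extensional)
    then show "?z \<in> {0..} \<rightarrow>\<^sub>E prob_simplex" using simplex by (simp add: PiE_iff)
    show "cadlag ?z"
      unfolding cadlag_def
    proof (intro conjI allI impI)
      fix t :: real assume t: "0 \<le> t"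
      then have "(?z \<longlongrightarrow> ?z t) (at t within {0..})" using cont by (auto simp: continuous_on_def)
      then show "(?z \<longlongrightarrow> ?z t) (at_right t)" by (rule tendsto_within_subset) (use t in auto)
    next
      fix t :: real assume t: "0 < t"
      have "continuous (at t) ?z" by (rule continuous_on_interior[OF cont]) (use t in simp)
      then have "(?z \<longlongrightarrow> ?z t) (at t)" by (simp add: isCont_def)
      then show "\<exists>l. (?z \<longlongrightarrow> l) (at_left t)" by (blast intro: tendsto_within_subset)
    qed
  qed
qed

context started_zrp begin

text \<open>On the null event that particles are not conserved, \<open>rescaled_path\<close> leaves
  the path space. Its image measure is therefore compared with that of a measurable modification
  \<open>f'\<close>, which takes the value \<open>z\<close> there.\<close>

lemma rescaled_law_estimate:
  fixes F :: "(real \<Rightarrow> real ^ 'v) \<Rightarrow> real"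
  assumes N: "particles x0 = N" "N \<ge> 1"
    and F: "continuous_map (skorokhod_topology prob_simplex) euclidean F"
    and K: "\<And>y. y \<in> cadlag_paths prob_simplex \<Longrightarrow> \<bar>F y\<bar> \<le> K"
    and z: "z \<in> cadlag_paths prob_simplex"
    and B: "B \<in> sets M" "measure M B \<le> p" "\<And>\<omega>. \<omega> \<in> space M - B \<Longrightarrow> \<forall>t\<ge>0. particles (X t \<omega>) = N"
    and close: "\<And>\<omega>. \<omega> \<in> space M - B \<Longrightarrow> rescaled_path N X \<omega> \<in> cadlag_paths prob_simplex \<Longrightarrow> \<bar>F (rescaled_path N X \<omega>) - F z\<bar> \<le> \<epsilon>"
    and \<epsilon>: "\<epsilon> \<ge> 0"
  shows "\<bar>(\<integral>x. F x \<partial>rescaled_law N M X) - F z\<bar> \<le> \<epsilon> + 2 * K * p"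
proof -
  let ?f = "rescaled_path N X" and ?S = "skorokhod_borel prob_simplex :: (real \<Rightarrow> real ^ 'v) measure"
  define e where "e x = (\<chi> i. real (x i) / real N :: real ^ 'v)" for x :: "'v \<Rightarrow> nat"
  have f: "?f \<omega> = (\<lambda>t\<in>{0..}. e (X (t * real N) \<omega>))" for \<omega> by (simp add: rescaled_path_def e_def)
  have e: "e x \<in> prob_simplex \<longleftrightarrow> particles x = N" for x
  proof -
    have "(\<Sum>i\<in>UNIV. e x $ i) = real (particles x) / real N"
      by (simp add: e_def particles_def sum_divide_distrib)
    moreover have "real (particles x) / real N = 1 \<longleftrightarrow> particles x = N" using N(2) by auto
    ultimately have "(\<Sum>i\<in>UNIV. e x $ i) = 1 \<longleftrightarrow> particles x = N" by (simp only:)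
    then show ?thesis using prob_simplexI[of "e x"] prob_simplexD(3)[of "e x"] by (auto simp: e_def)
  qed
  have rc: "right_constant (\<lambda>t. X t \<omega>)" and lc: "left_constant (\<lambda>t. X t \<omega>)" if "\<omega> \<in> space M" for \<omega>
    using cadlag_right_constant cadlag_left_const paths[OF that] by auto
  \<comment> \<open>Rational times make this event measurable, and \<open>max 0 q\<close> avoids
    negative times.\<close>
  define \<Omega> where "\<Omega> = {\<omega> \<in> space M. \<forall>q::rat. particles (X (of_rat (max 0 q)) \<omega>) = N}"
  have \<Omega>_sets: "\<Omega> \<in> sets M" unfolding \<Omega>_def
  proof (intro sets.sets_Collect_countable_All)
    fix q :: rat
    have "0 \<le> (of_rat (max 0 q) :: real)" by simp
    from law_event[OF this, of "{x. particles x = N}"]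
    show "{\<omega> \<in> space M. particles (X (of_rat (max 0 q)) \<omega>) = N} \<in> sets M" by simp
  qed
  have \<Omega>D: "particles (X t \<omega>) = N" if "\<omega> \<in> \<Omega>" "0 \<le> t" for \<omega> t
  proof -
    note t = that
    have sp: "\<omega> \<in> space M" using t by (simp add: \<Omega>_def)
    obtain u where u: "u > t" "\<forall>s. t \<le> s \<and> s < u \<longrightarrow> X s \<omega> = X t \<omega>"
      using rc[OF sp] t(2) unfolding right_constant_def by blast
    from of_rat_dense[OF u(1)] obtain q where q: "t < of_rat q" "of_rat q < u" by blast
    have "0 \<le> (of_rat q :: real)" using q t(2) by linarith
    then have "max 0 q = q" by (simp add: max_def)
    moreover have "particles (X (of_rat (max 0 q)) \<omega>) = N" using t(1) by (simp add: \<Omega>_def)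
    moreover have "X (of_rat q) \<omega> = X t \<omega>" by (intro u(2)[rule_format]) (use q in simp)
    ultimately show ?thesis by simp
  qed
  have \<Omega>_sub: "\<Omega> \<subseteq> space M" by (auto simp: \<Omega>_def)
  have AE_\<Omega>: "AE \<omega> in M. \<omega> \<in> \<Omega>"
    using AE_particles AE_space by eventually_elim (auto simp: \<Omega>_def N(1))
  have B\<Omega>: "space M - B \<subseteq> \<Omega>" using B(3) by (auto simp: \<Omega>_def)
  have cad: "?f \<omega> \<in> cadlag_paths prob_simplex" if "\<omega> \<in> \<Omega>" for \<omega>
    unfolding f
  proof (rule cadlag_paths_of_constant[where p="\<lambda>t. X (t * real N) \<omega>"])
    have sp: "\<omega> \<in> space M" using that \<Omega>_sub by blast
    show "right_constant (\<lambda>t. X (t * real N) \<omega>)" "left_constant (\<lambda>t. X (t * real N) \<omega>)"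
      using right_constant_scale[OF rc[OF sp], of "real N"] left_constant_scale[OF lc[OF sp], of "real N"] N(2) by auto
    show "e (X (t * real N) \<omega>) \<in> prob_simplex" if "0 \<le> t" for t
      using \<Omega>D[OF \<open>\<omega> \<in> \<Omega>\<close>, of "t * real N"] that by (simp add: e)
  qed
  \<comment> \<open>Preimages of Borel sets under \<open>rescaled_path\<close> thus lie in
    \<open>\<Omega>\<close>, where it agrees with \<open>f'\<close>; as \<open>\<Omega>\<close> has
    full measure, both maps have the same image measure.\<close>
  have notcad: "?f \<omega> \<notin> cadlag_paths prob_simplex" if "\<omega> \<in> space M - \<Omega>" for \<omega>
  proof
    assume c: "?f \<omega> \<in> cadlag_paths prob_simplex"
    have "particles (X (of_rat (max 0 q)) \<omega>) = N" for q :: rat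
    proof -
      define t where "t = (of_rat (max 0 q) :: real) / real N"
      have t0: "0 \<le> (of_rat (max 0 q) :: real)" by simp
      then have "0 \<le> t" unfolding t_def by (rule divide_nonneg_nonneg) simp
      then have "e (X (t * real N) \<omega>) \<in> prob_simplex" using c unfolding f cadlag_paths_def by (auto simp: PiE_iff)
      moreover have "t * real N = of_rat (max 0 q)" using N(2) by (simp add: t_def)
      ultimately show ?thesis by (simp add: e)
    qed
    then show False using that by (auto simp: \<Omega>_def)
  qed
  define f' where "f' \<omega> = (if \<omega> \<in> \<Omega> then ?f \<omega> else z)" for \<omega>
  have f'_meas: "f' \<in> M \<rightarrow>\<^sub>M ?S"
    unfolding skorokhod_borel_def
  proof (rule measurable_measure_of)
    show "f' \<in> space M \<rightarrow> cadlag_paths prob_simplex" using cad z by (auto simp: f'_def)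
    fix U :: "(real \<Rightarrow> real ^ 'v) set" assume "U \<in> {U. openin (skorokhod_topology prob_simplex) U}"
    then have U: "skorokhod_open prob_simplex U" by simp
    have "{\<omega> \<in> \<Omega>. (\<lambda>t\<in>{0..}. e (X (t * real N) \<omega>)) \<in> U} \<in> sets M"
    proof (rule skorokhod_open_measurable[where Y="\<lambda>t. X (t * real N)", OF _ _ _ \<Omega>_sets _ U])
      show "X (t * real N) \<in> M \<rightarrow>\<^sub>M count_space UNIV" if "0 \<le> t" for t using that by (intro meas) simp
      show "right_constant (\<lambda>t. X (t * real N) \<omega>)" if "\<omega> \<in> space M" for \<omega>
        by (rule right_constant_scale[OF rc[OF that]]) (use N in simp)
      show "left_constant (\<lambda>t. X (t * real N) \<omega>)" if "\<omega> \<in> space M" for \<omega>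
        by (rule left_constant_scale[OF lc[OF that]]) (use N in simp)
    qed (use cad f in auto)
    then have "{\<omega> \<in> \<Omega>. ?f \<omega> \<in> U} \<in> sets M" by (simp only: f)
    moreover have "f' -` U \<inter> space M = {\<omega> \<in> \<Omega>. ?f \<omega> \<in> U} \<union> (if z \<in> U then space M - \<Omega> else {})"
      using \<Omega>_sub by (auto simp: f'_def split: if_splits)
    ultimately show "f' -` U \<inter> space M \<in> sets M" using \<Omega>_sets by auto
  qed (auto simp: skorokhod_open_def)
  have "rescaled_law N M X = distr M ?S f'"
    unfolding rescaled_law_def distr_def
  proof (rule measure_of_eq)
    show "sets ?S \<subseteq> Pow (space ?S)" using sets.space_closed by blast
    fix A assume "A \<in> sigma_sets (space ?S) (sets ?S)"
    then have A: "A \<in> sets ?S" by (simp add: sets.sigma_sets_eq)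
    then have sub: "A \<subseteq> cadlag_paths prob_simplex" using sets.sets_into_space space_skorokhod_borel by blast
    have "?f -` A \<inter> space M = (f' -` A \<inter> space M) \<inter> \<Omega>"
    proof (rule set_eqI)
      fix \<omega> show "\<omega> \<in> ?f -` A \<inter> space M \<longleftrightarrow> \<omega> \<in> (f' -` A \<inter> space M) \<inter> \<Omega>"
        using notcad[of \<omega>] sub by (cases "\<omega> \<in> \<Omega>") (auto simp: f'_def)
    qed
    moreover have "emeasure M ((f' -` A \<inter> space M) \<inter> \<Omega>) = emeasure M (f' -` A \<inter> space M)"
      by (rule emeasure_eq_AE) (use AE_\<Omega> measurable_sets[OF f'_meas A] \<Omega>_sets in auto)
    ultimately show "emeasure M (?f -` A \<inter> space M) = emeasure M (f' -` A \<inter> space M)" by simp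
  qed
  then have eq: "(\<integral>x. F x \<partial>rescaled_law N M X) = (\<integral>\<omega>. F (f' \<omega>) \<partial>M)"
    using integral_distr[OF f'_meas skorokhod_borel_measurable_continuous[OF F]] by simp
  have meas': "(\<lambda>\<omega>. F (f' \<omega>)) \<in> borel_measurable M"
    by (rule measurable_compose[OF f'_meas skorokhod_borel_measurable_continuous[OF F]])
  have bnd: "\<bar>F (f' \<omega>)\<bar> \<le> K" for \<omega> using cad z by (intro K) (auto simp: f'_def)
  have int: "integrable M (\<lambda>\<omega>. F (f' \<omega>))"
    by (rule integrable_const_bound[where B=K]) (use bnd meas' in auto)
  have "\<bar>(\<integral>\<omega>. F (f' \<omega>) \<partial>M) - F z\<bar> = \<bar>\<integral>\<omega>. F (f' \<omega>) - F z \<partial>M\<bar>"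
    using int by (simp add: prob_space)
  also have "\<dots> \<le> (\<integral>\<omega>. \<bar>F (f' \<omega>) - F z\<bar> \<partial>M)" by (rule integral_abs_bound)
  also have "\<dots> \<le> (\<integral>\<omega>. \<epsilon> + 2 * K * indicator B \<omega> \<partial>M)"
  proof (rule integral_mono)
    show "integrable M (\<lambda>\<omega>. \<bar>F (f' \<omega>) - F z\<bar>)" using int by simp
    show "integrable M (\<lambda>\<omega>. \<epsilon> + 2 * K * indicator B \<omega>)"
      using B(1) by (intro Bochner_Integration.integrable_add integrable_const integrable_mult_right integrable_real_indicator) (auto simp: emeasure_eq_measure)
    fix \<omega> assume \<omega>: "\<omega> \<in> space M"
    show "\<bar>F (f' \<omega>) - F z\<bar> \<le> \<epsilon> + 2 * K * indicator B \<omega>"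
    proof (cases "\<omega> \<in> B")
      case True
      then show ?thesis using bnd[of \<omega>] K[OF z] \<epsilon> by simp
    next
      case False
      then have "\<omega> \<in> \<Omega>" using B\<Omega> \<omega> by blast
      then show ?thesis using close[of \<omega>] cad[of \<omega>] \<omega> False by (simp add: f'_def)
    qed
  qed
  also have "\<dots> = \<epsilon> + 2 * K * measure M B"
    using B(1) by (simp add: prob_space emeasure_eq_measure sets.Int_space_eq2)
  also have "\<dots> \<le> \<epsilon> + 2 * K * p"
    using B(2) K[OF z] by (intro add_left_mono mult_left_mono) auto
  finally show ?thesis unfolding eq .
qed

end

theorem theorem2p9:
  fixes r :: "'v::finite \<Rightarrow> 'v \<Rightarrow> real"
    and g :: "nat \<Rightarrow> real"
    and M :: "nat \<Rightarrow> 'w measure"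
    and \<eta> :: "nat \<Rightarrow> real \<Rightarrow> 'w \<Rightarrow> 'v \<Rightarrow> nat"
    and uN :: "nat \<Rightarrow> real ^ 'v"
    and u :: "real ^ 'v"
  assumes r_nonneg: "\<And>i j. 0 \<le> r i j"
    and r_diag: "\<And>i. r i i = 0"
    and r_irred: "irreducible_rates r"
    and g_nonneg: "\<And>n. 0 \<le> g n"
    and g_0: "g 0 = 0"
    and g_lim: "g \<longlonglongrightarrow> 1"
    and g_ge_1: "\<And>n. n \<ge> 1 \<Longrightarrow> g n \<ge> 1"
    and uN: "\<And>N. N \<ge> 1 \<Longrightarrow> uN N \<in> lattice_simplex N"
    and u: "u \<in> prob_simplex"
    and uN_lim: "uN \<longlonglongrightarrow> u"
    and zrp: "\<And>N. N \<ge> 1 \<Longrightarrow> zero_range_process r g (M N) (\<eta> N)"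
    and start: "\<And>N. N \<ge> 1 \<Longrightarrow> AE \<omega> in M N. \<forall>i. real (\<eta> N 0 \<omega> i) = real N * uN N $ i"
  shows "converges_weakly (skorokhod_topology prob_simplex)
           (\<lambda>N. rescaled_law N (M N) (\<eta> N))
           (return (skorokhod_borel prob_simplex) (limit_path r u))"
proof -
  interpret zero_range r g by unfold_locales (fact r_nonneg r_diag r_irred g_nonneg g_0 g_lim g_ge_1)+
  let ?z = "limit_path r u"
  have z: "?z \<in> cadlag_paths prob_simplex" by (rule limit_path_cadlag[OF u])
  \<comment> \<open>\<open>real N * uN N $ i\<close> is a natural number, so the floor loses
    nothing.\<close>
  define x0 where "x0 N i = nat \<lfloor>real N * uN N $ i\<rfloor>" for N i
  have x0: "real (x0 N i) = real N * uN N $ i" if "N \<ge> 1" for N i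
  proof -
    have "real N * uN N $ i \<in> \<nat>" using uN[OF that] by (simp add: lattice_simplex_def)
    then show ?thesis by (auto simp: x0_def elim: Nats_cases)
  qed
  have px0: "particles (x0 N) = N" if "N \<ge> 1" for N
  proof -
    have "real (particles (x0 N)) = real N * (\<Sum>i\<in>UNIV. uN N $ i)"
      by (simp add: particles_def x0[OF that] sum_distrib_left)
    also have "(\<Sum>i\<in>UNIV. uN N $ i) = 1" using uN[OF that] by (intro prob_simplexD(3)) (simp add: lattice_simplex_def)
    finally show ?thesis by simp
  qed
  \<comment> \<open>The transition semigroup is obtained for each \<open>N\<close> separately;
    nothing ties those of different \<open>N\<close> together except the generator.\<close>
  have zp: "\<exists>P. started_zrp r g P (M N) (\<eta> N) (x0 N)" if N: "N \<ge> 1" for N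
  proof -
    have mp: "markov_process (zrp_generator r g) (M N) (\<eta> N)" using zrp[OF N] by (simp add: zero_range_process_def)
    from mp[unfolded markov_process_def, THEN conjunct2, THEN conjunct2, THEN conjunct2]
    obtain P where mg: "markov_semigroup P \<and> has_generator P (zrp_generator r g) \<and>
      (\<forall>s\<ge>0. \<forall>t\<ge>0. \<forall>f :: ('v \<Rightarrow> nat) \<Rightarrow> real. bounded (range f) \<longrightarrow>
        (AE \<omega> in M N. real_cond_exp (M N) (natural_filtration (M N) (\<eta> N) s) (\<lambda>\<omega>. f (\<eta> N (s + t) \<omega>)) \<omega>
          = measure_pmf.expectation (P t (\<eta> N s \<omega>)) f))" ..
    note P = mg[THEN conjunct1] mg[THEN conjunct2, THEN conjunct1] mg[THEN conjunct2, THEN conjunct2, rule_format]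
    have init: "AE \<omega> in M N. \<eta> N 0 \<omega> = x0 N"
      using start[OF N]
    proof eventually_elim
      case (elim \<omega>)
      have "real (\<eta> N 0 \<omega> i) = real (x0 N i)" for i using elim x0[OF N] by simp
      then show ?case by (intro ext) simp
    qed
    have "started_zrp r g P (M N) (\<eta> N) (x0 N)"
    proof (intro started_zrp.intro started_zrp_axioms.intro zrp_semigroup.intro zrp_semigroup_axioms.intro)
      show "zero_range r g" by unfold_locales
      show "prob_space (M N)" using mp by (simp add: markov_process_def)
      show "\<eta> N t \<in> M N \<rightarrow>\<^sub>M count_space UNIV" if "t \<ge> 0" for t using mp that by (simp add: markov_process_def)
      show "cadlag (\<lambda>t. \<eta> N t \<omega>)" if "\<omega> \<in> space (M N)" for \<omega> using mp that by (simp add: markov_process_def)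
    qed (fact P init)+
    then show ?thesis by blast
  qed
  show ?thesis
    unfolding converges_weakly_def topspace_skorokhod
  proof (intro allI impI, elim conjE)
    fix F :: "(real \<Rightarrow> real ^ 'v) \<Rightarrow> real"
    assume F: "continuous_map (skorokhod_topology prob_simplex) euclidean F" and bd: "bounded (F ` cadlag_paths prob_simplex)"
    obtain K where K: "\<And>y. y \<in> cadlag_paths prob_simplex \<Longrightarrow> \<bar>F y\<bar> \<le> K" using bd by (auto simp: bounded_iff)
    have K0: "0 \<le> K" using K[OF z] by simp
    have "(\<integral>x. F x \<partial>return (skorokhod_borel prob_simplex) ?z) = F ?z"
      by (rule integral_return) (use z skorokhod_borel_measurable_continuous[OF F] in \<open>auto simp: space_skorokhod_borel\<close>)
    moreover have "(\<lambda>N. \<integral>x. F x \<partial>rescaled_law N (M N) (\<eta> N)) \<longlonglongrightarrow> F ?z"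
    proof (rule tendstoI)
      fix \<epsilon> :: real assume \<epsilon>: "0 < \<epsilon>"
      have "0 < \<epsilon> / 2" using \<epsilon> by simp
      from uniform_neighbourhood[OF F z this] obtain n :: nat where n': "\<forall>y\<in>cadlag_paths prob_simplex.
        (\<forall>t. 0 \<le> t \<and> t \<le> real (Suc n) \<longrightarrow> dist (y t) (?z t) \<le> 1 / real (Suc n)) \<longrightarrow> \<bar>F y - F ?z\<bar> < \<epsilon> / 2" ..
      have n: "\<And>y. y \<in> cadlag_paths prob_simplex \<Longrightarrow>
        (\<And>t. 0 \<le> t \<Longrightarrow> t \<le> real (Suc n) \<Longrightarrow> dist (y t) (?z t) \<le> 1 / real (Suc n)) \<Longrightarrow> \<bar>F y - F ?z\<bar> < \<epsilon> / 2"
        using n' by blast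
      \<comment> \<open>The summand 4 in the denominator admits \<open>K = 0\<close> and makes the
        bound on \<open>2 * K * p\<close> strict.\<close>
      define p where "p = \<epsilon> / (4 * K + 4)"
      have p: "0 < p" "2 * K * p < \<epsilon> / 2" using \<epsilon> K0 by (auto simp: p_def field_simps)
      \<comment> \<open>A coordinatewise error of at most \<open>d\<close> gives a norm of at most
        \<open>1 / real (Suc n)\<close>.\<close>
      define d where "d = 1 / real (Suc n) / real CARD('v)"
      have d: "0 < d" "real CARD('v) * d = 1 / real (Suc n)" by (simp_all add: d_def)
      have T0: "0 < real (Suc n)" by simp
      obtain \<theta> where \<theta>: "\<theta> > 0" and conv: "\<forall>\<^sub>F N in sequentially. \<forall>P (M :: 'w measure) X x0 u. started_zrp r g P M X x0 \<and> particles x0 = N \<and> u \<in> prob_simplex \<and>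
          (\<forall>i. \<bar>real (x0 i) / real N - u $ i\<bar> \<le> \<theta>) \<longrightarrow>
          (\<exists>B\<in>sets M. measure M B \<le> p \<and> (\<forall>\<omega>\<in>space M - B. (\<forall>t\<ge>0. particles (X t \<omega>) = N) \<and>
             (\<forall>t i. 0 \<le> t \<and> t \<le> real (Suc n) \<longrightarrow> \<bar>real (X (t * real N) \<omega> i) / real N - limit_path r u t $ i\<bar> \<le> d)))"
        using path_convergence[OF T0 d(1) p(1)] by (elim exE conjE) (rule that)
      have "\<forall>\<^sub>F N in sequentially. dist (uN N) u < \<theta>" using uN_lim \<theta> by (rule tendstoD)
      with conv eventually_ge_at_top[of 1]
      show "\<forall>\<^sub>F N in sequentially. dist (\<integral>x. F x \<partial>rescaled_law N (M N) (\<eta> N)) (F ?z) < \<epsilon>"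
      proof eventually_elim
        case (elim N)
        obtain P where P: "started_zrp r g P (M N) (\<eta> N) (x0 N)" using zp[OF elim(2)] by blast
        interpret S: started_zrp r g P "M N" "\<eta> N" "x0 N" by (rule P)
        have start_close: "\<bar>real (x0 N i) / real N - u $ i\<bar> \<le> \<theta>" for i
        proof -
          have "real (x0 N i) / real N = uN N $ i" using elim(2) by (simp add: x0)
          then have "\<bar>real (x0 N i) / real N - u $ i\<bar> = \<bar>(uN N - u) $ i\<bar>" by simp
          also have "\<dots> \<le> norm (uN N - u)" by (rule component_le_norm_cart)
          finally show ?thesis using elim(3) by (simp add: dist_norm)
        qed
        from elim(1)[THEN spec, THEN spec, THEN spec, THEN spec, THEN spec, THEN mp,
          OF conjI[OF P conjI[OF px0[OF elim(2)] conjI[OF u allI[OF start_close]]]]]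
        obtain B where B: "B \<in> sets (M N)" "measure (M N) B \<le> p"
          and off: "\<forall>\<omega>\<in>space (M N) - B. (\<forall>t\<ge>0. particles (\<eta> N t \<omega>) = N) \<and>
             (\<forall>t i. 0 \<le> t \<and> t \<le> real (Suc n) \<longrightarrow> \<bar>real (\<eta> N (t * real N) \<omega> i) / real N - ?z t $ i\<bar> \<le> d)"
          by (elim bexE conjE) (rule that)
        note off1 = off[THEN bspec, THEN conjunct1] and off2 = off[THEN bspec, THEN conjunct2, THEN spec, THEN spec, THEN mp, OF _ conjI]
        have "\<bar>(\<integral>x. F x \<partial>rescaled_law N (M N) (\<eta> N)) - F ?z\<bar> \<le> \<epsilon> / 2 + 2 * K * p"
        proof (rule S.rescaled_law_estimate[OF px0[OF elim(2)] elim(2) F K z B off1])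
          fix \<omega> assume \<omega>: "\<omega> \<in> space (M N) - B" and cad: "rescaled_path N (\<eta> N) \<omega> \<in> cadlag_paths prob_simplex"
          have "dist (rescaled_path N (\<eta> N) \<omega> t) (?z t) \<le> 1 / real (Suc n)" if t: "0 \<le> t" "t \<le> real (Suc n)" for t
          proof -
            have "\<bar>(rescaled_path N (\<eta> N) \<omega> t - ?z t) $ i\<bar> \<le> d" for i
              using off2[OF \<omega> t, of i] t by (simp add: rescaled_path_def)
            from norm_vec_le_sup[of "rescaled_path N (\<eta> N) \<omega> t - ?z t", OF this] show ?thesis unfolding d(2) by (simp only: dist_norm)
          qed
          then show "\<bar>F (rescaled_path N (\<eta> N) \<omega>) - F ?z\<bar> \<le> \<epsilon> / 2" using n[OF cad] by (simp add: less_imp_le)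
        qed (use \<epsilon> in simp_all)
        then show ?case using p(2) by (simp add: dist_real_def)
      qed
    qed
    ultimately show "(\<lambda>N. \<integral>x. F x \<partial>rescaled_law N (M N) (\<eta> N)) \<longlonglongrightarrow> (\<integral>x. F x \<partial>return (skorokhod_borel prob_simplex) ?z)" by simp
  qed
qed

end
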